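(* Let $p$ be a (finite) prime, let $G_p=\prod_{\ell\ne p}\mathbb Z_\ell^*$ be the group of automorphisms of the multiplicative group $\mu^{(p)}$ of roots of unity in $\mathbb Q^{\rm cyc}$ of order prime to $p$, and let $f_p\in G_p$ be the element $\xi\mapsto\xi^p$. Let $G_p$ act freely and transitively on a compact space $X$. Let $Y$ be the quotient space $$Y=\left(X\times(0,1)\right)/\sigma^{\mathbb Z},$$ where $\sigma^{\mathbb Z}$ acts on the product $X\times(0,1)$ by $$\sigma(x,\rho)=(f_px,\rho^p)\qquad\forall x\in X,\ \rho\in(0,1).$$ Then: (1) The space $Y$ is compact and is an $S$-principal bundle over the quotient $Z$ of $X$ by $f_p^{\hat{\mathbb Z}}\subset G_p$, where $S=(\hat{\mathbb Z}\times\mathbb R)/\mathbb Z$. (2) For $X=G_p$ and $Z=G_p/p^{\hat{\mathbb Z}}$, $Y$ is canonically isomorphic to the fiber $P_p(\mathbb H_{\mathbb Q})$.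
   Context: $\mathbb Q^{\rm cyc}$ is the field generated over $\mathbb Q$ by all roots of unity. $f_p^{\hat{\mathbb Z}}=p^{\hat{\mathbb Z}}$ is the closed subgroup of $G_p$ generated by $f_p$ (the element of $\prod_{\ell\neq p}\mathbb Z_\ell^*$ all of whose components are $p$). The solenoid $S=(\hat{\mathbb Z}\times\mathbb R)/\mathbb Z$ is the quotient by the diagonal copy of $\mathbb Z$; equivalently, via $\log$ in base $p$ on $\mathbb R_+^*$, $S\simeq(\hat{\mathbb Z}\times\mathbb R_+^* )/(1,p)^{\mathbb Z}$. Actions are continuous. $\mathbb H_{\mathbb Q}=\mathbb A_{\mathbb Q}/\mathbb Q^\times$ is the hyperring of adèle classes of $\mathbb Q$: classes of adèles under multiplication by $\mathbb Q^\times$, with induced multiplication and multivalued addition. $P(\mathbb H_{\mathbb Q})$ is the set of its prime elements, i.e. elements generating a principal prime ideal; principal prime ideals correspond to places $w$ of $\mathbb Q$, as $\mathfrak p_w=\{a\in\mathbb H_{\mathbb Q}\mid a_w=0\}$. $P_p(\mathbb H_{\mathbb Q})$ is the fiber over the place $p$, i.e. the set of $a\in\mathbb H_{\mathbb Q}$ generating $\mathfrak p_p$; it is the orbit under the idèle class group $C_{\mathbb Q}=\mathbb A_{\mathbb Q}^*/\mathbb Q^*$ of the class of the idempotent adèle with component $0$ at $p$ and $1$ at all other places, and the isotropy group is $W_p=\mathbb Q_p^*\subset C_{\mathbb Q}$ (classes of idèles with all components $1$ outside $p$), so that $P_p(\mathbb H_{\mathbb Q})\simeq C_{\mathbb Q}/W_p$.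 *)

theory Defs
  imports
    "HOL-Analysis.Analysis"
    "HOL-Algebra.QuotRing"
    "HOL-Algebra.Group_Action"
    "HOL-Algebra.Product_Groups"
begin

section \<open>Quotient topologies\<close>

definition quotient_topology :: "'a topology \<Rightarrow> ('a \<Rightarrow> 'b) \<Rightarrow> 'b topology" where
  "quotient_topology X f =
     topology (\<lambda>U. U \<subseteq> f ` topspace X \<and> openin X {x \<in> topspace X. f x \<in> U})"

lemma openin_quotient_topology:
  "openin (quotient_topology X f) U \<longleftrightarrow>
     U \<subseteq> f ` topspace X \<and> openin X {x \<in> topspace X. f x \<in> U}"
proof -
  let ?L = "\<lambda>U. U \<subseteq> f ` topspace X \<and> openin X {x \<in> topspace X. f x \<in> U}"
  have int: "{x \<in> topspace X. f x \<in> S \<inter> T} =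
      {x \<in> topspace X. f x \<in> S} \<inter> {x \<in> topspace X. f x \<in> T}" for S T
    by blast
  have un: "{x \<in> topspace X. f x \<in> \<Union>K} = (\<Union>S\<in>K. {x \<in> topspace X. f x \<in> S})" for K
    by blast
  have "istopology ?L"
    unfolding istopology_def int un by (auto intro!: openin_Int openin_Union)
  then show ?thesis
    unfolding quotient_topology_def by (simp add: topology_inverse')
qed

lemma topspace_quotient_topology [simp]:
  "topspace (quotient_topology X f) = f ` topspace X"
proof -
  have "{x \<in> topspace X. f x \<in> f ` topspace X} = topspace X"
    by blast
  then have "openin (quotient_topology X f) (f ` topspace X)"
    by (simp add: openin_quotient_topology)
  moreover have "U \<subseteq> f ` topspace X" if "openin (quotient_topology X f) U" for U
    using that by (simp add: openin_quotient_topology)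
  ultimately show ?thesis
    unfolding topspace_def by blast
qed

lemma quotient_map_quotient_topology:
  "quotient_map X (quotient_topology X f) f"
  unfolding quotient_map_def by (auto simp: openin_quotient_topology)


section \<open>The fields of \<open>l\<close>-adic numbers\<close>

abbreviation primes :: "nat set" where
  "primes \<equiv> {l. prime l}"

definition padic_abs :: "nat \<Rightarrow> rat \<Rightarrow> real" where
  "padic_abs l q = (if q = 0 then 0 else
     real l powi (int (multiplicity (int l) (snd (quotient_of q)))
                  - int (multiplicity (int l) (fst (quotient_of q)))))"

text \<open>The field \<open>Qp l\<close> is the completion of the rationals for \<^const>\<open>padic_abs\<close>: the ring of
  Cauchy sequences modulo the ideal of null sequences.\<close>

definition padic_cauchy_ring :: "nat \<Rightarrow> (nat \<Rightarrow> rat) ring" where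
  "padic_cauchy_ring l =
     \<lparr>carrier = {x. \<forall>e>0. \<exists>N. \<forall>m\<ge>N. \<forall>n\<ge>N. padic_abs l (x m - x n) < e},
      monoid.mult = (\<lambda>x y n. x n * y n), one = (\<lambda>n. 1),
      ring.zero = (\<lambda>n. 0), add = (\<lambda>x y n. x n + y n)\<rparr>"

definition padic_null :: "nat \<Rightarrow> (nat \<Rightarrow> rat) set" where
  "padic_null l = {x. (\<lambda>n. padic_abs l (x n)) \<longlonglongrightarrow> 0}"

definition Qp :: "nat \<Rightarrow> (nat \<Rightarrow> rat) set ring" where
  "Qp l = padic_cauchy_ring l Quot padic_null l"

definition Qp_of_rat :: "nat \<Rightarrow> rat \<Rightarrow> (nat \<Rightarrow> rat) set" where
  "Qp_of_rat l q = padic_null l +>\<^bsub>padic_cauchy_ring l\<^esub> (\<lambda>n. q)"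

definition padic_norm :: "nat \<Rightarrow> (nat \<Rightarrow> rat) set \<Rightarrow> real" where
  "padic_norm l a = (THE r. \<forall>x\<in>a. (\<lambda>n. padic_abs l (x n)) \<longlonglongrightarrow> r)"

text \<open>The value 0 outside the carrier is needed because \<^locale>\<open>Metric_space\<close> requires
  non-negativity and symmetry on the whole type.\<close>

definition padic_dist :: "nat \<Rightarrow> (nat \<Rightarrow> rat) set \<Rightarrow> (nat \<Rightarrow> rat) set \<Rightarrow> real" where
  "padic_dist l a b =
     (if a \<in> carrier (Qp l) \<and> b \<in> carrier (Qp l) then padic_norm l (a \<ominus>\<^bsub>Qp l\<^esub> b) else 0)"

definition Qp_top :: "nat \<Rightarrow> (nat \<Rightarrow> rat) set topology" where
  "Qp_top l = Metric_space.mtopology (carrier (Qp l)) (padic_dist l)"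

definition Zp :: "nat \<Rightarrow> (nat \<Rightarrow> rat) set ring" where
  "Zp l = (Qp l)\<lparr>carrier := {a \<in> carrier (Qp l). padic_norm l a \<le> 1}\<rparr>"


section \<open>The group \<open>G\<^sub>p\<close> and its action on roots of unity\<close>

definition Gp :: "nat \<Rightarrow> (nat \<Rightarrow> (nat \<Rightarrow> rat) set) monoid" where
  "Gp p = product_group (primes - {p}) (\<lambda>l. units_of (Zp l))"

definition Gp_top :: "nat \<Rightarrow> (nat \<Rightarrow> (nat \<Rightarrow> rat) set) topology" where
  "Gp_top p =
     product_topology (\<lambda>l. subtopology (Qp_top l) (Units (Zp l))) (primes - {p})"

definition frob :: "nat \<Rightarrow> nat \<Rightarrow> (nat \<Rightarrow> rat) set" where
  "frob p = (\<lambda>l\<in>primes - {p}. Qp_of_rat l (of_nat p))"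

definition mu_prime_to :: "nat \<Rightarrow> complex monoid" where
  "mu_prime_to p =
     \<lparr>carrier = {\<xi>. \<exists>n>0. coprime n p \<and> \<xi> ^ n = 1}, monoid.mult = (*), one = 1\<rparr>"

text \<open>For \<open>\<xi>\<close> with \<open>\<xi> ^ n = 1\<close>, the power \<open>\<xi>\<^sup>u\<close> is \<open>\<xi> ^ k\<close> for any natural number \<open>k\<close> with
  \<open>u\<^sub>l - k \<in> n \<int>\<^sub>l\<close> for every prime divisor \<open>l\<close> of \<open>n\<close>.\<close>

definition mu_action :: "nat \<Rightarrow> (nat \<Rightarrow> (nat \<Rightarrow> rat) set) \<Rightarrow> complex \<Rightarrow> complex" where
  "mu_action p u = (\<lambda>\<xi>\<in>carrier (mu_prime_to p). THE \<zeta>. \<exists>n k :: nat.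
     n > 0 \<and> coprime n p \<and> \<xi> ^ n = 1 \<and>
     (\<forall>l\<in>primes. l dvd n \<longrightarrow>
        padic_norm l (u l \<ominus>\<^bsub>Qp l\<^esub> Qp_of_rat l (of_nat k)) \<le> padic_abs l (of_nat n)) \<and>
     \<zeta> = \<xi> ^ k)"

text \<open>The closed subgroup generated by \<^const>\<open>frob\<close>.\<close>

definition frob_closure :: "nat \<Rightarrow> (nat \<Rightarrow> (nat \<Rightarrow> rat) set) set" where
  "frob_closure p = Gp_top p closure_of generate (Gp p) {frob p}"


section \<open>The solenoid\<close>

definition Zhat :: "(nat \<Rightarrow> int) monoid" where
  "Zhat = (product_group {1..} integer_mod_group)
     \<lparr>carrier := {a \<in> carrier (product_group {1..} integer_mod_group).
        \<forall>m\<ge>1. \<forall>n\<ge>1. m dvd n \<longrightarrow> a n mod int m = a m}\<rparr>"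

definition Zhat_top :: "(nat \<Rightarrow> int) topology" where
  "Zhat_top = subtopology
     (product_topology (\<lambda>n. discrete_topology (carrier (integer_mod_group n))) {1..})
     (carrier Zhat)"

definition Zhat_of_int :: "int \<Rightarrow> nat \<Rightarrow> int" where
  "Zhat_of_int k = (\<lambda>n\<in>{1..}. k mod int n)"

definition real_add_group :: "real monoid" where
  "real_add_group = \<lparr>carrier = UNIV, monoid.mult = (+), one = 0\<rparr>"

definition diagonal_Z :: "((nat \<Rightarrow> int) \<times> real) set" where
  "diagonal_Z = range (\<lambda>k::int. (Zhat_of_int k, of_int k))"

definition solenoid :: "((nat \<Rightarrow> int) \<times> real) set monoid" where
  "solenoid = (Zhat \<times>\<times> real_add_group) Mod diagonal_Z"

definition solenoid_class :: "(nat \<Rightarrow> int) \<times> real \<Rightarrow> ((nat \<Rightarrow> int) \<times> real) set" where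
  "solenoid_class z = diagonal_Z #>\<^bsub>Zhat \<times>\<times> real_add_group\<^esub> z"

definition solenoid_top :: "((nat \<Rightarrow> int) \<times> real) set topology" where
  "solenoid_top = quotient_topology (prod_topology Zhat_top euclideanreal) solenoid_class"


section \<open>Principal bundles\<close>

definition continuous_group_action ::
    "('g, 'm) monoid_scheme \<Rightarrow> 'g topology \<Rightarrow> 'x topology \<Rightarrow> ('g \<Rightarrow> 'x \<Rightarrow> 'x) \<Rightarrow> bool" where
  "continuous_group_action G T X \<phi> \<longleftrightarrow>
     group_action G (topspace X) \<phi> \<and>
     continuous_map (prod_topology T X) X (\<lambda>(g, x). \<phi> g x)"

text \<open>Principal bundles are required to be locally trivial. Local triviality implies that the
  action is free and that its orbits are the fibers of \<open>\<pi>\<close>.\<close>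

definition principal_bundle ::
    "('g, 'm) monoid_scheme \<Rightarrow> 'g topology \<Rightarrow> ('g \<Rightarrow> 'y \<Rightarrow> 'y) \<Rightarrow>
     'y topology \<Rightarrow> 'z topology \<Rightarrow> ('y \<Rightarrow> 'z) \<Rightarrow> bool" where
  "principal_bundle G T \<tau> Y Z \<pi> \<longleftrightarrow>
     continuous_group_action G T Y \<tau> \<and>
     continuous_map Y Z \<pi> \<and>
     (\<forall>z\<in>topspace Z. \<exists>U h. openin Z U \<and> z \<in> U \<and>
        homeomorphic_map (prod_topology (subtopology Z U) T)
          (subtopology Y {y \<in> topspace Y. \<pi> y \<in> U}) h \<and>
        (\<forall>u\<in>U. \<forall>s\<in>carrier G. \<pi> (h (u, s)) = u) \<and>
        (\<forall>u\<in>U. \<forall>s\<in>carrier G. \<forall>t\<in>carrier G. h (u, t \<otimes>\<^bsub>G\<^esub> s) = \<tau> t (h (u, s))))"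


section \<open>The spaces \<open>Y\<close> and \<open>Z\<close>\<close>

text \<open>``Compact'' includes the Hausdorff property.\<close>

definition compact_Gp_torsor ::
    "nat \<Rightarrow> 'x topology \<Rightarrow> ((nat \<Rightarrow> (nat \<Rightarrow> rat) set) \<Rightarrow> 'x \<Rightarrow> 'x) \<Rightarrow> bool" where
  "compact_Gp_torsor p X \<phi> \<longleftrightarrow>
     compact_space X \<and> Hausdorff_space X \<and>
     continuous_group_action (Gp p) (Gp_top p) X \<phi> \<and>
     transitive_action (Gp p) (topspace X) \<phi> \<and>
     (\<forall>x\<in>topspace X. stabilizer (Gp p) \<phi> x = {\<one>\<^bsub>Gp p\<^esub>})"

definition sigma ::
    "nat \<Rightarrow> ((nat \<Rightarrow> (nat \<Rightarrow> rat) set) \<Rightarrow> 'x \<Rightarrow> 'x) \<Rightarrow> 'x \<times> real \<Rightarrow> 'x \<times> real" where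
  "sigma p \<phi> = (\<lambda>(x, \<rho>). (\<phi> (frob p) x, \<rho> ^ p))"

text \<open>The orbit under all integer powers of the bijection \<^const>\<open>sigma\<close> of
  \<open>topspace X \<times> {0<..<1}\<close>; the second disjunct accounts for the negative powers.\<close>

definition sigma_orbit ::
    "nat \<Rightarrow> 'x topology \<Rightarrow> ((nat \<Rightarrow> (nat \<Rightarrow> rat) set) \<Rightarrow> 'x \<Rightarrow> 'x) \<Rightarrow>
     'x \<times> real \<Rightarrow> ('x \<times> real) set" where
  "sigma_orbit p X \<phi> z =
     {w \<in> topspace X \<times> {0<..<1}.
        \<exists>n::nat. w = (sigma p \<phi> ^^ n) z \<or> z = (sigma p \<phi> ^^ n) w}"

definition Yspace ::
    "nat \<Rightarrow> 'x topology \<Rightarrow> ((nat \<Rightarrow> (nat \<Rightarrow> rat) set) \<Rightarrow> 'x \<Rightarrow> 'x) \<Rightarrow>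
     ('x \<times> real) set topology" where
  "Yspace p X \<phi> =
     quotient_topology (prod_topology X (top_of_set {0<..<1})) (sigma_orbit p X \<phi>)"

definition frob_orbit ::
    "nat \<Rightarrow> ((nat \<Rightarrow> (nat \<Rightarrow> rat) set) \<Rightarrow> 'x \<Rightarrow> 'x) \<Rightarrow> 'x \<Rightarrow> 'x set" where
  "frob_orbit p \<phi> = orbit ((Gp p)\<lparr>carrier := frob_closure p\<rparr>) \<phi>"

definition Zspace ::
    "nat \<Rightarrow> 'x topology \<Rightarrow> ((nat \<Rightarrow> (nat \<Rightarrow> rat) set) \<Rightarrow> 'x \<Rightarrow> 'x) \<Rightarrow> 'x set topology" where
  "Zspace p X \<phi> = quotient_topology X (frob_orbit p \<phi>)"

definition Gp_translation ::
    "nat \<Rightarrow> (nat \<Rightarrow> (nat \<Rightarrow> rat) set) \<Rightarrow> (nat \<Rightarrow> (nat \<Rightarrow> rat) set) \<Rightarrow>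
     (nat \<Rightarrow> (nat \<Rightarrow> rat) set)" where
  "Gp_translation p g = (\<lambda>x\<in>carrier (Gp p). g \<otimes>\<^bsub>Gp p\<^esub> x)"


section \<open>Adeles and ideles of the rationals\<close>

type_synonym adele = "(nat \<Rightarrow> (nat \<Rightarrow> rat) set) \<times> real"

definition adele_ring :: "adele ring" where
  "adele_ring =
     \<lparr>carrier = {(a, r). a \<in> (\<Pi>\<^sub>E l\<in>primes. carrier (Qp l)) \<and>
                        finite {l \<in> primes. a l \<notin> carrier (Zp l)}},
      monoid.mult = (\<lambda>(a, r) (b, s). (\<lambda>l\<in>primes. a l \<otimes>\<^bsub>Qp l\<^esub> b l, r * s)),
      one = (\<lambda>l\<in>primes. \<one>\<^bsub>Qp l\<^esub>, 1),
      ring.zero = (\<lambda>l\<in>primes. \<zero>\<^bsub>Qp l\<^esub>, 0),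
      add = (\<lambda>(a, r) (b, s). (\<lambda>l\<in>primes. a l \<oplus>\<^bsub>Qp l\<^esub> b l, r + s))\<rparr>"

definition principal_ideles :: "adele set" where
  "principal_ideles = {(\<lambda>l\<in>primes. Qp_of_rat l q, of_rat q) | q. q \<noteq> 0}"

definition idele_top :: "adele topology" where
  "idele_top = topology_generated_by
     {(\<Pi>\<^sub>E l\<in>primes. U l) \<times> V | U V.
        (\<forall>l\<in>primes. openin (Qp_top l) (U l) \<and> U l \<subseteq> Units (Qp l)) \<and>
        finite {l \<in> primes. U l \<noteq> Units (Zp l)} \<and>
        open V \<and> 0 \<notin> V}"

definition idele_class_group :: "adele set monoid" where
  "idele_class_group = units_of adele_ring Mod principal_ideles"

definition idele_class_top :: "adele set topology" where
  "idele_class_top =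
     quotient_topology idele_top (\<lambda>a. principal_ideles #>\<^bsub>units_of adele_ring\<^esub> a)"


section \<open>Hyperrings and the adele class space\<close>

record 'a hyperring = "'a monoid" +
  hzero :: 'a
  hadd :: "'a \<Rightarrow> 'a \<Rightarrow> 'a set"

text \<open>Closure under negation follows from closure under multiplication by \<open>-1\<close>.\<close>

definition hyperideal :: "'a hyperring \<Rightarrow> 'a set \<Rightarrow> bool" where
  "hyperideal H I \<longleftrightarrow>
     I \<subseteq> carrier H \<and> hzero H \<in> I \<and>
     (\<forall>x\<in>I. \<forall>y\<in>I. hadd H x y \<subseteq> I) \<and>
     (\<forall>r\<in>carrier H. \<forall>x\<in>I. r \<otimes>\<^bsub>H\<^esub> x \<in> I)"

definition prime_hyperideal :: "'a hyperring \<Rightarrow> 'a set \<Rightarrow> bool" where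
  "prime_hyperideal H I \<longleftrightarrow>
     hyperideal H I \<and> I \<noteq> carrier H \<and>
     (\<forall>x\<in>carrier H. \<forall>y\<in>carrier H. x \<otimes>\<^bsub>H\<^esub> y \<in> I \<longrightarrow> x \<in> I \<or> y \<in> I)"

definition principal_hyperideal :: "'a hyperring \<Rightarrow> 'a \<Rightarrow> 'a set" where
  "principal_hyperideal H a = \<Inter>{I. hyperideal H I \<and> a \<in> I}"

definition prime_elements :: "'a hyperring \<Rightarrow> 'a set" where
  "prime_elements H = {a \<in> carrier H. prime_hyperideal H (principal_hyperideal H a)}"

definition adele_class :: "adele \<Rightarrow> adele set" where
  "adele_class a = principal_ideles #>\<^bsub>adele_ring\<^esub> a"

text \<open>The product set of two classes is again a class, namely that of the product.\<close>

definition HQ :: "adele set hyperring" where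
  "HQ = \<lparr>carrier = adele_class ` carrier adele_ring,
         monoid.mult = set_mult adele_ring,
         one = adele_class \<one>\<^bsub>adele_ring\<^esub>,
         hzero = adele_class \<zero>\<^bsub>adele_ring\<^esub>,
         hadd = (\<lambda>x y. {adele_class (a \<oplus>\<^bsub>adele_ring\<^esub> b) | a b. a \<in> x \<and> b \<in> y})\<rparr>"

definition place_ideal :: "nat \<Rightarrow> adele set set" where
  "place_ideal p = {c \<in> carrier HQ. \<forall>a\<in>c. fst a p = \<zero>\<^bsub>Qp p\<^esub>}"

definition Pp :: "nat \<Rightarrow> adele set set" where
  "Pp p = {a \<in> prime_elements HQ. principal_hyperideal HQ a = place_ideal p}"

text \<open>The adele with component 0 at \<open>p\<close>, \<open>g\<^sub>l\<close> at the primes \<open>l \<noteq> p\<close>, and \<open>r\<close> at infinity.\<close>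

definition adele_zero_at :: "nat \<Rightarrow> (nat \<Rightarrow> (nat \<Rightarrow> rat) set) \<Rightarrow> real \<Rightarrow> adele" where
  "adele_zero_at p g r = (\<lambda>l\<in>primes. if l = p then \<zero>\<^bsub>Qp p\<^esub> else g l, r)"

text \<open>The fiber carries the topology of the homogeneous space of the idele class group, i.e. the
  quotient topology for the orbit map through the class of the idempotent adele. This is
  compact and strictly finer than the subspace topology induced by the adele classes, which is
  not Hausdorff.\<close>

definition Pp_top :: "nat \<Rightarrow> adele set topology" where
  "Pp_top p = quotient_topology idele_class_top
     (\<lambda>c. c \<otimes>\<^bsub>HQ\<^esub> adele_class (adele_zero_at p \<one>\<^bsub>Gp p\<^esub> 1))"

end

theory Submission
  imports Defs "HOL-Number_Theory.Residues"
begin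

text \<open>The group \<open>G\<^sub>p\<close> is described by residues: an element \<open>g\<close> has an invertible residue \<open>red N g\<close>
  modulo every \<open>N\<close> prime to \<open>p\<close>, and the elements of \<open>G\<^sub>p\<close> are exactly the compatible systems of such
  residues (\<open>Gp_eqI\<close>, \<open>Gp_of_compatible_residues\<close>). The residues generate the topology, so that \<open>G\<^sub>p\<close> is
  a compact Hausdorff group. An element \<open>g\<close> raises the \<open>N\<close>-th roots of unity to the power
  \<open>red N g\<close>; conversely the exponents by which an automorphism acts on primitive roots form a compatible
  system, which identifies \<open>G\<^sub>p\<close> with the automorphism group of \<open>\<mu>\<^sup>(\<^sup>p\<^sup>)\<close>.

  The bundle rests on a continuous map \<open>r\<close> from \<open>G\<^sub>p\<close> to \<open>\<int>\<close>-hat, the profinite integers, with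
  \<open>r (f\<^sub>p g) = 1 + r g\<close> (\<open>retraction_exists\<close>). It exists because \<open>p\<close> has order exactly \<open>n\<close> modulo
  \<open>p ^ n - 1\<close>: multiplication by \<open>p\<close> makes the units modulo \<open>p ^ n - 1\<close> a free \<open>\<int>/n\<close>-set, hence there is
  an equivariant function to \<open>\<int>/n\<close>, and such functions can be lifted from level to level. By density \<open>r\<close> is
  equivariant for the whole closed subgroup generated by \<open>f\<^sub>p\<close>, and it maps that subgroup bijectively, hence
  homeomorphically, onto the profinite integers (\<open>r_inj\<close>, \<open>r_image\<close>). In particular powers \<open>f\<^sub>p\<^sup>a\<close> with
  profinite exponent are defined.

  A point of a torsor \<open>X\<close> transports \<open>r\<close> to a map \<open>rX\<close> on \<open>X\<close>. With \<open>\<rho> = exp (- p\<^sup>s)\<close> the map \<open>\<sigma>\<close> becomes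
  \<open>(x, s) \<mapsto> (f\<^sub>p x, s + 1)\<close>, and \<open>(x, \<rho>) \<mapsto> (orbit of x, class of (rX x, s))\<close> induces a continuous
  bijection from \<open>Y\<close> to \<open>Z \<times> S\<close>. As \<open>Y\<close> is compact, and \<open>Z\<close> and \<open>S\<close> are Hausdorff, this is a
  homeomorphism (\<open>Yspace_trivialization\<close>). So the bundle is even globally trivial, and the action of \<open>S\<close> is
  the translation of the second factor.

  For the fiber over \<open>p\<close>, the hyperideal generated by an adele class consists of its multiples; therefore
  the generators of the prime ideal at \<open>p\<close> are the classes of the adeles that vanish at \<open>p\<close> and agree with
  an idele elsewhere (\<open>Pp_eq\<close>). Since \<open>\<rat>\<close> has class number one, every idele is a rational multiple of an
  idele with unit components and positive real component (\<open>idele_decompose\<close>). So every element of the fiber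
  is the class of an adele with components \<open>0\<close> at \<open>p\<close>, \<open>g\<close> outside \<open>p\<close> and \<open>- ln \<rho> > 0\<close> at infinity,
  with \<open>g\<close> in \<open>G\<^sub>p\<close>. Two such adeles have the same class if and only if they differ by a positive rational
  that is a unit outside \<open>p\<close>, which is a power of \<open>p\<close>, that is, if and only if the points \<open>(g, \<rho>)\<close> differ by
  a power of \<open>\<sigma>\<close> (\<open>fiber_point_eq_iff\<close>). Both \<open>Y\<close> and the fiber carry the quotient topology of
  \<open>G\<^sub>p \<times> (0, 1)\<close> (\<open>quotient_map_fiber_point\<close>), hence they are homeomorphic.\<close>

section \<open>The \<open>l\<close>-adic absolute value on the rationals\<close>

lemma rat_quotient_exhaust:
  fixes q :: rat
  obtains a b :: int where "b \<noteq> 0" "q = of_int a / of_int b"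
  by (metis Fract_of_int_quotient Rat_cases less_irrefl)

context
  fixes l :: nat
  assumes prime_l: "prime l"
begin

lemma padic_abs_quotient:
  assumes "a \<noteq> 0" "b \<noteq> 0"
  shows "padic_abs l (of_int a / of_int b) =
    real l powi (int (multiplicity (int l) b) - int (multiplicity (int l) a))"
proof -
  obtain n d where nd: "quotient_of (of_int a / of_int b) = (n, d)"
    by fastforce
  have d: "d > 0" using quotient_of_denom_pos[OF nd] .
  have eq: "of_int a / of_int b = (of_int n / of_int d :: rat)"
    using quotient_of_div[OF nd] .
  then have "of_int (a * d) = (of_int (n * b) :: rat)"
    using d assms by (simp add: field_simps)
  then have ad: "a * d = n * b"
    by (simp only: of_int_eq_iff)
  then have n: "n \<noteq> 0" using assms d by auto
  have p: "prime_elem (int l)" using prime_l by simp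
  have "multiplicity (int l) a + multiplicity (int l) d = multiplicity (int l) n + multiplicity (int l) b"
    using ad assms d n prime_elem_multiplicity_mult_distrib[OF p] by (metis less_irrefl)
  then have "int (multiplicity (int l) d) - int (multiplicity (int l) n) =
      int (multiplicity (int l) b) - int (multiplicity (int l) a)"
    by linarith
  then show ?thesis
    using nd assms by (simp add: padic_abs_def)
qed

lemma padic_abs_of_int:
  "a \<noteq> 0 \<Longrightarrow> padic_abs l (of_int a) = real l powi (- int (multiplicity (int l) a))"
  using padic_abs_quotient[of a 1] by simp

lemma padic_abs_zero [simp]: "padic_abs l 0 = 0"
  by (simp add: padic_abs_def)

lemma prime_base_pos: "real l > 1" "l > 1" "l > 0"
  using prime_gt_1_nat[OF prime_l] by auto

lemma padic_abs_pos: "q \<noteq> 0 \<Longrightarrow> padic_abs l q > 0"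
  using prime_base_pos by (simp add: padic_abs_def)

lemma padic_abs_nonneg [simp]: "padic_abs l q \<ge> 0"
  using padic_abs_pos[of q] by (cases "q = 0") auto

lemma padic_abs_eq_0_iff [simp]: "padic_abs l q = 0 \<longleftrightarrow> q = 0"
  using padic_abs_pos[of q] by (cases "q = 0") auto

lemma padic_abs_mult: "padic_abs l (x * y) = padic_abs l x * padic_abs l y"
proof (cases "x = 0 \<or> y = 0")
  case False
  obtain a b where x: "b \<noteq> 0" "x = of_int a / of_int b" by (rule rat_quotient_exhaust)
  obtain c d where y: "d \<noteq> 0" "y = of_int c / of_int d" by (rule rat_quotient_exhaust)
  have ac: "a \<noteq> 0" "c \<noteq> 0" using False x y by auto
  have p: "prime_elem (int l)" using prime_l by simp
  have xy: "x * y = of_int (a * c) / of_int (b * d)" using x y by simp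
  show ?thesis
    unfolding xy using x y ac prime_base_pos
    by (simp add: padic_abs_quotient prime_elem_multiplicity_mult_distrib[OF p]
        flip: power_int_add del: of_int_mult) (simp add: algebra_simps)
qed auto

lemma padic_abs_one [simp]: "padic_abs l 1 = 1"
  using padic_abs_of_int[of 1] by simp

lemma padic_abs_minus [simp]: "padic_abs l (- x) = padic_abs l x"
proof -
  have "padic_abs l (-1) ^ 2 = 1"
    by (simp add: power2_eq_square flip: padic_abs_mult)
  then have "padic_abs l (-1) = 1"
    using padic_abs_nonneg[of "-1"] by (simp add: power2_eq_1_iff)
  then show ?thesis using padic_abs_mult[of "-1" x] by simp
qed

lemma padic_abs_inverse: "padic_abs l (inverse x) = inverse (padic_abs l x)"
proof (cases "x = 0")
  case False
  then have "padic_abs l x * padic_abs l (inverse x) = 1"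
    by (simp flip: padic_abs_mult)
  then show ?thesis by (metis inverse_unique)
qed auto

lemma padic_abs_divide: "padic_abs l (x / y) = padic_abs l x / padic_abs l y"
  by (simp add: divide_inverse padic_abs_mult padic_abs_inverse)

text \<open>This translates absolute values of integers into divisibility by powers of \<open>l\<close>; the ultrametric
  inequality and all statements on residues are deduced from it.\<close>

lemma padic_abs_of_int_le_iff:
  "padic_abs l (of_int a) \<le> inverse (real l ^ k) \<longleftrightarrow> int l ^ k dvd a"
proof (cases "a = 0")
  case False
  have "padic_abs l (of_int a) \<le> inverse (real l ^ k) \<longleftrightarrow>
      real l ^ k \<le> real l ^ multiplicity (int l) a"
    unfolding padic_abs_of_int[OF False] power_int_minus power_int_of_nat
    using prime_base_pos by (intro inverse_le_iff_le) auto
  also have "\<dots> \<longleftrightarrow> k \<le> multiplicity (int l) a"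
    using prime_base_pos by (intro power_increasing_iff)
  also have "\<dots> \<longleftrightarrow> int l ^ k dvd a"
  proof -
    have "\<not> is_unit (int l)" using prime_l not_prime_unit by auto
    then show ?thesis using False by (simp add: power_dvd_iff_le_multiplicity)
  qed
  finally show ?thesis .
qed (use prime_base_pos in auto)

lemma padic_abs_of_int_le_1 [simp]: "padic_abs l (of_int a) \<le> 1"
  using padic_abs_of_int_le_iff[of a 0] by simp

lemma padic_abs_of_int_cases:
  assumes "a \<noteq> 0" obtains k where "padic_abs l (of_int a) = inverse (real l ^ k)"
  using that[of "multiplicity (int l) a"] prime_base_pos padic_abs_of_int[OF assms]
  by (simp add: power_int_minus)

lemma padic_abs_of_int_add_le:
  assumes "padic_abs l (of_int a) \<le> padic_abs l (of_int c)"
  shows "padic_abs l (of_int (a + c)) \<le> padic_abs l (of_int c)"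
proof (cases "c = 0")
  case True
  then have "padic_abs l (of_int a) = 0" using assms padic_abs_nonneg[of "of_int a"] by simp
  then have "a = 0" by (simp only: padic_abs_eq_0_iff of_int_eq_0_iff)
  then show ?thesis using True by simp
next
  case False
  obtain k where k: "padic_abs l (of_int c) = inverse (real l ^ k)"
    using padic_abs_of_int_cases[OF False] .
  then have "int l ^ k dvd c" "int l ^ k dvd a"
    using assms by (simp_all flip: padic_abs_of_int_le_iff)
  then show ?thesis unfolding k padic_abs_of_int_le_iff by simp
qed

lemma padic_abs_add_le: "padic_abs l (x + y) \<le> max (padic_abs l x) (padic_abs l y)"
proof -
  obtain a b where x: "b \<noteq> 0" "x = of_int a / of_int b" by (rule rat_quotient_exhaust)
  obtain c d where y: "d \<noteq> 0" "y = of_int c / of_int d" by (rule rat_quotient_exhaust)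
  have x': "x = of_int (a * d) / of_int (b * d)" and y': "y = of_int (c * b) / of_int (b * d)"
    and xy: "x + y = of_int (a * d + c * b) / of_int (b * d)"
    using x y by (simp_all add: field_simps)
  have "padic_abs l (of_int (a * d + c * b)) \<le> max (padic_abs l (of_int (a * d))) (padic_abs l (of_int (c * b)))"
  proof (cases "padic_abs l (of_int (a * d)) \<le> padic_abs l (of_int (c * b))")
    case True
    then show ?thesis using padic_abs_of_int_add_le[of "a * d" "c * b"] by (simp only: max_absorb2)
  next
    case False
    then show ?thesis using padic_abs_of_int_add_le[of "c * b" "a * d"]
      by (simp only: max_absorb1 linear add.commute)
  qed
  then have "padic_abs l (of_int (a * d + c * b)) / padic_abs l (of_int (b * d)) \<le>
      max (padic_abs l (of_int (a * d))) (padic_abs l (of_int (c * b))) / padic_abs l (of_int (b * d))"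
    by (rule divide_right_mono) (rule padic_abs_nonneg)
  then show ?thesis
    unfolding xy unfolding x' y' padic_abs_divide max_divide_distrib_right
    by (simp only: padic_abs_nonneg if_True)
qed

lemma padic_abs_add_leI: "padic_abs l x \<le> e \<Longrightarrow> padic_abs l y \<le> e \<Longrightarrow> padic_abs l (x + y) \<le> e"
  using padic_abs_add_le[of x y] by linarith

lemma padic_abs_diff_leI: "padic_abs l x \<le> e \<Longrightarrow> padic_abs l y \<le> e \<Longrightarrow> padic_abs l (x - y) \<le> e"
  using padic_abs_add_leI[of x e "- y"] by simp

lemma padic_abs_add_ltI: "padic_abs l x < e \<Longrightarrow> padic_abs l y < e \<Longrightarrow> padic_abs l (x + y) < e"
  using padic_abs_add_le[of x y] by linarith

lemma padic_abs_triangle: "padic_abs l (x + y) \<le> padic_abs l x + padic_abs l y"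
  using padic_abs_add_le[of x y] padic_abs_nonneg[of x] padic_abs_nonneg[of y] by linarith

lemma padic_abs_eqI:
  assumes "padic_abs l (x - y) < padic_abs l x"
  shows "padic_abs l y = padic_abs l x"
proof (rule antisym)
  show "padic_abs l y \<le> padic_abs l x"
    using padic_abs_diff_leI[of x _ "x - y"] assms by simp
  show "padic_abs l x \<le> padic_abs l y"
    using padic_abs_add_le[of "x - y" y] assms by auto
qed

lemma padic_abs_prime: "padic_abs l (of_nat l) = inverse (real l)"
proof -
  have "multiplicity (int l) (int l) = 1"
    using prime_l by (intro multiplicity_self) (auto simp: not_prime_unit)
  then show ?thesis using padic_abs_of_int[of "int l"] prime_base_pos by (simp add: power_int_minus)
qed

lemma padic_abs_of_nat_eq_1:
  assumes "\<not> l dvd n" shows "padic_abs l (of_nat n) = 1"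
proof -
  have n0: "n \<noteq> 0" using assms by (metis dvd_0_right)
  have "\<not> int l dvd int n" using assms by simp
  then have "multiplicity (int l) (int n) = 0" by (simp add: not_dvd_imp_multiplicity_0)
  then show ?thesis using padic_abs_of_int[of "int n"] n0 by simp
qed

text \<open>Rationals of absolute value at most 1 are fractions with denominator prime to \<open>l\<close>, and such a
  denominator is invertible modulo every power of \<open>l\<close>.\<close>

lemma padic_abs_le_1_approx:
  assumes "padic_abs l q \<le> 1"
  shows "\<exists>m::int. padic_abs l (q - of_int m) \<le> inverse (real l ^ k)"
proof (cases "q = 0")
  case True
  then show ?thesis using prime_base_pos by (intro exI[of _ 0]) simp
next
  case False
  obtain a b where nd: "quotient_of q = (a, b)"
    by fastforce
  then have b: "b > 0" and q: "q = of_int a / of_int b" and cop: "coprime a b"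
    using quotient_of_denom_pos quotient_of_div quotient_of_coprime by blast+
  have nl: "\<not> int l dvd b"
  proof
    assume lb: "int l dvd b"
    have "\<not> is_unit (int l)" using prime_l not_prime_unit by auto
    then have "\<not> int l dvd a" using lb cop coprime_common_divisor by blast
    then have a: "multiplicity (int l) a = 0" by (simp add: not_dvd_imp_multiplicity_0)
    have "multiplicity (int l) b > 0"
      using lb b prime_l by (intro multiplicity_gt_zero_iff[THEN iffD2]) (auto simp: not_prime_unit)
    then have "padic_abs l q > 1"
      unfolding q using False q b prime_base_pos a
      by (subst padic_abs_quotient) (auto simp: one_less_power_int)
    then show False using assms by simp
  qed
  then have "coprime (int l) b" using prime_l by (simp add: prime_imp_coprime)
  then have "coprime b (int l ^ k)" by (simp add: coprime_commute)
  \<comment> \<open>the integer \<open>a * x\<close> approximates \<open>a / b\<close>\<close>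
  then obtain x where x: "[b * x = 1] (mod int l ^ k)"
    using cong_solve_coprime_int by blast
  then have "int l ^ k dvd a * (1 - b * x)"
    by (simp add: cong_iff_dvd_diff dvd_diff_commute)
  then have *: "padic_abs l (of_int (a * (1 - b * x))) \<le> inverse (real l ^ k)"
    using padic_abs_of_int_le_iff by blast
  have b1: "padic_abs l (of_int b) = 1"
    using padic_abs_of_int[of b] b nl by (simp add: not_dvd_imp_multiplicity_0)
  have "q - of_int (a * x) = of_int (a * (1 - b * x)) / of_int b"
    using b by (simp add: q field_simps)
  then have "padic_abs l (q - of_int (a * x)) \<le> inverse (real l ^ k)"
    using * by (simp only: padic_abs_divide b1 div_by_1)
  then show ?thesis by blast
qed

end

section \<open>The completed field and its norm\<close>

definition Qp_lim :: "nat \<Rightarrow> (nat \<Rightarrow> rat) \<Rightarrow> (nat \<Rightarrow> rat) set" where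
  "Qp_lim l x = padic_null l +>\<^bsub>padic_cauchy_ring l\<^esub> x"

lemma Qp_of_rat_conv_lim: "Qp_of_rat l q = Qp_lim l (\<lambda>n. q)"
  by (simp add: Qp_of_rat_def Qp_lim_def)

lemma padic_cauchy_iff:
  "x \<in> carrier (padic_cauchy_ring l) \<longleftrightarrow>
    (\<forall>e>0. \<exists>N. \<forall>m\<ge>N. \<forall>n\<ge>N. padic_abs l (x m - x n) < e)"
  by (simp add: padic_cauchy_ring_def)

lemma padic_null_iff: "x \<in> padic_null l \<longleftrightarrow> (\<lambda>n. padic_abs l (x n)) \<longlonglongrightarrow> 0"
  by (simp add: padic_null_def)

lemma padic_cauchy_ring_simps [simp]:
  "monoid.mult (padic_cauchy_ring l) = (\<lambda>x y n. x n * y n)"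
  "one (padic_cauchy_ring l) = (\<lambda>n. 1)"
  "ring.zero (padic_cauchy_ring l) = (\<lambda>n. 0)"
  "add (padic_cauchy_ring l) = (\<lambda>x y n. x n + y n)"
  by (simp_all add: padic_cauchy_ring_def)

context
  fixes l :: nat
  assumes prime_l: "prime l"
begin

declare padic_abs_nonneg [OF prime_l, simp] padic_abs_eq_0_iff [OF prime_l, simp]
  padic_abs_minus [OF prime_l, simp] padic_abs_one [OF prime_l, simp]
  padic_abs_zero [OF prime_l, simp]

lemma padic_cauchy_const [simp]: "(\<lambda>n. q) \<in> carrier (padic_cauchy_ring l)"
  by (simp add: padic_cauchy_iff)

lemma padic_null_cauchy: "x \<in> padic_null l \<Longrightarrow> x \<in> carrier (padic_cauchy_ring l)"
  unfolding padic_null_iff padic_cauchy_iff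
proof (intro allI impI)
  fix e :: real assume x: "(\<lambda>n. padic_abs l (x n)) \<longlonglongrightarrow> 0" and "e > 0"
  then obtain N where N: "\<And>n. n \<ge> N \<Longrightarrow> padic_abs l (x n) < e"
    using LIMSEQ_D[OF x \<open>e > 0\<close>] by (auto simp: abs_of_nonneg)
  have "padic_abs l (x m - x n) < e" if "m \<ge> N" "n \<ge> N" for m n
    using padic_abs_add_ltI[OF prime_l, of "x m" e "- x n"] N that by simp
  then show "\<exists>N. \<forall>m\<ge>N. \<forall>n\<ge>N. padic_abs l (x m - x n) < e" by blast
qed

text \<open>By the ultrametric inequality, the absolute values of the terms of a Cauchy sequence that
  does not tend to 0 are eventually constant.\<close>

lemma padic_cauchy_cases:
  assumes x: "x \<in> carrier (padic_cauchy_ring l)"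
  obtains (null) "x \<in> padic_null l"
  | (const) N c where "c > 0" "\<And>n. n \<ge> N \<Longrightarrow> padic_abs l (x n) = c"
proof (cases "x \<in> padic_null l")
  case False
  then obtain e where e: "e > 0" "\<And>N. \<exists>n\<ge>N. padic_abs l (x n) \<ge> e"
    by (force simp: padic_null_iff lim_sequentially not_less)
  obtain N where N: "\<And>m n. m \<ge> N \<Longrightarrow> n \<ge> N \<Longrightarrow> padic_abs l (x m - x n) < e"
    using x e(1) unfolding padic_cauchy_iff by blast
  obtain n0 where n0: "n0 \<ge> N" "padic_abs l (x n0) \<ge> e" using e(2) by blast
  have "padic_abs l (x n) = padic_abs l (x n0)" if "n \<ge> N" for n
    using padic_abs_eqI[OF prime_l, of "x n0" "x n"] N[OF n0(1) that] n0(2) by linarith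
  moreover have "padic_abs l (x n0) > 0" using n0 e(1) by linarith
  ultimately show ?thesis using const[of "padic_abs l (x n0)" N] by blast
qed (rule null)

lemma padic_cauchy_abs_convergent:
  assumes "x \<in> carrier (padic_cauchy_ring l)"
  shows "convergent (\<lambda>n. padic_abs l (x n))"
  using assms
proof (cases rule: padic_cauchy_cases)
  case null
  then show ?thesis by (auto simp: padic_null_iff convergent_def)
next
  case (const N c)
  then have "(\<lambda>n. padic_abs l (x n)) \<longlonglongrightarrow> c"
    by (intro tendsto_eventually) (auto simp: eventually_sequentially)
  then show ?thesis by (auto simp: convergent_def)
qed

lemma padic_cauchy_bounded:
  assumes "x \<in> carrier (padic_cauchy_ring l)"
  obtains B where "B > 0" "\<And>n. padic_abs l (x n) \<le> B"
  using convergent_imp_Bseq[OF padic_cauchy_abs_convergent[OF assms]] that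
  by (auto simp: Bseq_def)

lemma padic_cauchy_add:
  assumes "x \<in> carrier (padic_cauchy_ring l)" "y \<in> carrier (padic_cauchy_ring l)"
  shows "(\<lambda>n. x n + y n) \<in> carrier (padic_cauchy_ring l)"
  unfolding padic_cauchy_iff
proof (intro allI impI)
  fix e :: real assume "e > 0"
  obtain N where N: "\<And>m n. m \<ge> N \<Longrightarrow> n \<ge> N \<Longrightarrow> padic_abs l (x m - x n) < e"
    using assms(1) \<open>e > 0\<close> unfolding padic_cauchy_iff by blast
  obtain M where M: "\<And>m n. m \<ge> M \<Longrightarrow> n \<ge> M \<Longrightarrow> padic_abs l (y m - y n) < e"
    using assms(2) \<open>e > 0\<close> unfolding padic_cauchy_iff by blast
  have "padic_abs l (x m + y m - (x n + y n)) < e" if "m \<ge> max M N" "n \<ge> max M N" for m n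
    using padic_abs_add_ltI[OF prime_l N[of m n] M[of m n]] that by (simp add: algebra_simps)
  then show "\<exists>N. \<forall>m\<ge>N. \<forall>n\<ge>N. padic_abs l (x m + y m - (x n + y n)) < e" by blast
qed

lemma padic_cauchy_mult:
  assumes "x \<in> carrier (padic_cauchy_ring l)" "y \<in> carrier (padic_cauchy_ring l)"
  shows "(\<lambda>n. x n * y n) \<in> carrier (padic_cauchy_ring l)"
  unfolding padic_cauchy_iff
proof (intro allI impI)
  fix e :: real assume "e > 0"
  obtain A where A: "A > 0" "\<And>n. padic_abs l (x n) \<le> A" using padic_cauchy_bounded[OF assms(1)] by blast
  obtain B where B: "B > 0" "\<And>n. padic_abs l (y n) \<le> B" using padic_cauchy_bounded[OF assms(2)] by blast
  obtain N where N: "\<And>m n. m \<ge> N \<Longrightarrow> n \<ge> N \<Longrightarrow> padic_abs l (x m - x n) < e / B"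
    using assms(1) \<open>e > 0\<close> B(1) unfolding padic_cauchy_iff by (meson divide_pos_pos)
  obtain M where M: "\<And>m n. m \<ge> M \<Longrightarrow> n \<ge> M \<Longrightarrow> padic_abs l (y m - y n) < e / A"
    using assms(2) \<open>e > 0\<close> A(1) unfolding padic_cauchy_iff by (meson divide_pos_pos)
  have "padic_abs l (x m * y m - x n * y n) < e" if "m \<ge> max M N" "n \<ge> max M N" for m n
  proof -
    have "padic_abs l (x m * (y m - y n)) \<le> A * padic_abs l (y m - y n)"
      using A by (simp add: padic_abs_mult[OF prime_l] mult_right_mono)
    also have "\<dots> < e" using M[of m n] that A(1) by (simp add: pos_less_divide_eq mult.commute)
    finally have 1: "padic_abs l (x m * (y m - y n)) < e" .
    have "padic_abs l ((x m - x n) * y n) \<le> padic_abs l (x m - x n) * B"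
      using B by (simp add: padic_abs_mult[OF prime_l] mult_left_mono)
    also have "\<dots> < e" using N[of m n] that B(1) by (simp add: pos_less_divide_eq)
    finally have 2: "padic_abs l ((x m - x n) * y n) < e" .
    show ?thesis using padic_abs_add_ltI[OF prime_l 1 2] by (simp add: algebra_simps)
  qed
  then show "\<exists>N. \<forall>m\<ge>N. \<forall>n\<ge>N. padic_abs l (x m * y m - x n * y n) < e" by blast
qed

lemma padic_cauchy_uminus:
  "x \<in> carrier (padic_cauchy_ring l) \<Longrightarrow> (\<lambda>n. - x n) \<in> carrier (padic_cauchy_ring l)"
  using padic_cauchy_mult[OF padic_cauchy_const[of "-1"]] by simp

lemma cring_padic_cauchy_ring: "cring (padic_cauchy_ring l)"
proof (intro cringI abelian_groupI comm_monoidI)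
  fix x assume "x \<in> carrier (padic_cauchy_ring l)"
  then show "\<exists>y\<in>carrier (padic_cauchy_ring l). y \<oplus>\<^bsub>padic_cauchy_ring l\<^esub> x = \<zero>\<^bsub>padic_cauchy_ring l\<^esub>"
    by (intro bexI[OF _ padic_cauchy_uminus]) auto
qed (auto simp: padic_cauchy_add padic_cauchy_mult algebra_simps)

lemma padic_cauchy_a_inv:
  "x \<in> carrier (padic_cauchy_ring l) \<Longrightarrow> \<ominus>\<^bsub>padic_cauchy_ring l\<^esub> x = (\<lambda>n. - x n)"
  using abelian_group.minus_equality[of "padic_cauchy_ring l" "\<lambda>n. - x n" x]
    cring_padic_cauchy_ring padic_cauchy_uminus
  by (auto simp: cring_def ring_def)

lemma padic_null_add: "x \<in> padic_null l \<Longrightarrow> y \<in> padic_null l \<Longrightarrow> (\<lambda>n. x n + y n) \<in> padic_null l"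
  unfolding padic_null_iff
  by (rule Lim_null_comparison[OF always_eventually tendsto_add_zero
        [where f = "\<lambda>n. padic_abs l (x n)" and g = "\<lambda>n. padic_abs l (y n)"]])
    (simp_all add: padic_abs_triangle[OF prime_l])

lemma padic_null_uminus: "x \<in> padic_null l \<Longrightarrow> (\<lambda>n. - x n) \<in> padic_null l"
  by (simp add: padic_null_iff)

lemma padic_null_mult:
  assumes "x \<in> padic_null l" "y \<in> carrier (padic_cauchy_ring l)"
  shows "(\<lambda>n. x n * y n) \<in> padic_null l"
proof -
  obtain B where B: "B > 0" "\<And>n. padic_abs l (y n) \<le> B" using padic_cauchy_bounded[OF assms(2)] by blast
  have "(\<lambda>n. padic_abs l (x n) * B) \<longlonglongrightarrow> 0"
    using assms(1) by (auto simp: padic_null_iff intro: tendsto_mult_left_zero)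
  then show ?thesis
    unfolding padic_null_iff padic_abs_mult[OF prime_l]
    by (rule Lim_null_comparison[OF always_eventually, rotated]) (simp add: mult_left_mono B)
qed

lemma ideal_padic_null: "ideal (padic_null l) (padic_cauchy_ring l)"
proof (rule idealI)
  interpret R: cring "padic_cauchy_ring l" by (rule cring_padic_cauchy_ring)
  show "ring (padic_cauchy_ring l)" by (rule R.ring_axioms)
  show "subgroup (padic_null l) (add_monoid (padic_cauchy_ring l))"
  proof (rule R.add.subgroupI)
    fix x assume x: "x \<in> padic_null l"
    then show "\<ominus>\<^bsub>padic_cauchy_ring l\<^esub> x \<in> padic_null l"
      by (simp add: padic_cauchy_a_inv padic_null_cauchy padic_null_uminus)
  next
    have "(\<lambda>n. 0) \<in> padic_null l" by (simp add: padic_null_iff)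
    then show "padic_null l \<noteq> {}" by blast
  qed (auto intro: padic_null_cauchy padic_null_add)
  fix x y assume "x \<in> padic_null l" "y \<in> carrier (padic_cauchy_ring l)"
  then have *: "(\<lambda>n. x n * y n) \<in> padic_null l" by (rule padic_null_mult)
  show "x \<otimes>\<^bsub>padic_cauchy_ring l\<^esub> y \<in> padic_null l" using * by simp
  show "y \<otimes>\<^bsub>padic_cauchy_ring l\<^esub> x \<in> padic_null l" using * by (simp add: mult.commute)
qed

lemma cring_Qp: "cring (Qp l)"
  unfolding Qp_def by (rule ideal.quotient_is_cring[OF ideal_padic_null cring_padic_cauchy_ring])

lemma ring_hom_Qp_lim: "ring_hom_cring (padic_cauchy_ring l) (Qp l) (Qp_lim l)"
  using ideal.rcos_ring_hom_cring[OF ideal_padic_null cring_padic_cauchy_ring]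
  unfolding Qp_def Qp_lim_def[abs_def] .

interpretation H: ring_hom_cring "padic_cauchy_ring l" "Qp l" "Qp_lim l"
  by (rule ring_hom_Qp_lim)

lemma Qp_lim_closed [simp, intro]:
  "x \<in> carrier (padic_cauchy_ring l) \<Longrightarrow> Qp_lim l x \<in> carrier (Qp l)"
  by (rule H.hom_closed)

lemma Qp_cases:
  assumes "a \<in> carrier (Qp l)"
  obtains x where "x \<in> carrier (padic_cauchy_ring l)" "a = Qp_lim l x"
  using assms by (auto simp: Qp_def FactRing_def A_RCOSETS_def' Qp_lim_def)

lemma Qp_lim_add:
  "x \<in> carrier (padic_cauchy_ring l) \<Longrightarrow> y \<in> carrier (padic_cauchy_ring l) \<Longrightarrow>
    Qp_lim l x \<oplus>\<^bsub>Qp l\<^esub> Qp_lim l y = Qp_lim l (\<lambda>n. x n + y n)"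
  using H.hom_add[of x y] by simp

lemma Qp_lim_mult:
  "x \<in> carrier (padic_cauchy_ring l) \<Longrightarrow> y \<in> carrier (padic_cauchy_ring l) \<Longrightarrow>
    Qp_lim l x \<otimes>\<^bsub>Qp l\<^esub> Qp_lim l y = Qp_lim l (\<lambda>n. x n * y n)"
  using H.hom_mult[of x y] by simp

lemma Qp_lim_uminus:
  "x \<in> carrier (padic_cauchy_ring l) \<Longrightarrow> \<ominus>\<^bsub>Qp l\<^esub> Qp_lim l x = Qp_lim l (\<lambda>n. - x n)"
  using H.hom_a_inv[of x] by (simp add: padic_cauchy_a_inv)

lemma Qp_lim_diff:
  "x \<in> carrier (padic_cauchy_ring l) \<Longrightarrow> y \<in> carrier (padic_cauchy_ring l) \<Longrightarrow>
    Qp_lim l x \<ominus>\<^bsub>Qp l\<^esub> Qp_lim l y = Qp_lim l (\<lambda>n. x n - y n)"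
  by (simp add: a_minus_def Qp_lim_uminus Qp_lim_add padic_cauchy_uminus)

lemma Qp_one_conv_lim: "\<one>\<^bsub>Qp l\<^esub> = Qp_lim l (\<lambda>n. 1)"
  using H.hom_one by simp

lemma Qp_lim_eq_zero_iff:
  assumes x: "x \<in> carrier (padic_cauchy_ring l)"
  shows "Qp_lim l x = \<zero>\<^bsub>Qp l\<^esub> \<longleftrightarrow> x \<in> padic_null l"
proof -
  interpret I: ideal "padic_null l" "padic_cauchy_ring l" by (rule ideal_padic_null)
  have z: "\<zero>\<^bsub>Qp l\<^esub> = padic_null l" by (simp add: Qp_def FactRing_def)
  show ?thesis unfolding z Qp_lim_def
    using x I.rcos_const_imp_mem I.a_rcos_const by blast
qed

subsection \<open>The norm\<close>

text \<open>All representatives of a class have the same limit of absolute values, so the definite description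
  in \<^const>\<open>padic_norm\<close> is meaningful.\<close>

lemma padic_norm_lim:
  assumes x: "x \<in> carrier (padic_cauchy_ring l)"
  shows "(\<lambda>n. padic_abs l (x n)) \<longlonglongrightarrow> padic_norm l (Qp_lim l x)"
proof -
  obtain r where r: "(\<lambda>n. padic_abs l (x n)) \<longlonglongrightarrow> r"
    using padic_cauchy_abs_convergent[OF x] by (auto simp: convergent_def)
  have *: "(\<lambda>n. padic_abs l (y n)) \<longlonglongrightarrow> r" if y: "y \<in> Qp_lim l x" for y
  proof -
    obtain h where h: "h \<in> padic_null l" "y = (\<lambda>n. h n + x n)"
      using y by (auto simp: Qp_lim_def a_r_coset_def')
    have "\<bar>padic_abs l (y n) - padic_abs l (x n)\<bar> \<le> padic_abs l (h n)" for n
      using padic_abs_triangle[OF prime_l, of "h n" "x n"]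
        padic_abs_triangle[OF prime_l, of "- h n" "h n + x n"] by (simp add: h(2))
    then have "\<forall>n. norm (padic_abs l (y n) - padic_abs l (x n)) \<le> padic_abs l (h n)"
      by simp
    then have "(\<lambda>n. padic_abs l (y n) - padic_abs l (x n)) \<longlonglongrightarrow> 0"
      by (rule Lim_null_comparison[OF always_eventually]) (use h(1) in \<open>simp add: padic_null_iff\<close>)
    from tendsto_add[OF this r] show ?thesis by simp
  qed
  have x': "x \<in> Qp_lim l x"
    unfolding Qp_lim_def by (rule abelian_subgroup.a_rcos_self[OF abelian_subgroupI3 x])
      (use ideal_padic_null cring_padic_cauchy_ring in \<open>auto simp: ideal_def cring_def ring_def\<close>)
  have "padic_norm l (Qp_lim l x) = r"
    unfolding padic_norm_def
  proof (rule the_equality)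
    show "\<forall>y\<in>Qp_lim l x. (\<lambda>n. padic_abs l (y n)) \<longlonglongrightarrow> r" using * by blast
    show "s = r" if "\<forall>y\<in>Qp_lim l x. (\<lambda>n. padic_abs l (y n)) \<longlonglongrightarrow> s" for s
      using that x' r LIMSEQ_unique by blast
  qed
  then show ?thesis using r by simp
qed

lemma padic_norm_nonneg:
  assumes "a \<in> carrier (Qp l)" shows "padic_norm l a \<ge> 0"
proof -
  obtain x where x: "x \<in> carrier (padic_cauchy_ring l)" "a = Qp_lim l x" using Qp_cases[OF assms] .
  show ?thesis unfolding x(2) by (rule LIMSEQ_le_const[OF padic_norm_lim[OF x(1)]]) auto
qed

lemma padic_norm_of_rat [simp]: "padic_norm l (Qp_of_rat l q) = padic_abs l q"
  using LIMSEQ_unique[OF padic_norm_lim[OF padic_cauchy_const] tendsto_const]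
  by (auto simp: Qp_of_rat_conv_lim)

lemma Qp_of_rat_closed [simp, intro]: "Qp_of_rat l q \<in> carrier (Qp l)"
  by (simp add: Qp_of_rat_conv_lim)

lemma Qp_of_rat_one: "Qp_of_rat l 1 = \<one>\<^bsub>Qp l\<^esub>"
  by (simp add: Qp_of_rat_conv_lim Qp_one_conv_lim)

lemma Qp_of_rat_mult: "Qp_of_rat l (q * r) = Qp_of_rat l q \<otimes>\<^bsub>Qp l\<^esub> Qp_of_rat l r"
  by (simp add: Qp_of_rat_conv_lim Qp_lim_mult)

lemma Qp_of_rat_diff: "Qp_of_rat l (q - r) = Qp_of_rat l q \<ominus>\<^bsub>Qp l\<^esub> Qp_of_rat l r"
  by (simp add: Qp_of_rat_conv_lim Qp_lim_diff)

lemma padic_norm_mult: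
  assumes "a \<in> carrier (Qp l)" "b \<in> carrier (Qp l)"
  shows "padic_norm l (a \<otimes>\<^bsub>Qp l\<^esub> b) = padic_norm l a * padic_norm l b"
proof -
  obtain x where x: "x \<in> carrier (padic_cauchy_ring l)" "a = Qp_lim l x" using Qp_cases[OF assms(1)] .
  obtain y where y: "y \<in> carrier (padic_cauchy_ring l)" "b = Qp_lim l y" using Qp_cases[OF assms(2)] .
  have "(\<lambda>n. padic_abs l (x n * y n)) \<longlonglongrightarrow> padic_norm l a * padic_norm l b"
    unfolding padic_abs_mult[OF prime_l] x(2) y(2) by (intro tendsto_mult padic_norm_lim x y)
  then show ?thesis
    using LIMSEQ_unique[OF padic_norm_lim[OF padic_cauchy_mult[OF x(1) y(1)]]]
    by (simp add: x y Qp_lim_mult)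
qed

lemma padic_norm_add_le:
  assumes "a \<in> carrier (Qp l)" "b \<in> carrier (Qp l)"
  shows "padic_norm l (a \<oplus>\<^bsub>Qp l\<^esub> b) \<le> max (padic_norm l a) (padic_norm l b)"
proof -
  obtain x where x: "x \<in> carrier (padic_cauchy_ring l)" "a = Qp_lim l x" using Qp_cases[OF assms(1)] .
  obtain y where y: "y \<in> carrier (padic_cauchy_ring l)" "b = Qp_lim l y" using Qp_cases[OF assms(2)] .
  have "(\<lambda>n. max (padic_abs l (x n)) (padic_abs l (y n))) \<longlonglongrightarrow> max (padic_norm l a) (padic_norm l b)"
    unfolding x(2) y(2) by (intro tendsto_max padic_norm_lim x y)
  then show ?thesis
    using padic_norm_lim[OF padic_cauchy_add[OF x(1) y(1)]]
    by (intro LIMSEQ_le[of _ _ "\<lambda>n. max (padic_abs l (x n)) (padic_abs l (y n))"])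
      (auto simp: x y Qp_lim_add padic_abs_add_le[OF prime_l])
qed

lemma padic_norm_uminus [simp]:
  assumes "a \<in> carrier (Qp l)" shows "padic_norm l (\<ominus>\<^bsub>Qp l\<^esub> a) = padic_norm l a"
proof -
  obtain x where x: "x \<in> carrier (padic_cauchy_ring l)" "a = Qp_lim l x" using Qp_cases[OF assms(1)] .
  show ?thesis
    using LIMSEQ_unique[OF padic_norm_lim[OF padic_cauchy_uminus[OF x(1)]]] padic_norm_lim[OF x(1)]
    by (simp add: x Qp_lim_uminus)
qed

lemma padic_norm_eq_0_iff:
  assumes "a \<in> carrier (Qp l)" shows "padic_norm l a = 0 \<longleftrightarrow> a = \<zero>\<^bsub>Qp l\<^esub>"
proof -
  obtain x where x: "x \<in> carrier (padic_cauchy_ring l)" "a = Qp_lim l x" using Qp_cases[OF assms(1)] .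
  show ?thesis unfolding x(2) Qp_lim_eq_zero_iff[OF x(1)] padic_null_iff
    using padic_norm_lim[OF x(1)] LIMSEQ_unique by metis
qed

lemma padic_norm_pos: "a \<in> carrier (Qp l) \<Longrightarrow> a \<noteq> \<zero>\<^bsub>Qp l\<^esub> \<Longrightarrow> padic_norm l a > 0"
  using padic_norm_eq_0_iff[of a] padic_norm_nonneg[of a] by linarith

lemma padic_norm_one [simp]: "padic_norm l \<one>\<^bsub>Qp l\<^esub> = 1"
  using padic_norm_of_rat[of 1] by (simp add: Qp_of_rat_one)

lemma padic_norm_lim_le:
  assumes x: "x \<in> carrier (padic_cauchy_ring l)"
    and le: "\<And>n. n \<ge> N \<Longrightarrow> padic_abs l (x n - q) \<le> e"
  shows "padic_norm l (Qp_lim l x \<ominus>\<^bsub>Qp l\<^esub> Qp_of_rat l q) \<le> e"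
proof -
  have xq: "(\<lambda>n. x n - q) \<in> carrier (padic_cauchy_ring l)"
    using padic_cauchy_add[OF x padic_cauchy_const[of "- q"]] by simp
  show ?thesis
    using LIMSEQ_le_const2[OF padic_norm_lim[OF xq], of e] le
    by (auto simp: Qp_of_rat_conv_lim Qp_lim_diff x)
qed

lemma Qp_of_rat_dense:
  assumes "a \<in> carrier (Qp l)" "e > 0"
  obtains q where "padic_norm l (a \<ominus>\<^bsub>Qp l\<^esub> Qp_of_rat l q) < e"
proof -
  obtain x where x: "x \<in> carrier (padic_cauchy_ring l)" "a = Qp_lim l x" using Qp_cases[OF assms(1)] .
  obtain N where N: "\<And>m n. m \<ge> N \<Longrightarrow> n \<ge> N \<Longrightarrow> padic_abs l (x m - x n) < e / 2"
    using x(1) assms(2) unfolding padic_cauchy_iff by (meson half_gt_zero)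
  have "padic_norm l (a \<ominus>\<^bsub>Qp l\<^esub> Qp_of_rat l (x N)) \<le> e / 2"
    unfolding x(2) using N by (intro padic_norm_lim_le[OF x(1), of N]) (simp add: less_imp_le)
  then show ?thesis using assms(2) by (intro that[of "x N"]) linarith
qed

text \<open>The terms of a sequence that represents a nonzero element eventually have constant positive absolute
  value, so their inverses form a Cauchy sequence, too.\<close>

lemma Qp_inverse_exists:
  assumes a: "a \<in> carrier (Qp l)" "a \<noteq> \<zero>\<^bsub>Qp l\<^esub>"
  shows "\<exists>b\<in>carrier (Qp l). a \<otimes>\<^bsub>Qp l\<^esub> b = \<one>\<^bsub>Qp l\<^esub>"
proof -
  obtain x where x: "x \<in> carrier (padic_cauchy_ring l)" "a = Qp_lim l x" using Qp_cases[OF a(1)] .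
  have nn: "x \<notin> padic_null l" using a x Qp_lim_eq_zero_iff by metis
  obtain N c where c: "c > 0" "\<And>n. n \<ge> N \<Longrightarrow> padic_abs l (x n) = c"
    using padic_cauchy_cases[OF x(1)] nn by metis
  have nz: "x n \<noteq> 0" if "n \<ge> N" for n using c(1) c(2)[OF that] by auto
  have y: "(\<lambda>n. inverse (x n)) \<in> carrier (padic_cauchy_ring l)"
    unfolding padic_cauchy_iff
  proof (intro allI impI)
    fix e :: real assume "e > 0"
    then have "e * (c * c) > 0" using c by simp
    then obtain M where M: "\<And>m n. m \<ge> M \<Longrightarrow> n \<ge> M \<Longrightarrow> padic_abs l (x m - x n) < e * (c * c)"
      using x(1) unfolding padic_cauchy_iff by blast
    have "padic_abs l (inverse (x m) - inverse (x n)) < e" if "m \<ge> max M N" "n \<ge> max M N" for m n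
    proof -
      have "inverse (x m) - inverse (x n) = (x n - x m) / (x m * x n)"
        using nz that by (simp add: field_simps)
      then have "padic_abs l (inverse (x m) - inverse (x n)) = padic_abs l (x n - x m) / (c * c)"
        using c that by (simp add: padic_abs_divide[OF prime_l] padic_abs_mult[OF prime_l])
      then show ?thesis using M[of n m] that c(1) by (simp add: pos_divide_less_eq)
    qed
    then show "\<exists>N. \<forall>m\<ge>N. \<forall>n\<ge>N. padic_abs l (inverse (x m) - inverse (x n)) < e" by blast
  qed
  have one: "x n * inverse (x n) - 1 = 0" if "n \<ge> N" for n using nz[OF that] by simp
  have "padic_norm l (Qp_lim l (\<lambda>n. x n * inverse (x n)) \<ominus>\<^bsub>Qp l\<^esub> Qp_of_rat l 1) \<le> 0"
    by (rule padic_norm_lim_le[OF padic_cauchy_mult[OF x(1) y], of N]) (simp add: one)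
  moreover have carr: "Qp_lim l (\<lambda>n. x n * inverse (x n)) \<in> carrier (Qp l)"
    using padic_cauchy_mult[OF x(1) y] by blast
  ultimately have "padic_norm l (Qp_lim l (\<lambda>n. x n * inverse (x n)) \<ominus>\<^bsub>Qp l\<^esub> Qp_of_rat l 1) = 0"
    by (intro antisym padic_norm_nonneg H.S.minus_closed) auto
  then have "Qp_lim l (\<lambda>n. x n * inverse (x n)) = \<one>\<^bsub>Qp l\<^esub>"
    using carr by (simp add: padic_norm_eq_0_iff Qp_of_rat_one)
  then have "a \<otimes>\<^bsub>Qp l\<^esub> Qp_lim l (\<lambda>n. inverse (x n)) = \<one>\<^bsub>Qp l\<^esub>"
    using Qp_lim_mult[OF x(1) y] x(2) by simp
  then show ?thesis by (rule bexI) (rule Qp_lim_closed[OF y])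
qed

lemma Units_Qp: "Units (Qp l) = carrier (Qp l) - {\<zero>\<^bsub>Qp l\<^esub>}"
proof -
  have "padic_norm l \<one>\<^bsub>Qp l\<^esub> \<noteq> padic_norm l \<zero>\<^bsub>Qp l\<^esub>"
    by (simp add: padic_norm_eq_0_iff[THEN iffD2])
  then have "\<one>\<^bsub>Qp l\<^esub> \<noteq> \<zero>\<^bsub>Qp l\<^esub>" by fastforce
  show ?thesis
  proof (intro subset_antisym subsetI)
    fix a assume "a \<in> Units (Qp l)"
    then obtain b where "a \<in> carrier (Qp l)" "b \<in> carrier (Qp l)" "a \<otimes>\<^bsub>Qp l\<^esub> b = \<one>\<^bsub>Qp l\<^esub>"
      unfolding Units_def by blast
    moreover have "a \<noteq> \<zero>\<^bsub>Qp l\<^esub>"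
      using H.S.l_null[OF \<open>b \<in> carrier (Qp l)\<close>] \<open>a \<otimes>\<^bsub>Qp l\<^esub> b = \<one>\<^bsub>Qp l\<^esub>\<close>
        \<open>\<one>\<^bsub>Qp l\<^esub> \<noteq> \<zero>\<^bsub>Qp l\<^esub>\<close> by metis
    ultimately show "a \<in> carrier (Qp l) - {\<zero>\<^bsub>Qp l\<^esub>}" by simp
  next
    fix a assume a: "a \<in> carrier (Qp l) - {\<zero>\<^bsub>Qp l\<^esub>}"
    then obtain b where b: "b \<in> carrier (Qp l)" "a \<otimes>\<^bsub>Qp l\<^esub> b = \<one>\<^bsub>Qp l\<^esub>"
      using Qp_inverse_exists by blast
    then have "b \<otimes>\<^bsub>Qp l\<^esub> a = \<one>\<^bsub>Qp l\<^esub>" using H.S.m_comm[of a b] a by simp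
    then show "a \<in> Units (Qp l)" using a b unfolding Units_def by blast
  qed
qed

end

section \<open>Topology of the completed field\<close>

context
  fixes l :: nat
  assumes prime_l: "prime l"
begin

interpretation Q: cring "Qp l"
  by (rule cring_Qp[OF prime_l])

lemmas Qp_nonneg = padic_norm_nonneg[OF prime_l]

lemma padic_norm_minus_commute:
  assumes "a \<in> carrier (Qp l)" "b \<in> carrier (Qp l)"
  shows "padic_norm l (a \<ominus>\<^bsub>Qp l\<^esub> b) = padic_norm l (b \<ominus>\<^bsub>Qp l\<^esub> a)"
proof -
  have "a \<ominus>\<^bsub>Qp l\<^esub> b = \<ominus>\<^bsub>Qp l\<^esub> (b \<ominus>\<^bsub>Qp l\<^esub> a)" using assms by algebra
  then show ?thesis using assms padic_norm_uminus[OF prime_l] by simp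
qed

lemma padic_norm_diff_triangle:
  assumes "a \<in> carrier (Qp l)" "b \<in> carrier (Qp l)" "c \<in> carrier (Qp l)"
  shows "padic_norm l (a \<ominus>\<^bsub>Qp l\<^esub> c) \<le> max (padic_norm l (a \<ominus>\<^bsub>Qp l\<^esub> b)) (padic_norm l (b \<ominus>\<^bsub>Qp l\<^esub> c))"
proof -
  have "a \<ominus>\<^bsub>Qp l\<^esub> c = (a \<ominus>\<^bsub>Qp l\<^esub> b) \<oplus>\<^bsub>Qp l\<^esub> (b \<ominus>\<^bsub>Qp l\<^esub> c)" using assms by algebra
  then show ?thesis using assms padic_norm_add_le[OF prime_l] by simp
qed

lemma padic_norm_diff_leI:
  assumes "a \<in> carrier (Qp l)" "b \<in> carrier (Qp l)" "c \<in> carrier (Qp l)"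
    and "padic_norm l (a \<ominus>\<^bsub>Qp l\<^esub> b) \<le> e" "padic_norm l (b \<ominus>\<^bsub>Qp l\<^esub> c) \<le> e"
  shows "padic_norm l (a \<ominus>\<^bsub>Qp l\<^esub> c) \<le> e"
  using padic_norm_diff_triangle[OF assms(1-3)] assms(4,5) by linarith

lemma padic_norm_le_diff:
  assumes "a \<in> carrier (Qp l)" "b \<in> carrier (Qp l)"
  shows "padic_norm l a \<le> max (padic_norm l (a \<ominus>\<^bsub>Qp l\<^esub> b)) (padic_norm l b)"
proof -
  have "a = (a \<ominus>\<^bsub>Qp l\<^esub> b) \<oplus>\<^bsub>Qp l\<^esub> b" using assms by algebra
  then show ?thesis using assms padic_norm_add_le[OF prime_l, of "a \<ominus>\<^bsub>Qp l\<^esub> b" b] by simp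
qed

lemma padic_norm_eqI:
  assumes "a \<in> carrier (Qp l)" "b \<in> carrier (Qp l)"
    and "padic_norm l (a \<ominus>\<^bsub>Qp l\<^esub> b) < padic_norm l a"
  shows "padic_norm l b = padic_norm l a"
  using padic_norm_le_diff[OF assms(1,2)] padic_norm_le_diff[OF assms(2,1)]
    padic_norm_minus_commute[OF assms(1,2)] assms(3) by linarith

lemma Metric_space_Qp: "Metric_space (carrier (Qp l)) (padic_dist l)"
proof
  show "0 \<le> padic_dist l x y" for x y
    by (simp add: padic_dist_def Qp_nonneg)
  show "padic_dist l x y = padic_dist l y x" for x y
    by (simp add: padic_dist_def padic_norm_minus_commute)
  show "padic_dist l x y = 0 \<longleftrightarrow> x = y" if "x \<in> carrier (Qp l)" "y \<in> carrier (Qp l)" for x y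
    using that by (simp add: padic_dist_def padic_norm_eq_0_iff[OF prime_l])
  show "padic_dist l x z \<le> padic_dist l x y + padic_dist l y z"
    if "x \<in> carrier (Qp l)" "y \<in> carrier (Qp l)" "z \<in> carrier (Qp l)" for x y z
    using that padic_norm_diff_triangle[of x y z] Qp_nonneg[of "x \<ominus>\<^bsub>Qp l\<^esub> y"] Qp_nonneg[of "y \<ominus>\<^bsub>Qp l\<^esub> z"]
    by (simp add: padic_dist_def)
qed

lemma openin_Qp_top_iff:
  "openin (Qp_top l) U \<longleftrightarrow> U \<subseteq> carrier (Qp l) \<and>
    (\<forall>x\<in>U. \<exists>e>0. \<forall>y\<in>carrier (Qp l). padic_norm l (y \<ominus>\<^bsub>Qp l\<^esub> x) < e \<longrightarrow> y \<in> U)"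
proof -
  interpret M: Metric_space "carrier (Qp l)" "padic_dist l" by (rule Metric_space_Qp)
  have "M.mball x e \<subseteq> U \<longleftrightarrow> (\<forall>y\<in>carrier (Qp l). padic_norm l (y \<ominus>\<^bsub>Qp l\<^esub> x) < e \<longrightarrow> y \<in> U)"
    if "x \<in> carrier (Qp l)" for x e
    using that by (simp add: M.mball_def padic_dist_def padic_norm_minus_commute subset_iff Ball_def)
  then have "(\<exists>e>0. M.mball x e \<subseteq> U) \<longleftrightarrow>
      (\<exists>e>0. \<forall>y\<in>carrier (Qp l). padic_norm l (y \<ominus>\<^bsub>Qp l\<^esub> x) < e \<longrightarrow> y \<in> U)"
    if "U \<subseteq> carrier (Qp l)" "x \<in> U" for x
    using that by (simp add: subset_iff)
  then show ?thesis
    unfolding Qp_top_def M.openin_mtopology Ball_def[symmetric] by (intro conj_cong ball_cong refl)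
qed

lemma topspace_Qp_top [simp]: "topspace (Qp_top l) = carrier (Qp l)"
  unfolding Qp_top_def by (rule Metric_space.topspace_mtopology[OF Metric_space_Qp])

lemma openin_Qp_cball:
  assumes "a \<in> carrier (Qp l)" "e > 0"
  shows "openin (Qp_top l) {x \<in> carrier (Qp l). padic_norm l (x \<ominus>\<^bsub>Qp l\<^esub> a) \<le> e}"
  unfolding openin_Qp_top_iff
proof (intro conjI ballI)
  fix x assume x: "x \<in> {x \<in> carrier (Qp l). padic_norm l (x \<ominus>\<^bsub>Qp l\<^esub> a) \<le> e}"
  then have "padic_norm l (y \<ominus>\<^bsub>Qp l\<^esub> a) \<le> e"
    if "y \<in> carrier (Qp l)" "padic_norm l (y \<ominus>\<^bsub>Qp l\<^esub> x) < e" for y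
    using that assms by (intro padic_norm_diff_leI[of y x a]) simp_all
  then show "\<exists>e'>0. \<forall>y\<in>carrier (Qp l). padic_norm l (y \<ominus>\<^bsub>Qp l\<^esub> x) < e' \<longrightarrow>
      y \<in> {x \<in> carrier (Qp l). padic_norm l (x \<ominus>\<^bsub>Qp l\<^esub> a) \<le> e}"
    using assms(2) by (intro exI[of _ e]) simp
qed auto

lemma Zp_simps [simp]:
  "carrier (Zp l) = {a \<in> carrier (Qp l). padic_norm l a \<le> 1}"
  "monoid.mult (Zp l) = monoid.mult (Qp l)"
  "one (Zp l) = one (Qp l)"
  by (simp_all add: Zp_def)

lemma comm_monoid_Zp: "comm_monoid (Zp l)"
  by (rule comm_monoidI)
    (simp_all add: padic_norm_mult[OF prime_l] padic_norm_one[OF prime_l] Qp_nonneg mult_le_one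
      Q.m_assoc, rule Q.m_comm, simp_all)

lemma Units_Zp: "Units (Zp l) = {a \<in> carrier (Qp l). padic_norm l a = 1}"
proof (intro subset_antisym subsetI)
  fix a assume "a \<in> Units (Zp l)"
  then obtain b where ab: "a \<in> carrier (Qp l)" "padic_norm l a \<le> 1" "b \<in> carrier (Qp l)"
      "padic_norm l b \<le> 1" "a \<otimes>\<^bsub>Qp l\<^esub> b = \<one>\<^bsub>Qp l\<^esub>"
    unfolding Units_def Zp_simps by blast
  then have "padic_norm l a * padic_norm l b = 1"
    using padic_norm_mult[OF prime_l, of a b] padic_norm_one[OF prime_l] by simp
  then have "padic_norm l a = 1"
    using ab Qp_nonneg[of a] mult_left_le[of "padic_norm l b" "padic_norm l a"] by simp
  then show "a \<in> {a \<in> carrier (Qp l). padic_norm l a = 1}" using ab by blast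
next
  fix a assume a: "a \<in> {a \<in> carrier (Qp l). padic_norm l a = 1}"
  then have "a \<noteq> \<zero>\<^bsub>Qp l\<^esub>" using padic_norm_eq_0_iff[OF prime_l, of a] by force
  then obtain b where b: "b \<in> carrier (Qp l)" "a \<otimes>\<^bsub>Qp l\<^esub> b = \<one>\<^bsub>Qp l\<^esub>"
    using Qp_inverse_exists[OF prime_l] a by blast
  then have "padic_norm l b = 1"
    using padic_norm_mult[OF prime_l, of a b] a padic_norm_one[OF prime_l] by simp
  then show "a \<in> Units (Zp l)"
    unfolding Units_def Zp_simps using a b Q.m_comm[of a b] by (intro CollectI conjI bexI[of _ b]) simp_all
qed

lemma Units_Zp_subset_Units_Qp: "Units (Zp l) \<subseteq> Units (Qp l)"
  using padic_norm_eq_0_iff[OF prime_l] by (force simp: Units_Zp Units_Qp[OF prime_l])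

text \<open>The norm is locally constant away from 0.\<close>

lemma openin_Units_Zp: "openin (Qp_top l) (Units (Zp l))"
  unfolding openin_Qp_top_iff Units_Zp
proof (intro conjI ballI)
  fix x assume "x \<in> {a \<in> carrier (Qp l). padic_norm l a = 1}"
  then have "padic_norm l y = 1" if "y \<in> carrier (Qp l)" "padic_norm l (y \<ominus>\<^bsub>Qp l\<^esub> x) < 1" for y
    using padic_norm_eqI[of x y] padic_norm_minus_commute[of x y] that by simp
  then show "\<exists>e>0. \<forall>y\<in>carrier (Qp l). padic_norm l (y \<ominus>\<^bsub>Qp l\<^esub> x) < e \<longrightarrow> y \<in> {a \<in> carrier (Qp l). padic_norm l a = 1}"
    by (intro exI[of _ 1]) simp
qed auto

lemma openin_Units_Qp: "openin (Qp_top l) (Units (Qp l))"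
  unfolding openin_Qp_top_iff
proof (intro conjI ballI)
  fix x assume "x \<in> Units (Qp l)"
  then have x: "x \<in> carrier (Qp l)" "padic_norm l x > 0"
    using padic_norm_pos[OF prime_l] by (auto simp: Units_Qp[OF prime_l])
  then have "y \<in> Units (Qp l)" if "y \<in> carrier (Qp l)" "padic_norm l (y \<ominus>\<^bsub>Qp l\<^esub> x) < padic_norm l x" for y
    using padic_norm_eqI[of x y] padic_norm_minus_commute[of x y] that padic_norm_eq_0_iff[OF prime_l, of y]
    by (auto simp: Units_Qp[OF prime_l])
  then show "\<exists>e>0. \<forall>y\<in>carrier (Qp l). padic_norm l (y \<ominus>\<^bsub>Qp l\<^esub> x) < e \<longrightarrow> y \<in> Units (Qp l)"
    using x(2) by blast
qed (auto simp: Units_Qp[OF prime_l])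

text \<open>Scaling by \<open>c\<close> multiplies all distances by the norm of \<open>c\<close>.\<close>

lemma openin_Qp_scale:
  assumes c: "c \<in> Units (Qp l)" and U: "openin (Qp_top l) U"
  shows "openin (Qp_top l) ((\<lambda>x. c \<otimes>\<^bsub>Qp l\<^esub> x) ` U)"
  unfolding openin_Qp_top_iff
proof (intro conjI ballI)
  have cc: "c \<in> carrier (Qp l)" and n0: "padic_norm l c > 0"
    using c padic_norm_pos[OF prime_l] by (auto simp: Units_Qp[OF prime_l])
  have Uc: "U \<subseteq> carrier (Qp l)" using U by (simp add: openin_Qp_top_iff)
  then show "(\<lambda>x. c \<otimes>\<^bsub>Qp l\<^esub> x) ` U \<subseteq> carrier (Qp l)" using cc by blast
  fix y assume "y \<in> (\<lambda>x. c \<otimes>\<^bsub>Qp l\<^esub> x) ` U"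
  then obtain x where x: "x \<in> U" "y = c \<otimes>\<^bsub>Qp l\<^esub> x" by blast
  obtain e where e: "e > 0" "\<And>z. z \<in> carrier (Qp l) \<Longrightarrow> padic_norm l (z \<ominus>\<^bsub>Qp l\<^esub> x) < e \<Longrightarrow> z \<in> U"
    using U x(1) unfolding openin_Qp_top_iff by blast
  have "z \<in> (\<lambda>x. c \<otimes>\<^bsub>Qp l\<^esub> x) ` U"
    if z: "z \<in> carrier (Qp l)" "padic_norm l (z \<ominus>\<^bsub>Qp l\<^esub> y) < e * padic_norm l c" for z
  proof -
    define w where "w = inv\<^bsub>Qp l\<^esub> c \<otimes>\<^bsub>Qp l\<^esub> z"
    have w: "w \<in> carrier (Qp l)" "z = c \<otimes>\<^bsub>Qp l\<^esub> w"
      using c cc z by (simp_all add: w_def flip: Q.m_assoc)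
    have xc: "x \<in> carrier (Qp l)" using x Uc by blast
    have "z \<ominus>\<^bsub>Qp l\<^esub> y = c \<otimes>\<^bsub>Qp l\<^esub> (w \<ominus>\<^bsub>Qp l\<^esub> x)"
      unfolding w(2) x(2) using w(1) xc cc by algebra
    then have "padic_norm l c * padic_norm l (w \<ominus>\<^bsub>Qp l\<^esub> x) < e * padic_norm l c"
      using z(2) w(1) xc cc by (simp add: padic_norm_mult[OF prime_l])
    then have "w \<in> U" using e(2) w(1) n0 by (simp add: mult.commute)
    then show ?thesis unfolding w(2) by (rule imageI)
  qed
  then show "\<exists>e>0. \<forall>z\<in>carrier (Qp l). padic_norm l (z \<ominus>\<^bsub>Qp l\<^esub> y) < e \<longrightarrow> z \<in> (\<lambda>x. c \<otimes>\<^bsub>Qp l\<^esub> x) ` U"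
    using e(1) n0 by (intro exI[of _ "e * padic_norm l c"]) simp
qed

lemma padic_norm_eq_power:
  assumes a: "a \<in> carrier (Qp l)" "a \<noteq> \<zero>\<^bsub>Qp l\<^esub>"
  obtains k :: int where "padic_norm l a = real l powi k"
proof -
  obtain q where "padic_norm l (a \<ominus>\<^bsub>Qp l\<^esub> Qp_of_rat l q) < padic_norm l a"
    using Qp_of_rat_dense[OF prime_l a(1)] padic_norm_pos[OF prime_l a] by blast
  then have "padic_abs l q = padic_norm l a"
    using padic_norm_eqI[OF a(1) Qp_of_rat_closed[OF prime_l]] padic_norm_of_rat[OF prime_l] by simp
  moreover have "q \<noteq> 0" using calculation padic_norm_pos[OF prime_l a] padic_abs_zero[OF prime_l] by auto
  ultimately show ?thesis using that by (metis padic_abs_def)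
qed

text \<open>A rational close to \<open>a\<close> has absolute value at most 1, and such rationals are approximated by integers.\<close>

lemma Qp_of_int_approx:
  assumes a: "a \<in> carrier (Qp l)" "padic_norm l a \<le> 1"
  shows "\<exists>m::int. padic_norm l (a \<ominus>\<^bsub>Qp l\<^esub> Qp_of_rat l (of_int m)) \<le> inverse (real l ^ k)"
proof -
  have pos: "inverse (real l ^ k) > 0" and le1: "inverse (real l ^ k) \<le> 1"
    using prime_base_pos[OF prime_l] by (auto intro!: inverse_le_1_iff[THEN iffD2] one_le_power)
  obtain q where q: "padic_norm l (a \<ominus>\<^bsub>Qp l\<^esub> Qp_of_rat l q) < inverse (real l ^ k)"
    using Qp_of_rat_dense[OF prime_l a(1) pos] by blast
  have "padic_abs l q \<le> 1"
    using padic_norm_le_diff[OF Qp_of_rat_closed[OF prime_l] a(1), of q] q a(2) le1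
      padic_norm_minus_commute[OF a(1) Qp_of_rat_closed[OF prime_l], of q] padic_norm_of_rat[OF prime_l, of q]
    by linarith
  then obtain m :: int where m: "padic_abs l (q - of_int m) \<le> inverse (real l ^ k)"
    using padic_abs_le_1_approx[OF prime_l] by blast
  then have "padic_norm l (Qp_of_rat l q \<ominus>\<^bsub>Qp l\<^esub> Qp_of_rat l (of_int m)) \<le> inverse (real l ^ k)"
    by (simp add: padic_norm_of_rat[OF prime_l] flip: Qp_of_rat_diff[OF prime_l])
  then show ?thesis
    using q padic_norm_diff_leI[OF a(1) Qp_of_rat_closed[OF prime_l] Qp_of_rat_closed[OF prime_l], of q "inverse (real l ^ k)"]
    by (intro exI[of _ m]) simp
qed

text \<open>The form of completeness that builds the components of elements of \<open>G\<^sub>p\<close> from residues.\<close>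

lemma Qp_limit_of_int_sequence:
  assumes m: "\<And>i j. i \<le> j \<Longrightarrow> int l ^ i dvd m j - m i"
  shows "\<exists>a\<in>carrier (Qp l). \<forall>j. padic_norm l (a \<ominus>\<^bsub>Qp l\<^esub> Qp_of_rat l (of_int (m j))) \<le> inverse (real l ^ j)"
proof -
  have le: "padic_abs l (of_int (m j) - of_int (m i)) \<le> inverse (real l ^ i)" if "i \<le> j" for i j
    using m[OF that] padic_abs_of_int_le_iff[OF prime_l, of "m j - m i" i] by simp
  have x: "(\<lambda>n. of_int (m n)) \<in> carrier (padic_cauchy_ring l)"
    unfolding padic_cauchy_iff
  proof (intro allI impI)
    fix e :: real assume e: "e > 0"
    have "inverse (real l) < 1" using prime_base_pos[OF prime_l] by (simp add: inverse_less_1_iff)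
    then obtain N where "inverse (real l) ^ N < e"
      using real_arch_pow_inv[OF e] by blast
    then have N: "inverse (real l ^ N) < e" by (simp only: power_inverse)
    have "padic_abs l (of_int (m i) - of_int (m j)) < e" if "i \<ge> N" "j \<ge> N" for i j
    proof -
      have "padic_abs l (of_int (m i) - of_int (m N)) \<le> inverse (real l ^ N)"
        "padic_abs l (of_int (m j) - of_int (m N)) \<le> inverse (real l ^ N)"
        using le that by simp_all
      from padic_abs_diff_leI[OF prime_l this] show ?thesis using N by simp
    qed
    then show "\<exists>N. \<forall>i\<ge>N. \<forall>j\<ge>N. padic_abs l (of_int (m i) - of_int (m j)) < e"
      by (intro exI[of _ N]) simp
  qed
  have "padic_norm l (Qp_lim l (\<lambda>n. of_int (m n)) \<ominus>\<^bsub>Qp l\<^esub> Qp_of_rat l (of_int (m j))) \<le> inverse (real l ^ j)" for j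
    by (rule padic_norm_lim_le[OF prime_l x, of j]) (rule le)
  then have "\<forall>j. padic_norm l (Qp_lim l (\<lambda>n. of_int (m n)) \<ominus>\<^bsub>Qp l\<^esub> Qp_of_rat l (of_int (m j))) \<le> inverse (real l ^ j)"
    by (rule allI)
  then show ?thesis by (rule bexI) (rule Qp_lim_closed[OF prime_l x])
qed

end

section \<open>Residues of elements of \<open>G\<^sub>p\<close>\<close>

lemma padic_abs_of_nat_conv_multiplicity:
  assumes "prime l" "N > 0"
  shows "padic_abs l (of_nat N) = inverse (real l ^ multiplicity l N)"
proof -
  have "multiplicity (int l) (int N) = multiplicity l N"
    by (simp add: multiplicity_def flip: of_nat_power)
  then show ?thesis
    using padic_abs_of_int[of l "int N"] assms by (simp add: power_int_minus)
qed

text \<open>Divisibility by \<open>N\<close> is a local condition at the primes dividing \<open>N\<close>.\<close>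

lemma dvd_iff_padic_abs_le:
  assumes "N > 0"
  shows "int N dvd a \<longleftrightarrow> (\<forall>l. prime l \<longrightarrow> l dvd N \<longrightarrow> padic_abs l (of_int a) \<le> padic_abs l (of_nat N))"
    (is "_ \<longleftrightarrow> ?R")
proof
  assume a: "int N dvd a"
  show ?R
  proof (intro allI impI)
    fix l :: nat assume l: "prime l"
    obtain b where b: "a = int N * b" using a by blast
    have "padic_abs l (of_int a) = padic_abs l (of_nat N) * padic_abs l (of_int b)"
      by (simp add: b padic_abs_mult[OF l])
    also have "\<dots> \<le> padic_abs l (of_nat N) * 1"
      by (intro mult_left_mono padic_abs_of_int_le_1[OF l] padic_abs_nonneg[OF l])
    finally show "padic_abs l (of_int a) \<le> padic_abs l (of_nat N)" by simp
  qed
next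
  assume R: ?R
  have "N dvd nat \<bar>a\<bar>"
  proof (cases "a = 0")
    case False
    show ?thesis
    proof (rule multiplicity_le_imp_dvd)
      fix l :: nat assume l: "prime l"
      show "multiplicity l N \<le> multiplicity l (nat \<bar>a\<bar>)"
      proof (cases "l dvd N")
        case True
        then have "padic_abs l (of_int a) \<le> inverse (real l ^ multiplicity l N)"
          using R[rule_format, OF l True] unfolding padic_abs_of_nat_conv_multiplicity[OF l assms] by simp
        then have "int l ^ multiplicity l N dvd a"
          by (simp add: padic_abs_of_int_le_iff[OF l])
        then have "int (l ^ multiplicity l N) dvd int (nat \<bar>a\<bar>)"
          by simp
        then have "l ^ multiplicity l N dvd nat \<bar>a\<bar>"
          by (simp only: of_nat_dvd_iff)
        moreover have "\<not> is_unit l" using l not_prime_unit by blast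
        ultimately show ?thesis
          using False by (intro multiplicity_geI) auto
      qed (simp add: not_dvd_imp_multiplicity_0)
    qed (use assms False in auto)
  qed simp
  then have "int N dvd int (nat \<bar>a\<bar>)" by (simp only: of_nat_dvd_iff)
  then show "int N dvd a" by simp
qed

text \<open>The congruence of \<open>g\<close> and \<open>k\<close> modulo \<open>N\<close>, tested at the primes dividing \<open>N\<close>; the same condition
  occurs in the definition of \<^const>\<open>mu_action\<close>.\<close>

definition has_residue :: "nat \<Rightarrow> (nat \<Rightarrow> (nat \<Rightarrow> rat) set) \<Rightarrow> int \<Rightarrow> bool" where
  "has_residue N g k \<longleftrightarrow> (\<forall>l. prime l \<longrightarrow> l dvd N \<longrightarrow>
     padic_norm l (g l \<ominus>\<^bsub>Qp l\<^esub> Qp_of_rat l (of_int k)) \<le> padic_abs l (of_nat N))"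

text \<open>The image of \<open>g\<close> in \<open>\<int>/N\<close>, as its least nonnegative representative. For \<open>g\<close> in \<open>G\<^sub>p\<close> it is defined
  at the levels \<open>N\<close> prime to \<open>p\<close>, since \<open>g\<close> has no component at \<open>p\<close>.\<close>

definition red :: "nat \<Rightarrow> (nat \<Rightarrow> (nat \<Rightarrow> rat) set) \<Rightarrow> int" where
  "red N g = (THE k. k \<in> {0..<int N} \<and> has_residue N g k)"

definition coprime_levels :: "nat \<Rightarrow> nat set" where
  "coprime_levels p = {N. N > 0 \<and> coprime N p}"

context
  fixes p :: nat
  assumes prime_p: "prime p"
begin

lemma coprime_levels_dvd: "N \<in> coprime_levels p \<Longrightarrow> M dvd N \<Longrightarrow> M \<in> coprime_levels p"
  by (auto simp: coprime_levels_def dvd_imp_le intro: coprime_divisors dest: dvd_pos_nat)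

lemma coprime_levels_prime_ne: "N \<in> coprime_levels p \<Longrightarrow> l dvd N \<Longrightarrow> prime l \<Longrightarrow> l \<noteq> p"
proof
  assume "N \<in> coprime_levels p" "l dvd N" "prime l" "l = p"
  then have "is_unit p" unfolding coprime_levels_def using coprime_common_divisor[of N p p] by simp
  then show False using prime_p not_prime_unit by blast
qed

lemma coprime_levels_prime_power: "prime l \<Longrightarrow> l \<noteq> p \<Longrightarrow> l ^ k \<in> coprime_levels p"
  using prime_p by (auto simp: coprime_levels_def primes_coprime prime_gt_0_nat)

lemma coprime_levels_mult: "M \<in> coprime_levels p \<Longrightarrow> N \<in> coprime_levels p \<Longrightarrow> M * N \<in> coprime_levels p"
  by (simp add: coprime_levels_def)

lemma carrier_Gp: "g \<in> carrier (Gp p) \<longleftrightarrow>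
    g \<in> extensional (primes - {p}) \<and> (\<forall>l. prime l \<longrightarrow> l \<noteq> p \<longrightarrow> g l \<in> carrier (Qp l) \<and> padic_norm l (g l) = 1)"
  by (auto simp: Gp_def units_of_def PiE_iff Units_Zp)

lemma Gp_closed: "g \<in> carrier (Gp p) \<Longrightarrow> prime l \<Longrightarrow> l \<noteq> p \<Longrightarrow> g l \<in> carrier (Qp l)"
  by (simp add: carrier_Gp)

lemma Gp_mult: "prime l \<Longrightarrow> l \<noteq> p \<Longrightarrow> (g \<otimes>\<^bsub>Gp p\<^esub> h) l = g l \<otimes>\<^bsub>Qp l\<^esub> h l"
  by (simp add: Gp_def units_of_def)

lemma Gp_one: "prime l \<Longrightarrow> l \<noteq> p \<Longrightarrow> \<one>\<^bsub>Gp p\<^esub> l = \<one>\<^bsub>Qp l\<^esub>"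
  by (simp add: Gp_def units_of_def)

lemma comm_group_Gp: "comm_group (Gp p)"
proof -
  have *: "comm_group (units_of (Zp l))" if "l \<in> primes - {p}" for l
    using that by (intro comm_monoid.units_comm_group comm_monoid_Zp) simp
  then have "group (Gp p)"
    unfolding Gp_def by (intro product_group) (simp add: comm_group.axioms(2))
  then show ?thesis
  proof (rule group.group_comm_groupI)
    fix x y assume "x \<in> carrier (Gp p)" "y \<in> carrier (Gp p)"
    then have "x l \<otimes>\<^bsub>Qp l\<^esub> y l = y l \<otimes>\<^bsub>Qp l\<^esub> x l" if "prime l" "l \<noteq> p" for l
      using that by (intro comm_monoid.m_comm[OF cring.axioms(2)[OF cring_Qp[OF that(1)]]] Gp_closed)
    then show "x \<otimes>\<^bsub>Gp p\<^esub> y = y \<otimes>\<^bsub>Gp p\<^esub> x"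
      by (simp add: Gp_def units_of_def restrict_def fun_eq_iff)
  qed
qed

lemma frob_in_Gp: "frob p \<in> carrier (Gp p)"
  using prime_p by (auto simp: carrier_Gp frob_def padic_norm_of_rat primes_dvd_imp_eq
      intro!: padic_abs_of_nat_eq_1)

subsection \<open>Existence and uniqueness of residues\<close>

lemma has_residue_cong:
  assumes g: "g \<in> carrier (Gp p)" and N: "N \<in> coprime_levels p"
    and k: "has_residue N g k" and km: "int N dvd k - m"
  shows "has_residue N g m"
  unfolding has_residue_def
proof (intro allI impI)
  fix l assume l: "prime l" "l dvd N"
  have "padic_abs l (of_int (k - m)) \<le> padic_abs l (of_nat N)"
    using km l N dvd_iff_padic_abs_le[of N "k - m"] by (simp add: coprime_levels_def)
  then have "padic_norm l (Qp_of_rat l (of_int k) \<ominus>\<^bsub>Qp l\<^esub> Qp_of_rat l (of_int m)) \<le> padic_abs l (of_nat N)"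
    by (simp add: padic_norm_of_rat[OF l(1)] flip: Qp_of_rat_diff[OF l(1)])
  from _ this show "padic_norm l (g l \<ominus>\<^bsub>Qp l\<^esub> Qp_of_rat l (of_int m)) \<le> padic_abs l (of_nat N)"
    by (rule padic_norm_diff_leI[OF l(1) Gp_closed[OF g l(1) coprime_levels_prime_ne[OF N l(2,1)]]
        Qp_of_rat_closed[OF l(1)] Qp_of_rat_closed[OF l(1)]])
      (use k l in \<open>simp add: has_residue_def\<close>)
qed

lemma has_residue_unique:
  assumes g: "g \<in> carrier (Gp p)" and N: "N \<in> coprime_levels p"
    and k: "has_residue N g k" and m: "has_residue N g m"
  shows "int N dvd k - m"
proof -
  have "padic_abs l (of_int (k - m)) \<le> padic_abs l (of_nat N)" if l: "prime l" "l dvd N" for l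
  proof -
    have gl: "g l \<in> carrier (Qp l)" using Gp_closed[OF g l(1)] coprime_levels_prime_ne[OF N l(2,1)] by simp
    have "padic_norm l (Qp_of_rat l (of_int k) \<ominus>\<^bsub>Qp l\<^esub> Qp_of_rat l (of_int m)) \<le> padic_abs l (of_nat N)"
      by (rule padic_norm_diff_leI[OF l(1) Qp_of_rat_closed[OF l(1)] gl Qp_of_rat_closed[OF l(1)]])
        (use k m l padic_norm_minus_commute[OF l(1) Qp_of_rat_closed[OF l(1)] gl, of "of_int k"]
         in \<open>simp_all add: has_residue_def\<close>)
    then show ?thesis
      by (simp add: padic_norm_of_rat[OF l(1)] flip: Qp_of_rat_diff[OF l(1)])
  qed
  then show ?thesis
    using N dvd_iff_padic_abs_le[of N "k - m"] by (simp add: coprime_levels_def)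
qed

text \<open>The components at the primes dividing \<open>N\<close> are approximated by integers separately, and the Chinese
  remainder theorem combines these.\<close>

lemma has_residue_exists:
  assumes g: "g \<in> carrier (Gp p)" and N: "N \<in> coprime_levels p"
  shows "\<exists>k. has_residue N g k"
proof -
  have N0: "N > 0" using N by (simp add: coprime_levels_def)
  define F where "F = prime_factors N"
  have F: "prime l \<and> l dvd N \<longleftrightarrow> l \<in> F" for l
    using N0 by (auto simp: F_def prime_factors_dvd)
  have "\<exists>m::int. padic_norm l (g l \<ominus>\<^bsub>Qp l\<^esub> Qp_of_rat l (of_int m)) \<le> inverse (real l ^ multiplicity l N)"
    if "l \<in> F" for l
  proof -
    have l: "prime l" "l dvd N" using that F by blast+
    then show ?thesis
      using g coprime_levels_prime_ne[OF N l(2,1)]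
      by (intro Qp_of_int_approx) (simp_all add: carrier_Gp)
  qed
  then obtain m :: "nat \<Rightarrow> int" where
    m: "\<And>l. l \<in> F \<Longrightarrow> padic_norm l (g l \<ominus>\<^bsub>Qp l\<^esub> Qp_of_rat l (of_int (m l))) \<le> inverse (real l ^ multiplicity l N)"
    by metis
  define q where "q l = l ^ multiplicity l N" for l
  have "\<exists>x. \<forall>l\<in>F. [x = nat (m l mod int (q l))] (mod q l)"
  proof (rule chinese_remainder_nat)
    show "finite F" by (simp add: F_def)
    show "\<forall>i\<in>F. \<forall>j\<in>F. i \<noteq> j \<longrightarrow> coprime (q i) (q j)"
      by (simp add: q_def primes_coprime flip: F)
  qed
  then obtain x where x: "\<And>l. l \<in> F \<Longrightarrow> [x = nat (m l mod int (q l))] (mod q l)" by blast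
  have "has_residue N g (int x)"
    unfolding has_residue_def
  proof (intro allI impI)
    fix l assume l: "prime l" "l dvd N"
    then have lF: "l \<in> F" using F by blast
    have "q l > 0" using l(1) by (simp add: q_def prime_gt_0_nat)
    then have "[int x = m l mod int (q l)] (mod int (q l))"
      using x[OF lF] by (simp flip: cong_int_iff)
    then have "[m l = int x] (mod int (q l))"
      by (simp add: cong_def)
    then have "int l ^ multiplicity l N dvd m l - int x"
      by (simp add: q_def cong_iff_dvd_diff)
    then have "padic_abs l (of_int (m l - int x)) \<le> inverse (real l ^ multiplicity l N)"
      by (simp only: padic_abs_of_int_le_iff[OF l(1)])
    then have *: "padic_norm l (Qp_of_rat l (of_int (m l)) \<ominus>\<^bsub>Qp l\<^esub> Qp_of_rat l (of_int (int x))) \<le> inverse (real l ^ multiplicity l N)"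
      by (simp add: padic_norm_of_rat[OF l(1)] flip: Qp_of_rat_diff[OF l(1)])
    show "padic_norm l (g l \<ominus>\<^bsub>Qp l\<^esub> Qp_of_rat l (of_int (int x))) \<le> padic_abs l (of_nat N)"
      unfolding padic_abs_of_nat_conv_multiplicity[OF l(1) N0]
      by (rule padic_norm_diff_leI[OF l(1) Gp_closed[OF g l(1) coprime_levels_prime_ne[OF N l(2,1)]]
          Qp_of_rat_closed[OF l(1)] Qp_of_rat_closed[OF l(1)] m[OF lF] *])
  qed
  then show ?thesis by blast
qed

lemma red_props:
  assumes g: "g \<in> carrier (Gp p)" and N: "N \<in> coprime_levels p"
  shows red_range: "red N g \<in> {0..<int N}" and has_residue_red: "has_residue N g (red N g)"
proof -
  have N0: "int N > 0" using N by (simp add: coprime_levels_def)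
  obtain k where k: "has_residue N g k" using has_residue_exists[OF g N] by blast
  have "\<exists>!k. k \<in> {0..<int N} \<and> has_residue N g k"
  proof (rule ex1I)
    show "k mod int N \<in> {0..<int N} \<and> has_residue N g (k mod int N)"
      using N0 by (auto intro!: has_residue_cong[OF g N k] simp: minus_mod_eq_mult_div)
    fix m assume m: "m \<in> {0..<int N} \<and> has_residue N g m"
    then have "[k = m] (mod int N)"
      using has_residue_unique[OF g N k] by (simp add: cong_iff_dvd_diff)
    then show "m = k mod int N" using m by (simp add: cong_def)
  qed
  from theI'[OF this] show "red N g \<in> {0..<int N}" "has_residue N g (red N g)"
    unfolding red_def by blast+
qed

lemma has_residue_iff_cong:
  assumes g: "g \<in> carrier (Gp p)" and N: "N \<in> coprime_levels p"
  shows "has_residue N g k \<longleftrightarrow> [red N g = k] (mod int N)"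
  unfolding cong_iff_dvd_diff
  using has_residue_cong[OF g N has_residue_red[OF g N]] has_residue_unique[OF g N has_residue_red[OF g N]]
  by blast

lemma red_eqI:
  assumes g: "g \<in> carrier (Gp p)" and N: "N \<in> coprime_levels p" and "has_residue N g k"
  shows "red N g = k mod int N"
  using assms red_range[OF g N] by (simp add: has_residue_iff_cong cong_def)

lemma has_residue_dvd:
  assumes N: "N \<in> coprime_levels p" and MN: "M dvd N" and k: "has_residue N g k"
  shows "has_residue M g k"
  unfolding has_residue_def
proof (intro allI impI)
  fix l assume l: "prime l" "l dvd M"
  have M0: "M > 0" using N MN by (auto simp: coprime_levels_def intro: Nat.gr0I)
  have "padic_abs l (of_nat N) \<le> padic_abs l (of_nat M)"
    using dvd_iff_padic_abs_le[of M "int N"] M0 MN l by simp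
  moreover have "padic_norm l (g l \<ominus>\<^bsub>Qp l\<^esub> Qp_of_rat l (of_int k)) \<le> padic_abs l (of_nat N)"
    using k l MN by (auto simp: has_residue_def)
  ultimately show "padic_norm l (g l \<ominus>\<^bsub>Qp l\<^esub> Qp_of_rat l (of_int k)) \<le> padic_abs l (of_nat M)"
    by linarith
qed

lemma red_mod:
  assumes g: "g \<in> carrier (Gp p)" and N: "N \<in> coprime_levels p" and MN: "M dvd N"
  shows "red M g = red N g mod int M"
  using red_eqI[OF g coprime_levels_dvd[OF N MN]] has_residue_dvd[OF N MN has_residue_red[OF g N]] by simp

lemma has_residue_mult:
  assumes g: "g \<in> carrier (Gp p)" and h: "h \<in> carrier (Gp p)" and N: "N \<in> coprime_levels p"
    and k: "has_residue N g k" and m: "has_residue N h m"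
  shows "has_residue N (g \<otimes>\<^bsub>Gp p\<^esub> h) (k * m)"
  unfolding has_residue_def
proof (intro allI impI)
  fix l assume l: "prime l" "l dvd N"
  interpret Q: cring "Qp l" by (rule cring_Qp[OF l(1)])
  have lp: "l \<noteq> p" by (rule coprime_levels_prime_ne[OF N l(2,1)])
  have gl: "g l \<in> carrier (Qp l)" "padic_norm l (g l) = 1" and hl: "h l \<in> carrier (Qp l)"
    using g h l lp by (simp_all add: carrier_Gp)
  define a where "a = Qp_of_rat l (of_int k)"
  define b where "b = Qp_of_rat l (of_int m)"
  have ab: "a \<in> carrier (Qp l)" "b \<in> carrier (Qp l)" "padic_norm l b \<le> 1"
    by (simp_all add: a_def b_def Qp_of_rat_closed[OF l(1)] padic_norm_of_rat[OF l(1)] padic_abs_of_int_le_1[OF l(1)])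
  have ga: "padic_norm l (g l \<ominus>\<^bsub>Qp l\<^esub> a) \<le> padic_abs l (of_nat N)"
    and hb: "padic_norm l (h l \<ominus>\<^bsub>Qp l\<^esub> b) \<le> padic_abs l (of_nat N)"
    using k m l by (simp_all add: has_residue_def a_def b_def)
  have eq: "g l \<otimes>\<^bsub>Qp l\<^esub> h l \<ominus>\<^bsub>Qp l\<^esub> a \<otimes>\<^bsub>Qp l\<^esub> b =
      g l \<otimes>\<^bsub>Qp l\<^esub> (h l \<ominus>\<^bsub>Qp l\<^esub> b) \<oplus>\<^bsub>Qp l\<^esub> (g l \<ominus>\<^bsub>Qp l\<^esub> a) \<otimes>\<^bsub>Qp l\<^esub> b"
    using gl(1) hl ab(1,2) by algebra
  have "padic_norm l (g l \<otimes>\<^bsub>Qp l\<^esub> (h l \<ominus>\<^bsub>Qp l\<^esub> b)) \<le> padic_abs l (of_nat N)"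
    using gl hl ab hb by (simp add: padic_norm_mult[OF l(1)])
  moreover have "padic_norm l ((g l \<ominus>\<^bsub>Qp l\<^esub> a) \<otimes>\<^bsub>Qp l\<^esub> b) \<le> padic_abs l (of_nat N)"
  proof -
    have "padic_norm l (g l \<ominus>\<^bsub>Qp l\<^esub> a) * padic_norm l b \<le> padic_norm l (g l \<ominus>\<^bsub>Qp l\<^esub> a) * 1"
      using ab gl by (intro mult_left_mono padic_norm_nonneg[OF l(1)]) simp_all
    then show ?thesis using gl ab ga by (simp add: padic_norm_mult[OF l(1)])
  qed
  ultimately have "padic_norm l (g l \<otimes>\<^bsub>Qp l\<^esub> h l \<ominus>\<^bsub>Qp l\<^esub> a \<otimes>\<^bsub>Qp l\<^esub> b) \<le> padic_abs l (of_nat N)"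
    unfolding eq
    using padic_norm_add_le[OF l(1), of "g l \<otimes>\<^bsub>Qp l\<^esub> (h l \<ominus>\<^bsub>Qp l\<^esub> b)" "(g l \<ominus>\<^bsub>Qp l\<^esub> a) \<otimes>\<^bsub>Qp l\<^esub> b"] gl hl ab
    by simp
  then show "padic_norm l ((g \<otimes>\<^bsub>Gp p\<^esub> h) l \<ominus>\<^bsub>Qp l\<^esub> Qp_of_rat l (of_int (k * m))) \<le> padic_abs l (of_nat N)"
    by (simp add: Gp_mult[OF l(1) lp] a_def b_def Qp_of_rat_mult[OF l(1)])
qed

lemma red_mult:
  assumes "g \<in> carrier (Gp p)" "h \<in> carrier (Gp p)" "N \<in> coprime_levels p"
  shows "red N (g \<otimes>\<^bsub>Gp p\<^esub> h) = red N g * red N h mod int N"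
proof -
  interpret G: comm_group "Gp p" by (rule comm_group_Gp)
  show ?thesis
    using assms by (intro red_eqI has_residue_mult has_residue_red) simp_all
qed

lemma red_one: "N \<in> coprime_levels p \<Longrightarrow> red N \<one>\<^bsub>Gp p\<^esub> = 1 mod int N"
proof -
  interpret G: comm_group "Gp p" by (rule comm_group_Gp)
  assume N: "N \<in> coprime_levels p"
  have "has_residue N \<one>\<^bsub>Gp p\<^esub> 1"
    unfolding has_residue_def
  proof (intro allI impI)
    fix l assume l: "prime l" "l dvd N"
    interpret Q: cring "Qp l" by (rule cring_Qp[OF l(1)])
    have "\<one>\<^bsub>Gp p\<^esub> l \<ominus>\<^bsub>Qp l\<^esub> Qp_of_rat l (of_int 1) = \<zero>\<^bsub>Qp l\<^esub>"
      by (simp add: Gp_one[OF l(1) coprime_levels_prime_ne[OF N l(2,1)]] Qp_of_rat_one[OF l(1)] Q.r_right_minus_eq)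
    then show "padic_norm l (\<one>\<^bsub>Gp p\<^esub> l \<ominus>\<^bsub>Qp l\<^esub> Qp_of_rat l (of_int 1)) \<le> padic_abs l (of_nat N)"
      using padic_norm_eq_0_iff[OF l(1), of "\<zero>\<^bsub>Qp l\<^esub>"] by (simp add: padic_abs_nonneg[OF l(1)])
  qed
  then show ?thesis by (intro red_eqI N) simp_all
qed

lemma has_residue_frob: "N \<in> coprime_levels p \<Longrightarrow> has_residue N (frob p) (int p)"
  unfolding has_residue_def
proof (intro allI impI)
  fix l assume N: "N \<in> coprime_levels p" and l: "prime l" "l dvd N"
  interpret Q: cring "Qp l" by (rule cring_Qp[OF l(1)])
  have "frob p l \<ominus>\<^bsub>Qp l\<^esub> Qp_of_rat l (of_int (int p)) = \<zero>\<^bsub>Qp l\<^esub>"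
    using l coprime_levels_prime_ne[OF N l(2,1)] by (simp add: frob_def Q.r_right_minus_eq Qp_of_rat_closed)
  then show "padic_norm l (frob p l \<ominus>\<^bsub>Qp l\<^esub> Qp_of_rat l (of_int (int p))) \<le> padic_abs l (of_nat N)"
    using padic_norm_eq_0_iff[OF l(1), of "\<zero>\<^bsub>Qp l\<^esub>"] by (simp add: padic_abs_nonneg[OF l(1)])
qed

lemma red_frob: "N \<in> coprime_levels p \<Longrightarrow> red N (frob p) = int p mod int N"
  by (intro red_eqI frob_in_Gp has_residue_frob)

text \<open>The residues of \<open>g\<close> and of its inverse are inverse to each other.\<close>

lemma coprime_red:
  assumes g: "g \<in> carrier (Gp p)" and N: "N \<in> coprime_levels p"
  shows "coprime (red N g) (int N)"
proof -
  interpret G: comm_group "Gp p" by (rule comm_group_Gp)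
  have "1 mod int N = red N g * red N (inv\<^bsub>Gp p\<^esub> g) mod int N"
    using red_mult[OF g _ N, of "inv\<^bsub>Gp p\<^esub> g"] red_one[OF N] g by simp
  then have "[red N g * red N (inv\<^bsub>Gp p\<^esub> g) = 1] (mod int N)"
    by (simp add: cong_def)
  then show ?thesis
    using coprime_iff_invertible_int by blast
qed

text \<open>The residues modulo the powers of \<open>l\<close> determine the component at \<open>l\<close>.\<close>

lemma Gp_eqI:
  assumes g: "g \<in> carrier (Gp p)" and h: "h \<in> carrier (Gp p)"
    and eq: "\<And>N. N \<in> coprime_levels p \<Longrightarrow> red N g = red N h"
  shows "g = h"
proof (rule extensionalityI[of _ "primes - {p}"])
  show "g \<in> extensional (primes - {p})" "h \<in> extensional (primes - {p})"
    using g h by (simp_all add: carrier_Gp)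
  fix l assume "l \<in> primes - {p}"
  then have l: "prime l" "l \<noteq> p" by auto
  interpret Q: cring "Qp l" by (rule cring_Qp[OF l(1)])
  have gl: "g l \<in> carrier (Qp l)" "h l \<in> carrier (Qp l)" using g h l by (simp_all add: carrier_Gp)
  have le: "padic_norm l (g l \<ominus>\<^bsub>Qp l\<^esub> h l) \<le> inverse (real l) ^ j" for j
  proof (cases "j = 0")
    case True
    have "padic_norm l (g l \<oplus>\<^bsub>Qp l\<^esub> \<ominus>\<^bsub>Qp l\<^esub> h l) \<le> max (padic_norm l (g l)) (padic_norm l (\<ominus>\<^bsub>Qp l\<^esub> h l))"
      using gl by (intro padic_norm_add_le[OF l(1)]) simp_all
    then show ?thesis using g h l gl True padic_norm_uminus[OF l(1)] by (simp add: carrier_Gp a_minus_def)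
  next
    case False
    define N where "N = l ^ j"
    have N: "N \<in> coprime_levels p" unfolding N_def by (rule coprime_levels_prime_power[OF l])
    define k where "k = red N g"
    have "has_residue N g k" "has_residue N h k"
      using has_residue_red[OF g N] has_residue_red[OF h N] eq[OF N] by (simp_all add: k_def)
    moreover have "l dvd N" using False by (simp add: N_def)
    ultimately have *: "padic_norm l (g l \<ominus>\<^bsub>Qp l\<^esub> Qp_of_rat l (of_int k)) \<le> padic_abs l (of_nat N)"
       "padic_norm l (Qp_of_rat l (of_int k) \<ominus>\<^bsub>Qp l\<^esub> h l) \<le> padic_abs l (of_nat N)"
      using l padic_norm_minus_commute[OF l(1) Qp_of_rat_closed[OF l(1)] gl(2), of "of_int k"]
      by (simp_all add: has_residue_def)
    have "padic_abs l (of_nat N) \<le> inverse (real l ^ j)"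
      using padic_abs_of_int_le_iff[OF l(1), of "int N" j] by (simp add: N_def)
    then show ?thesis
      using padic_norm_diff_leI[OF l(1) gl(1) Qp_of_rat_closed[OF l(1)] gl(2) *] by (simp add: power_inverse)
  qed
  have "padic_norm l (g l \<ominus>\<^bsub>Qp l\<^esub> h l) \<le> 0"
  proof (rule LIMSEQ_le_const)
    show "(\<lambda>j. inverse (real l) ^ j) \<longlonglongrightarrow> 0"
      using prime_base_pos[OF l(1)] by (intro LIMSEQ_realpow_zero) (auto simp: inverse_less_1_iff)
    show "\<exists>N. \<forall>n\<ge>N. padic_norm l (g l \<ominus>\<^bsub>Qp l\<^esub> h l) \<le> inverse (real l) ^ n"
      by (intro exI allI impI le)
  qed
  then have "padic_norm l (g l \<ominus>\<^bsub>Qp l\<^esub> h l) = 0"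
    using padic_norm_nonneg[OF l(1), of "g l \<ominus>\<^bsub>Qp l\<^esub> h l"] gl by simp
  then show "g l = h l"
    using padic_norm_eq_0_iff[OF l(1), of "g l \<ominus>\<^bsub>Qp l\<^esub> h l"] gl by simp
qed

text \<open>A compatible system of invertible residues comes from an element of \<open>G\<^sub>p\<close>: its component at
  \<open>l\<close> is the limit of the residues modulo the powers of \<open>l\<close>.\<close>

lemma Gp_of_compatible_residues:
  assumes cop: "\<And>N. N \<in> coprime_levels p \<Longrightarrow> coprime (k N) (int N)"
    and comp: "\<And>M N. N \<in> coprime_levels p \<Longrightarrow> M dvd N \<Longrightarrow> int M dvd k N - k M"
  shows "\<exists>g\<in>carrier (Gp p). \<forall>N\<in>coprime_levels p. has_residue N g (k N)"
proof -
  have "\<exists>a\<in>carrier (Qp l). \<forall>j. padic_norm l (a \<ominus>\<^bsub>Qp l\<^esub> Qp_of_rat l (of_int (k (l ^ j)))) \<le> inverse (real l ^ j)"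
    if l: "prime l" "l \<noteq> p" for l
  proof (rule Qp_limit_of_int_sequence[OF l(1)])
    fix i j :: nat assume "i \<le> j"
    then have "int (l ^ i) dvd k (l ^ j) - k (l ^ i)"
      by (intro comp coprime_levels_prime_power l le_imp_power_dvd)
    then show "int l ^ i dvd k (l ^ j) - k (l ^ i)" by simp
  qed
  then obtain a where a: "\<And>l. prime l \<Longrightarrow> l \<noteq> p \<Longrightarrow> a l \<in> carrier (Qp l)"
    "\<And>l j. prime l \<Longrightarrow> l \<noteq> p \<Longrightarrow> padic_norm l (a l \<ominus>\<^bsub>Qp l\<^esub> Qp_of_rat l (of_int (k (l ^ j)))) \<le> inverse (real l ^ j)"
    by metis
  define g where "g = restrict a (primes - {p})"
  have norm1: "padic_norm l (a l) = 1" if l: "prime l" "l \<noteq> p" for l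
  proof -
    have "\<not> int l dvd k l"
    proof
      assume "int l dvd k l"
      moreover have "coprime (k l) (int l)" using cop[OF coprime_levels_prime_power[OF l, of 1]] by simp
      ultimately have "is_unit (int l)" using coprime_common_divisor[of "k l" "int l" "int l"] by simp
      then show False using prime_base_pos[OF l(1)] by simp
    qed
    then have "\<not> padic_abs l (of_int (k l)) \<le> inverse (real l ^ 1)"
      unfolding padic_abs_of_int_le_iff[OF l(1)] by simp
    then have "padic_abs l (of_int (k l)) > inverse (real l ^ 1)" by (simp only: not_le)
    moreover have "padic_norm l (a l \<ominus>\<^bsub>Qp l\<^esub> Qp_of_rat l (of_int (k l))) \<le> inverse (real l ^ 1)"
      using a(2)[OF l, of 1] by simp
    ultimately have *: "padic_norm l (a l) = padic_abs l (of_int (k l))"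
      using padic_norm_eqI[OF l(1) Qp_of_rat_closed[OF l(1)] a(1)[OF l], of "of_int (k l)"]
        padic_norm_minus_commute[OF l(1) Qp_of_rat_closed[OF l(1)] a(1)[OF l], of "of_int (k l)"]
      by (simp add: padic_norm_of_rat[OF l(1)])
    have "multiplicity (int l) (k l) = 0" using \<open>\<not> int l dvd k l\<close> by (rule not_dvd_imp_multiplicity_0)
    moreover have "k l \<noteq> 0" using \<open>\<not> int l dvd k l\<close> by auto
    ultimately show ?thesis using padic_abs_of_int[OF l(1), of "k l"] * by simp
  qed
  have g: "g \<in> carrier (Gp p)"
    using a(1) norm1 by (auto simp: carrier_Gp g_def)
  have "has_residue N g (k N)" if N: "N \<in> coprime_levels p" for N
    unfolding has_residue_def
  proof (intro allI impI)
    fix l assume l: "prime l" "l dvd N"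
    have lp: "l \<noteq> p" by (rule coprime_levels_prime_ne[OF N l(2,1)])
    define j where "j = multiplicity l N"
    have "int (l ^ j) dvd k N - k (l ^ j)"
      using N by (intro comp) (simp_all add: j_def multiplicity_dvd)
    then have "int l ^ j dvd k (l ^ j) - k N" by (simp add: dvd_diff_commute)
    then have "padic_abs l (of_int (k (l ^ j) - k N)) \<le> inverse (real l ^ j)"
      by (simp only: padic_abs_of_int_le_iff[OF l(1)])
    then have *: "padic_norm l (Qp_of_rat l (of_int (k (l ^ j))) \<ominus>\<^bsub>Qp l\<^esub> Qp_of_rat l (of_int (k N))) \<le> inverse (real l ^ j)"
      by (simp add: padic_norm_of_rat[OF l(1)] flip: Qp_of_rat_diff[OF l(1)])
    have N0: "N > 0" using N by (simp add: coprime_levels_def)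
    have gl: "g l = a l" using l lp by (simp add: g_def)
    show "padic_norm l (g l \<ominus>\<^bsub>Qp l\<^esub> Qp_of_rat l (of_int (k N))) \<le> padic_abs l (of_nat N)"
      unfolding padic_abs_of_nat_conv_multiplicity[OF l(1) N0] gl j_def[symmetric]
      by (rule padic_norm_diff_leI[OF l(1) a(1)[OF l(1) lp] Qp_of_rat_closed[OF l(1)] Qp_of_rat_closed[OF l(1)] a(2)[OF l(1) lp] *])
  qed
  then show ?thesis using g by blast
qed

end

section \<open>\<open>G\<^sub>p\<close> as a profinite group\<close>

lemma group_actionI:
  assumes G: "group G"
    and ext: "\<And>g. g \<in> carrier G \<Longrightarrow> \<phi> g \<in> extensional E"
    and closed: "\<And>g x. g \<in> carrier G \<Longrightarrow> x \<in> E \<Longrightarrow> \<phi> g x \<in> E"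
    and one: "\<And>x. x \<in> E \<Longrightarrow> \<phi> \<one>\<^bsub>G\<^esub> x = x"
    and mult: "\<And>g h x. g \<in> carrier G \<Longrightarrow> h \<in> carrier G \<Longrightarrow> x \<in> E \<Longrightarrow> \<phi> (g \<otimes>\<^bsub>G\<^esub> h) x = \<phi> g (\<phi> h x)"
  shows "group_action G E \<phi>"
proof -
  interpret G: group G by (rule G)
  have Bij: "\<phi> g \<in> Bij E" if g: "g \<in> carrier G" for g
  proof -
    have "bij_betw (\<phi> g) E E"
    proof (rule bij_betw_byWitness[where f' = "\<phi> (inv\<^bsub>G\<^esub> g)"])
      show "\<forall>x\<in>E. \<phi> (inv\<^bsub>G\<^esub> g) (\<phi> g x) = x" "\<forall>x\<in>E. \<phi> g (\<phi> (inv\<^bsub>G\<^esub> g) x) = x"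
        using g by (simp_all add: one flip: mult)
    qed (use g closed in auto)
    then show ?thesis using ext[OF g] by (simp add: Bij_def)
  qed
  show ?thesis
  proof (intro group_action.intro group_hom.intro G group_BijGroup group_hom_axioms.intro homI)
    show "\<phi> g \<in> carrier (BijGroup E)" if "g \<in> carrier G" for g
      using Bij[OF that] by (simp add: BijGroup_def)
    fix g h assume gh: "g \<in> carrier G" "h \<in> carrier G"
    have "\<phi> (g \<otimes>\<^bsub>G\<^esub> h) = compose E (\<phi> g) (\<phi> h)"
      by (rule extensionalityI[of _ E]) (use gh in \<open>auto simp: ext compose_def mult\<close>)
    then show "\<phi> (g \<otimes>\<^bsub>G\<^esub> h) = \<phi> g \<otimes>\<^bsub>BijGroup E\<^esub> \<phi> h"
      using Bij gh by (simp add: BijGroup_def)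
  qed
qed

context
  fixes p :: nat
  assumes prime_p: "prime p"
begin

lemma carrier_Gp_PiE: "carrier (Gp p) = (\<Pi>\<^sub>E l\<in>primes - {p}. Units (Zp l))"
  by (simp add: Gp_def units_of_def)

lemma topspace_Units_top: "prime l \<Longrightarrow> topspace (subtopology (Qp_top l) (Units (Zp l))) = Units (Zp l)"
  using openin_subset[OF openin_Units_Zp] by (simp add: Int_absorb1)

lemma topspace_Gp_top [simp]: "topspace (Gp_top p) = carrier (Gp p)"
  unfolding Gp_top_def topspace_product_topology carrier_Gp_PiE
  by (rule PiE_cong) (simp add: topspace_Units_top del: topspace_subtopology)

text \<open>Having a given residue modulo \<open>N\<close> restricts the components at the finitely many primes dividing \<open>N\<close>
  to balls, and these are open.\<close>

lemma openin_red:
  assumes N: "N \<in> coprime_levels p"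
  shows "openin (Gp_top p) {g \<in> carrier (Gp p). red N g = k}"
proof (cases "k \<in> {0..<int N}")
  case True
  define W where "W l = (if l dvd N then {x \<in> Units (Zp l). padic_norm l (x \<ominus>\<^bsub>Qp l\<^esub> Qp_of_rat l (of_int k)) \<le> padic_abs l (of_nat N)}
    else Units (Zp l))" for l
  have N0: "N > 0" using N by (simp add: coprime_levels_def)
  have red: "red N g = k \<longleftrightarrow> has_residue N g k" if "g \<in> carrier (Gp p)" for g
    using has_residue_iff_cong[OF prime_p that N, of k] red_range[OF prime_p that N] True
    by (simp add: cong_def)
  have PiE_W: "g \<in> (\<Pi>\<^sub>E l\<in>primes - {p}. W l) \<longleftrightarrow> g \<in> carrier (Gp p) \<and> has_residue N g k" for g
  proof -
    have "(\<forall>l\<in>primes - {p}. g l \<in> W l) \<longleftrightarrow> (\<forall>l\<in>primes - {p}. g l \<in> Units (Zp l)) \<and> has_residue N g k"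
      using coprime_levels_prime_ne[OF prime_p N] unfolding W_def has_residue_def
      by (simp add: if_distrib[of "\<lambda>A. _ \<in> A"]) blast
    then show ?thesis unfolding carrier_Gp_PiE PiE_iff by blast
  qed
  have "openin (Gp_top p) (\<Pi>\<^sub>E l\<in>primes - {p}. W l)"
    unfolding Gp_top_def openin_PiE_gen
  proof (intro disjI2 conjI ballI)
    show "finite {l \<in> primes - {p}. W l \<noteq> topspace (subtopology (Qp_top l) (Units (Zp l)))}"
    proof (rule finite_subset)
      show "{l \<in> primes - {p}. W l \<noteq> topspace (subtopology (Qp_top l) (Units (Zp l)))} \<subseteq> {l. l dvd N}"
        by (auto simp: W_def topspace_Units_top simp del: topspace_subtopology split: if_splits)
      show "finite {l. l dvd N}" using N0 by simp
    qed
    fix l assume "l \<in> primes - {p}"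
    then have l: "prime l" by simp
    show "openin (subtopology (Qp_top l) (Units (Zp l))) (W l)"
    proof (cases "l dvd N")
      case True
      have "W l = {x \<in> carrier (Qp l). padic_norm l (x \<ominus>\<^bsub>Qp l\<^esub> Qp_of_rat l (of_int k)) \<le> padic_abs l (of_nat N)} \<inter> Units (Zp l)"
        using True Units_Zp[OF l] by (auto simp: W_def)
      then show ?thesis
        using openin_Qp_cball[OF l Qp_of_rat_closed[OF l]] padic_abs_pos[OF l, of "of_nat N"] N0
        by (auto simp: openin_subtopology)
    next
      case False
      then show ?thesis using openin_Units_Zp[OF l] by (auto simp: W_def openin_subtopology)
    qed
  qed
  then have "openin (Gp_top p) {g. g \<in> carrier (Gp p) \<and> has_residue N g k}"
    by (simp flip: PiE_W)
  also have "{g. g \<in> carrier (Gp p) \<and> has_residue N g k} = {g \<in> carrier (Gp p). red N g = k}"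
    by (simp add: red cong: conj_cong)
  finally show ?thesis .
next
  case False
  then have "{g \<in> carrier (Gp p). red N g = k} = {}"
    using red_range[OF prime_p _ N] by auto
  then show ?thesis by (simp only: openin_empty)
qed

text \<open>The residue classes form a basis: an open set restricts finitely many components, each
  up to a power of the respective prime, and a product of such powers is a level.\<close>

lemma Gp_top_residue_nhd:
  assumes W: "openin (Gp_top p) W" and g: "g \<in> W"
  obtains N where "N \<in> coprime_levels p"
    "\<And>h. h \<in> carrier (Gp p) \<Longrightarrow> red N h = red N g \<Longrightarrow> h \<in> W"
proof -
  define I where "I = primes - {p}"
  obtain U where U: "finite {l \<in> I. U l \<noteq> topspace (subtopology (Qp_top l) (Units (Zp l)))}"
    "\<And>l. l \<in> I \<Longrightarrow> openin (subtopology (Qp_top l) (Units (Zp l))) (U l)"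
    "g \<in> PiE I U" "PiE I U \<subseteq> W"
    using W g unfolding Gp_top_def openin_product_topology_alt I_def[symmetric] by meson
  have gG: "g \<in> carrier (Gp p)" using openin_subset[OF W] g by auto
  define F where "F = {l \<in> I. U l \<noteq> topspace (subtopology (Qp_top l) (Units (Zp l)))}"
  have F: "finite F" "F \<subseteq> I" using U(1) by (auto simp: F_def)
  have "\<exists>j. \<forall>y\<in>Units (Zp l). padic_norm l (y \<ominus>\<^bsub>Qp l\<^esub> g l) \<le> inverse (real l ^ j) \<longrightarrow> y \<in> U l" if lI: "l \<in> I" for l
  proof -
    have l: "prime l" using lI by (simp add: I_def)
    obtain T where T: "openin (Qp_top l) T" "U l = T \<inter> Units (Zp l)"
      using U(2)[OF lI] by (auto simp: openin_subtopology)
    have "g l \<in> T" using U(3) lI T(2) by (auto simp: PiE_iff)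
    then obtain e where e: "e > 0" "\<forall>y\<in>carrier (Qp l). padic_norm l (y \<ominus>\<^bsub>Qp l\<^esub> g l) < e \<longrightarrow> y \<in> T"
      using T(1) unfolding openin_Qp_top_iff[OF l] by meson
    have "inverse (real l) < 1" using prime_base_pos[OF l] by (simp add: inverse_less_1_iff)
    then obtain j where "inverse (real l) ^ j < e" using real_arch_pow_inv[OF e(1)] by meson
    then have j: "inverse (real l ^ j) < e" by (simp add: power_inverse)
    have "y \<in> U l" if y: "y \<in> Units (Zp l)" "padic_norm l (y \<ominus>\<^bsub>Qp l\<^esub> g l) \<le> inverse (real l ^ j)" for y
    proof -
      have "y \<in> carrier (Qp l)" using y(1) by (simp add: Units_Zp[OF l])
      moreover have "padic_norm l (y \<ominus>\<^bsub>Qp l\<^esub> g l) < e" using y(2) j by linarith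
      ultimately have "y \<in> T" using e(2) by simp
      then show ?thesis using y(1) T(2) by simp
    qed
    then show ?thesis by (intro exI[of _ j]) simp
  qed
  then obtain j where j: "\<And>l y. l \<in> I \<Longrightarrow> y \<in> Units (Zp l) \<Longrightarrow> padic_norm l (y \<ominus>\<^bsub>Qp l\<^esub> g l) \<le> inverse (real l ^ j l) \<Longrightarrow> y \<in> U l"
    by metis
  \<comment> \<open>the exponent \<open>Suc (j l)\<close> lets \<open>l\<close> divide \<open>N\<close> also for \<open>j l = 0\<close>, so that residues modulo \<open>N\<close> see the component at \<open>l\<close>\<close>
  define N where "N = (\<Prod>l\<in>F. l ^ Suc (j l))"
  have N: "N \<in> coprime_levels p"
    unfolding N_def using F
  proof (induction F rule: finite_induct)
    case empty
    then show ?case by (simp add: coprime_levels_def)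
  next
    case (insert l F)
    then have "l ^ Suc (j l) \<in> coprime_levels p"
      by (intro coprime_levels_prime_power[OF prime_p]) (auto simp: I_def)
    then show ?case using insert by (simp add: coprime_levels_mult[OF prime_p] del: power_Suc)
  qed
  have "h \<in> W" if h: "h \<in> carrier (Gp p)" "red N h = red N g" for h
  proof -
    have "h l \<in> U l" if lI: "l \<in> I" for l
    proof (cases "l \<in> F")
      case True
      have l: "prime l" "l \<noteq> p" using lI by (simp_all add: I_def)
      have dvd: "l ^ Suc (j l) dvd N" unfolding N_def using F True by (intro dvd_prodI)
      then have lN: "l dvd N" by (metis dvd_mult_left power_Suc)
      define k where "k = red N g"
      have "has_residue N g k" "has_residue N h k"
        using has_residue_red[OF prime_p gG N] has_residue_red[OF prime_p h(1) N] h(2) by (simp_all add: k_def)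
      then have *: "padic_norm l (h l \<ominus>\<^bsub>Qp l\<^esub> Qp_of_rat l (of_int k)) \<le> padic_abs l (of_nat N)"
        "padic_norm l (Qp_of_rat l (of_int k) \<ominus>\<^bsub>Qp l\<^esub> g l) \<le> padic_abs l (of_nat N)"
        using l lN padic_norm_minus_commute[OF l(1) Qp_of_rat_closed[OF l(1)] Gp_closed[OF prime_p gG l], of "of_int k"]
        by (simp_all add: has_residue_def)
      have "padic_abs l (of_int (int N)) \<le> inverse (real l ^ j l)"
        unfolding padic_abs_of_int_le_iff[OF l(1)]
        using dvd_trans[OF le_imp_power_dvd[of "j l" "Suc (j l)" l] dvd] by (simp flip: of_nat_power)
      then have "padic_norm l (h l \<ominus>\<^bsub>Qp l\<^esub> g l) \<le> inverse (real l ^ j l)"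
        using padic_norm_diff_leI[OF l(1) Gp_closed[OF prime_p h(1) l] Qp_of_rat_closed[OF l(1)] Gp_closed[OF prime_p gG l] *]
        by simp
      moreover have "h l \<in> Units (Zp l)" using h(1) lI by (auto simp: carrier_Gp_PiE I_def PiE_iff)
      ultimately show ?thesis using j lI by simp
    next
      case False
      then have "U l = topspace (subtopology (Qp_top l) (Units (Zp l)))"
        using lI by (simp add: F_def)
      then have "U l = Units (Zp l)" using lI topspace_Units_top[of l] by (simp add: I_def)
      then show ?thesis using h(1) lI by (auto simp: carrier_Gp_PiE I_def PiE_iff)
    qed
    then have "h \<in> PiE I U" using h(1) by (auto simp: carrier_Gp_PiE I_def PiE_iff)
    then show ?thesis using U(4) by (rule subsetD[rotated])
  qed
  then show ?thesis using that N by blast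
qed

lemma continuous_map_into_Gp_top:
  assumes f: "\<And>x. x \<in> topspace T \<Longrightarrow> f x \<in> carrier (Gp p)"
    and red: "\<And>N k. N \<in> coprime_levels p \<Longrightarrow> openin T {x \<in> topspace T. red N (f x) = k}"
  shows "continuous_map T (Gp_top p) f"
  unfolding continuous_map_def
proof (intro conjI allI impI)
  show "f \<in> topspace T \<rightarrow> topspace (Gp_top p)" using f by simp
  fix W assume W: "openin (Gp_top p) W"
  show "openin T {x \<in> topspace T. f x \<in> W}"
  proof (subst openin_subopen, intro ballI)
    fix x assume x: "x \<in> {x \<in> topspace T. f x \<in> W}"
    then obtain N where N: "N \<in> coprime_levels p"
      "\<And>h. h \<in> carrier (Gp p) \<Longrightarrow> red N h = red N (f x) \<Longrightarrow> h \<in> W"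
      using Gp_top_residue_nhd[OF W] by auto
    have "{y \<in> topspace T. red N (f y) = red N (f x)} \<subseteq> {x \<in> topspace T. f x \<in> W}"
      using N(2) f by auto
    then show "\<exists>V. openin T V \<and> x \<in> V \<and> V \<subseteq> {x \<in> topspace T. f x \<in> W}"
      using red[OF N(1)] x by (intro exI[of _ "{y \<in> topspace T. red N (f y) = red N (f x)}"]) simp
  qed
qed

lemma Hausdorff_space_Gp_top: "Hausdorff_space (Gp_top p)"
  unfolding Hausdorff_space_def
proof (intro allI impI)
  fix g h assume "g \<in> topspace (Gp_top p) \<and> h \<in> topspace (Gp_top p) \<and> g \<noteq> h"
  then have gh: "g \<in> carrier (Gp p)" "h \<in> carrier (Gp p)" "g \<noteq> h" by simp_all
  then obtain N where N: "N \<in> coprime_levels p" "red N g \<noteq> red N h"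
    using Gp_eqI[OF prime_p gh(1,2)] by meson
  show "\<exists>U V. openin (Gp_top p) U \<and> openin (Gp_top p) V \<and> g \<in> U \<and> h \<in> V \<and> disjnt U V"
    by (rule exI[of _ "{x \<in> carrier (Gp p). red N x = red N g}"],
        rule exI[of _ "{x \<in> carrier (Gp p). red N x = red N h}"])
      (use gh N openin_red[OF N(1)] in \<open>auto simp: disjnt_iff\<close>)
qed

text \<open>The compatible systems of invertible residues form a closed subset of a product of finite
  discrete spaces, which is compact; \<open>G\<^sub>p\<close> is a continuous image of it.\<close>

lemma compact_space_Gp_top: "compact_space (Gp_top p)"
proof -
  define T where "T = product_topology (\<lambda>N. discrete_topology {0..<int N}) (coprime_levels p)"
  have T: "compact_space T"
    unfolding T_def compact_space_product_topology by (simp add: compact_space_discrete_topology)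
  define K where "K = topspace T \<inter> (\<Inter>(M, N)\<in>{(M, N). N \<in> coprime_levels p \<and> M dvd N}.
    {k \<in> topspace T. coprime (k N) (int N) \<and> int M dvd k N - k M})"
  have cl: "closedin T {k \<in> topspace T. coprime (k N) (int N) \<and> int M dvd k N - k M}"
    if "N \<in> coprime_levels p" "M dvd N" for M N
  proof -
    have M: "M \<in> coprime_levels p" using coprime_levels_dvd[OF prime_p that] .
    have "continuous_map T (prod_topology (discrete_topology {0..<int N}) (discrete_topology {0..<int M})) (\<lambda>k. (k N, k M))"
      unfolding T_def using that(1) M by (intro continuous_map_pairedI continuous_map_product_projection)
    then have "continuous_map T (discrete_topology ({0..<int N} \<times> {0..<int M})) (\<lambda>k. (k N, k M))"
      by (simp add: prod_topology_discrete_topology)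
    moreover have "closedin (discrete_topology ({0..<int N} \<times> {0..<int M}))
        {(a, b). a \<in> {0..<int N} \<and> b \<in> {0..<int M} \<and> coprime a (int N) \<and> int M dvd a - b}"
      by (auto simp: closedin_discrete_topology)
    ultimately have "closedin T {k \<in> topspace T. (k N, k M) \<in> {(a, b). a \<in> {0..<int N} \<and> b \<in> {0..<int M} \<and> coprime a (int N) \<and> int M dvd a - b}}"
      by (rule closedin_continuous_map_preimage)
    moreover have "k N \<in> {0..<int N}" "k M \<in> {0..<int M}" if "k \<in> topspace T" for k
      using that \<open>N \<in> coprime_levels p\<close> M by (auto simp: T_def PiE_iff)
    then have "{k \<in> topspace T. (k N, k M) \<in> {(a, b). a \<in> {0..<int N} \<and> b \<in> {0..<int M} \<and> coprime a (int N) \<and> int M dvd a - b}}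
        = {k \<in> topspace T. coprime (k N) (int N) \<and> int M dvd k N - k M}"
      by auto
    ultimately show ?thesis by simp
  qed
  have "(1, 1) \<in> {(M, N). N \<in> coprime_levels p \<and> M dvd N}" by (simp add: coprime_levels_def)
  then have "{(M, N). N \<in> coprime_levels p \<and> M dvd N} \<noteq> {}" by blast
  then have "closedin T K"
    unfolding K_def using cl by (intro closedin_Int closedin_INT) auto
  then have K: "compactin T K" using T closedin_compact_space by blast
  have Kk: "coprime (k N) (int N)" "int M dvd k N - k M" if "k \<in> K" "N \<in> coprime_levels p" "M dvd N" for k M N
    using that by (auto simp: K_def)
  have Ktop: "K \<subseteq> topspace T" by (auto simp: K_def)
  have "\<exists>g\<in>carrier (Gp p). \<forall>N\<in>coprime_levels p. has_residue N g (k N)" if "k \<in> K" for k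
    using Kk[OF that] by (intro Gp_of_compatible_residues[OF prime_p]) auto
  then obtain G where G: "\<And>k. k \<in> K \<Longrightarrow> G k \<in> carrier (Gp p)"
    "\<And>k N. k \<in> K \<Longrightarrow> N \<in> coprime_levels p \<Longrightarrow> has_residue N (G k) (k N)"
    by metis
  have red: "red N (G k) = k N" if "k \<in> K" "N \<in> coprime_levels p" for k N
  proof -
    have "k N \<in> {0..<int N}" using that Ktop by (auto simp: T_def PiE_iff)
    then show ?thesis using red_eqI[OF prime_p G(1)[OF that(1)] that(2) G(2)[OF that]] by simp
  qed
  have "continuous_map (subtopology T K) (Gp_top p) G"
  proof (rule continuous_map_into_Gp_top)
    show "G k \<in> carrier (Gp p)" if "k \<in> topspace (subtopology T K)" for k
      using that G(1) by simp
    fix N a assume N: "N \<in> coprime_levels p"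
    have "continuous_map (subtopology T K) (discrete_topology {0..<int N}) (\<lambda>k. k N)"
      unfolding T_def by (intro continuous_map_from_subtopology continuous_map_product_projection N)
    from openin_continuous_map_preimage[OF this, of "{a} \<inter> {0..<int N}"]
    have "openin (subtopology T K) {k \<in> topspace (subtopology T K). k N \<in> {a} \<inter> {0..<int N}}" by simp
    also have "{k \<in> topspace (subtopology T K). k N \<in> {a} \<inter> {0..<int N}} = {k \<in> topspace (subtopology T K). red N (G k) = a}"
      using red N Ktop by (auto simp: T_def PiE_iff)
    finally show "openin (subtopology T K) {k \<in> topspace (subtopology T K). red N (G k) = a}" .
  qed
  moreover have "compactin (subtopology T K) K" using K by (simp add: compactin_subtopology)
  ultimately have "compactin (Gp_top p) (G ` K)" by (rule image_compactin[rotated])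
  moreover have "G ` K = topspace (Gp_top p)"
  proof (intro subset_antisym subsetI)
    show "g \<in> topspace (Gp_top p)" if "g \<in> G ` K" for g using that G(1) by auto
    fix g assume "g \<in> topspace (Gp_top p)"
    then have g: "g \<in> carrier (Gp p)" by simp
    define k where "k = restrict (\<lambda>N. red N g) (coprime_levels p)"
    have "k \<in> topspace T"
      using red_range[OF prime_p g] by (simp add: T_def k_def)
    moreover have "int M dvd k N - k M" if "N \<in> coprime_levels p" "M dvd N" for M N
      unfolding k_def using that coprime_levels_dvd[OF prime_p that] red_mod[OF prime_p g that]
      by (simp add: minus_mod_eq_mult_div)
    ultimately have "k \<in> K"
      unfolding K_def using coprime_red[OF prime_p g] by (auto simp: k_def)
    moreover have "G k = g"
      by (rule Gp_eqI[OF prime_p G(1)[OF \<open>k \<in> K\<close>] g]) (simp add: red[OF \<open>k \<in> K\<close>], simp add: k_def)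
    ultimately show "g \<in> G ` K" by blast
  qed
  ultimately show ?thesis by (simp add: compact_space_def)
qed

lemma continuous_map_Gp_mult:
  "continuous_map (prod_topology (Gp_top p) (Gp_top p)) (Gp_top p) (\<lambda>(g, h). g \<otimes>\<^bsub>Gp p\<^esub> h)"
proof (rule continuous_map_into_Gp_top)
  interpret G: comm_group "Gp p" by (rule comm_group_Gp[OF prime_p])
  show "(case x of (g, h) \<Rightarrow> g \<otimes>\<^bsub>Gp p\<^esub> h) \<in> carrier (Gp p)"
    if "x \<in> topspace (prod_topology (Gp_top p) (Gp_top p))" for x
    using that by auto
  fix N k assume N: "N \<in> coprime_levels p"
  have "{x \<in> topspace (prod_topology (Gp_top p) (Gp_top p)). red N (case x of (g, h) \<Rightarrow> g \<otimes>\<^bsub>Gp p\<^esub> h) = k} =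
      (\<Union>(a, b)\<in>{(a, b). a * b mod int N = k}. {g \<in> carrier (Gp p). red N g = a} \<times> {g \<in> carrier (Gp p). red N g = b})"
    by (auto simp: red_mult[OF prime_p _ _ N])
  also have "openin (prod_topology (Gp_top p) (Gp_top p)) \<dots>"
    by (intro openin_Union ballI) (auto simp: openin_prod_Times_iff intro!: openin_red N)
  finally show "openin (prod_topology (Gp_top p) (Gp_top p))
    {x \<in> topspace (prod_topology (Gp_top p) (Gp_top p)). red N (case x of (g, h) \<Rightarrow> g \<otimes>\<^bsub>Gp p\<^esub> h) = k}" .
qed

lemma compact_Gp_torsor_translation: "compact_Gp_torsor p (Gp_top p) (Gp_translation p)"
proof -
  interpret G: comm_group "Gp p" by (rule comm_group_Gp[OF prime_p])
  have act: "group_action (Gp p) (carrier (Gp p)) (Gp_translation p)"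
    by (rule group_actionI) (simp_all add: Gp_translation_def G.is_group G.m_assoc)
  have cont: "continuous_map (prod_topology (Gp_top p) (Gp_top p)) (Gp_top p) (\<lambda>(g, x). Gp_translation p g x)"
    by (rule continuous_map_eq[OF continuous_map_Gp_mult]) (auto simp: Gp_translation_def)
  have trans: "transitive_action (Gp p) (carrier (Gp p)) (Gp_translation p)"
  proof (intro transitive_action.intro act transitive_action_axioms.intro)
    fix x y assume xy: "x \<in> carrier (Gp p)" "y \<in> carrier (Gp p)"
    then have "Gp_translation p (y \<otimes>\<^bsub>Gp p\<^esub> inv\<^bsub>Gp p\<^esub> x) x = y"
      by (simp add: Gp_translation_def G.m_assoc)
    then show "\<exists>g\<in>carrier (Gp p). Gp_translation p g x = y"
      using xy by (intro bexI[of _ "y \<otimes>\<^bsub>Gp p\<^esub> inv\<^bsub>Gp p\<^esub> x"]) simp_all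
  qed
  have stab: "stabilizer (Gp p) (Gp_translation p) x = {\<one>\<^bsub>Gp p\<^esub>}" if x: "x \<in> carrier (Gp p)" for x
    using x G.r_cancel_one by (auto simp: stabilizer_def Gp_translation_def)
  show ?thesis
    unfolding compact_Gp_torsor_def continuous_group_action_def
    using compact_space_Gp_top Hausdorff_space_Gp_top act cont trans stab by simp
qed

end

section \<open>The action on roots of unity\<close>

lemma power_eq_if_cong:
  fixes \<xi> :: complex
  assumes "\<xi> ^ n = 1" "[a = b] (mod n)"
  shows "\<xi> ^ a = \<xi> ^ b"
proof -
  have "\<xi> ^ c = \<xi> ^ (c mod n)" for c
  proof -
    have "\<xi> ^ c = \<xi> ^ (n * (c div n) + c mod n)" by simp
    also have "\<dots> = \<xi> ^ (c mod n)" unfolding power_add power_mult assms(1) by simp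
    finally show ?thesis .
  qed
  then show ?thesis using assms(2) unfolding cong_def by metis
qed

definition unity_root :: "nat \<Rightarrow> complex" where
  "unity_root n = exp (2 * of_real pi * \<i> / of_nat n)"

lemma unity_root_power: "unity_root n ^ j = exp (2 * of_real pi * \<i> * of_nat j / of_nat n)"
  unfolding unity_root_def by (simp flip: exp_of_nat_mult add: field_simps)

lemma unity_root_power_eq_iff: "n > 0 \<Longrightarrow> unity_root n ^ j = unity_root n ^ k \<longleftrightarrow> [j = k] (mod n)"
  unfolding unity_root_power cong_def by (rule complex_root_unity_eq) simp

lemma unity_root_power_self: "n > 0 \<Longrightarrow> unity_root n ^ n = 1"
  using unity_root_power_eq_iff[of n n 0] by (simp add: cong_def)

lemma root_of_unity_cases:
  assumes "n > 0" "\<xi> ^ n = 1"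
  obtains j where "\<xi> = unity_root n ^ j"
  using assms complex_roots_unity[of n] unity_root_power[of n] by auto

lemma unity_root_mult: "m > 0 \<Longrightarrow> n > 0 \<Longrightarrow> unity_root (m * n) ^ m = unity_root n"
  using unity_root_power[of "m * n" m] by (simp add: unity_root_def field_simps)

context
  fixes p :: nat
  assumes prime_p: "prime p"
begin

lemma carrier_mu: "\<xi> \<in> carrier (mu_prime_to p) \<longleftrightarrow> (\<exists>n\<in>coprime_levels p. \<xi> ^ n = 1)"
  by (auto simp: mu_prime_to_def coprime_levels_def)

lemma mu_simps [simp]: "monoid.mult (mu_prime_to p) = (*)" "one (mu_prime_to p) = 1"
  by (simp_all add: mu_prime_to_def)

lemma mu_common_level:
  assumes "\<xi> \<in> carrier (mu_prime_to p)" "\<eta> \<in> carrier (mu_prime_to p)"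
  obtains N where "N \<in> coprime_levels p" "\<xi> ^ N = 1" "\<eta> ^ N = 1"
proof -
  obtain m n where mn: "m \<in> coprime_levels p" "\<xi> ^ m = 1" "n \<in> coprime_levels p" "\<eta> ^ n = 1"
    using assms unfolding carrier_mu by blast
  have "\<xi> ^ (m * n) = 1" using mn(2) by (simp add: power_mult)
  moreover have "\<eta> ^ (m * n) = 1" using mn(4) by (simp add: power_mult mult.commute[of m])
  ultimately show ?thesis using that coprime_levels_mult[OF prime_p mn(1,3)] by blast
qed

text \<open>The value does not depend on the level \<open>n\<close> and the exponent \<open>k\<close> in the definition of
  \<^const>\<open>mu_action\<close>: exponents from two levels are both congruent to the residue modulo the product of the
  levels.\<close>

lemma mu_action_eq:
  assumes g: "g \<in> carrier (Gp p)" and N: "N \<in> coprime_levels p" and \<xi>: "\<xi> ^ N = 1"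
  shows "mu_action p g \<xi> = \<xi> ^ nat (red N g)"
proof -
  have *: "\<xi> ^ k = \<xi> ^ nat (red N g)"
    if n: "n \<in> coprime_levels p" "\<xi> ^ n = 1" and k: "has_residue n g (int k)" for n k
  proof -
    define r where "r = red (n * N) g"
    have nN: "n * N \<in> coprime_levels p" by (rule coprime_levels_mult[OF prime_p n(1) N])
    have r: "r \<ge> 0" "has_residue (n * N) g r"
      using red_range[OF prime_p g nN] has_residue_red[OF prime_p g nN] by (simp_all add: r_def)
    have "has_residue n g r" "has_residue N g r"
      using has_residue_dvd[OF prime_p nN _ r(2)] by simp_all
    then have "[r = int k] (mod int n)" "[r = red N g] (mod int N)"
      using has_residue_unique[OF prime_p g n(1) _ k] has_residue_unique[OF prime_p g N _ has_residue_red[OF prime_p g N]]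
      by (simp_all add: cong_iff_dvd_diff)
    moreover have "int (nat r) = r" "int (nat (red N g)) = red N g"
      using r(1) red_range[OF prime_p g N] by simp_all
    ultimately have "[nat r = k] (mod n)" "[nat r = nat (red N g)] (mod N)"
      by (simp_all flip: cong_int_iff)
    then show ?thesis
      using power_eq_if_cong[OF n(2)] power_eq_if_cong[OF \<xi>] by metis
  qed
  have mem: "\<xi> \<in> carrier (mu_prime_to p)" using N \<xi> carrier_mu by blast
  have res: "(\<forall>l\<in>primes. l dvd n \<longrightarrow>
        padic_norm l (g l \<ominus>\<^bsub>Qp l\<^esub> Qp_of_rat l (of_nat k)) \<le> padic_abs l (of_nat n)) \<longleftrightarrow> has_residue n g (int k)" for n k
    by (simp add: has_residue_def)
  have lev: "n > 0 \<and> coprime n p \<and> A \<longleftrightarrow> n \<in> coprime_levels p \<and> A" for n A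
    by (simp add: coprime_levels_def)
  have "(THE \<zeta>. \<exists>n k :: nat. n \<in> coprime_levels p \<and> \<xi> ^ n = 1 \<and> has_residue n g (int k) \<and> \<zeta> = \<xi> ^ k)
      = \<xi> ^ nat (red N g)"
  proof (rule the_equality)
    have "int (nat (red N g)) = red N g" using red_range[OF prime_p g N] by simp
    then show "\<exists>n k :: nat. n \<in> coprime_levels p \<and> \<xi> ^ n = 1 \<and> has_residue n g (int k) \<and> \<xi> ^ nat (red N g) = \<xi> ^ k"
      using N \<xi> has_residue_red[OF prime_p g N] by (intro exI[of _ N] exI[of _ "nat (red N g)"]) simp
  qed (use * in blast)
  then show ?thesis using mem unfolding mu_action_def res lev by simp
qed

lemma mu_action_level:
  assumes "g \<in> carrier (Gp p)" "N \<in> coprime_levels p" "\<xi> ^ N = 1"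
  shows "mu_action p g \<xi> ^ N = 1"
  using assms by (simp add: mu_action_eq power_mult[symmetric] mult.commute[of _ N] power_mult)

lemma mu_action_closed:
  "g \<in> carrier (Gp p) \<Longrightarrow> \<xi> \<in> carrier (mu_prime_to p) \<Longrightarrow> mu_action p g \<xi> \<in> carrier (mu_prime_to p)"
  using mu_action_level unfolding carrier_mu by blast

lemma mu_action_mult:
  assumes g: "g \<in> carrier (Gp p)" and h: "h \<in> carrier (Gp p)" and \<xi>: "\<xi> \<in> carrier (mu_prime_to p)"
  shows "mu_action p (g \<otimes>\<^bsub>Gp p\<^esub> h) \<xi> = mu_action p g (mu_action p h \<xi>)"
proof -
  interpret G: comm_group "Gp p" by (rule comm_group_Gp[OF prime_p])
  obtain N where N: "N \<in> coprime_levels p" "\<xi> ^ N = 1" using \<xi> unfolding carrier_mu by blast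
  have pos: "red N g \<ge> 0" "red N h \<ge> 0" using red_range[OF prime_p _ N(1)] g h by simp_all
  have "mu_action p (g \<otimes>\<^bsub>Gp p\<^esub> h) \<xi> = \<xi> ^ nat (red N g * red N h mod int N)"
    using g h N by (simp add: mu_action_eq red_mult[OF prime_p])
  also have "\<dots> = \<xi> ^ (nat (red N h) * nat (red N g))"
  proof (rule power_eq_if_cong[OF N(2)])
    have "int (nat (red N g * red N h mod int N)) = red N g * red N h mod int N"
      using N(1) by (simp add: coprime_levels_def)
    then show "[nat (red N g * red N h mod int N) = nat (red N h) * nat (red N g)] (mod N)"
      using pos by (simp flip: cong_int_iff) (simp add: cong_def mult.commute)
  qed
  also have "\<dots> = mu_action p g (mu_action p h \<xi>)"
    using g h N mu_action_level[OF h N] by (simp add: mu_action_eq power_mult)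
  finally show ?thesis .
qed

lemma mu_action_one:
  assumes \<xi>: "\<xi> \<in> carrier (mu_prime_to p)"
  shows "mu_action p \<one>\<^bsub>Gp p\<^esub> \<xi> = \<xi>"
proof -
  interpret G: comm_group "Gp p" by (rule comm_group_Gp[OF prime_p])
  obtain N where N: "N \<in> coprime_levels p" "\<xi> ^ N = 1" using \<xi> unfolding carrier_mu by blast
  have "int (nat (1 mod int N)) = 1 mod int N" using N(1) by (simp add: coprime_levels_def)
  then have "[nat (1 mod int N) = 1] (mod N)"
    by (simp flip: cong_int_iff)
  then show ?thesis
    using power_eq_if_cong[OF N(2), of _ 1] N by (simp add: mu_action_eq red_one[OF prime_p])
qed

lemma mu_action_frob:
  assumes \<xi>: "\<xi> \<in> carrier (mu_prime_to p)"
  shows "mu_action p (frob p) \<xi> = \<xi> ^ p"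
proof -
  obtain N where N: "N \<in> coprime_levels p" "\<xi> ^ N = 1" using \<xi> unfolding carrier_mu by blast
  have "nat (int p mod int N) = p mod N" by (simp flip: of_nat_mod)
  then show ?thesis
    using power_eq_if_cong[OF N(2), of "p mod N" p] N frob_in_Gp[OF prime_p]
    by (simp add: mu_action_eq red_frob[OF prime_p] cong_def)
qed

lemma mu_power_closed: "\<xi> \<in> carrier (mu_prime_to p) \<Longrightarrow> \<xi> ^ j \<in> carrier (mu_prime_to p)"
  unfolding carrier_mu by (metis power_mult mult.commute power_one)

lemma mu_hom_power:
  assumes h: "\<alpha> \<in> hom (mu_prime_to p) (mu_prime_to p)" and \<xi>: "\<xi> \<in> carrier (mu_prime_to p)"
  shows "\<alpha> (\<xi> ^ j) = \<alpha> \<xi> ^ j"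
proof (induction j)
  case 0
  have one: "1 \<in> carrier (mu_prime_to p)" using mu_power_closed[OF \<xi>, of 0] by simp
  have "\<alpha> (1 * 1) = \<alpha> 1 * \<alpha> 1" using hom_mult[OF h one one] by simp
  moreover have "\<alpha> 1 \<noteq> 0"
    using hom_in_carrier[OF h one] unfolding carrier_mu by (auto simp: coprime_levels_def power_0_left)
  ultimately show ?case by simp
next
  case (Suc j)
  then show ?case using hom_mult[OF h \<xi> mu_power_closed[OF \<xi>, of j]] by simp
qed

lemma mu_action_auto:
  assumes g: "g \<in> carrier (Gp p)"
  shows "mu_action p g \<in> auto (mu_prime_to p)"
proof -
  interpret G: comm_group "Gp p" by (rule comm_group_Gp[OF prime_p])
  have "mu_action p g \<in> hom (mu_prime_to p) (mu_prime_to p)"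
  proof (rule homI)
    fix \<xi> \<eta> assume "\<xi> \<in> carrier (mu_prime_to p)" "\<eta> \<in> carrier (mu_prime_to p)"
    then obtain N where N: "N \<in> coprime_levels p" "\<xi> ^ N = 1" "\<eta> ^ N = 1"
      by (rule mu_common_level)
    then show "mu_action p g (\<xi> \<otimes>\<^bsub>mu_prime_to p\<^esub> \<eta>) = mu_action p g \<xi> \<otimes>\<^bsub>mu_prime_to p\<^esub> mu_action p g \<eta>"
      using g by (simp add: mu_action_eq[OF g N(1)] power_mult_distrib)
  qed (rule mu_action_closed[OF g])
  moreover have "bij_betw (mu_action p g) (carrier (mu_prime_to p)) (carrier (mu_prime_to p))"
  proof (rule bij_betw_byWitness[where f' = "mu_action p (inv\<^bsub>Gp p\<^esub> g)"])
    show "\<forall>a\<in>carrier (mu_prime_to p). mu_action p (inv\<^bsub>Gp p\<^esub> g) (mu_action p g a) = a"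
      "\<forall>a\<in>carrier (mu_prime_to p). mu_action p g (mu_action p (inv\<^bsub>Gp p\<^esub> g) a) = a"
      using g by (simp_all add: mu_action_one flip: mu_action_mult)
  qed (use g mu_action_closed in auto)
  moreover have "mu_action p g \<in> extensional (carrier (mu_prime_to p))"
    by (simp add: mu_action_def)
  ultimately show ?thesis by (simp add: auto_def Bij_def)
qed

text \<open>An automorphism raises the root \<open>unity_root N\<close> to some power \<open>k N\<close>, and these exponents form a
  compatible system of invertible residues.\<close>

lemma mu_action_surj:
  assumes \<alpha>: "\<alpha> \<in> auto (mu_prime_to p)"
  shows "\<exists>g\<in>carrier (Gp p). mu_action p g = \<alpha>"
proof -
  have hom: "\<alpha> \<in> hom (mu_prime_to p) (mu_prime_to p)" and ext: "\<alpha> \<in> extensional (carrier (mu_prime_to p))"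
    and inj: "inj_on \<alpha> (carrier (mu_prime_to p))"
    using \<alpha> by (auto simp: auto_def Bij_def bij_betw_def)
  have mem: "unity_root N \<in> carrier (mu_prime_to p)" if "N \<in> coprime_levels p" for N
    using that unity_root_power_self[of N] unfolding carrier_mu by (auto simp: coprime_levels_def)
  have one: "1 \<in> carrier (mu_prime_to p)" unfolding carrier_mu
    by (auto simp: coprime_levels_def intro!: bexI[of _ 1])
  have "\<exists>j. \<alpha> (unity_root N) = unity_root N ^ j" if N: "N \<in> coprime_levels p" for N
  proof -
    have N0: "N > 0" using N by (simp add: coprime_levels_def)
    have "\<alpha> (unity_root N) ^ N = \<alpha> (unity_root N ^ N)" by (rule mu_hom_power[OF hom mem[OF N], symmetric])
    also have "\<dots> = \<alpha> (1 ^ 0)" by (simp add: unity_root_power_self[OF N0])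
    also have "\<dots> = 1" by (subst mu_hom_power[OF hom one]) simp
    finally show ?thesis using root_of_unity_cases[OF N0] by metis
  qed
  then obtain k where k: "\<And>N. N \<in> coprime_levels p \<Longrightarrow> \<alpha> (unity_root N) = unity_root N ^ k N"
    by metis
  have "\<exists>g\<in>carrier (Gp p). \<forall>N\<in>coprime_levels p. has_residue N g (int (k N))"
  proof (rule Gp_of_compatible_residues[OF prime_p])
    fix N assume N: "N \<in> coprime_levels p"
    have N0: "N > 0" using N by (simp add: coprime_levels_def)
    \<comment> \<open>\<open>\<alpha>\<close> maps \<open>unity_root N ^ (N div d)\<close> to 1, so injectivity forces \<open>d = 1\<close>\<close>
    define d where "d = gcd (k N) N"
    define e where "e = N div d"
    have d0: "d > 0" using N0 by (simp add: d_def)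
    have Nde: "N = d * e" by (simp add: d_def e_def)
    obtain c where c: "k N = d * c" by (metis d_def gcd_dvd1 dvdE)
    have e0: "e > 0" using N0 Nde by (cases e) auto
    have "\<alpha> (unity_root N ^ e) = unity_root N ^ (k N * e)"
      using mu_hom_power[OF hom mem[OF N]] k[OF N] by (simp add: power_mult)
    also have "k N * e = N * c" using c Nde by simp
    also have "unity_root N ^ (N * c) = 1" by (simp add: power_mult unity_root_power_self[OF N0])
    also have "1 = \<alpha> (1 ^ 0)" by (subst mu_hom_power[OF hom one]) simp
    finally have "unity_root N ^ e = 1 ^ 0"
      using inj mu_power_closed[OF mem[OF N]] one by (simp add: inj_on_def)
    then have "[e = 0] (mod N)" using unity_root_power_eq_iff[OF N0, of e 0] by simp
    then have "N dvd e" by (simp add: cong_0_iff)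
    then have "N \<le> e" using e0 by (rule dvd_imp_le)
    then have "d = 1" using Nde d0 e0 by (cases d) auto
    then show "coprime (int (k N)) (int N)" by (simp add: d_def coprime_iff_gcd_eq_1)
  next
    fix M N assume N: "N \<in> coprime_levels p" and MN: "M dvd N"
    have M: "M \<in> coprime_levels p" by (rule coprime_levels_dvd[OF prime_p N MN])
    have M0: "M > 0" "N > 0" using M N by (simp_all add: coprime_levels_def)
    obtain c where c: "N = c * M" using MN by (metis dvd_div_mult_self)
    have c0: "c > 0" using c M0 by (cases c) auto
    have "unity_root M = unity_root N ^ c" using unity_root_mult[OF c0 M0(1)] by (simp add: c)
    then have "\<alpha> (unity_root M) = unity_root M ^ k N"
      using mu_hom_power[OF hom mem[OF N], of c] k[OF N] by (simp add: mult.commute flip: power_mult)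
    then have "[k M = k N] (mod M)" using k[OF M] unity_root_power_eq_iff[OF M0(1)] by metis
    then have "[int (k N) = int (k M)] (mod int M)" by (simp add: cong_int_iff cong_sym)
    then show "int M dvd int (k N) - int (k M)" by (simp add: cong_iff_dvd_diff)
  qed
  then obtain g where g: "g \<in> carrier (Gp p)" "\<And>N. N \<in> coprime_levels p \<Longrightarrow> has_residue N g (int (k N))"
    by blast
  have "mu_action p g = \<alpha>"
  proof (rule extensionalityI[OF _ ext])
    show "mu_action p g \<in> extensional (carrier (mu_prime_to p))" by (simp add: mu_action_def)
    fix \<xi> assume "\<xi> \<in> carrier (mu_prime_to p)"
    then obtain N where N: "N \<in> coprime_levels p" "\<xi> ^ N = 1" unfolding carrier_mu by blast
    have N0: "N > 0" using N by (simp add: coprime_levels_def)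
    obtain j where j: "\<xi> = unity_root N ^ j" using root_of_unity_cases[OF N0 N(2)] .
    have "red N g = int (k N) mod int N" by (rule red_eqI[OF prime_p g(1) N(1) g(2)[OF N(1)]])
    then have "nat (red N g) = k N mod N" by (simp flip: of_nat_mod)
    then have "mu_action p g \<xi> = \<xi> ^ k N"
      using mu_action_eq[OF g(1) N] power_eq_if_cong[OF N(2), of "k N mod N" "k N"] by (simp add: cong_def)
    also have "\<dots> = \<alpha> (unity_root N) ^ j" using k[OF N(1)] by (simp add: j mult.commute flip: power_mult)
    also have "\<dots> = \<alpha> \<xi>" unfolding j by (rule mu_hom_power[OF hom mem[OF N(1)], symmetric])
    finally show "mu_action p g \<xi> = \<alpha> \<xi>" .
  qed
  then show ?thesis using g(1) by blast
qed

text \<open>Injectivity holds since primitive roots of unity detect all residues.\<close>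

lemma mu_action_iso: "mu_action p \<in> iso (Gp p) (AutoGroup (mu_prime_to p))"
proof -
  have "mu_action p \<in> hom (Gp p) (AutoGroup (mu_prime_to p))"
  proof (rule homI)
    show "mu_action p g \<in> carrier (AutoGroup (mu_prime_to p))" if "g \<in> carrier (Gp p)" for g
      using mu_action_auto[OF that] by (simp add: AutoGroup_def)
    fix g h assume gh: "g \<in> carrier (Gp p)" "h \<in> carrier (Gp p)"
    have "mu_action p (g \<otimes>\<^bsub>Gp p\<^esub> h) = compose (carrier (mu_prime_to p)) (mu_action p g) (mu_action p h)"
      by (rule extensionalityI[of _ "carrier (mu_prime_to p)"])
        (use gh mu_action_mult in \<open>auto simp: mu_action_def compose_def\<close>)
    then show "mu_action p (g \<otimes>\<^bsub>Gp p\<^esub> h) = mu_action p g \<otimes>\<^bsub>AutoGroup (mu_prime_to p)\<^esub> mu_action p h"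
      using mu_action_auto gh by (simp add: AutoGroup_def BijGroup_def auto_def)
  qed
  moreover have "bij_betw (mu_action p) (carrier (Gp p)) (carrier (AutoGroup (mu_prime_to p)))"
    unfolding bij_betw_def
  proof
    show "inj_on (mu_action p) (carrier (Gp p))"
    proof (rule inj_onI)
      fix g h assume gh: "g \<in> carrier (Gp p)" "h \<in> carrier (Gp p)" "mu_action p g = mu_action p h"
      show "g = h"
      proof (rule Gp_eqI[OF prime_p gh(1,2)])
        fix N assume N: "N \<in> coprime_levels p"
        have N0: "N > 0" using N by (simp add: coprime_levels_def)
        have "unity_root N ^ nat (red N g) = unity_root N ^ nat (red N h)"
          using gh(3) mu_action_eq[OF gh(1) N unity_root_power_self[OF N0]]
            mu_action_eq[OF gh(2) N unity_root_power_self[OF N0]] by simp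
        then have "[nat (red N g) = nat (red N h)] (mod N)"
          by (simp add: unity_root_power_eq_iff[OF N0])
        then have "[int (nat (red N g)) = int (nat (red N h))] (mod int N)" by (simp only: cong_int_iff)
        then show "red N g = red N h"
          using red_range[OF prime_p gh(1) N] red_range[OF prime_p gh(2) N] by (simp add: cong_def)
      qed
    qed
    show "mu_action p ` carrier (Gp p) = carrier (AutoGroup (mu_prime_to p))"
    proof (intro subset_antisym subsetI)
      show "\<alpha> \<in> carrier (AutoGroup (mu_prime_to p))" if "\<alpha> \<in> mu_action p ` carrier (Gp p)" for \<alpha>
        using that mu_action_auto by (auto simp: AutoGroup_def)
      fix \<alpha> assume "\<alpha> \<in> carrier (AutoGroup (mu_prime_to p))"
      then have "\<alpha> \<in> auto (mu_prime_to p)" by (simp add: AutoGroup_def)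
      then show "\<alpha> \<in> mu_action p ` carrier (Gp p)" using mu_action_surj by blast
    qed
  qed
  ultimately show ?thesis by (simp add: iso_def)
qed

end

section \<open>Profinite integers\<close>

lemma carrier_Zhat: "a \<in> carrier Zhat \<longleftrightarrow> a \<in> extensional {1..} \<and>
    (\<forall>n\<ge>1. 0 \<le> a n \<and> a n < int n) \<and> (\<forall>m\<ge>1. \<forall>n\<ge>1. m dvd n \<longrightarrow> a n mod int m = a m)"
  by (auto simp: Zhat_def PiE_iff carrier_integer_mod_group)

lemma Zhat_mult: "n \<ge> 1 \<Longrightarrow> (a \<otimes>\<^bsub>Zhat\<^esub> b) n = (a n + b n) mod int n"
  by (simp add: Zhat_def)

lemma Zhat_one: "n \<ge> 1 \<Longrightarrow> \<one>\<^bsub>Zhat\<^esub> n = 0"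
  by (simp add: Zhat_def)

lemma Zhat_eqI:
  "a \<in> carrier Zhat \<Longrightarrow> b \<in> carrier Zhat \<Longrightarrow> (\<And>n. n \<ge> 1 \<Longrightarrow> a n = b n) \<Longrightarrow> a = b"
  by (rule extensionalityI[of _ "{1..}"]) (auto simp: carrier_Zhat)

lemma Zhat_mod: "a \<in> carrier Zhat \<Longrightarrow> n \<ge> 1 \<Longrightarrow> a n mod int n = a n"
  by (simp add: carrier_Zhat)

lemma Zhat_compat: "a \<in> carrier Zhat \<Longrightarrow> m \<ge> 1 \<Longrightarrow> n \<ge> 1 \<Longrightarrow> m dvd n \<Longrightarrow> a n mod int m = a m"
  by (simp add: carrier_Zhat)

lemma Zhat_memI:
  assumes "\<And>m n. m \<ge> 1 \<Longrightarrow> n \<ge> 1 \<Longrightarrow> m dvd n \<Longrightarrow> f n mod int m = f m mod int m"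
  shows "(\<lambda>n\<in>{1..}. f n mod int n) \<in> carrier Zhat"
proof -
  have "f n mod int n mod int m = f m mod int m" if "m \<ge> 1" "n \<ge> 1" "m dvd n" for m n
    using assms[OF that] that by (simp add: mod_mod_cancel)
  then show ?thesis by (simp add: carrier_Zhat)
qed

lemma comm_group_Zhat: "comm_group Zhat"
proof (rule comm_groupI)
  show "\<one>\<^bsub>Zhat\<^esub> \<in> carrier Zhat"
    by (simp add: carrier_Zhat Zhat_one) (simp add: Zhat_def)
  fix x y assume x: "x \<in> carrier Zhat" and y: "y \<in> carrier Zhat"
  have "(\<lambda>n\<in>{1..}. (x n + y n) mod int n) \<in> carrier Zhat"
  proof (rule Zhat_memI)
    fix m n :: nat assume mn: "m \<ge> 1" "n \<ge> 1" "m dvd n"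
    have "(x n + y n) mod int m = (x n mod int m + y n mod int m) mod int m" by (rule mod_add_eq[symmetric])
    then show "(x n + y n) mod int m = (x m + y m) mod int m"
      using Zhat_compat[OF x mn] Zhat_compat[OF y mn] by simp
  qed
  then show xy: "x \<otimes>\<^bsub>Zhat\<^esub> y \<in> carrier Zhat" by (simp add: Zhat_def)
  show "x \<otimes>\<^bsub>Zhat\<^esub> y = y \<otimes>\<^bsub>Zhat\<^esub> x" by (simp add: Zhat_def add.commute)
next
  fix x y z assume "x \<in> carrier Zhat" "y \<in> carrier Zhat" "z \<in> carrier Zhat"
  show "x \<otimes>\<^bsub>Zhat\<^esub> y \<otimes>\<^bsub>Zhat\<^esub> z = x \<otimes>\<^bsub>Zhat\<^esub> (y \<otimes>\<^bsub>Zhat\<^esub> z)"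
    by (simp add: Zhat_def fun_eq_iff mod_add_left_eq mod_add_right_eq add.assoc)
next
  fix x assume x: "x \<in> carrier Zhat"
  show "\<one>\<^bsub>Zhat\<^esub> \<otimes>\<^bsub>Zhat\<^esub> x = x"
    by (rule extensionalityI[of _ "{1..}"]) (use x in \<open>auto simp: carrier_Zhat Zhat_mult Zhat_one, simp add: Zhat_def\<close>)
  have "(\<lambda>n\<in>{1..}. (- x n) mod int n) \<in> carrier Zhat"
  proof (rule Zhat_memI)
    fix m n :: nat assume mn: "m \<ge> 1" "n \<ge> 1" "m dvd n"
    have "(- x n) mod int m = (- (x n mod int m)) mod int m" by (rule mod_minus_eq[symmetric])
    then show "(- x n) mod int m = (- x m) mod int m"
      using Zhat_compat[OF x mn] by simp
  qed
  moreover have "(\<lambda>n\<in>{1..}. (- x n) mod int n) \<otimes>\<^bsub>Zhat\<^esub> x = \<one>\<^bsub>Zhat\<^esub>"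
    by (simp add: Zhat_def fun_eq_iff mod_add_left_eq)
  ultimately show "\<exists>y\<in>carrier Zhat. y \<otimes>\<^bsub>Zhat\<^esub> x = \<one>\<^bsub>Zhat\<^esub>" by blast
qed

lemma Zhat_of_int_closed [simp]: "Zhat_of_int k \<in> carrier Zhat"
  unfolding Zhat_of_int_def by (rule Zhat_memI) simp

lemma Zhat_of_int_apply: "n \<ge> 1 \<Longrightarrow> Zhat_of_int k n = k mod int n"
  by (simp add: Zhat_of_int_def)

lemma Zhat_of_int_add: "Zhat_of_int (k + m) = Zhat_of_int k \<otimes>\<^bsub>Zhat\<^esub> Zhat_of_int m"
  by (simp add: Zhat_def Zhat_of_int_def fun_eq_iff mod_add_eq)

lemma Zhat_of_int_0: "Zhat_of_int 0 = \<one>\<^bsub>Zhat\<^esub>"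
  by (simp add: Zhat_def Zhat_of_int_def fun_eq_iff)

lemma topspace_Zhat_top [simp]: "topspace Zhat_top = carrier Zhat"
  by (auto simp: Zhat_top_def Zhat_def)

lemma continuous_map_Zhat_coord:
  "n \<ge> 1 \<Longrightarrow> continuous_map Zhat_top (discrete_topology {0..<int n}) (\<lambda>a. a n)"
  unfolding Zhat_top_def
  using continuous_map_product_projection[of n "{1..}" "\<lambda>n. discrete_topology (carrier (integer_mod_group n))"]
  by (intro continuous_map_from_subtopology) (simp add: carrier_integer_mod_group)

lemma openin_Zhat_coord:
  assumes "n \<ge> 1" shows "openin Zhat_top {a \<in> carrier Zhat. a n = k}"
proof -
  have "openin Zhat_top {a \<in> topspace Zhat_top. a n \<in> {k} \<inter> {0..<int n}}"
    by (rule openin_continuous_map_preimage[OF continuous_map_Zhat_coord[OF assms]]) simp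
  also have "{a \<in> topspace Zhat_top. a n \<in> {k} \<inter> {0..<int n}} = {a \<in> carrier Zhat. a n = k}"
    using assms by (auto simp: carrier_Zhat)
  finally show ?thesis .
qed

lemma continuous_map_into_Zhat_top:
  assumes f: "\<And>x. x \<in> topspace T \<Longrightarrow> f x \<in> carrier Zhat"
    and open_: "\<And>n k. n \<ge> 1 \<Longrightarrow> openin T {x \<in> topspace T. f x n = k}"
  shows "continuous_map T Zhat_top f"
proof -
  have "continuous_map T (discrete_topology (carrier (integer_mod_group n))) (\<lambda>x. f x n)" if n: "n \<in> {1..}" for n
    unfolding continuous_map_def
  proof (intro conjI allI impI)
    show "(\<lambda>x. f x n) \<in> topspace T \<rightarrow> topspace (discrete_topology (carrier (integer_mod_group n)))"
      using f n by (auto simp: carrier_Zhat carrier_integer_mod_group)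
    fix U assume "openin (discrete_topology (carrier (integer_mod_group n))) U"
    have "{x \<in> topspace T. f x n \<in> U} = (\<Union>k\<in>U. {x \<in> topspace T. f x n = k})" by auto
    then show "openin T {x \<in> topspace T. f x n \<in> U}"
      using open_ n by auto
  qed
  moreover have "f ` topspace T \<subseteq> extensional {1..}" using f by (auto simp: carrier_Zhat)
  ultimately show ?thesis
    unfolding Zhat_top_def using f
    by (auto simp: continuous_map_in_subtopology continuous_map_componentwise)
qed

lemma Hausdorff_space_Zhat_top: "Hausdorff_space Zhat_top"
  unfolding Hausdorff_space_def
proof (intro allI impI)
  fix a b assume "a \<in> topspace Zhat_top \<and> b \<in> topspace Zhat_top \<and> a \<noteq> b"
  then have ab: "a \<in> carrier Zhat" "b \<in> carrier Zhat" "a \<noteq> b" by auto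
  then obtain n where n: "n \<ge> 1" "a n \<noteq> b n" using Zhat_eqI by blast
  show "\<exists>U V. openin Zhat_top U \<and> openin Zhat_top V \<and> a \<in> U \<and> b \<in> V \<and> disjnt U V"
    by (rule exI[of _ "{x \<in> carrier Zhat. x n = a n}"], rule exI[of _ "{x \<in> carrier Zhat. x n = b n}"])
      (use n ab openin_Zhat_coord[OF n(1)] in \<open>auto simp: disjnt_iff\<close>)
qed

text \<open>An open set restricts finitely many coordinates, and the coordinate at the product of their indices
  determines them all.\<close>

lemma Zhat_top_nhd:
  assumes W: "openin Zhat_top W" and a: "a \<in> W"
  obtains n where "n \<ge> 1" "\<And>b. b \<in> carrier Zhat \<Longrightarrow> b n = a n \<Longrightarrow> b \<in> W"
proof -
  obtain V where V: "openin (product_topology (\<lambda>n. discrete_topology (carrier (integer_mod_group n))) {1..}) V"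
      "W = V \<inter> carrier Zhat"
    using W by (auto simp: Zhat_top_def openin_subtopology)
  have "a \<in> V" using a V by blast
  then obtain U where U: "finite {n \<in> {1::nat..}. U n \<noteq> topspace (discrete_topology (carrier (integer_mod_group n)))}"
      "a \<in> PiE {1..} U" "PiE {1..} U \<subseteq> V"
    using V(1) unfolding openin_product_topology_alt by meson
  define F where "F = {n \<in> {1::nat..}. U n \<noteq> topspace (discrete_topology (carrier (integer_mod_group n)))}"
  define n where "n = \<Prod>F"
  have F: "finite F" "\<And>m. m \<in> F \<Longrightarrow> m \<ge> 1" using U(1) by (auto simp: F_def)
  then have "0 \<notin> F" by fastforce
  then have n: "n \<ge> 1" using F(1) by (simp add: n_def Suc_le_eq prod_pos_nat_iff) (metis neq0_conv)
  have aZ: "a \<in> carrier Zhat" using a V by blast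
  have "b \<in> W" if b: "b \<in> carrier Zhat" "b n = a n" for b
  proof -
    have "b m \<in> U m" if m: "m \<ge> 1" for m
    proof (cases "m \<in> F")
      case True
      then have "m dvd n" unfolding n_def using F(1) by (rule dvd_prodI[where f = "\<lambda>x. x", simplified, rotated])
      then have "b m = a m" using b aZ m n unfolding carrier_Zhat by metis
      then show ?thesis using U(2) m by (auto simp: PiE_iff)
    next
      case False
      then have "U m = carrier (integer_mod_group m)" using m by (auto simp: F_def)
      then show ?thesis using b(1) m by (auto simp: carrier_Zhat carrier_integer_mod_group)
    qed
    then have "b \<in> PiE {1..} U" using b(1) by (auto simp: PiE_iff carrier_Zhat)
    then show ?thesis using U(3) V(2) b(1) by blast
  qed
  then show ?thesis using that n by blast
qed

text \<open>The integer \<open>a n\<close> agrees with \<open>a\<close> in the coordinate \<open>n\<close>.\<close>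

lemma Zhat_of_int_dense: "Zhat_top closure_of (range Zhat_of_int) = carrier Zhat"
proof (intro subset_antisym subsetI)
  show "a \<in> carrier Zhat" if "a \<in> Zhat_top closure_of (range Zhat_of_int)" for a
    using that closure_of_subset_topspace[of Zhat_top] by auto
  fix a assume a: "a \<in> carrier Zhat"
  show "a \<in> Zhat_top closure_of (range Zhat_of_int)"
    unfolding in_closure_of
  proof (intro conjI allI impI)
    fix W assume "a \<in> W \<and> openin Zhat_top W"
    then obtain n where n: "n \<ge> 1" "\<And>b. b \<in> carrier Zhat \<Longrightarrow> b n = a n \<Longrightarrow> b \<in> W"
      using Zhat_top_nhd by metis
    have "Zhat_of_int (a n) \<in> W"
      using n(2)[OF Zhat_of_int_closed] Zhat_of_int_apply[OF n(1)] Zhat_mod[OF a n(1)] by simp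
    then show "\<exists>y. y \<in> range Zhat_of_int \<and> y \<in> W" by blast
  qed (use a in simp)
qed

lemma continuous_map_Zhat_mult:
  "continuous_map (prod_topology Zhat_top Zhat_top) Zhat_top (\<lambda>(a, b). a \<otimes>\<^bsub>Zhat\<^esub> b)"
proof (rule continuous_map_into_Zhat_top)
  interpret comm_group Zhat by (rule comm_group_Zhat)
  show "(case x of (a, b) \<Rightarrow> a \<otimes>\<^bsub>Zhat\<^esub> b) \<in> carrier Zhat" if "x \<in> topspace (prod_topology Zhat_top Zhat_top)" for x
    using that by auto
  fix n :: nat and k assume n: "n \<ge> 1"
  have "{x \<in> topspace (prod_topology Zhat_top Zhat_top). (case x of (a, b) \<Rightarrow> a \<otimes>\<^bsub>Zhat\<^esub> b) n = k} =
     (\<Union>(i, j)\<in>{(i, j). (i + j) mod int n = k}. {a \<in> carrier Zhat. a n = i} \<times> {a \<in> carrier Zhat. a n = j})"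
    using Zhat_mult[OF n] by auto
  also have "openin (prod_topology Zhat_top Zhat_top) \<dots>"
    by (intro openin_Union ballI) (auto simp: openin_prod_Times_iff intro!: openin_Zhat_coord n)
  finally show "openin (prod_topology Zhat_top Zhat_top)
     {x \<in> topspace (prod_topology Zhat_top Zhat_top). (case x of (a, b) \<Rightarrow> a \<otimes>\<^bsub>Zhat\<^esub> b) n = k}" .
qed

section \<open>The solenoid as a topological group\<close>

abbreviation solenoid_cover :: "((nat \<Rightarrow> int) \<times> real) monoid" where
  "solenoid_cover \<equiv> Zhat \<times>\<times> real_add_group"

abbreviation solenoid_cover_top :: "((nat \<Rightarrow> int) \<times> real) topology" where
  "solenoid_cover_top \<equiv> prod_topology Zhat_top euclideanreal"

abbreviation diag :: "int \<Rightarrow> (nat \<Rightarrow> int) \<times> real" where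
  "diag k \<equiv> (Zhat_of_int k, of_int k)"

lemma real_add_group_simps [simp]:
  "carrier real_add_group = UNIV" "monoid.mult real_add_group = (+)" "one real_add_group = 0"
  by (simp_all add: real_add_group_def)

lemma comm_group_real_add: "comm_group real_add_group"
proof (rule comm_groupI)
  fix x assume "x \<in> carrier real_add_group"
  then show "\<exists>y\<in>carrier real_add_group. y \<otimes>\<^bsub>real_add_group\<^esub> x = \<one>\<^bsub>real_add_group\<^esub>"
    by (intro bexI[of _ "- x"]) simp_all
qed simp_all

lemma continuous_map_comp_fst:
  "continuous_map X Y f \<Longrightarrow> continuous_map (prod_topology X Z) Y (\<lambda>x. f (fst x))"
  using continuous_map_compose[OF continuous_map_fst, of X Y f Z] by (simp add: comp_def)

lemma continuous_map_comp_snd: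
  "continuous_map Z Y f \<Longrightarrow> continuous_map (prod_topology X Z) Y (\<lambda>x. f (snd x))"
  using continuous_map_compose[OF continuous_map_snd, of Z Y f X] by (simp add: comp_def)

lemma comm_group_solenoid_cover: "comm_group solenoid_cover"
proof -
  interpret Z: comm_group Zhat by (rule comm_group_Zhat)
  interpret R: comm_group real_add_group by (rule comm_group_real_add)
  show ?thesis
    by (rule group.group_comm_groupI[OF DirProd_group[OF Z.is_group R.is_group]])
      (auto simp: Z.m_comm R.m_comm)
qed

lemma solenoid_cover_mult: "(a, s) \<otimes>\<^bsub>solenoid_cover\<^esub> (b, t) = (a \<otimes>\<^bsub>Zhat\<^esub> b, s + t)"
  by (simp add: DirProd_def)

lemma topspace_solenoid_cover_top: "topspace solenoid_cover_top = carrier solenoid_cover"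
  by simp

lemma diag_mult: "diag k \<otimes>\<^bsub>solenoid_cover\<^esub> diag m = diag (k + m)"
  by (simp add: solenoid_cover_mult Zhat_of_int_add)

lemma diag_closed: "diag k \<in> carrier solenoid_cover"
  by simp

lemma subgroup_diagonal_Z: "subgroup diagonal_Z solenoid_cover"
proof -
  interpret G: comm_group solenoid_cover by (rule comm_group_solenoid_cover)
  show ?thesis
  proof (rule G.subgroupI)
    show "diagonal_Z \<subseteq> carrier solenoid_cover" using diag_closed by (auto simp: diagonal_Z_def)
    show "diagonal_Z \<noteq> {}" by (simp add: diagonal_Z_def)
    fix x assume "x \<in> diagonal_Z"
    then obtain k where k: "x = diag k" by (auto simp: diagonal_Z_def)
    have "inv\<^bsub>solenoid_cover\<^esub> x = diag (- k)"
      unfolding k by (rule G.inv_equality) (simp_all only: diag_mult diag_closed, simp add: Zhat_of_int_0)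
    moreover have "diag (- k) \<in> diagonal_Z" unfolding diagonal_Z_def by (rule rangeI)
    ultimately show "inv\<^bsub>solenoid_cover\<^esub> x \<in> diagonal_Z" by (simp only:)
    fix y assume "y \<in> diagonal_Z"
    then obtain m where "y = diag m" by (auto simp: diagonal_Z_def)
    then have "x \<otimes>\<^bsub>solenoid_cover\<^esub> y = diag (k + m)" unfolding k by (simp only: diag_mult)
    then show "x \<otimes>\<^bsub>solenoid_cover\<^esub> y \<in> diagonal_Z" unfolding diagonal_Z_def by blast
  qed
qed

lemma normal_diagonal_Z: "diagonal_Z \<lhd> solenoid_cover"
  by (rule comm_group.subgroup_imp_normal[OF comm_group_solenoid_cover subgroup_diagonal_Z])

lemma group_solenoid: "group solenoid"
  unfolding solenoid_def by (rule normal.factorgroup_is_group[OF normal_diagonal_Z])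

lemma solenoid_class_closed: "z \<in> carrier solenoid_cover \<Longrightarrow> solenoid_class z \<in> carrier solenoid"
  unfolding solenoid_class_def solenoid_def by (auto simp: FactGroup_def RCOSETS_def)

lemma solenoid_cases:
  assumes "s \<in> carrier solenoid"
  obtains z where "z \<in> carrier solenoid_cover" "s = solenoid_class z"
  using assms unfolding solenoid_class_def solenoid_def by (auto simp: FactGroup_def RCOSETS_def)

lemma solenoid_class_mult:
  "z \<in> carrier solenoid_cover \<Longrightarrow> w \<in> carrier solenoid_cover \<Longrightarrow>
    solenoid_class (z \<otimes>\<^bsub>solenoid_cover\<^esub> w) = solenoid_class z \<otimes>\<^bsub>solenoid\<^esub> solenoid_class w"
  using normal.rcos_sum[OF normal_diagonal_Z, of z w]
  by (simp add: solenoid_class_def solenoid_def FactGroup_def)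

lemma solenoid_class_eq_iff:
  assumes z: "z \<in> carrier solenoid_cover" and w: "w \<in> carrier solenoid_cover"
  shows "solenoid_class z = solenoid_class w \<longleftrightarrow> (\<exists>k. w = diag k \<otimes>\<^bsub>solenoid_cover\<^esub> z)"
proof -
  interpret G: comm_group solenoid_cover by (rule comm_group_solenoid_cover)
  show ?thesis
  proof
    assume "solenoid_class z = solenoid_class w"
    then have "w \<in> solenoid_class z"
      using G.rcos_self[OF w subgroup_diagonal_Z] by (simp add: solenoid_class_def)
    then show "\<exists>k. w = diag k \<otimes>\<^bsub>solenoid_cover\<^esub> z"
      by (auto simp: solenoid_class_def r_coset_def diagonal_Z_def)
  next
    assume "\<exists>k. w = diag k \<otimes>\<^bsub>solenoid_cover\<^esub> z"
    then have "w \<in> diagonal_Z #>\<^bsub>solenoid_cover\<^esub> z"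
      by (auto simp: r_coset_def diagonal_Z_def)
    then show "solenoid_class z = solenoid_class w"
      unfolding solenoid_class_def by (rule G.repr_independence[OF _ z subgroup_diagonal_Z])
  qed
qed

lemma topspace_solenoid_top [simp]: "topspace solenoid_top = carrier solenoid"
proof -
  have "solenoid_class ` carrier solenoid_cover = carrier solenoid"
    using solenoid_class_closed solenoid_cases by (auto simp: image_iff) metis
  then show ?thesis
    by (simp only: solenoid_top_def topspace_quotient_topology topspace_solenoid_cover_top)
qed

lemma quotient_map_solenoid_class: "quotient_map solenoid_cover_top solenoid_top solenoid_class"
  unfolding solenoid_top_def by (rule quotient_map_quotient_topology)

lemma continuous_map_solenoid_class: "continuous_map solenoid_cover_top solenoid_top solenoid_class"
  by (rule quotient_imp_continuous_map[OF quotient_map_solenoid_class])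

lemma continuous_map_solenoid_cover_mult:
  "continuous_map (prod_topology solenoid_cover_top solenoid_cover_top) solenoid_cover_top
     (\<lambda>(z, w). z \<otimes>\<^bsub>solenoid_cover\<^esub> w)"
proof -
  note fst_fst = continuous_map_comp_fst[OF continuous_map_fst] and fst_snd = continuous_map_comp_snd[OF continuous_map_fst]
    and snd_fst = continuous_map_comp_fst[OF continuous_map_snd] and snd_snd = continuous_map_comp_snd[OF continuous_map_snd]
  have "continuous_map (prod_topology solenoid_cover_top solenoid_cover_top) (prod_topology Zhat_top Zhat_top)
      (\<lambda>x. (fst (fst x), fst (snd x)))"
    by (rule continuous_map_pairedI[OF fst_fst fst_snd])
  from continuous_map_compose[OF this continuous_map_Zhat_mult]
  have 1: "continuous_map (prod_topology solenoid_cover_top solenoid_cover_top) Zhat_top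
      (\<lambda>x. fst (fst x) \<otimes>\<^bsub>Zhat\<^esub> fst (snd x))"
    by (simp add: comp_def)
  have 2: "continuous_map (prod_topology solenoid_cover_top solenoid_cover_top) euclideanreal
      (\<lambda>x. snd (fst x) + snd (snd x))"
    by (rule continuous_map_add[OF snd_fst snd_snd])
  show ?thesis
    by (rule continuous_map_eq[OF continuous_map_pairedI[OF 1 2]]) (auto simp: solenoid_cover_mult)
qed

text \<open>The saturation of an open set is the union of its translates by the diagonal integers.\<close>

lemma open_map_solenoid_class: "open_map solenoid_cover_top solenoid_top solenoid_class"
  unfolding open_map_def
proof (intro allI impI)
  fix U assume U: "openin solenoid_cover_top U"
  interpret G: comm_group solenoid_cover by (rule comm_group_solenoid_cover)
  have Uc: "U \<subseteq> carrier solenoid_cover" using openin_subset[OF U] by (simp only: topspace_solenoid_cover_top)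
  have "openin solenoid_cover_top {z \<in> topspace solenoid_cover_top. diag k \<otimes>\<^bsub>solenoid_cover\<^esub> z \<in> U}" for k
  proof -
    have "continuous_map solenoid_cover_top (prod_topology solenoid_cover_top solenoid_cover_top) (\<lambda>z. (diag k, z))"
      by (intro continuous_map_pairedI continuous_map_id[unfolded id_def]) auto
    from continuous_map_compose[OF this continuous_map_solenoid_cover_mult]
    have "continuous_map solenoid_cover_top solenoid_cover_top (\<lambda>z. diag k \<otimes>\<^bsub>solenoid_cover\<^esub> z)"
      by (simp add: comp_def)
    from openin_continuous_map_preimage[OF this U] show ?thesis .
  qed
  then have "openin solenoid_cover_top (\<Union>k. {z \<in> topspace solenoid_cover_top. diag k \<otimes>\<^bsub>solenoid_cover\<^esub> z \<in> U})"
    by (intro openin_Union) auto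
  also have "(\<Union>k. {z \<in> topspace solenoid_cover_top. diag k \<otimes>\<^bsub>solenoid_cover\<^esub> z \<in> U}) =
      {z \<in> topspace solenoid_cover_top. solenoid_class z \<in> solenoid_class ` U}"
  proof (intro subset_antisym subsetI)
    fix z assume "z \<in> (\<Union>k. {z \<in> topspace solenoid_cover_top. diag k \<otimes>\<^bsub>solenoid_cover\<^esub> z \<in> U})"
    then obtain k where k: "z \<in> carrier solenoid_cover" "diag k \<otimes>\<^bsub>solenoid_cover\<^esub> z \<in> U"
      unfolding topspace_solenoid_cover_top by blast
    then have "solenoid_class z = solenoid_class (diag k \<otimes>\<^bsub>solenoid_cover\<^esub> z)"
      using solenoid_class_eq_iff[OF k(1)] Uc by blast
    then show "z \<in> {z \<in> topspace solenoid_cover_top. solenoid_class z \<in> solenoid_class ` U}"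
      using k unfolding topspace_solenoid_cover_top by blast
  next
    fix z assume "z \<in> {z \<in> topspace solenoid_cover_top. solenoid_class z \<in> solenoid_class ` U}"
    then obtain w where w: "z \<in> carrier solenoid_cover" "w \<in> U" "solenoid_class z = solenoid_class w"
      unfolding topspace_solenoid_cover_top by blast
    then obtain k where "w = diag k \<otimes>\<^bsub>solenoid_cover\<^esub> z"
      using solenoid_class_eq_iff[OF w(1)] Uc by blast
    then show "z \<in> (\<Union>k. {z \<in> topspace solenoid_cover_top. diag k \<otimes>\<^bsub>solenoid_cover\<^esub> z \<in> U})"
      using w unfolding topspace_solenoid_cover_top by blast
  qed
  finally have "openin solenoid_cover_top {z \<in> topspace solenoid_cover_top. solenoid_class z \<in> solenoid_class ` U}" .
  then show "openin solenoid_top (solenoid_class ` U)"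
    unfolding solenoid_top_def openin_quotient_topology
    using Uc by (simp only: topspace_solenoid_cover_top image_mono simp_thms)
qed

lemma quotient_map_lift:
  assumes f: "quotient_map X Y f" and h: "continuous_map X Z h"
    and const: "\<And>x y. x \<in> topspace X \<Longrightarrow> y \<in> topspace X \<Longrightarrow> f x = f y \<Longrightarrow> h x = h y"
  shows "\<exists>g. continuous_map Y Z g \<and> (\<forall>x\<in>topspace X. g (f x) = h x)"
proof (rule quotient_map_lift_exists[OF f h])
  show "h x = h y" if "x \<in> topspace X" "y \<in> topspace X" "f x = f y" for x y
    using const that .
qed blast

lemma image_prod_map: "(\<lambda>(x, y). (f x, g y)) ` (A \<times> B) = f ` A \<times> g ` B"
  by force

lemma open_map_prod_map:
  assumes f: "open_map X X' f" and g: "open_map Y Y' g"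
  shows "open_map (prod_topology X Y) (prod_topology X' Y') (\<lambda>(x, y). (f x, g y))"
  unfolding open_map_def
proof (intro allI impI)
  fix U assume U: "openin (prod_topology X Y) U"
  show "openin (prod_topology X' Y') ((\<lambda>(x, y). (f x, g y)) ` U)"
    unfolding openin_prod_topology_alt
  proof (intro allI impI)
    fix x' y' assume "(x', y') \<in> (\<lambda>(x, y). (f x, g y)) ` U"
    then obtain x y where xy: "(x, y) \<in> U" "x' = f x" "y' = g y" by auto
    then obtain A B where AB: "openin X A" "openin Y B" "x \<in> A" "y \<in> B" "A \<times> B \<subseteq> U"
      using U unfolding openin_prod_topology_alt by meson
    have "f ` A \<times> g ` B \<subseteq> (\<lambda>(x, y). (f x, g y)) ` U" using AB(5) by force
    then show "\<exists>A B. openin X' A \<and> openin Y' B \<and> x' \<in> A \<and> y' \<in> B \<and> A \<times> B \<subseteq> (\<lambda>(x, y). (f x, g y)) ` U"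
      using AB f g xy unfolding open_map_def by (intro exI[of _ "f ` A"] exI[of _ "g ` B"]) auto
  qed
qed

text \<open>As the class map is open, so is its product with itself; hence the multiplication of the cover
  descends.\<close>

lemma continuous_map_solenoid_mult:
  "continuous_map (prod_topology solenoid_top solenoid_top) solenoid_top (\<lambda>(s, t). s \<otimes>\<^bsub>solenoid\<^esub> t)"
proof -
  let ?q = "\<lambda>(z, w). (solenoid_class z, solenoid_class w)"
  have op: "open_map (prod_topology solenoid_cover_top solenoid_cover_top) (prod_topology solenoid_top solenoid_top) ?q"
    by (rule open_map_prod_map) (rule open_map_solenoid_class)+
  have co: "continuous_map (prod_topology solenoid_cover_top solenoid_cover_top) (prod_topology solenoid_top solenoid_top) ?q"
    unfolding case_prod_unfold
    by (rule continuous_map_pairedI[OF continuous_map_comp_fst[OF continuous_map_solenoid_class]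
          continuous_map_comp_snd[OF continuous_map_solenoid_class]])
  have surj: "solenoid_class ` carrier solenoid_cover = carrier solenoid"
    using solenoid_class_closed solenoid_cases by (auto simp: image_iff) metis
  have "?q ` topspace (prod_topology solenoid_cover_top solenoid_cover_top) = topspace (prod_topology solenoid_top solenoid_top)"
    unfolding topspace_prod_topology[of solenoid_cover_top] topspace_prod_topology[of solenoid_top]
      topspace_solenoid_cover_top topspace_solenoid_top
    using image_prod_map[of solenoid_class solenoid_class "carrier solenoid_cover" "carrier solenoid_cover"]
    unfolding surj .
  then have q: "quotient_map (prod_topology solenoid_cover_top solenoid_cover_top) (prod_topology solenoid_top solenoid_top) ?q"
    using continuous_open_quotient_map[OF co op] by blast
  have "continuous_map (prod_topology solenoid_cover_top solenoid_cover_top) solenoid_top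
      (solenoid_class \<circ> (\<lambda>(z, w). z \<otimes>\<^bsub>solenoid_cover\<^esub> w))"
    by (rule continuous_map_compose[OF continuous_map_solenoid_cover_mult continuous_map_solenoid_class])
  then have "continuous_map (prod_topology solenoid_cover_top solenoid_cover_top) solenoid_top
      ((\<lambda>(s, t). s \<otimes>\<^bsub>solenoid\<^esub> t) \<circ> ?q)"
    by (rule continuous_map_eq)
      (auto simp: solenoid_class_mult simp del: mult_DirProd)
  then show ?thesis
    using continuous_compose_quotient_map_eq[OF q] by blast
qed

text \<open>The functions \<open>(a, s) \<mapsto> exp (2 \<pi> \<i> (s - a n) / n)\<close> are characters of the solenoid that separate its
  points: if all of them agree at two points, then the one for \<open>n = 1\<close> shows that the real coordinates differ
  by an integer \<open>k\<close>, and the others show that the profinite coordinates differ by \<open>k\<close>, too.\<close>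

lemma Hausdorff_space_solenoid_top: "Hausdorff_space solenoid_top"
proof -
  define ch where "ch n z = cis (2 * pi * (snd z - of_int (fst z n)) / of_nat n)" for n :: nat and z :: "(nat \<Rightarrow> int) \<times> real"
  have cis_int: "cis (2 * pi * of_int k) = 1" for k
    by (simp add: cis_conv_exp exp_eq_1)
  have cis_eq: "cis x = cis y \<longleftrightarrow> (\<exists>k::int. x = y + 2 * pi * of_int k)" for x y
  proof -
    have "cis x = cis y \<longleftrightarrow> exp (\<i> * of_real x) = exp (\<i> * of_real y)" by (simp add: cis_conv_exp)
    also have "\<dots> \<longleftrightarrow> (\<exists>k::int. \<i> * of_real x = \<i> * of_real y + complex_of_real (of_int (2 * k) * pi) * \<i>)"
      by (rule exp_eq)
    also have "\<dots> \<longleftrightarrow> (\<exists>k::int. x = y + 2 * pi * of_int k)"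
    proof (intro ex_cong1)
      fix k :: int
      have "\<i> * of_real y + complex_of_real (of_int (2 * k) * pi) * \<i> = \<i> * complex_of_real (y + 2 * pi * of_int k)"
        by (simp add: algebra_simps)
      then show "\<i> * of_real x = \<i> * of_real y + complex_of_real (of_int (2 * k) * pi) * \<i> \<longleftrightarrow> x = y + 2 * pi * of_int k"
        by (simp only: mult_cancel_left of_real_eq_iff) simp
    qed
    finally show ?thesis .
  qed
  have inv: "ch n (diag k \<otimes>\<^bsub>solenoid_cover\<^esub> z) = ch n z" if z: "z \<in> carrier solenoid_cover" and n: "n \<ge> 1" for n k z
  proof -
    obtain a s where as: "z = (a, s)" by (cases z)
    have a: "a \<in> carrier Zhat" using z as by simp
    \<comment> \<open>\<open>n * q\<close> is what the two reductions modulo \<open>n\<close> subtract\<close>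
    define q where "q = (k mod int n + a n) div int n + k div int n"
    have "(k mod int n + a n) mod int n = k + a n - int n * q"
      unfolding q_def by (simp add: minus_mult_div_eq_mod[symmetric] algebra_simps)
    then have "(Zhat_of_int k \<otimes>\<^bsub>Zhat\<^esub> a) n = k + a n - int n * q"
      by (simp add: Zhat_mult[OF n] Zhat_of_int_apply[OF n])
    then have eq: "real_of_int ((Zhat_of_int k \<otimes>\<^bsub>Zhat\<^esub> a) n) = of_int k + of_int (a n) - of_nat n * of_int q"
      by simp
    have "2 * pi * (of_int k + s - of_int ((Zhat_of_int k \<otimes>\<^bsub>Zhat\<^esub> a) n)) / of_nat n
        = 2 * pi * (s - of_int (a n)) / of_nat n + 2 * pi * of_int q"
      unfolding eq using n by (simp add: field_simps)
    then show ?thesis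
      unfolding ch_def as solenoid_cover_mult fst_conv snd_conv cis_eq by blast
  qed
  have cont: "continuous_map solenoid_cover_top euclidean (ch n)" if n: "n \<ge> 1" for n
  proof -
    have "continuous_map Zhat_top euclideanreal (\<lambda>a. of_int (a n))"
      using continuous_map_compose[OF continuous_map_Zhat_coord[OF n], of euclideanreal of_int]
      by (simp add: comp_def)
    from continuous_map_compose[OF continuous_map_fst this]
    have 1: "continuous_map solenoid_cover_top euclideanreal (\<lambda>z. of_int (fst z n))" by (simp add: comp_def)
    have "continuous_map solenoid_cover_top euclideanreal (\<lambda>z. (2 * pi / of_nat n) * (snd z - of_int (fst z n)))"
      by (intro continuous_map_real_mult continuous_map_diff continuous_map_snd 1) simp
    moreover have "continuous_map euclideanreal euclidean cis"
      by (simp add: continuous_on_cis continuous_on_id[unfolded id_def])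
    ultimately have "continuous_map solenoid_cover_top euclidean (cis \<circ> (\<lambda>z. (2 * pi / of_nat n) * (snd z - of_int (fst z n))))"
      by (rule continuous_map_compose)
    then show ?thesis by (simp add: comp_def ch_def[abs_def])
  qed
  have ex: "\<exists>F. continuous_map solenoid_top euclidean F \<and> (\<forall>z\<in>carrier solenoid_cover. F (solenoid_class z) = ch n z)"
    if n: "n \<ge> 1" for n
  proof -
    have const: "ch n z = ch n w" if zw: "z \<in> topspace solenoid_cover_top" "w \<in> topspace solenoid_cover_top"
      "solenoid_class z = solenoid_class w" for z w
      using zw inv[OF _ n, of z] solenoid_class_eq_iff[of z w] unfolding topspace_solenoid_cover_top by auto
    from quotient_map_lift[OF quotient_map_solenoid_class cont[OF n], OF const]
    show ?thesis unfolding topspace_solenoid_cover_top by blast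
  qed
  show ?thesis
    unfolding Hausdorff_space_def
  proof (intro allI impI)
    fix s t assume "s \<in> topspace solenoid_top \<and> t \<in> topspace solenoid_top \<and> s \<noteq> t"
    then have st: "s \<in> carrier solenoid" "t \<in> carrier solenoid" "s \<noteq> t" by auto
    obtain z where z: "z \<in> carrier solenoid_cover" "s = solenoid_class z" using solenoid_cases[OF st(1)] .
    obtain w where w: "w \<in> carrier solenoid_cover" "t = solenoid_class w" using solenoid_cases[OF st(2)] .
    have "\<exists>n\<ge>1. ch n z \<noteq> ch n w"
    proof (rule ccontr)
      assume "\<not> (\<exists>n\<ge>1. ch n z \<noteq> ch n w)"
      then have eq: "ch n z = ch n w" if "n \<ge> 1" for n using that by blast
      obtain a u b v where ab: "z = (a, u)" "w = (b, v)" by (cases z, cases w)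
      have aZ: "a \<in> carrier Zhat" "b \<in> carrier Zhat" using z w ab by simp_all
      have *: "\<exists>k::int. u - of_int (a n) = v - of_int (b n) + of_nat n * of_int k" if n: "n \<ge> 1" for n
      proof -
        obtain k :: int where "2 * pi * (u - of_int (a n)) / of_nat n = 2 * pi * (v - of_int (b n)) / of_nat n + 2 * pi * of_int k"
          using eq[OF n] unfolding ch_def ab fst_conv snd_conv cis_eq by blast
        then have "2 * pi * (u - of_int (a n)) = 2 * pi * (v - of_int (b n) + of_nat n * of_int k)"
          using n by (simp add: field_simps)
        then show ?thesis by (simp only: mult_cancel_left) auto
      qed
      obtain k0 :: int where "u - of_int (a 1) = v - of_int (b 1) + of_nat 1 * of_int k0" using *[of 1] by auto
      then have "v = u + of_int (b 1 - a 1 - k0)" by simp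
      then obtain k :: int where k: "v = of_int k + u" by (metis add.commute)
      have "b n = (k mod int n + a n) mod int n" if n: "n \<ge> 1" for n
      proof -
        obtain j :: int where "u - of_int (a n) = v - of_int (b n) + of_nat n * of_int j" using *[OF n] by blast
        then have "of_int (b n) = (of_int (k + a n + int n * j) :: real)" by (simp add: k)
        then have "b n = k + a n + int n * j" by (simp only: of_int_eq_iff)
        then have "b n mod int n = (k + a n) mod int n" by simp
        then show ?thesis using Zhat_mod[OF aZ(2) n] by (simp add: mod_add_left_eq)
      qed
      then have "b = Zhat_of_int k \<otimes>\<^bsub>Zhat\<^esub> a"
        using aZ comm_group_Zhat
        by (intro Zhat_eqI) (simp_all add: Zhat_mult Zhat_of_int_apply comm_group_def comm_monoid_def monoid.m_closed)
      then have "w = diag k \<otimes>\<^bsub>solenoid_cover\<^esub> z" using ab k by (simp add: solenoid_cover_mult)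
      then show False using solenoid_class_eq_iff[OF z(1) w(1)] z w st(3) by blast
    qed
    then obtain n where n: "n \<ge> 1" "ch n z \<noteq> ch n w" by blast
    obtain F where F: "continuous_map solenoid_top euclidean F" "\<forall>z\<in>carrier solenoid_cover. F (solenoid_class z) = ch n z"
      using ex[OF n(1)] by blast
    have "F s = ch n z" "F t = ch n w"
      unfolding z(2) w(2) using F(2) z(1) w(1) by (auto simp only:)
    then have "F s \<noteq> F t" using n(2) by simp
    then obtain U V where UV: "open U" "open V" "F s \<in> U" "F t \<in> V" "U \<inter> V = {}" using hausdorff by metis
    have "openin solenoid_top {x \<in> topspace solenoid_top. F x \<in> U}" "openin solenoid_top {x \<in> topspace solenoid_top. F x \<in> V}"
      by (rule openin_continuous_map_preimage[OF F(1)], use UV in simp)+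
    then show "\<exists>U V. openin solenoid_top U \<and> openin solenoid_top V \<and> s \<in> U \<and> t \<in> V \<and> disjnt U V"
      using UV st by (intro exI[of _ "{x \<in> topspace solenoid_top. F x \<in> U}"] exI[of _ "{x \<in> topspace solenoid_top. F x \<in> V}"])
        (auto simp: disjnt_iff)
  qed
qed

section \<open>An equivariant retraction onto the profinite integers\<close>

text \<open>Functions on \<open>\<int>/N\<close>, as periodic functions on the integers, that turn multiplication of units
  by \<open>p\<close> into adding 1 modulo \<open>n\<close>.\<close>

definition equivariant_mod :: "nat \<Rightarrow> nat \<Rightarrow> nat \<Rightarrow> (int \<Rightarrow> int) \<Rightarrow> bool" where
  "equivariant_mod p N n F \<longleftrightarrow> (\<forall>u v. [u = v] (mod int N) \<longrightarrow> F u = F v) \<and>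
     (\<forall>u. coprime u (int N) \<longrightarrow> [F (int p * u) = F u + 1] (mod int n))"

lemma equivariant_mod_power:
  assumes F: "equivariant_mod p N n F" and u: "coprime u (int N)" and p: "coprime p N"
  shows "[F (int p ^ i * u) = F u + int i] (mod int n)"
proof (induction i)
  case (Suc i)
  have "coprime (int p ^ i * u) (int N)" using u p by simp
  then have "[F (int p * (int p ^ i * u)) = F (int p ^ i * u) + 1] (mod int n)"
    using F by (simp add: equivariant_mod_def)
  also have "[F (int p ^ i * u) + 1 = F u + int i + 1] (mod int n)"
    using Suc by (intro cong_add cong_refl)
  also have "int p * (int p ^ i * u) = int p ^ Suc i * u" by simp
  also have "F u + int i + 1 = F u + int (Suc i)" by simp
  finally show ?case .
qed simp

context
  fixes p :: nat
  assumes prime_p: "prime p"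
begin

lemma frobenius_level: "n \<ge> 1 \<Longrightarrow> p ^ n - 1 \<in> coprime_levels p"
proof -
  assume n: "n \<ge> 1"
  have p2: "p \<ge> 2" using prime_p prime_ge_2_nat by blast
  have "p ^ 1 \<le> p ^ n" using n p2 by (intro power_increasing) auto
  then have pn: "p ^ n \<ge> 2" using p2 by simp
  have "coprime (p ^ n - 1) (p ^ n)" using p2 by (intro coprime_diff_one_left_nat) simp
  then have "coprime (p ^ n - 1) p" using n p2 by simp
  then show ?thesis using pn by (simp add: coprime_levels_def)
qed

lemma frobenius_power_cong_1: "n \<ge> 1 \<Longrightarrow> [p ^ n = 1] (mod (p ^ n - 1))"
  using prime_gt_0_nat[OF prime_p] by (subst cong_altdef_nat) simp_all

text \<open>The order of \<open>p\<close> modulo \<open>p ^ n - 1\<close> is exactly \<open>n\<close>, because \<open>p ^ i - 1\<close> lies strictly between 0 and the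
  modulus for \<open>0 < i < n\<close>.\<close>

lemma frobenius_order:
  assumes n: "n \<ge> 1" and j: "[p ^ j = 1] (mod (p ^ n - 1))"
  shows "n dvd j"
proof -
  have p2: "p \<ge> 2" using prime_p prime_ge_2_nat by blast
  have "[p ^ n = 1] (mod (p ^ n - 1))" by (rule frobenius_power_cong_1[OF n])
  then have "[(p ^ n) ^ (j div n) * p ^ (j mod n) = 1 ^ (j div n) * p ^ (j mod n)] (mod (p ^ n - 1))"
    by (intro cong_mult cong_pow cong_refl)
  moreover have "(p ^ n) ^ (j div n) * p ^ (j mod n) = p ^ j"
    by (simp flip: power_mult power_add)
  ultimately have "[p ^ (j mod n) = 1] (mod (p ^ n - 1))"
    using j by (simp add: cong_def)
  then have dvd: "p ^ n - 1 dvd p ^ (j mod n) - 1"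
    using p2 by (subst (asm) cong_altdef_nat) simp_all
  have "p ^ (j mod n) < p ^ n" using p2 n by (intro power_strict_increasing) auto
  moreover have "p ^ (j mod n) \<ge> 1" using p2 by simp
  ultimately have "p ^ (j mod n) - 1 < p ^ n - 1" by linarith
  then have "p ^ (j mod n) - 1 = 0" using dvd by (metis dvd_imp_le gr0I not_le)
  then have "p ^ (j mod n) \<le> p ^ 0" by simp
  then have "j mod n = 0" using p2 power_le_imp_le_exp[of p "j mod n" 0] by simp
  then show ?thesis by (simp add: mod_eq_0_iff_dvd)
qed

lemma frobenius_power_cong:
  assumes n: "n \<ge> 1" and ij: "[p ^ i = p ^ j] (mod (p ^ n - 1))"
  shows "[i = j] (mod n)"
proof -
  have *: "[i = j] (mod n)" if le: "i \<le> j" and ij: "[p ^ i = p ^ j] (mod (p ^ n - 1))" for i j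
  proof -
    have "coprime (p ^ i) (p ^ n - 1)"
      using frobenius_level[OF n] by (simp add: coprime_levels_def coprime_commute)
    moreover have "[p ^ i * p ^ (j - i) = p ^ i * 1] (mod (p ^ n - 1))"
      using ij le by (simp flip: power_add add: cong_sym_eq)
    ultimately have "[p ^ (j - i) = 1] (mod (p ^ n - 1))"
      using cong_mult_lcancel_nat by blast
    then have "n dvd j - i" by (rule frobenius_order[OF n])
    then have "[j = i] (mod n)" using le by (simp add: cong_altdef_nat)
    then show ?thesis by (rule cong_sym)
  qed
  show ?thesis
  proof (cases "i \<le> j")
    case False
    then show ?thesis using *[of j i] ij by (simp add: cong_sym_eq)
  qed (use * ij in blast)
qed

text \<open>The orbits of multiplication by \<open>p\<close> on the units modulo \<open>p ^ n - 1\<close> are free \<open>\<int>/n\<close>-sets, so an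
  equivariant function lifts: its values on orbit representatives can be chosen freely.\<close>

lemma equivariant_mod_lift:
  assumes n: "n \<ge> 1" and N: "N = p ^ n - 1" and MN: "M dvd N" and mn: "m dvd n"
    and F: "equivariant_mod p M m F"
  shows "\<exists>F'. equivariant_mod p N n F' \<and> (\<forall>u. coprime u (int N) \<longrightarrow> [F' u = F u] (mod int m))"
proof -
  have lev: "N \<in> coprime_levels p" unfolding N by (rule frobenius_level[OF n])
  then have pN: "coprime p N" by (simp add: coprime_levels_def coprime_commute)
  have pM: "coprime p M" using pN MN by (rule coprime_divisors[OF dvd_refl, rotated])
  define E where "E u = {v. \<exists>i::nat. [u = int p ^ i * v] (mod int N)}" for u
  \<comment> \<open>a representative of the orbit of \<open>u\<close>; as \<open>E u\<close> depends on the orbit only, so does the choice\<close>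
  define rep where "rep u = (SOME v. v \<in> E u)" for u
  define e where "e u = (SOME i::nat. [u = int p ^ i * rep u] (mod int N))" for u
  \<comment> \<open>for a unit \<open>u\<close>, the exponent \<open>e u\<close> is unique modulo \<open>n\<close>, since \<open>p\<close> has order \<open>n\<close> modulo \<open>N\<close>\<close>
  define F' where "F' u = F (rep u) + int (e u)" for u
  have pn: "[int p ^ n = 1] (mod int N)"
    using frobenius_power_cong_1[OF n] unfolding N[symmetric] by (simp flip: cong_int_iff)
  have E_cong: "E u = E v" if "[u = v] (mod int N)" for u v
    unfolding E_def using that cong_trans cong_sym by blast
  have E_mult: "E (int p * u) = E u" for u
  proof (intro subset_antisym subsetI)
    fix v assume "v \<in> E u"
    then obtain i where "[u = int p ^ i * v] (mod int N)" unfolding E_def by blast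
    then have "[int p * u = int p * (int p ^ i * v)] (mod int N)" by (rule cong_mult[OF cong_refl])
    then have "[int p * u = int p ^ Suc i * v] (mod int N)" by (simp add: mult.assoc)
    then show "v \<in> E (int p * u)" unfolding E_def by blast
  next
    fix v assume "v \<in> E (int p * u)"
    then obtain i where "[int p * u = int p ^ i * v] (mod int N)" unfolding E_def by blast
    then have "[int p ^ (n - 1) * (int p * u) = int p ^ (n - 1) * (int p ^ i * v)] (mod int N)"
      by (rule cong_mult[OF cong_refl])
    moreover have "int p ^ (n - 1) * (int p * u) = int p ^ n * u"
      using n by (cases n) simp_all
    ultimately have "[int p ^ n * u = int p ^ (n - 1 + i) * v] (mod int N)"
      by (simp only: power_add mult.assoc)
    moreover have "[int p ^ n * u = 1 * u] (mod int N)" using pn by (intro cong_mult cong_refl)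
    ultimately have "[u = int p ^ (n - 1 + i) * v] (mod int N)" by (simp add: cong_def)
    then show "v \<in> E u" unfolding E_def by blast
  qed
  have rep: "[u = int p ^ e u * rep u] (mod int N)" for u
  proof -
    have "[u = int p ^ 0 * u] (mod int N)" by simp
    then have "u \<in> E u" unfolding E_def by blast
    then have "rep u \<in> E u" unfolding rep_def by (rule someI)
    then have "\<exists>i::nat. [u = int p ^ i * rep u] (mod int N)" unfolding E_def by blast
    then show ?thesis unfolding e_def by (rule someI_ex)
  qed
  have rep_coprime: "coprime (rep u) (int N)" if "coprime u (int N)" for u
  proof -
    have "coprime (int p ^ e u * rep u) (int N)"
      using cong_imp_coprime[OF rep that] by simp
    then show ?thesis by simp
  qed
  have "equivariant_mod p N n F'"
    unfolding equivariant_mod_def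
  proof (intro conjI allI impI)
    fix u v :: int assume uv: "[u = v] (mod int N)"
    have "rep u = rep v" unfolding rep_def E_cong[OF uv] ..
    moreover have "[u = w] (mod int N) \<longleftrightarrow> [v = w] (mod int N)" for w using uv by (simp add: cong_def)
    ultimately show "F' u = F' v" unfolding F'_def e_def by simp
  next
    fix u assume u: "coprime u (int N)"
    have r: "rep (int p * u) = rep u" unfolding rep_def E_mult ..
    have "[int p ^ e (int p * u) * rep u = int p * u] (mod int N)"
      using rep[of "int p * u"] unfolding r by (rule cong_sym)
    also have "[int p * u = int p * (int p ^ e u * rep u)] (mod int N)"
      by (rule cong_mult[OF cong_refl rep])
    finally have "[int p ^ e (int p * u) * rep u = int p ^ Suc (e u) * rep u] (mod int N)"
      by (simp add: mult.assoc)
    then have "[int p ^ e (int p * u) = int p ^ Suc (e u)] (mod int N)"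
      using cong_mult_rcancel[OF rep_coprime[OF u]] by blast
    then have "[p ^ e (int p * u) = p ^ Suc (e u)] (mod N)"
      by (simp only: cong_int_iff flip: of_nat_power)
    then have "[e (int p * u) = Suc (e u)] (mod n)"
      unfolding N by (rule frobenius_power_cong[OF n])
    then have "[int (e (int p * u)) = int (Suc (e u))] (mod int n)" by (simp only: cong_int_iff)
    then have "[F (rep u) + int (e (int p * u)) = F (rep u) + int (Suc (e u))] (mod int n)"
      by (rule cong_add[OF cong_refl])
    then show "[F' (int p * u) = F' u + 1] (mod int n)" unfolding F'_def r by (simp add: algebra_simps)
  qed
  moreover have "[F' u = F u] (mod int m)" if u: "coprime u (int N)" for u
  proof -
    have "coprime (rep u) (int M)"
      using rep_coprime[OF u] MN by (metis coprime_divisors dvd_refl of_nat_dvd_iff)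
    then have *: "[F (int p ^ e u * rep u) = F (rep u) + int (e u)] (mod int m)"
      by (rule equivariant_mod_power[OF F _ pM])
    have "[u = int p ^ e u * rep u] (mod int M)"
      using rep MN by (metis cong_dvd_modulus of_nat_dvd_iff)
    then have "F u = F (int p ^ e u * rep u)" using F by (simp add: equivariant_mod_def)
    then show ?thesis unfolding F'_def using * by (simp add: cong_sym_eq)
  qed
  ultimately show ?thesis by blast
qed

lemma frobenius_level_dvd: "m dvd n \<Longrightarrow> p ^ m - 1 dvd p ^ n - 1"
proof -
  assume "m dvd n"
  then obtain k where k: "n = m * k" by blast
  have "[(p ^ m) ^ k = 1 ^ k] (mod (p ^ m - 1))"
  proof (cases "m = 0")
    case False
    then show ?thesis by (intro cong_pow frobenius_power_cong_1) simp
  qed simp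
  then have "[p ^ n = 1] (mod (p ^ m - 1))" by (simp add: k power_mult)
  moreover have "p ^ n \<ge> 1" using prime_gt_0_nat[OF prime_p] by simp
  ultimately show ?thesis by (simp add: cong_altdef_nat)
qed

text \<open>The factorials form a chain under divisibility in which every positive integer divides some member, so
  successive lifts suffice for a compatible system.\<close>

lemma equivariant_system:
  obtains F where
    "\<And>k. equivariant_mod p (p ^ fact k - 1) (fact k) (F k)"
    "\<And>j k u. k \<le> j \<Longrightarrow> coprime u (int (p ^ fact j - 1)) \<Longrightarrow> [F j u = F k u] (mod fact k)"
proof -
  have "\<exists>F. \<forall>k. equivariant_mod p (p ^ fact k - 1) (fact k) (F k) \<and>
      (\<forall>u. coprime u (int (p ^ fact (Suc k) - 1)) \<longrightarrow> [F (Suc k) u = F k u] (mod int (fact k)))"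
  proof (rule dependent_nat_choice)
    have "equivariant_mod p (p ^ fact 0 - 1) (fact 0) (\<lambda>_. 0)"
      by (simp add: equivariant_mod_def)
    then show "\<exists>F. equivariant_mod p (p ^ fact 0 - 1) (fact 0) F" by blast
    fix F k assume F: "equivariant_mod p (p ^ fact k - 1) (fact k) F"
    have "fact k dvd (fact (Suc k) :: nat)" by (rule fact_dvd) simp
    from equivariant_mod_lift[OF fact_ge_1 refl frobenius_level_dvd[OF this] this F]
    show "\<exists>F'. equivariant_mod p (p ^ fact (Suc k) - 1) (fact (Suc k)) F' \<and>
      (\<forall>u. coprime u (int (p ^ fact (Suc k) - 1)) \<longrightarrow> [F' u = F u] (mod int (fact k)))" .
  qed
  then obtain F where F: "\<And>k. equivariant_mod p (p ^ fact k - 1) (fact k) (F k)"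
      "\<And>k u. coprime u (int (p ^ fact (Suc k) - 1)) \<Longrightarrow> [F (Suc k) u = F k u] (mod int (fact k))"
    by blast
  have "[F j u = F k u] (mod int (fact k))" if "k \<le> j" "coprime u (int (p ^ fact j - 1))" for j k u
    using that
  proof (induction j rule: dec_induct)
    case (step j)
    have "p ^ fact j - 1 dvd p ^ fact (Suc j) - 1" by (intro frobenius_level_dvd fact_dvd) simp
    then have "coprime u (int (p ^ fact j - 1))"
      using step.prems by (meson coprime_divisors dvd_refl of_nat_dvd_iff)
    then have "[F j u = F k u] (mod int (fact k))" by (rule step.IH)
    moreover have "int (fact k) dvd int (fact j)" using step.hyps by (simp only: of_nat_dvd_iff fact_dvd)
    then have "[F (Suc j) u = F j u] (mod int (fact k))"
      using F(2)[OF step.prems] by (rule cong_dvd_modulus[rotated])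
    ultimately show ?case using cong_trans by blast
  qed simp
  then show ?thesis using that[of F] F(1) by simp
qed

text \<open>Up to a constant, the coordinate of \<open>r g\<close> at \<open>n\<close> is the value of an equivariant function at the residue of \<open>g\<close> modulo
  \<open>p ^ fact n - 1\<close>. It depends on one residue only, which makes \<open>r\<close> continuous.\<close>

lemma retraction_exists:
  obtains r where "continuous_map (Gp_top p) Zhat_top r" "r \<one>\<^bsub>Gp p\<^esub> = \<one>\<^bsub>Zhat\<^esub>"
    "\<And>g. g \<in> carrier (Gp p) \<Longrightarrow> r (frob p \<otimes>\<^bsub>Gp p\<^esub> g) = Zhat_of_int 1 \<otimes>\<^bsub>Zhat\<^esub> r g"
proof -
  interpret G: comm_group "Gp p" by (rule comm_group_Gp[OF prime_p])
  obtain F where F: "\<And>k. equivariant_mod p (p ^ fact k - 1) (fact k) (F k)"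
    and comp: "\<And>j k u. k \<le> j \<Longrightarrow> coprime u (int (p ^ fact j - 1)) \<Longrightarrow> [F j u = F k u] (mod fact k)"
    using equivariant_system by metis
  define N where "N k = p ^ fact k - 1" for k :: nat
  have lev: "N k \<in> coprime_levels p" for k
    unfolding N_def by (rule frobenius_level[OF fact_ge_1])
  have Ndvd: "N k dvd N j" if "k \<le> j" for j k
    unfolding N_def using that by (intro frobenius_level_dvd fact_dvd)
  have F_cong: "F k u = F k v" if "[u = v] (mod int (N k))" for k u v
    using F[of k] that by (simp add: equivariant_mod_def N_def)
  have F_mult: "[F k (int p * u) = F k u + 1] (mod int (fact k))" if "coprime u (int (N k))" for k u
    using F[of k] that by (simp add: equivariant_mod_def N_def)
  \<comment> \<open>subtracting the value at 1 normalizes \<open>r\<close> to be trivial at the neutral element\<close>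
  define \<rho> where "\<rho> g k = F k (red (N k) g) - F k 1" for g and k :: nat
  define r where "r g = (\<lambda>n\<in>{1..}. \<rho> g n mod int n)" for g
  have dvd_fact_int: "int k dvd fact k" if "k \<ge> 1" for k :: nat
    using that dvd_fact[of k k] by (metis le_refl of_nat_dvd_iff of_nat_fact)
  have \<rho>_comp: "\<rho> g n mod int m = \<rho> g m mod int m" if g: "g \<in> carrier (Gp p)" and mn: "m \<ge> 1" "m \<le> n" for g m n
  proof -
    have *: "[F n u = F m u] (mod int m)" if "coprime u (int (N n))" for u
      using comp[OF mn(2)] that dvd_fact_int[OF mn(1)] unfolding N_def by (metis cong_dvd_modulus)
    have "red (N m) g = red (N n) g mod int (N m)" by (rule red_mod[OF prime_p g lev Ndvd[OF mn(2)]])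
    then have "F m (red (N m) g) = F m (red (N n) g)" by (intro F_cong) (simp add: cong_def)
    then have "[F n (red (N n) g) - F n 1 = F m (red (N m) g) - F m 1] (mod int m)"
      using *[OF coprime_red[OF prime_p g lev]] *[of 1] by (metis coprime_1_left cong_diff)
    then show ?thesis by (simp add: \<rho>_def cong_def)
  qed
  have closed: "r g \<in> carrier Zhat" if "g \<in> carrier (Gp p)" for g
    unfolding r_def
  proof (rule Zhat_memI)
    fix m n :: nat assume "m \<ge> 1" "n \<ge> 1" "m dvd n"
    then show "\<rho> g n mod int m = \<rho> g m mod int m" by (intro \<rho>_comp[OF that] dvd_imp_le) simp_all
  qed
  have "continuous_map (Gp_top p) Zhat_top r"
  proof (rule continuous_map_into_Zhat_top)
    show "r g \<in> carrier Zhat" if "g \<in> topspace (Gp_top p)" for g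
      using that closed topspace_Gp_top[OF prime_p] by simp
    fix n :: nat and k assume n: "n \<ge> 1"
    have "{g \<in> topspace (Gp_top p). r g n = k} =
       (\<Union>a\<in>{a. (F n a - F n 1) mod int n = k}. {g \<in> carrier (Gp p). red (N n) g = a})"
      using n topspace_Gp_top[OF prime_p] by (auto simp: r_def \<rho>_def)
    then show "openin (Gp_top p) {g \<in> topspace (Gp_top p). r g n = k}"
      using openin_red[OF prime_p lev] by auto
  qed
  moreover have "r \<one>\<^bsub>Gp p\<^esub> = \<one>\<^bsub>Zhat\<^esub>"
  proof (rule Zhat_eqI)
    show "r \<one>\<^bsub>Gp p\<^esub> \<in> carrier Zhat" by (rule closed) simp
    show "\<one>\<^bsub>Zhat\<^esub> \<in> carrier Zhat" using comm_group_Zhat by (simp add: comm_group_def comm_monoid_def monoid.one_closed)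
    fix n :: nat assume n: "n \<ge> 1"
    have "F n (red (N n) \<one>\<^bsub>Gp p\<^esub>) = F n 1"
      by (rule F_cong) (simp add: red_one[OF prime_p lev] cong_def)
    then show "r \<one>\<^bsub>Gp p\<^esub> n = \<one>\<^bsub>Zhat\<^esub> n" using n by (simp add: r_def \<rho>_def Zhat_one)
  qed
  moreover have "r (frob p \<otimes>\<^bsub>Gp p\<^esub> g) = Zhat_of_int 1 \<otimes>\<^bsub>Zhat\<^esub> r g" if g: "g \<in> carrier (Gp p)" for g
  proof (rule Zhat_eqI)
    show "r (frob p \<otimes>\<^bsub>Gp p\<^esub> g) \<in> carrier Zhat" by (intro closed G.m_closed frob_in_Gp[OF prime_p] g)
    show "Zhat_of_int 1 \<otimes>\<^bsub>Zhat\<^esub> r g \<in> carrier Zhat"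
      using comm_group_Zhat closed[OF g] by (simp add: comm_group_def comm_monoid_def monoid.m_closed)
    fix n :: nat assume n: "n \<ge> 1"
    have "F n (red (N n) (frob p \<otimes>\<^bsub>Gp p\<^esub> g)) = F n (int p * red (N n) g)"
      by (rule F_cong) (simp add: red_mult[OF prime_p frob_in_Gp[OF prime_p] g lev] red_frob[OF prime_p lev] cong_def mod_mult_left_eq)
    moreover have "[F n (int p * red (N n) g) = F n (red (N n) g) + 1] (mod int n)"
      using F_mult[OF coprime_red[OF prime_p g lev]] dvd_fact_int[OF n] by (metis cong_dvd_modulus of_nat_fact)
    ultimately have "[F n (red (N n) (frob p \<otimes>\<^bsub>Gp p\<^esub> g)) - F n 1 = F n (red (N n) g) + 1 - F n 1] (mod int n)"
      by (metis cong_diff cong_refl)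
    then have "\<rho> (frob p \<otimes>\<^bsub>Gp p\<^esub> g) n mod int n = (1 + \<rho> g n) mod int n"
      by (simp add: \<rho>_def cong_def algebra_simps)
    then show "r (frob p \<otimes>\<^bsub>Gp p\<^esub> g) n = (Zhat_of_int 1 \<otimes>\<^bsub>Zhat\<^esub> r g) n"
      using n by (simp add: r_def Zhat_mult Zhat_of_int_apply mod_add_eq)
  qed
  ultimately show ?thesis using that by blast
qed

end

section \<open>The closed subgroup generated by \<open>f\<^sub>p\<close>\<close>

context
  fixes p :: nat
  assumes prime_p: "prime p"
begin

interpretation G: comm_group "Gp p" by (rule comm_group_Gp[OF prime_p])
interpretation Z: comm_group Zhat by (rule comm_group_Zhat)

lemma continuous_map_Gp_inv: "continuous_map (Gp_top p) (Gp_top p) (\<lambda>g. inv\<^bsub>Gp p\<^esub> g)"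
proof (rule continuous_map_into_Gp_top[OF prime_p])
  show "inv\<^bsub>Gp p\<^esub> g \<in> carrier (Gp p)" if "g \<in> topspace (Gp_top p)" for g
    using that topspace_Gp_top[OF prime_p] by simp
  fix N k assume N: "N \<in> coprime_levels p"
  have red: "red N (inv\<^bsub>Gp p\<^esub> g) = k \<longleftrightarrow> k \<in> {0..<int N} \<and> [red N g * k = 1] (mod int N)"
    if g: "g \<in> carrier (Gp p)" for g
  proof -
    have gi: "inv\<^bsub>Gp p\<^esub> g \<in> carrier (Gp p)" using g by simp
    have one: "[red N g * red N (inv\<^bsub>Gp p\<^esub> g) = 1] (mod int N)"
      using red_mult[OF prime_p g gi N] red_one[OF prime_p N] g by (simp add: cong_def)
    have range: "red N (inv\<^bsub>Gp p\<^esub> g) \<in> {0..<int N}" by (rule red_range[OF prime_p gi N])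
    have "red N (inv\<^bsub>Gp p\<^esub> g) = k" if k: "k \<in> {0..<int N}" "[red N g * k = 1] (mod int N)"
    proof -
      have "[red N g * red N (inv\<^bsub>Gp p\<^esub> g) = red N g * k] (mod int N)"
        using one k(2) by (simp add: cong_def)
      then have "[red N (inv\<^bsub>Gp p\<^esub> g) = k] (mod int N)"
        using cong_mult_lcancel[OF coprime_red[OF prime_p g N]] by blast
      then show ?thesis using k(1) range by (simp add: cong_def)
    qed
    then show ?thesis using one range by blast
  qed
  have "{g \<in> topspace (Gp_top p). red N (inv\<^bsub>Gp p\<^esub> g) = k} =
      (\<Union>a\<in>{a. k \<in> {0..<int N} \<and> [a * k = 1] (mod int N)}. {g \<in> carrier (Gp p). red N g = a})"
    using red topspace_Gp_top[OF prime_p] by auto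
  then show "openin (Gp_top p) {g \<in> topspace (Gp_top p). red N (inv\<^bsub>Gp p\<^esub> g) = k}"
    using openin_red[OF prime_p N] by auto
qed

lemma continuous_map_Gp_mult2:
  assumes "continuous_map T (Gp_top p) f" "continuous_map T (Gp_top p) g"
  shows "continuous_map T (Gp_top p) (\<lambda>x. f x \<otimes>\<^bsub>Gp p\<^esub> g x)"
  using continuous_map_compose[OF continuous_map_pairedI[OF assms] continuous_map_Gp_mult[OF prime_p]]
  by (simp add: comp_def)

lemma continuous_map_Zhat_mult2:
  assumes "continuous_map T Zhat_top f" "continuous_map T Zhat_top g"
  shows "continuous_map T Zhat_top (\<lambda>x. f x \<otimes>\<^bsub>Zhat\<^esub> g x)"
  using continuous_map_compose[OF continuous_map_pairedI[OF assms] continuous_map_Zhat_mult]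
  by (simp add: comp_def)

lemma frob_closure_eq:
  "frob_closure p = (Gp_top p) closure_of (range (\<lambda>k::int. frob p [^]\<^bsub>Gp p\<^esub> k))"
proof -
  have "generate (Gp p) {frob p} = range (\<lambda>k::int. frob p [^]\<^bsub>Gp p\<^esub> k)"
    using G.generate_pow[OF frob_in_Gp[OF prime_p]] by auto
  then show ?thesis by (simp add: frob_closure_def)
qed

lemma frob_closure_subset: "frob_closure p \<subseteq> carrier (Gp p)"
  unfolding frob_closure_eq using closure_of_subset_topspace topspace_Gp_top[OF prime_p] by metis

lemma frob_pow_closed: "frob p [^]\<^bsub>Gp p\<^esub> (k::int) \<in> carrier (Gp p)"
  using frob_in_Gp[OF prime_p] by simp

lemma frob_pow_in_closure: "frob p [^]\<^bsub>Gp p\<^esub> (k::int) \<in> frob_closure p"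
proof -
  have "range (\<lambda>k::int. frob p [^]\<^bsub>Gp p\<^esub> k) \<subseteq> topspace (Gp_top p)"
    using frob_pow_closed topspace_Gp_top[OF prime_p] by auto
  then show ?thesis unfolding frob_closure_eq using closure_of_subset by blast
qed

lemma frob_closure_image:
  assumes f: "continuous_map (Gp_top p) (Gp_top p) f"
    and S: "\<And>k::int. f (frob p [^]\<^bsub>Gp p\<^esub> k) \<in> frob_closure p"
    and c: "c \<in> frob_closure p"
  shows "f c \<in> frob_closure p"
proof -
  have "f c \<in> (Gp_top p) closure_of (f ` range (\<lambda>k::int. frob p [^]\<^bsub>Gp p\<^esub> k))"
    using continuous_map_image_closure_subset[OF f] c unfolding frob_closure_eq by blast
  also have "\<dots> \<subseteq> (Gp_top p) closure_of (frob_closure p)"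
    using S by (intro closure_of_mono) auto
  also have "\<dots> = frob_closure p" unfolding frob_closure_eq by simp
  finally show ?thesis .
qed

lemma subgroup_frob_closure: "subgroup (frob_closure p) (Gp p)"
proof (rule G.subgroupI[OF frob_closure_subset])
  show "frob_closure p \<noteq> {}" using frob_pow_in_closure by blast
  show "inv\<^bsub>Gp p\<^esub> c \<in> frob_closure p" if "c \<in> frob_closure p" for c
  proof (rule frob_closure_image[OF continuous_map_Gp_inv _ that])
    fix k :: int
    have "inv\<^bsub>Gp p\<^esub> (frob p [^]\<^bsub>Gp p\<^esub> k) = frob p [^]\<^bsub>Gp p\<^esub> (- k)"
      using G.int_pow_neg[OF frob_in_Gp[OF prime_p], of k] by simp
    then show "inv\<^bsub>Gp p\<^esub> (frob p [^]\<^bsub>Gp p\<^esub> k) \<in> frob_closure p"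
      using frob_pow_in_closure by metis
  qed
  fix c d assume c: "c \<in> frob_closure p" and d: "d \<in> frob_closure p"
  have cont: "continuous_map (Gp_top p) (Gp_top p) (\<lambda>x. a \<otimes>\<^bsub>Gp p\<^esub> x)"
    "continuous_map (Gp_top p) (Gp_top p) (\<lambda>x. x \<otimes>\<^bsub>Gp p\<^esub> a)" if "a \<in> carrier (Gp p)" for a
    using that topspace_Gp_top[OF prime_p] by (intro continuous_map_Gp_mult2 continuous_map_id[unfolded id_def]; simp)+
  have "frob p [^]\<^bsub>Gp p\<^esub> k \<otimes>\<^bsub>Gp p\<^esub> d \<in> frob_closure p" for k :: int
  proof (rule frob_closure_image[OF cont(1)[OF frob_pow_closed] _ d])
    fix m :: int
    show "frob p [^]\<^bsub>Gp p\<^esub> k \<otimes>\<^bsub>Gp p\<^esub> frob p [^]\<^bsub>Gp p\<^esub> m \<in> frob_closure p"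
      using G.int_pow_mult[OF frob_in_Gp[OF prime_p], of k m] frob_pow_in_closure by metis
  qed
  then show "c \<otimes>\<^bsub>Gp p\<^esub> d \<in> frob_closure p"
    using d frob_closure_subset by (intro frob_closure_image[OF cont(2) _ c]) blast+
qed

lemma red_pow: "g \<in> carrier (Gp p) \<Longrightarrow> N \<in> coprime_levels p \<Longrightarrow> red N (g [^]\<^bsub>Gp p\<^esub> (n::nat)) = red N g ^ n mod int N"
  by (induction n) (simp_all add: red_one[OF prime_p] red_mult[OF prime_p] mod_mult_right_eq mult.commute)

context
  fixes r
  assumes r_cont: "continuous_map (Gp_top p) Zhat_top r"
    and r_one: "r \<one>\<^bsub>Gp p\<^esub> = \<one>\<^bsub>Zhat\<^esub>"
    and r_frob: "\<And>g. g \<in> carrier (Gp p) \<Longrightarrow> r (frob p \<otimes>\<^bsub>Gp p\<^esub> g) = Zhat_of_int 1 \<otimes>\<^bsub>Zhat\<^esub> r g"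
begin

lemma r_closed: "g \<in> carrier (Gp p) \<Longrightarrow> r g \<in> carrier Zhat"
  using continuous_map_image_subset_topspace[OF r_cont] topspace_Gp_top[OF prime_p] by auto

lemma r_frob_pow_mult:
  assumes "g \<in> carrier (Gp p)"
  shows "r (frob p [^]\<^bsub>Gp p\<^esub> (k::int) \<otimes>\<^bsub>Gp p\<^esub> g) = Zhat_of_int k \<otimes>\<^bsub>Zhat\<^esub> r g"
  using assms
proof (induction k arbitrary: g rule: int_induct[of _ 0])
  case base
  then show ?case by (simp add: Zhat_of_int_0 r_closed)
next
  case (step1 k)
  have "frob p [^]\<^bsub>Gp p\<^esub> (k + 1) \<otimes>\<^bsub>Gp p\<^esub> g = frob p [^]\<^bsub>Gp p\<^esub> k \<otimes>\<^bsub>Gp p\<^esub> (frob p \<otimes>\<^bsub>Gp p\<^esub> g)"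
    using step1.prems frob_in_Gp[OF prime_p] by (simp add: G.int_pow_mult G.m_assoc)
  then have "r (frob p [^]\<^bsub>Gp p\<^esub> (k + 1) \<otimes>\<^bsub>Gp p\<^esub> g) = Zhat_of_int k \<otimes>\<^bsub>Zhat\<^esub> (Zhat_of_int 1 \<otimes>\<^bsub>Zhat\<^esub> r g)"
    using step1 frob_in_Gp[OF prime_p] r_frob by simp
  then show ?case using r_closed step1.prems by (simp add: Zhat_of_int_add Z.m_assoc)
next
  case (step2 k)
  define h where "h = inv\<^bsub>Gp p\<^esub> (frob p) \<otimes>\<^bsub>Gp p\<^esub> g"
  have h: "h \<in> carrier (Gp p)" "g = frob p \<otimes>\<^bsub>Gp p\<^esub> h"
    using step2.prems frob_in_Gp[OF prime_p] by (simp_all add: h_def flip: G.m_assoc)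
  have "frob p [^]\<^bsub>Gp p\<^esub> (k - 1) \<otimes>\<^bsub>Gp p\<^esub> g = frob p [^]\<^bsub>Gp p\<^esub> (k - 1 + 1) \<otimes>\<^bsub>Gp p\<^esub> h"
    unfolding h(2) using h(1) frob_in_Gp[OF prime_p] by (subst G.int_pow_mult) (simp_all add: G.m_assoc)
  then have "r (frob p [^]\<^bsub>Gp p\<^esub> (k - 1) \<otimes>\<^bsub>Gp p\<^esub> g) = Zhat_of_int k \<otimes>\<^bsub>Zhat\<^esub> r h"
    using step2.IH[OF h(1)] by simp
  also have "Zhat_of_int k = Zhat_of_int (k - 1) \<otimes>\<^bsub>Zhat\<^esub> Zhat_of_int 1"
    using Zhat_of_int_add[of "k - 1" 1] by simp
  finally show ?case using r_closed[OF h(1)] r_frob[OF h(1)] by (simp add: Z.m_assoc flip: h(2))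
qed

lemma r_frob_pow: "r (frob p [^]\<^bsub>Gp p\<^esub> (k::int)) = Zhat_of_int k"
  using r_frob_pow_mult[OF G.one_closed, of k] frob_in_Gp[OF prime_p] by (simp add: r_one)

text \<open>Both sides are continuous in \<open>c\<close>, and they agree at the powers of \<open>f\<^sub>p\<close>.\<close>

lemma r_mult:
  assumes c: "c \<in> frob_closure p" and g: "g \<in> carrier (Gp p)"
  shows "r (c \<otimes>\<^bsub>Gp p\<^esub> g) = r c \<otimes>\<^bsub>Zhat\<^esub> r g"
proof (rule forall_in_closure_of_eq[OF c[unfolded frob_closure_eq] Hausdorff_space_Zhat_top])
  have "continuous_map (Gp_top p) (Gp_top p) (\<lambda>c. c \<otimes>\<^bsub>Gp p\<^esub> g)"
    using g topspace_Gp_top[OF prime_p] by (intro continuous_map_Gp_mult2 continuous_map_id[unfolded id_def]) simp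
  from continuous_map_compose[OF this r_cont]
  show "continuous_map (Gp_top p) Zhat_top (\<lambda>c. r (c \<otimes>\<^bsub>Gp p\<^esub> g))" by (simp add: comp_def)
  show "continuous_map (Gp_top p) Zhat_top (\<lambda>c. r c \<otimes>\<^bsub>Zhat\<^esub> r g)"
    using r_closed[OF g] by (intro continuous_map_Zhat_mult2 r_cont) simp
  show "r (c \<otimes>\<^bsub>Gp p\<^esub> g) = r c \<otimes>\<^bsub>Zhat\<^esub> r g" if "c \<in> range (\<lambda>k::int. frob p [^]\<^bsub>Gp p\<^esub> k)" for c
    using that r_frob_pow_mult[OF g] r_frob_pow by auto
qed

text \<open>If \<open>p ^ t\<close> is 1 modulo \<open>N\<close> then the powers of \<open>f\<^sub>p\<close> with exponent divisible by \<open>t\<close> are trivial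
  modulo \<open>N\<close>. An element of the closure on which \<open>r\<close> vanishes is approximated by such powers, for
  every \<open>N\<close>.\<close>

lemma r_kernel:
  assumes c: "c \<in> frob_closure p" and rc: "r c = \<one>\<^bsub>Zhat\<^esub>"
  shows "c = \<one>\<^bsub>Gp p\<^esub>"
proof (rule Gp_eqI[OF prime_p])
  show cG: "c \<in> carrier (Gp p)" "\<one>\<^bsub>Gp p\<^esub> \<in> carrier (Gp p)" using c frob_closure_subset by auto
  fix N assume N: "N \<in> coprime_levels p"
  define t where "t = totient N"
  have t: "t \<ge> 1" using N by (simp add: t_def coprime_levels_def Suc_le_eq)
  have "[p ^ t = 1] (mod N)"
    unfolding t_def by (rule euler_theorem) (use N in \<open>simp add: coprime_levels_def coprime_commute\<close>)
  then have pt: "int p ^ t mod int N = 1 mod int N"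
    by (simp flip: cong_int_iff add: cong_def)
  define H where "H = {g \<in> carrier (Gp p). red N g = 1 mod int N}"
  have H: "subgroup H (Gp p)"
  proof (rule G.subgroupI)
    show "H \<subseteq> carrier (Gp p)" "H \<noteq> {}"
      using red_one[OF prime_p N] by (auto simp: H_def)
    show "a \<otimes>\<^bsub>Gp p\<^esub> b \<in> H" if "a \<in> H" "b \<in> H" for a b
      using that by (auto simp: H_def red_mult[OF prime_p _ _ N] mod_mult_left_eq mod_mult_right_eq)
    show "inv\<^bsub>Gp p\<^esub> a \<in> H" if a: "a \<in> H" for a
    proof -
      have aG: "a \<in> carrier (Gp p)" "red N a = 1 mod int N" using a by (auto simp: H_def)
      have "red N (inv\<^bsub>Gp p\<^esub> a) = red N (inv\<^bsub>Gp p\<^esub> a) mod int N"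
        using red_range[OF prime_p G.inv_closed[OF aG(1)] N] by simp
      also have "\<dots> = red N a * red N (inv\<^bsub>Gp p\<^esub> a) mod int N" by (simp add: aG(2) mod_mult_left_eq)
      also have "\<dots> = red N \<one>\<^bsub>Gp p\<^esub>" using aG(1) by (simp flip: red_mult[OF prime_p _ _ N])
      finally show ?thesis using aG red_one[OF prime_p N] by (simp add: H_def)
    qed
  qed
  have "red N (frob p [^]\<^bsub>Gp p\<^esub> t) = 1 mod int N"
    using red_pow[OF frob_in_Gp[OF prime_p] N] red_frob[OF prime_p N] pt by (simp add: power_mod)
  then have ft: "frob p [^]\<^bsub>Gp p\<^esub> t \<in> H" using frob_in_Gp[OF prime_p] by (simp add: H_def)
  \<comment> \<open>a neighborhood of \<open>c\<close> in which residues modulo \<open>N\<close> are constant and powers of \<open>f\<^sub>p\<close> have exponents divisible by \<open>t\<close>\<close>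
  define T where "T = {g \<in> topspace (Gp_top p). r g \<in> {a \<in> carrier Zhat. a t = 0}} \<inter> {g \<in> carrier (Gp p). red N g = red N c}"
  have "openin (Gp_top p) T"
    unfolding T_def
    by (intro openin_Int openin_red[OF prime_p N] openin_continuous_map_preimage[OF r_cont openin_Zhat_coord[OF t]])
  moreover have "c \<in> T"
    using cG rc Zhat_one[OF t] topspace_Gp_top[OF prime_p] by (simp add: T_def)
  ultimately have "\<exists>g. g \<in> range (\<lambda>k::int. frob p [^]\<^bsub>Gp p\<^esub> k) \<and> g \<in> T"
    using c unfolding frob_closure_eq in_closure_of by simp
  then obtain g where g: "g \<in> range (\<lambda>k::int. frob p [^]\<^bsub>Gp p\<^esub> k)" "r g t = 0" "red N g = red N c"
    unfolding T_def by blast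
  then obtain k :: int where k: "g = frob p [^]\<^bsub>Gp p\<^esub> k" by blast
  have "k mod int t = 0" using g(2) r_frob_pow[of k] Zhat_of_int_apply[OF t, of k] by (simp add: k)
  then obtain j where j: "k = int t * j" by (metis mod_0_imp_dvd dvdE)
  have "g = (frob p [^]\<^bsub>Gp p\<^esub> t) [^]\<^bsub>Gp p\<^esub> j"
    unfolding k j using G.int_pow_pow[OF frob_in_Gp[OF prime_p], of "int t" j] by (simp add: int_pow_int mult.commute)
  then have "g \<in> H" using G.subgroup_int_pow_closed[OF H ft] by simp
  then show "red N c = red N \<one>\<^bsub>Gp p\<^esub>" using g(3) red_one[OF prime_p N] by (simp add: H_def)
qed

lemma r_inj: "inj_on r (frob_closure p)"
proof (rule inj_onI)
  interpret C: subgroup "frob_closure p" "Gp p" by (rule subgroup_frob_closure)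
  fix c d assume cd: "c \<in> frob_closure p" "d \<in> frob_closure p" "r c = r d"
  have ccar: "c \<in> carrier (Gp p)" "d \<in> carrier (Gp p)" using cd frob_closure_subset by auto
  have di: "inv\<^bsub>Gp p\<^esub> d \<in> frob_closure p" using cd by simp
  have "r (inv\<^bsub>Gp p\<^esub> d \<otimes>\<^bsub>Gp p\<^esub> c) = r (inv\<^bsub>Gp p\<^esub> d) \<otimes>\<^bsub>Zhat\<^esub> r d"
    using r_mult[OF di ccar(1)] cd(3) by simp
  also have "\<dots> = \<one>\<^bsub>Zhat\<^esub>" using r_mult[OF di ccar(2)] ccar r_one by simp
  finally have "inv\<^bsub>Gp p\<^esub> d \<otimes>\<^bsub>Gp p\<^esub> c = \<one>\<^bsub>Gp p\<^esub>"
    using r_kernel[OF C.m_closed[OF di cd(1)]] by simp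
  then show "c = d" using ccar by (metis G.inv_closed G.inv_equality G.inv_inv)
qed

lemma compactin_frob_closure: "compactin (Gp_top p) (frob_closure p)"
  unfolding frob_closure_eq
  by (rule closedin_compact_space[OF compact_space_Gp_top[OF prime_p] closedin_closure_of])

text \<open>The image is compact and contains the dense subset of integers.\<close>

lemma r_image: "r ` frob_closure p = carrier Zhat"
proof (rule subset_antisym)
  show "r ` frob_closure p \<subseteq> carrier Zhat" using r_closed frob_closure_subset by auto
  have "closedin Zhat_top (r ` frob_closure p)"
    by (rule compactin_imp_closedin[OF Hausdorff_space_Zhat_top image_compactin[OF compactin_frob_closure r_cont]])
  moreover have "range Zhat_of_int \<subseteq> r ` frob_closure p"
    using r_frob_pow frob_pow_in_closure by (metis image_eqI image_subsetI rangeE subsetI)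
  ultimately show "carrier Zhat \<subseteq> r ` frob_closure p"
    using closure_of_minimal Zhat_of_int_dense by metis
qed

text \<open>The continuous bijection \<open>r\<close> from a compact to a Hausdorff space has a continuous inverse \<open>w\<close>; it
  extends \<open>k \<mapsto> f\<^sub>p\<^sup>k\<close> from the integers, so \<open>w a\<close> is the power \<open>f\<^sub>p\<^sup>a\<close>.\<close>

lemma frob_power_map:
  obtains w where "continuous_map Zhat_top (Gp_top p) w"
    "\<And>a. a \<in> carrier Zhat \<Longrightarrow> w a \<in> frob_closure p \<and> r (w a) = a"
    "\<And>c. c \<in> frob_closure p \<Longrightarrow> w (r c) = c"
proof -
  have top: "topspace (subtopology (Gp_top p) (frob_closure p)) = frob_closure p"
    using frob_closure_subset topspace_Gp_top[OF prime_p] by auto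
  have "homeomorphic_map (subtopology (Gp_top p) (frob_closure p)) Zhat_top r"
    by (rule continuous_imp_homeomorphic_map)
      (use r_image r_inj in \<open>simp_all add: continuous_map_from_subtopology r_cont Hausdorff_space_Zhat_top
        compact_space_subtopology compactin_frob_closure top del: topspace_subtopology\<close>)
  then obtain w where w: "homeomorphic_maps (subtopology (Gp_top p) (frob_closure p)) Zhat_top r w"
    unfolding homeomorphic_map_maps by blast
  have cont: "continuous_map Zhat_top (subtopology (Gp_top p) (frob_closure p)) w"
    and wr: "\<forall>c\<in>frob_closure p. w (r c) = c" and rw: "\<forall>a\<in>carrier Zhat. r (w a) = a"
    using w unfolding homeomorphic_maps_def top topspace_Zhat_top by blast+
  have "w a \<in> frob_closure p" if "a \<in> carrier Zhat" for a
    using continuous_map_image_subset_topspace[OF cont] that unfolding top topspace_Zhat_top by blast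
  then show ?thesis
    using that[OF continuous_map_into_fulltopology[OF cont]] wr rw by blast
qed

end

end

section \<open>The solenoid bundle\<close>

lemma Hausdorff_space_of_continuous_injection:
  assumes f: "continuous_map X Y f" and inj: "inj_on f (topspace X)" and Y: "Hausdorff_space Y"
  shows "Hausdorff_space X"
  unfolding Hausdorff_space_def
proof (intro allI impI)
  fix x y assume xy: "x \<in> topspace X \<and> y \<in> topspace X \<and> x \<noteq> y"
  then have "f x \<in> topspace Y \<and> f y \<in> topspace Y \<and> f x \<noteq> f y"
    using inj continuous_map_image_subset_topspace[OF f] by (auto simp: inj_on_def)
  then obtain U V where UV: "openin Y U" "openin Y V" "f x \<in> U" "f y \<in> V" "disjnt U V"
    using Y unfolding Hausdorff_space_def by blast
  have "openin X {z \<in> topspace X. f z \<in> U}" "openin X {z \<in> topspace X. f z \<in> V}"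
    using UV by (auto intro: openin_continuous_map_preimage[OF f])
  then show "\<exists>U V. openin X U \<and> openin X V \<and> x \<in> U \<and> y \<in> V \<and> disjnt U V"
    using UV xy by (intro exI[of _ "{z \<in> topspace X. f z \<in> U}"] exI[of _ "{z \<in> topspace X. f z \<in> V}"])
      (auto simp: disjnt_iff)
qed

lemma continuous_map_Zhat_inv: "continuous_map Zhat_top Zhat_top (\<lambda>a. inv\<^bsub>Zhat\<^esub> a)"
proof (rule continuous_map_into_Zhat_top)
  interpret Z: comm_group Zhat by (rule comm_group_Zhat)
  show "inv\<^bsub>Zhat\<^esub> a \<in> carrier Zhat" if "a \<in> topspace Zhat_top" for a using that by simp
  fix n :: nat and k assume n: "n \<ge> 1"
  have inv: "(inv\<^bsub>Zhat\<^esub> a) n = (- a n) mod int n" if a: "a \<in> carrier Zhat" for a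
  proof -
    have "(a n + (inv\<^bsub>Zhat\<^esub> a) n) mod int n = 0"
      using Z.r_inv[OF a] Zhat_mult[OF n, of a "inv\<^bsub>Zhat\<^esub> a"] Zhat_one[OF n] by simp
    then have "[(inv\<^bsub>Zhat\<^esub> a) n = - a n] (mod int n)"
      by (simp add: cong_iff_dvd_diff add.commute dvd_eq_mod_eq_0)
    then show ?thesis using Zhat_mod[OF Z.inv_closed[OF a] n] by (simp add: cong_def)
  qed
  have "{a \<in> topspace Zhat_top. (inv\<^bsub>Zhat\<^esub> a) n = k} = (\<Union>i\<in>{i. (- i) mod int n = k}. {a \<in> carrier Zhat. a n = i})"
    using inv by auto
  then show "openin Zhat_top {a \<in> topspace Zhat_top. (inv\<^bsub>Zhat\<^esub> a) n = k}"
    using openin_Zhat_coord[OF n] by auto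
qed

text \<open>The logarithmic coordinate on \<open>(0, 1)\<close>, in which \<open>\<rho> \<mapsto> \<rho>\<^sup>p\<close> is the translation by 1.\<close>

definition log_coord :: "nat \<Rightarrow> real \<Rightarrow> real" where
  "log_coord p \<rho> = log (real p) (- ln \<rho>)"

definition log_coord_inv :: "nat \<Rightarrow> real \<Rightarrow> real" where
  "log_coord_inv p s = exp (- (real p powr s))"

lemma log_coord_inv_range: "log_coord_inv p s \<in> {0<..<1}" if "p > 1"
  using that by (simp add: log_coord_inv_def)

lemma log_coord_log_coord_inv: "p > 1 \<Longrightarrow> log_coord p (log_coord_inv p s) = s"
  by (simp add: log_coord_inv_def log_coord_def)

lemma log_coord_inv_log_coord: "p > 1 \<Longrightarrow> \<rho> \<in> {0<..<1} \<Longrightarrow> log_coord_inv p (log_coord p \<rho>) = \<rho>"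
  by (simp add: log_coord_inv_def log_coord_def)

lemma log_coord_inj: "p > 1 \<Longrightarrow> \<rho> \<in> {0<..<1} \<Longrightarrow> \<rho>' \<in> {0<..<1} \<Longrightarrow> log_coord p \<rho> = log_coord p \<rho>' \<Longrightarrow> \<rho> = \<rho>'"
  by (metis log_coord_inv_log_coord)

lemma powr_unit_interval: "p > (1::nat) \<Longrightarrow> \<rho> \<in> {0<..<1} \<Longrightarrow> \<rho> powr (real p powr s) \<in> {0<..<(1::real)}"
  using powr_less_mono2[of "real p powr s" \<rho> 1] by simp

lemma log_coord_powr:
  assumes "p > 1" "\<rho> \<in> {0<..<1}"
  shows "log_coord p (\<rho> powr (real p powr s)) = s + log_coord p \<rho>"
proof -
  have "- ln (\<rho> powr (real p powr s)) = real p powr s * (- ln \<rho>)"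
    using assms by (simp add: ln_powr)
  moreover have "log (real p) (real p powr s * (- ln \<rho>)) = s + log (real p) (- ln \<rho>)"
    using assms by (subst log_mult) simp_all
  ultimately show ?thesis by (simp only: log_coord_def)
qed

lemma continuous_on_log_coord: "p > 1 \<Longrightarrow> continuous_on {0<..<1} (log_coord p)"
  unfolding log_coord_def[abs_def] log_def by (intro continuous_intros) auto

locale torsor =
  fixes p :: nat and X :: "'x topology" and \<phi>
  assumes prime_p: "prime p" and torsor: "compact_Gp_torsor p X \<phi>"
begin

sublocale G: comm_group "Gp p" by (rule comm_group_Gp[OF prime_p])
sublocale Z: comm_group Zhat by (rule comm_group_Zhat)
sublocale C: subgroup "frob_closure p" "Gp p" by (rule subgroup_frob_closure[OF prime_p])

lemma p_gt_1: "p > 1" by (rule prime_gt_1_nat[OF prime_p])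

lemma compact_X: "compact_space X" and Hausdorff_X: "Hausdorff_space X"
  and action: "group_action (Gp p) (topspace X) \<phi>"
  and \<phi>_cont: "continuous_map (prod_topology (Gp_top p) X) X (\<lambda>(g, x). \<phi> g x)"
  and trans: "transitive_action (Gp p) (topspace X) \<phi>"
  and stab: "x \<in> topspace X \<Longrightarrow> stabilizer (Gp p) \<phi> x = {\<one>\<^bsub>Gp p\<^esub>}"
  using torsor by (auto simp: compact_Gp_torsor_def continuous_group_action_def)

lemma \<phi>_closed: "g \<in> carrier (Gp p) \<Longrightarrow> x \<in> topspace X \<Longrightarrow> \<phi> g x \<in> topspace X"
  using group_action.element_image[OF action] by blast

lemma \<phi>_mult: "g \<in> carrier (Gp p) \<Longrightarrow> h \<in> carrier (Gp p) \<Longrightarrow> x \<in> topspace X \<Longrightarrow>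
    \<phi> (g \<otimes>\<^bsub>Gp p\<^esub> h) x = \<phi> g (\<phi> h x)"
  using group_action.composition_rule[OF action] by blast

lemma \<phi>_one: "x \<in> topspace X \<Longrightarrow> \<phi> \<one>\<^bsub>Gp p\<^esub> x = x"
  using group_action.id_eq_one[OF action] by (metis restrict_apply')

lemma \<phi>_free:
  assumes g: "g \<in> carrier (Gp p)" and h: "h \<in> carrier (Gp p)" and x: "x \<in> topspace X" and eq: "\<phi> g x = \<phi> h x"
  shows "g = h"
proof -
  have "\<phi> (inv\<^bsub>Gp p\<^esub> h \<otimes>\<^bsub>Gp p\<^esub> g) x = \<phi> (inv\<^bsub>Gp p\<^esub> h \<otimes>\<^bsub>Gp p\<^esub> h) x"
    using g h x eq by (simp only: \<phi>_mult G.inv_closed)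
  also have "\<dots> = x" using h x by (simp add: \<phi>_one)
  finally have "inv\<^bsub>Gp p\<^esub> h \<otimes>\<^bsub>Gp p\<^esub> g \<in> stabilizer (Gp p) \<phi> x"
    using g h by (simp add: stabilizer_def)
  then have "inv\<^bsub>Gp p\<^esub> h \<otimes>\<^bsub>Gp p\<^esub> g = \<one>\<^bsub>Gp p\<^esub>" using stab[OF x] by simp
  then show ?thesis using g h by (metis G.inv_closed G.inv_equality G.inv_inv)
qed

lemma frob_closure_carrier: "c \<in> frob_closure p \<Longrightarrow> c \<in> carrier (Gp p)"
  using frob_closure_subset[OF prime_p] by blast

text \<open>The choice of a point identifies \<open>X\<close> with \<open>G\<^sub>p\<close> and so transports the retraction.\<close>

lemma torsor_retraction:
  obtains r rX where "continuous_map (Gp_top p) Zhat_top r" "r \<one>\<^bsub>Gp p\<^esub> = \<one>\<^bsub>Zhat\<^esub>"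
    "\<And>g. g \<in> carrier (Gp p) \<Longrightarrow> r (frob p \<otimes>\<^bsub>Gp p\<^esub> g) = Zhat_of_int 1 \<otimes>\<^bsub>Zhat\<^esub> r g"
    "continuous_map X Zhat_top rX"
    "\<And>c x. c \<in> frob_closure p \<Longrightarrow> x \<in> topspace X \<Longrightarrow> rX (\<phi> c x) = r c \<otimes>\<^bsub>Zhat\<^esub> rX x"
proof -
  obtain r where r: "continuous_map (Gp_top p) Zhat_top r" "r \<one>\<^bsub>Gp p\<^esub> = \<one>\<^bsub>Zhat\<^esub>"
    "\<And>g. g \<in> carrier (Gp p) \<Longrightarrow> r (frob p \<otimes>\<^bsub>Gp p\<^esub> g) = Zhat_of_int 1 \<otimes>\<^bsub>Zhat\<^esub> r g"
    by (rule retraction_exists[OF prime_p]) (rule that)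
  show ?thesis
  proof (cases "topspace X = {}")
    case True
    have "continuous_map X Zhat_top (\<lambda>_. \<one>\<^bsub>Zhat\<^esub>)" by simp
    then show ?thesis using that[OF r, of "\<lambda>_. \<one>\<^bsub>Zhat\<^esub>"] True by blast
  next
    case False
    then obtain x0 where x0: "x0 \<in> topspace X" by blast
    have top: "topspace (Gp_top p) = carrier (Gp p)" by (rule topspace_Gp_top[OF prime_p])
    have "continuous_map (Gp_top p) (prod_topology (Gp_top p) X) (\<lambda>g. (g, x0))"
      using x0 by (intro continuous_map_pairedI continuous_map_id[unfolded id_def]) simp
    from continuous_map_compose[OF this \<phi>_cont]
    have cont: "continuous_map (Gp_top p) X (\<lambda>g. \<phi> g x0)" by (simp add: comp_def)
    have img: "(\<lambda>g. \<phi> g x0) ` topspace (Gp_top p) = topspace X"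
    proof (intro subset_antisym subsetI)
      show "x \<in> topspace X" if "x \<in> (\<lambda>g. \<phi> g x0) ` topspace (Gp_top p)" for x
        using that \<phi>_closed x0 top by auto
      show "x \<in> (\<lambda>g. \<phi> g x0) ` topspace (Gp_top p)" if "x \<in> topspace X" for x
        using transitive_action.unique_orbit[OF trans x0 that] unfolding top by blast
    qed
    have "homeomorphic_map (Gp_top p) X (\<lambda>g. \<phi> g x0)"
      using \<phi>_free[OF _ _ x0] top
      by (intro continuous_imp_homeomorphic_map[OF cont compact_space_Gp_top[OF prime_p] Hausdorff_X img] inj_onI) simp
    then obtain d where d: "homeomorphic_maps (Gp_top p) X (\<lambda>g. \<phi> g x0) d"
      unfolding homeomorphic_map_maps by blast
    then have dcont: "continuous_map X (Gp_top p) d" and d1: "\<forall>g\<in>carrier (Gp p). d (\<phi> g x0) = g"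
      and d2: "\<forall>x\<in>topspace X. \<phi> (d x) x0 = x"
      unfolding homeomorphic_maps_def top by auto
    have dG: "d x \<in> carrier (Gp p)" if "x \<in> topspace X" for x
      using continuous_map_image_subset_topspace[OF dcont] that unfolding top by blast
    have "(r \<circ> d) (\<phi> c x) = r c \<otimes>\<^bsub>Zhat\<^esub> (r \<circ> d) x" if c: "c \<in> frob_closure p" and x: "x \<in> topspace X" for c x
    proof -
      have cG: "c \<in> carrier (Gp p)" by (rule frob_closure_carrier[OF c])
      have "\<phi> c x = \<phi> (c \<otimes>\<^bsub>Gp p\<^esub> d x) x0" using d2 x \<phi>_mult[OF cG dG[OF x] x0] by simp
      then have "d (\<phi> c x) = c \<otimes>\<^bsub>Gp p\<^esub> d x" using d1 cG dG[OF x] by simp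
      then show ?thesis using r_mult[OF prime_p r c dG[OF x]] by simp
    qed
    then show ?thesis using that[OF r continuous_map_compose[OF dcont r(1)]] by blast
  qed
qed

abbreviation XI :: "('x \<times> real) topology" where
  "XI \<equiv> prod_topology X (top_of_set {0<..<1})"

lemma topspace_XI: "topspace XI = topspace X \<times> {0<..<1}"
  by simp

text \<open>The power \<open>\<sigma>\<^sup>k\<close>, for negative \<open>k\<close> as well.\<close>

definition shift :: "int \<Rightarrow> 'x \<times> real \<Rightarrow> 'x \<times> real" where
  "shift k z = (\<phi> (frob p [^]\<^bsub>Gp p\<^esub> k) (fst z), snd z powr (real p powr of_int k))"

lemma shift_closed: "z \<in> topspace XI \<Longrightarrow> shift k z \<in> topspace XI"
  using \<phi>_closed[OF frob_pow_closed[OF prime_p]] powr_unit_interval[OF p_gt_1]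
  unfolding topspace_XI shift_def by auto

lemma shift_add: "z \<in> topspace XI \<Longrightarrow> shift (k + m) z = shift k (shift m z)"
  using frob_in_Gp[OF prime_p] \<phi>_mult[OF frob_pow_closed[OF prime_p] frob_pow_closed[OF prime_p]]
  unfolding topspace_XI shift_def by (auto simp: G.int_pow_mult powr_powr powr_add mult.commute)

lemma shift_0: "z \<in> topspace XI \<Longrightarrow> shift 0 z = z"
  using p_gt_1 unfolding topspace_XI shift_def by (auto simp: \<phi>_one)

lemma sigma_eq_shift: "z \<in> topspace XI \<Longrightarrow> sigma p \<phi> z = shift 1 z"
  using frob_in_Gp[OF prime_p] p_gt_1 unfolding topspace_XI sigma_def shift_def
  by (auto simp: G.int_pow_1 powr_realpow)

lemma sigma_funpow: "z \<in> topspace XI \<Longrightarrow> (sigma p \<phi> ^^ n) z = shift (int n) z"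
proof (induction n)
  case (Suc n)
  then show ?case
    using sigma_eq_shift[OF shift_closed[OF Suc.prems]] shift_add[OF Suc.prems, of 1 "int n"] by simp
qed (simp add: shift_0 del: topspace_prod_topology)

lemma sigma_orbit_eq:
  assumes z: "z \<in> topspace XI"
  shows "sigma_orbit p X \<phi> z = range (\<lambda>k. shift k z)"
proof (intro subset_antisym subsetI)
  fix w assume "w \<in> sigma_orbit p X \<phi> z"
  then obtain n where w: "w \<in> topspace XI" "w = (sigma p \<phi> ^^ n) z \<or> z = (sigma p \<phi> ^^ n) w"
    unfolding sigma_orbit_def topspace_XI by blast
  from w(2) show "w \<in> range (\<lambda>k. shift k z)"
  proof
    assume "w = (sigma p \<phi> ^^ n) z"
    then show ?thesis using sigma_funpow[OF z] by simp
  next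
    assume "z = (sigma p \<phi> ^^ n) w"
    then have "z = shift (int n) w" using sigma_funpow[OF w(1)] by simp
    then have "w = shift (- int n) z"
      using shift_add[OF w(1), of "- int n" "int n"] shift_0[OF w(1)] by simp
    then show ?thesis by simp
  qed
next
  fix w assume "w \<in> range (\<lambda>k. shift k z)"
  then obtain k where k: "w = shift k z" by blast
  have w: "w \<in> topspace XI" unfolding k by (rule shift_closed[OF z])
  have "\<exists>n. w = (sigma p \<phi> ^^ n) z \<or> z = (sigma p \<phi> ^^ n) w"
  proof (cases "k \<ge> 0")
    case True
    then show ?thesis using sigma_funpow[OF z, of "nat k"] k by (intro exI[of _ "nat k"]) simp
  next
    case False
    have "z = shift (- k) w" unfolding k using shift_add[OF z, of "- k" k] shift_0[OF z] by simp
    then show ?thesis using sigma_funpow[OF w, of "nat (- k)"] False by (intro exI[of _ "nat (- k)"]) simp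
  qed
  then show "w \<in> sigma_orbit p X \<phi> z" using w unfolding sigma_orbit_def topspace_XI by blast
qed

lemma sigma_orbit_eq_iff:
  assumes z: "z \<in> topspace XI" and w: "w \<in> topspace XI"
  shows "sigma_orbit p X \<phi> z = sigma_orbit p X \<phi> w \<longleftrightarrow> (\<exists>k. w = shift k z)"
proof
  assume "sigma_orbit p X \<phi> z = sigma_orbit p X \<phi> w"
  moreover have "w \<in> sigma_orbit p X \<phi> w"
    unfolding sigma_orbit_eq[OF w] using shift_0[OF w] by (metis rangeI)
  ultimately show "\<exists>k. w = shift k z" unfolding sigma_orbit_eq[OF z] by blast
next
  assume "\<exists>k. w = shift k z"
  then obtain k where k: "w = shift k z" by blast
  have "shift m w = shift (m + k) z" "shift m z = shift (m - k) w" for m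
    using shift_add[OF z, of m k] shift_add[OF z, of "m - k" k] by (simp_all add: k)
  then show "sigma_orbit p X \<phi> z = sigma_orbit p X \<phi> w"
    unfolding sigma_orbit_eq[OF z] sigma_orbit_eq[OF w] by (metis (no_types, lifting) image_cong subset_antisym image_subsetI rangeI)
qed

lemma frob_orbit_mem: "y \<in> frob_orbit p \<phi> x \<longleftrightarrow> (\<exists>c\<in>frob_closure p. y = \<phi> c x)"
  by (auto simp: frob_orbit_def orbit_def)

lemma frob_orbit_eq_iff:
  assumes x: "x \<in> topspace X" and y: "y \<in> topspace X"
  shows "frob_orbit p \<phi> x = frob_orbit p \<phi> y \<longleftrightarrow> (\<exists>c\<in>frob_closure p. y = \<phi> c x)"
proof
  have "y = \<phi> \<one>\<^bsub>Gp p\<^esub> y" using \<phi>_one[OF y] by simp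
  then have "y \<in> frob_orbit p \<phi> y" unfolding frob_orbit_mem using C.one_closed by blast
  moreover assume "frob_orbit p \<phi> x = frob_orbit p \<phi> y"
  ultimately show "\<exists>c\<in>frob_closure p. y = \<phi> c x" unfolding frob_orbit_mem[symmetric] by simp
next
  assume "\<exists>c\<in>frob_closure p. y = \<phi> c x"
  then obtain c where c: "c \<in> frob_closure p" "y = \<phi> c x" by blast
  have cG: "c \<in> carrier (Gp p)" by (rule frob_closure_carrier[OF c(1)])
  show "frob_orbit p \<phi> x = frob_orbit p \<phi> y"
  proof (intro subset_antisym subsetI)
    fix v assume "v \<in> frob_orbit p \<phi> x"
    then obtain d where d: "d \<in> frob_closure p" "v = \<phi> d x" unfolding frob_orbit_mem by blast
    have dG: "d \<in> carrier (Gp p)" by (rule frob_closure_carrier[OF d(1)])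
    have "\<phi> (d \<otimes>\<^bsub>Gp p\<^esub> inv\<^bsub>Gp p\<^esub> c) y = \<phi> (d \<otimes>\<^bsub>Gp p\<^esub> inv\<^bsub>Gp p\<^esub> c \<otimes>\<^bsub>Gp p\<^esub> c) x"
      unfolding c(2) using cG dG x by (simp only: \<phi>_mult G.m_closed G.inv_closed)
    then have "\<phi> (d \<otimes>\<^bsub>Gp p\<^esub> inv\<^bsub>Gp p\<^esub> c) y = v" using cG dG d(2) by (simp add: G.m_assoc)
    then show "v \<in> frob_orbit p \<phi> y" unfolding frob_orbit_mem using c(1) d(1) by blast
  next
    fix v assume "v \<in> frob_orbit p \<phi> y"
    then obtain d where d: "d \<in> frob_closure p" "v = \<phi> d y" unfolding frob_orbit_mem by blast
    then have "v = \<phi> (d \<otimes>\<^bsub>Gp p\<^esub> c) x"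
      using \<phi>_mult[OF frob_closure_carrier[OF d(1)] cG x] c(2) by simp
    then show "v \<in> frob_orbit p \<phi> x" unfolding frob_orbit_mem using c(1) d(1) by blast
  qed
qed

lemma topspace_Zspace: "topspace (Zspace p X \<phi>) = frob_orbit p \<phi> ` topspace X"
  by (simp add: Zspace_def)

lemma quotient_map_Zspace: "quotient_map X (Zspace p X \<phi>) (frob_orbit p \<phi>)"
  unfolding Zspace_def by (rule quotient_map_quotient_topology)

lemma topspace_Yspace: "topspace (Yspace p X \<phi>) = sigma_orbit p X \<phi> ` topspace XI"
  by (simp add: Yspace_def)

lemma quotient_map_Yspace: "quotient_map XI (Yspace p X \<phi>) (sigma_orbit p X \<phi>)"
  unfolding Yspace_def by (rule quotient_map_quotient_topology)

text \<open>Every orbit meets the compact set where the logarithmic coordinate lies in \<open>[0, 1]\<close>.\<close>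

lemma compact_space_Yspace: "compact_space (Yspace p X \<phi>)"
proof -
  define K where "K = {log_coord_inv p 1..log_coord_inv p 0}"
  have K: "K \<subseteq> {0<..<1}"
    using log_coord_inv_range[OF p_gt_1, of 1] log_coord_inv_range[OF p_gt_1, of 0] by (auto simp: K_def)
  have mono: "log_coord_inv p t \<in> K" if "0 \<le> t" "t \<le> 1" for t
    using that p_gt_1 powr_mono[of 0 t "real p"] powr_mono[of t 1 "real p"] by (simp add: K_def log_coord_inv_def)
  have "compactin (top_of_set {0<..<1}) K"
    using K by (simp add: compactin_subtopology K_def)
  then have "compactin XI (topspace X \<times> K)"
    using compact_X by (simp add: compactin_Times compact_space_def)
  then have "compactin (Yspace p X \<phi>) (sigma_orbit p X \<phi> ` (topspace X \<times> K))"
    by (rule image_compactin[OF _ quotient_imp_continuous_map[OF quotient_map_Yspace]])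
  moreover have "sigma_orbit p X \<phi> ` (topspace X \<times> K) = topspace (Yspace p X \<phi>)"
  proof (intro subset_antisym subsetI)
    show "y \<in> topspace (Yspace p X \<phi>)" if "y \<in> sigma_orbit p X \<phi> ` (topspace X \<times> K)" for y
      using that K unfolding topspace_Yspace topspace_XI by blast
    fix y assume "y \<in> topspace (Yspace p X \<phi>)"
    then obtain z where z: "z \<in> topspace XI" "y = sigma_orbit p X \<phi> z" unfolding topspace_Yspace by blast
    define k where "k = - \<lfloor>log_coord p (snd z)\<rfloor>"
    define w where "w = shift k z"
    have w: "w \<in> topspace XI" unfolding w_def by (rule shift_closed[OF z(1)])
    have sz: "snd z \<in> {0<..<1}" "snd w \<in> {0<..<1}" using z(1) w unfolding topspace_XI by auto
    have "log_coord p (snd w) = log_coord p (snd z) - \<lfloor>log_coord p (snd z)\<rfloor>"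
      unfolding w_def shift_def snd_conv log_coord_powr[OF p_gt_1 sz(1)] by (simp add: k_def)
    then have "log_coord_inv p (log_coord p (snd w)) \<in> K" by (intro mono) linarith+
    then have "snd w \<in> K" using log_coord_inv_log_coord[OF p_gt_1 sz(2)] by simp
    then have "w \<in> topspace X \<times> K" using w unfolding topspace_XI by (auto simp: mem_Times_iff)
    moreover have "sigma_orbit p X \<phi> z = sigma_orbit p X \<phi> w"
      using sigma_orbit_eq_iff[OF z(1) w] w_def by blast
    ultimately show "y \<in> sigma_orbit p X \<phi> ` (topspace X \<times> K)" unfolding z(2) by (simp only: image_eqI)
  qed
  ultimately show ?thesis by (simp add: compact_space_def)
qed

text \<open>The map \<open>x \<mapsto> f\<^sub>p\<^sup>-\<^sup>a x\<close> with \<open>a = rX x\<close> is constant on the orbits of the closed subgroup and picks a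
  point of each orbit. So it induces a continuous injection of the quotient into the Hausdorff space \<open>X\<close>.\<close>

lemma Hausdorff_space_Zspace: "Hausdorff_space (Zspace p X \<phi>)"
proof -
  obtain r rX where r: "continuous_map (Gp_top p) Zhat_top r" "r \<one>\<^bsub>Gp p\<^esub> = \<one>\<^bsub>Zhat\<^esub>"
    "\<And>g. g \<in> carrier (Gp p) \<Longrightarrow> r (frob p \<otimes>\<^bsub>Gp p\<^esub> g) = Zhat_of_int 1 \<otimes>\<^bsub>Zhat\<^esub> r g"
    and rX: "continuous_map X Zhat_top rX"
    "\<And>c x. c \<in> frob_closure p \<Longrightarrow> x \<in> topspace X \<Longrightarrow> rX (\<phi> c x) = r c \<otimes>\<^bsub>Zhat\<^esub> rX x"
    by (rule torsor_retraction) blast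
  obtain w where w: "continuous_map Zhat_top (Gp_top p) w"
    "\<And>a. a \<in> carrier Zhat \<Longrightarrow> w a \<in> frob_closure p \<and> r (w a) = a"
    "\<And>c. c \<in> frob_closure p \<Longrightarrow> w (r c) = c"
    by (rule frob_power_map[OF prime_p r]) (assumption, rule that)
  have rXc: "rX x \<in> carrier Zhat" if "x \<in> topspace X" for x
    using continuous_map_image_subset_topspace[OF rX(1)] that by auto
  define d where "d x = w (inv\<^bsub>Zhat\<^esub> (rX x))" for x
  have dC: "d x \<in> frob_closure p" "r (d x) = inv\<^bsub>Zhat\<^esub> (rX x)" if "x \<in> topspace X" for x
    using w(2) rXc[OF that] by (simp_all add: d_def)
  have "continuous_map X (Gp_top p) (w \<circ> ((\<lambda>a. inv\<^bsub>Zhat\<^esub> a) \<circ> rX))"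
    by (intro continuous_map_compose[OF _ w(1)] continuous_map_compose[OF rX(1)] continuous_map_Zhat_inv)
  then have "continuous_map X (prod_topology (Gp_top p) X) (\<lambda>x. (d x, x))"
    by (intro continuous_map_pairedI continuous_map_id[unfolded id_def]) (simp add: d_def[abs_def] comp_def)
  from continuous_map_compose[OF this \<phi>_cont]
  have cont: "continuous_map X X (\<lambda>x. \<phi> (d x) x)" by (simp add: comp_def)
  have const: "\<phi> (d x) x = \<phi> (d y) y" if xy: "x \<in> topspace X" "y \<in> topspace X" "frob_orbit p \<phi> x = frob_orbit p \<phi> y" for x y
  proof -
    obtain c where c: "c \<in> frob_closure p" "y = \<phi> c x" using frob_orbit_eq_iff[OF xy(1,2)] xy(3) by blast
    have dyc: "d y \<otimes>\<^bsub>Gp p\<^esub> c \<in> frob_closure p" using dC(1)[OF xy(2)] c(1) by simp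
    have rc: "r c \<in> carrier Zhat" by (rule r_closed[OF prime_p r frob_closure_carrier[OF c(1)]])
    have "r (d y \<otimes>\<^bsub>Gp p\<^esub> c) = inv\<^bsub>Zhat\<^esub> (r c \<otimes>\<^bsub>Zhat\<^esub> rX x) \<otimes>\<^bsub>Zhat\<^esub> r c"
      using r_mult[OF prime_p r dC(1)[OF xy(2)] frob_closure_carrier[OF c(1)]] dC(2)[OF xy(2)] rX(2)[OF c(1) xy(1)] c(2) by simp
    also have "\<dots> = inv\<^bsub>Zhat\<^esub> (rX x)"
      using rc rXc[OF xy(1)] by (simp add: Z.inv_mult_group Z.m_assoc)
    also have "\<dots> = r (d x)" using dC(2)[OF xy(1)] by simp
    finally have "w (r (d y \<otimes>\<^bsub>Gp p\<^esub> c)) = w (r (d x))" by (rule arg_cong)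
    then have dd: "d y \<otimes>\<^bsub>Gp p\<^esub> c = d x" unfolding w(3)[OF dyc] w(3)[OF dC(1)[OF xy(1)]] .
    have "\<phi> (d y \<otimes>\<^bsub>Gp p\<^esub> c) x = \<phi> (d y) (\<phi> c x)"
      by (rule \<phi>_mult[OF frob_closure_carrier[OF dC(1)[OF xy(2)]] frob_closure_carrier[OF c(1)] xy(1)])
    then show ?thesis unfolding dd c(2)[symmetric] .
  qed
  obtain F where F: "continuous_map (Zspace p X \<phi>) X F" "\<forall>x\<in>topspace X. F (frob_orbit p \<phi> x) = \<phi> (d x) x"
    using quotient_map_lift[OF quotient_map_Zspace cont, OF const] by blast
  have "inj_on F (topspace (Zspace p X \<phi>))"
  proof (rule inj_onI)
    fix u v assume "u \<in> topspace (Zspace p X \<phi>)" "v \<in> topspace (Zspace p X \<phi>)" and eq: "F u = F v"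
    then obtain x y where xy: "x \<in> topspace X" "y \<in> topspace X" "u = frob_orbit p \<phi> x" "v = frob_orbit p \<phi> y"
      unfolding topspace_Zspace by blast
    have *: "frob_orbit p \<phi> x = frob_orbit p \<phi> (\<phi> (d x) x)" if "x \<in> topspace X" for x
      using frob_orbit_eq_iff[OF that \<phi>_closed[OF frob_closure_carrier[OF dC(1)[OF that]] that]] dC(1)[OF that] by blast
    have "\<phi> (d x) x = \<phi> (d y) y" using eq F(2) xy by simp
    then show "u = v" using *[OF xy(1)] *[OF xy(2)] xy by simp
  qed
  then show ?thesis by (rule Hausdorff_space_of_continuous_injection[OF F(1) _ Hausdorff_X])
qed

text \<open>If \<open>(x, \<rho>)\<close> and \<open>(c x, \<rho>')\<close> with \<open>c\<close> in the closed subgroup have the same image in the solenoid, then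
  \<open>r c\<close> and the difference of the logarithmic coordinates are the same integer \<open>k\<close>; hence \<open>c = f\<^sub>p\<^sup>k\<close> by
  injectivity of \<open>r\<close>. Surjectivity of \<open>r\<close> on the closed subgroup gives all points over a given orbit.\<close>

lemma Yspace_trivialization:
  obtains F rX where "homeomorphic_map (Yspace p X \<phi>) (prod_topology (Zspace p X \<phi>) solenoid_top) F"
    "\<And>x \<rho>. x \<in> topspace X \<Longrightarrow> \<rho> \<in> {0<..<1} \<Longrightarrow>
       F (sigma_orbit p X \<phi> (x, \<rho>)) = (frob_orbit p \<phi> x, solenoid_class (rX x, log_coord p \<rho>))"
    "\<And>x. x \<in> topspace X \<Longrightarrow> rX x \<in> carrier Zhat"
    "\<And>x n. x \<in> topspace X \<Longrightarrow> rX (\<phi> (frob p [^]\<^bsub>Gp p\<^esub> (n::int)) x) = Zhat_of_int n \<otimes>\<^bsub>Zhat\<^esub> rX x"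
    "Hausdorff_space (Yspace p X \<phi>)"
proof -
  obtain r rX where r: "continuous_map (Gp_top p) Zhat_top r" "r \<one>\<^bsub>Gp p\<^esub> = \<one>\<^bsub>Zhat\<^esub>"
    "\<And>g. g \<in> carrier (Gp p) \<Longrightarrow> r (frob p \<otimes>\<^bsub>Gp p\<^esub> g) = Zhat_of_int 1 \<otimes>\<^bsub>Zhat\<^esub> r g"
    and rX: "continuous_map X Zhat_top rX"
    "\<And>c x. c \<in> frob_closure p \<Longrightarrow> x \<in> topspace X \<Longrightarrow> rX (\<phi> c x) = r c \<otimes>\<^bsub>Zhat\<^esub> rX x"
    by (rule torsor_retraction) blast
  have inj: "inj_on r (frob_closure p)" by (rule r_inj[OF prime_p r])
  have image: "r ` frob_closure p = carrier Zhat" by (rule r_image[OF prime_p r])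
  have rXc: "rX x \<in> carrier Zhat" if "x \<in> topspace X" for x
    using continuous_map_image_subset_topspace[OF rX(1)] that by auto
  have rXf: "rX (\<phi> (frob p [^]\<^bsub>Gp p\<^esub> n) x) = Zhat_of_int n \<otimes>\<^bsub>Zhat\<^esub> rX x" if "x \<in> topspace X" for n :: int and x
    using rX(2)[OF frob_pow_in_closure[OF prime_p] that] r_frob_pow[OF prime_p r] by simp
  define \<Psi> where "\<Psi> z = (frob_orbit p \<phi> (fst z), solenoid_class (rX (fst z), log_coord p (snd z)))" for z
  have cover: "(rX x, t) \<in> carrier solenoid_cover" if "x \<in> topspace X" for x t
    using rXc[OF that] by simp
  have \<Psi>_cont: "continuous_map XI (prod_topology (Zspace p X \<phi>) solenoid_top) \<Psi>"
  proof -
    have 1: "continuous_map XI (Zspace p X \<phi>) (\<lambda>z. frob_orbit p \<phi> (fst z))"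
      by (rule continuous_map_comp_fst[OF quotient_imp_continuous_map[OF quotient_map_Zspace]])
    have "continuous_map (top_of_set {0<..<1}) euclideanreal (log_coord p)"
      using continuous_on_log_coord[OF p_gt_1] by simp
    then have "continuous_map XI solenoid_cover_top (\<lambda>z. (rX (fst z), log_coord p (snd z)))"
      by (intro continuous_map_pairedI continuous_map_comp_fst[OF rX(1)] continuous_map_comp_snd)
    from continuous_map_compose[OF this continuous_map_solenoid_class]
    have 2: "continuous_map XI solenoid_top (\<lambda>z. solenoid_class (rX (fst z), log_coord p (snd z)))" by (simp add: comp_def)
    show ?thesis using continuous_map_pairedI[OF 1 2] by (simp add: \<Psi>_def[abs_def])
  qed
  have \<Psi>_eq: "\<Psi> z = \<Psi> w \<longleftrightarrow> sigma_orbit p X \<phi> z = sigma_orbit p X \<phi> w" if z: "z \<in> topspace XI" and w: "w \<in> topspace XI" for z w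
  proof -
    obtain x \<rho> where x: "z = (x, \<rho>)" "x \<in> topspace X" "\<rho> \<in> {0<..<1}" using z unfolding topspace_XI by blast
    obtain y \<rho>' where y: "w = (y, \<rho>')" "y \<in> topspace X" "\<rho>' \<in> {0<..<1}" using w unfolding topspace_XI by blast
    have "\<Psi> z = \<Psi> w \<longleftrightarrow> (\<exists>c\<in>frob_closure p. y = \<phi> c x) \<and> (\<exists>k. (rX y, log_coord p \<rho>') = diag k \<otimes>\<^bsub>solenoid_cover\<^esub> (rX x, log_coord p \<rho>))"
      unfolding \<Psi>_def x(1) y(1) fst_conv snd_conv prod.inject frob_orbit_eq_iff[OF x(2) y(2)]
        solenoid_class_eq_iff[OF cover[OF x(2)] cover[OF y(2)]] ..
    also have "\<dots> \<longleftrightarrow> (\<exists>k. w = shift k z)"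
    proof
      assume "(\<exists>c\<in>frob_closure p. y = \<phi> c x) \<and> (\<exists>k. (rX y, log_coord p \<rho>') = diag k \<otimes>\<^bsub>solenoid_cover\<^esub> (rX x, log_coord p \<rho>))"
      then obtain c k where c: "c \<in> frob_closure p" "y = \<phi> c x"
        and k: "rX y = Zhat_of_int k \<otimes>\<^bsub>Zhat\<^esub> rX x" "log_coord p \<rho>' = of_int k + log_coord p \<rho>"
        unfolding solenoid_cover_mult prod.inject by blast
      have "r c \<otimes>\<^bsub>Zhat\<^esub> rX x = Zhat_of_int k \<otimes>\<^bsub>Zhat\<^esub> rX x" using k(1) rX(2)[OF c(1) x(2)] c(2) by simp
      then have "r c = Zhat_of_int k"
        using rXc[OF x(2)] r_closed[OF prime_p r frob_closure_carrier[OF c(1)]] by simp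
      then have "r c = r (frob p [^]\<^bsub>Gp p\<^esub> k)" using r_frob_pow[OF prime_p r] by simp
      then have "c = frob p [^]\<^bsub>Gp p\<^esub> k" by (rule inj_onD[OF inj _ c(1) frob_pow_in_closure[OF prime_p]])
      moreover have "\<rho>' = \<rho> powr (real p powr of_int k)"
        using log_coord_powr[OF p_gt_1 x(3)] powr_unit_interval[OF p_gt_1 x(3)] k(2)
        by (intro log_coord_inj[OF p_gt_1 y(3)]) simp_all
      ultimately have "w = shift k z" using c(2) by (simp add: shift_def x(1) y(1))
      then show "\<exists>k. w = shift k z" ..
    next
      assume "\<exists>k. w = shift k z"
      then obtain k where k: "y = \<phi> (frob p [^]\<^bsub>Gp p\<^esub> k) x" "\<rho>' = \<rho> powr (real p powr of_int k)"
        by (auto simp: shift_def x(1) y(1))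
      have "(rX y, log_coord p \<rho>') = diag k \<otimes>\<^bsub>solenoid_cover\<^esub> (rX x, log_coord p \<rho>)"
        unfolding solenoid_cover_mult k using rXf[OF x(2)] log_coord_powr[OF p_gt_1 x(3)] by simp
      then show "(\<exists>c\<in>frob_closure p. y = \<phi> c x) \<and> (\<exists>k. (rX y, log_coord p \<rho>') = diag k \<otimes>\<^bsub>solenoid_cover\<^esub> (rX x, log_coord p \<rho>))"
        using k(1) frob_pow_in_closure[OF prime_p] by blast
    qed
    also have "\<dots> \<longleftrightarrow> sigma_orbit p X \<phi> z = sigma_orbit p X \<phi> w" by (rule sigma_orbit_eq_iff[OF z w, symmetric])
    finally show ?thesis .
  qed
  obtain F where F: "continuous_map (Yspace p X \<phi>) (prod_topology (Zspace p X \<phi>) solenoid_top) F"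
    "\<forall>z\<in>topspace XI. F (sigma_orbit p X \<phi> z) = \<Psi> z"
    using quotient_map_lift[OF quotient_map_Yspace \<Psi>_cont] \<Psi>_eq by blast
  have haus: "Hausdorff_space (prod_topology (Zspace p X \<phi>) solenoid_top)"
    using Hausdorff_space_Zspace Hausdorff_space_solenoid_top by (simp add: Hausdorff_space_prod_topology)
  have inj_F: "inj_on F (topspace (Yspace p X \<phi>))"
  proof (rule inj_onI)
    fix u v assume "u \<in> topspace (Yspace p X \<phi>)" "v \<in> topspace (Yspace p X \<phi>)" and eq: "F u = F v"
    then obtain z w where zw: "z \<in> topspace XI" "w \<in> topspace XI" "u = sigma_orbit p X \<phi> z" "v = sigma_orbit p X \<phi> w"
      unfolding topspace_Yspace by blast
    then show "u = v" using eq F(2) \<Psi>_eq[OF zw(1,2)] by simp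
  qed
  have surj_F: "F ` topspace (Yspace p X \<phi>) = topspace (prod_topology (Zspace p X \<phi>) solenoid_top)"
  proof (rule subset_antisym[OF continuous_map_image_subset_topspace[OF F(1)]], rule subsetI)
    fix y assume "y \<in> topspace (prod_topology (Zspace p X \<phi>) solenoid_top)"
    then obtain u s where us: "y = (u, s)" "u \<in> topspace (Zspace p X \<phi>)" "s \<in> carrier solenoid" by auto
    obtain x where x: "x \<in> topspace X" "u = frob_orbit p \<phi> x" using us(2) unfolding topspace_Zspace by blast
    obtain z where z: "z \<in> carrier solenoid_cover" "s = solenoid_class z" by (rule solenoid_cases[OF us(3)])
    obtain a t where at: "z = (a, t)" "a \<in> carrier Zhat" using z(1) by auto
    have "a \<otimes>\<^bsub>Zhat\<^esub> inv\<^bsub>Zhat\<^esub> rX x \<in> r ` frob_closure p" unfolding image using at(2) rXc[OF x(1)] by simp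
    then obtain c where c: "c \<in> frob_closure p" "r c = a \<otimes>\<^bsub>Zhat\<^esub> inv\<^bsub>Zhat\<^esub> rX x" by force
    have x': "\<phi> c x \<in> topspace X" by (rule \<phi>_closed[OF frob_closure_carrier[OF c(1)] x(1)])
    have "rX (\<phi> c x) = a" using rX(2)[OF c(1) x(1)] c(2) at(2) rXc[OF x(1)] by (simp add: Z.m_assoc)
    moreover have "frob_orbit p \<phi> (\<phi> c x) = u" using frob_orbit_eq_iff[OF x(1) x'] c(1) x(2) by blast
    ultimately have "\<Psi> (\<phi> c x, log_coord_inv p t) = y"
      using log_coord_log_coord_inv[OF p_gt_1] by (simp add: \<Psi>_def us(1) z(2) at(1))
    moreover have "(\<phi> c x, log_coord_inv p t) \<in> topspace XI"
      unfolding topspace_XI using x' log_coord_inv_range[OF p_gt_1] by blast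
    ultimately show "y \<in> F ` topspace (Yspace p X \<phi>)" using F(2) unfolding topspace_Yspace by (metis image_eqI)
  qed
  have homeo: "homeomorphic_map (Yspace p X \<phi>) (prod_topology (Zspace p X \<phi>) solenoid_top) F"
    by (rule continuous_imp_homeomorphic_map[OF F(1) compact_space_Yspace haus surj_F inj_F])
  have "Hausdorff_space (Yspace p X \<phi>)"
    by (rule Hausdorff_space_of_continuous_injection[OF F(1) inj_F haus])
  moreover have "F (sigma_orbit p X \<phi> (x, \<rho>)) = (frob_orbit p \<phi> x, solenoid_class (rX x, log_coord p \<rho>))"
    if "x \<in> topspace X" "\<rho> \<in> {0<..<1}" for x \<rho>
    using F(2) that by (auto simp: \<Psi>_def)
  ultimately show ?thesis using that[OF homeo _ rXc rXf] by blast
qed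

text \<open>The action of the solenoid on \<open>Y\<close> is transported from the translation on the second factor of
  \<open>Z \<times> S\<close>. On classes of \<open>(n, s)\<close> with integral \<open>n\<close> it has the stated form because \<open>rX\<close> and the logarithmic
  coordinate turn \<open>f\<^sub>p\<^sup>n\<close> and \<open>\<rho> \<mapsto> \<rho> powr (p powr s)\<close> into adding \<open>n\<close> and \<open>s\<close>.\<close>

lemma solenoid_bundle:
  "Hausdorff_space (Yspace p X \<phi>) \<and>
   (\<exists>\<tau> \<pi>. principal_bundle solenoid solenoid_top \<tau> (Yspace p X \<phi>) (Zspace p X \<phi>) \<pi> \<and>
      (\<forall>x\<in>topspace X. \<forall>\<rho>\<in>{0<..<1::real}.
         \<pi> (sigma_orbit p X \<phi> (x, \<rho>)) = frob_orbit p \<phi> x \<and>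
         (\<forall>(n::int) (s::real).
            \<tau> (solenoid_class (Zhat_of_int n, s)) (sigma_orbit p X \<phi> (x, \<rho>)) =
            sigma_orbit p X \<phi> (\<phi> (frob p [^]\<^bsub>Gp p\<^esub> n) x, \<rho> powr (real p powr s)))))"
proof -
  obtain F rX where homeo: "homeomorphic_map (Yspace p X \<phi>) (prod_topology (Zspace p X \<phi>) solenoid_top) F"
    and F: "\<And>x \<rho>. x \<in> topspace X \<Longrightarrow> \<rho> \<in> {0<..<1} \<Longrightarrow>
       F (sigma_orbit p X \<phi> (x, \<rho>)) = (frob_orbit p \<phi> x, solenoid_class (rX x, log_coord p \<rho>))"
    and rXc: "\<And>x. x \<in> topspace X \<Longrightarrow> rX x \<in> carrier Zhat"
    and rXf: "\<And>x n. x \<in> topspace X \<Longrightarrow> rX (\<phi> (frob p [^]\<^bsub>Gp p\<^esub> (n::int)) x) = Zhat_of_int n \<otimes>\<^bsub>Zhat\<^esub> rX x"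
    and haus: "Hausdorff_space (Yspace p X \<phi>)"
    by (rule Yspace_trivialization) blast
  obtain H where FH: "homeomorphic_maps (Yspace p X \<phi>) (prod_topology (Zspace p X \<phi>) solenoid_top) F H"
    using homeo unfolding homeomorphic_map_maps by blast
  interpret S: group solenoid by (rule group_solenoid)
  let ?Y = "Yspace p X \<phi>" and ?Z = "Zspace p X \<phi>"
  have Fcont: "continuous_map ?Y (prod_topology ?Z solenoid_top) F" and Hcont: "continuous_map (prod_topology ?Z solenoid_top) ?Y H"
    and HF: "\<And>y. y \<in> topspace ?Y \<Longrightarrow> H (F y) = y"
    and FHid: "\<And>u. u \<in> topspace ?Z \<times> carrier solenoid \<Longrightarrow> F (H u) = u"
    using FH unfolding homeomorphic_maps_def by auto
  have Fy: "fst (F y) \<in> topspace ?Z" "snd (F y) \<in> carrier solenoid" if "y \<in> topspace ?Y" for y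
    using continuous_map_image_subset_topspace[OF Fcont] that by auto
  have Hu: "H u \<in> topspace ?Y" if "u \<in> topspace ?Z \<times> carrier solenoid" for u
    using continuous_map_image_subset_topspace[OF Hcont] that by auto
  define \<pi> where "\<pi> y = fst (F y)" for y
  define \<tau> where "\<tau> s = (\<lambda>y\<in>topspace ?Y. H (fst (F y), s \<otimes>\<^bsub>solenoid\<^esub> snd (F y)))" for s
  have F\<tau>: "F (\<tau> s y) = (fst (F y), s \<otimes>\<^bsub>solenoid\<^esub> snd (F y))" and \<tau>_closed: "\<tau> s y \<in> topspace ?Y"
    if "s \<in> carrier solenoid" "y \<in> topspace ?Y" for s y
    using that Fy[OF that(2)] by (auto simp: \<tau>_def intro!: FHid Hu)
  have act: "group_action solenoid (topspace ?Y) \<tau>"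
  proof (rule group_actionI[OF group_solenoid])
    show "\<tau> s \<in> extensional (topspace ?Y)" for s by (simp add: \<tau>_def)
    show "\<tau> s y \<in> topspace ?Y" if "s \<in> carrier solenoid" "y \<in> topspace ?Y" for s y
      by (rule \<tau>_closed[OF that])
    show "\<tau> \<one>\<^bsub>solenoid\<^esub> y = y" if "y \<in> topspace ?Y" for y
      using that Fy[OF that] HF[OF that] by (simp add: \<tau>_def)
    fix s t y assume st: "s \<in> carrier solenoid" "t \<in> carrier solenoid" and y: "y \<in> topspace ?Y"
    have "\<tau> s (\<tau> t y) = H (fst (F y), s \<otimes>\<^bsub>solenoid\<^esub> (t \<otimes>\<^bsub>solenoid\<^esub> snd (F y)))"
      using \<tau>_closed[OF st(2) y] F\<tau>[OF st(2) y] by (simp add: \<tau>_def[of s])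
    then show "\<tau> (s \<otimes>\<^bsub>solenoid\<^esub> t) y = \<tau> s (\<tau> t y)"
      using y st Fy[OF y] by (simp add: \<tau>_def[of "s \<otimes>\<^bsub>solenoid\<^esub> t"] S.m_assoc)
  qed
  have \<tau>_cont: "continuous_map (prod_topology solenoid_top ?Y) ?Y (\<lambda>(s, y). \<tau> s y)"
  proof -
    have fst_F: "continuous_map ?Y ?Z (\<lambda>y. fst (F y))" and snd_F: "continuous_map ?Y solenoid_top (\<lambda>y. snd (F y))"
      using Fcont by (simp_all add: continuous_map_pairwise comp_def)
    have "continuous_map (prod_topology solenoid_top ?Y) (prod_topology solenoid_top solenoid_top) (\<lambda>z. (fst z, snd (F (snd z))))"
      by (rule continuous_map_pairedI[OF continuous_map_fst continuous_map_comp_snd[OF snd_F]])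
    from continuous_map_compose[OF this continuous_map_solenoid_mult]
    have "continuous_map (prod_topology solenoid_top ?Y) solenoid_top (\<lambda>z. fst z \<otimes>\<^bsub>solenoid\<^esub> snd (F (snd z)))" by (simp add: comp_def)
    from continuous_map_compose[OF continuous_map_pairedI[OF continuous_map_comp_snd[OF fst_F] this] Hcont]
    have "continuous_map (prod_topology solenoid_top ?Y) ?Y (\<lambda>z. H (fst (F (snd z)), fst z \<otimes>\<^bsub>solenoid\<^esub> snd (F (snd z))))" by (simp add: comp_def)
    then show ?thesis by (rule continuous_map_eq) (auto simp: \<tau>_def)
  qed
  have principal: "principal_bundle solenoid solenoid_top \<tau> ?Y ?Z \<pi>"
    unfolding principal_bundle_def continuous_group_action_def
  proof (intro conjI act \<tau>_cont ballI)
    show "continuous_map ?Y ?Z \<pi>" using Fcont by (simp add: continuous_map_pairwise comp_def \<pi>_def[abs_def])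
    fix z assume z: "z \<in> topspace ?Z"
    have all: "{y \<in> topspace ?Y. \<pi> y \<in> topspace ?Z} = topspace ?Y" using Fy(1) by (auto simp: \<pi>_def)
    have "homeomorphic_map (prod_topology (subtopology ?Z (topspace ?Z)) solenoid_top)
        (subtopology ?Y {y \<in> topspace ?Y. \<pi> y \<in> topspace ?Z}) H"
      unfolding all using FH by (simp add: homeomorphic_maps_map)
    moreover have "\<pi> (H (u, s)) = u" if "u \<in> topspace ?Z" "s \<in> carrier solenoid" for u s
      using FHid[of "(u, s)"] that by (simp add: \<pi>_def)
    moreover have "H (u, t \<otimes>\<^bsub>solenoid\<^esub> s) = \<tau> t (H (u, s))" if "u \<in> topspace ?Z" "s \<in> carrier solenoid" "t \<in> carrier solenoid" for u s t
      using FHid[of "(u, s)"] Hu[of "(u, s)"] that by (simp add: \<tau>_def)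
    ultimately show "\<exists>U h. openin ?Z U \<and> z \<in> U \<and>
        homeomorphic_map (prod_topology (subtopology ?Z U) solenoid_top) (subtopology ?Y {y \<in> topspace ?Y. \<pi> y \<in> U}) h \<and>
        (\<forall>u\<in>U. \<forall>s\<in>carrier solenoid. \<pi> (h (u, s)) = u) \<and>
        (\<forall>u\<in>U. \<forall>s\<in>carrier solenoid. \<forall>t\<in>carrier solenoid. h (u, t \<otimes>\<^bsub>solenoid\<^esub> s) = \<tau> t (h (u, s)))"
      using z by (intro exI[of _ "topspace ?Z"] exI[of _ H]) blast
  qed
  have "\<tau> (solenoid_class (Zhat_of_int n, s)) (sigma_orbit p X \<phi> (x, \<rho>)) =
      sigma_orbit p X \<phi> (\<phi> (frob p [^]\<^bsub>Gp p\<^esub> n) x, \<rho> powr (real p powr s))"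
    if x: "x \<in> topspace X" and \<rho>: "\<rho> \<in> {0<..<1}" for x \<rho> s and n :: int
  proof -
    let ?x = "\<phi> (frob p [^]\<^bsub>Gp p\<^esub> n) x" and ?\<rho> = "\<rho> powr (real p powr s)"
    have x': "?x \<in> topspace X" by (rule \<phi>_closed[OF frob_pow_closed[OF prime_p] x])
    have \<rho>': "?\<rho> \<in> {0<..<1}" by (rule powr_unit_interval[OF p_gt_1 \<rho>])
    have y: "sigma_orbit p X \<phi> (x, \<rho>) \<in> topspace ?Y" "sigma_orbit p X \<phi> (?x, ?\<rho>) \<in> topspace ?Y"
      unfolding topspace_Yspace topspace_XI using x x' \<rho> \<rho>' by blast+
    have cov: "(Zhat_of_int n, s) \<in> carrier solenoid_cover" "(rX x, log_coord p \<rho>) \<in> carrier solenoid_cover"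
      using rXc[OF x] by simp_all
    have "F (\<tau> (solenoid_class (Zhat_of_int n, s)) (sigma_orbit p X \<phi> (x, \<rho>))) =
        (frob_orbit p \<phi> x, solenoid_class ((Zhat_of_int n, s) \<otimes>\<^bsub>solenoid_cover\<^esub> (rX x, log_coord p \<rho>)))"
      unfolding F\<tau>[OF solenoid_class_closed[OF cov(1)] y(1)] F[OF x \<rho>] solenoid_class_mult[OF cov] by simp
    also have "\<dots> = (frob_orbit p \<phi> ?x, solenoid_class (rX ?x, log_coord p ?\<rho>))"
      unfolding solenoid_cover_mult rXf[OF x] log_coord_powr[OF p_gt_1 \<rho>]
      using frob_orbit_eq_iff[OF x x'] frob_pow_in_closure[OF prime_p] by blast
    also have "\<dots> = F (sigma_orbit p X \<phi> (?x, ?\<rho>))" by (rule F[OF x' \<rho>', symmetric])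
    finally show ?thesis
      using HF[OF \<tau>_closed[OF solenoid_class_closed[OF cov(1)] y(1)]] HF[OF y(2)] by metis
  qed
  moreover have "\<pi> (sigma_orbit p X \<phi> (x, \<rho>)) = frob_orbit p \<phi> x" if "x \<in> topspace X" "\<rho> \<in> {0<..<1}" for x \<rho>
    using F[OF that] by (simp add: \<pi>_def)
  ultimately show ?thesis using haus principal by blast
qed

end

section \<open>Adeles and ideles\<close>

context
  fixes l :: nat
  assumes l: "prime l"
begin

interpretation Q: cring "Qp l" by (rule cring_Qp[OF l])

lemma Qp_ops:
  "a \<in> carrier (Qp l) \<Longrightarrow> b \<in> carrier (Qp l) \<Longrightarrow> a \<otimes>\<^bsub>Qp l\<^esub> b \<in> carrier (Qp l)"
  "a \<in> carrier (Qp l) \<Longrightarrow> b \<in> carrier (Qp l) \<Longrightarrow> a \<oplus>\<^bsub>Qp l\<^esub> b \<in> carrier (Qp l)"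
  "\<one>\<^bsub>Qp l\<^esub> \<in> carrier (Qp l)" "\<zero>\<^bsub>Qp l\<^esub> \<in> carrier (Qp l)"
  "a \<in> carrier (Qp l) \<Longrightarrow> \<one>\<^bsub>Qp l\<^esub> \<otimes>\<^bsub>Qp l\<^esub> a = a"
  "a \<in> carrier (Qp l) \<Longrightarrow> a \<otimes>\<^bsub>Qp l\<^esub> \<one>\<^bsub>Qp l\<^esub> = a"
  "a \<in> carrier (Qp l) \<Longrightarrow> \<zero>\<^bsub>Qp l\<^esub> \<otimes>\<^bsub>Qp l\<^esub> a = \<zero>\<^bsub>Qp l\<^esub>"
  "a \<in> carrier (Qp l) \<Longrightarrow> a \<otimes>\<^bsub>Qp l\<^esub> \<zero>\<^bsub>Qp l\<^esub> = \<zero>\<^bsub>Qp l\<^esub>"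
  by simp_all

lemma Qp_m_assoc:
  "a \<in> carrier (Qp l) \<Longrightarrow> b \<in> carrier (Qp l) \<Longrightarrow> c \<in> carrier (Qp l) \<Longrightarrow>
    a \<otimes>\<^bsub>Qp l\<^esub> b \<otimes>\<^bsub>Qp l\<^esub> c = a \<otimes>\<^bsub>Qp l\<^esub> (b \<otimes>\<^bsub>Qp l\<^esub> c)"
  by (rule Q.m_assoc)

lemma Qp_m_comm:
  "a \<in> carrier (Qp l) \<Longrightarrow> b \<in> carrier (Qp l) \<Longrightarrow> a \<otimes>\<^bsub>Qp l\<^esub> b = b \<otimes>\<^bsub>Qp l\<^esub> a"
  by (rule Q.m_comm)

lemma Qp_l_distr:
  "a \<in> carrier (Qp l) \<Longrightarrow> b \<in> carrier (Qp l) \<Longrightarrow> c \<in> carrier (Qp l) \<Longrightarrow>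
    (a \<oplus>\<^bsub>Qp l\<^esub> b) \<otimes>\<^bsub>Qp l\<^esub> c = a \<otimes>\<^bsub>Qp l\<^esub> c \<oplus>\<^bsub>Qp l\<^esub> b \<otimes>\<^bsub>Qp l\<^esub> c"
  by (rule Q.l_distr)

lemma padic_norm_zero: "padic_norm l \<zero>\<^bsub>Qp l\<^esub> = 0"
  using padic_norm_eq_0_iff[OF l Qp_ops(4)] by simp

lemma Qp_mult_eq_zero_iff:
  "a \<in> carrier (Qp l) \<Longrightarrow> b \<in> carrier (Qp l) \<Longrightarrow>
    a \<otimes>\<^bsub>Qp l\<^esub> b = \<zero>\<^bsub>Qp l\<^esub> \<longleftrightarrow> a = \<zero>\<^bsub>Qp l\<^esub> \<or> b = \<zero>\<^bsub>Qp l\<^esub>"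
  using padic_norm_mult[OF l, of a b] padic_norm_eq_0_iff[OF l] Qp_ops(1)[of a b]
  by (metis mult_eq_0_iff)

end

lemma adele_simps:
  "prime l \<Longrightarrow> fst (x \<otimes>\<^bsub>adele_ring\<^esub> y) l = fst x l \<otimes>\<^bsub>Qp l\<^esub> fst y l"
  "snd (x \<otimes>\<^bsub>adele_ring\<^esub> y) = snd x * snd y"
  "prime l \<Longrightarrow> fst (x \<oplus>\<^bsub>adele_ring\<^esub> y) l = fst x l \<oplus>\<^bsub>Qp l\<^esub> fst y l"
  "snd (x \<oplus>\<^bsub>adele_ring\<^esub> y) = snd x + snd y"
  "prime l \<Longrightarrow> fst \<one>\<^bsub>adele_ring\<^esub> l = \<one>\<^bsub>Qp l\<^esub>" "snd \<one>\<^bsub>adele_ring\<^esub> = 1"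
  "prime l \<Longrightarrow> fst \<zero>\<^bsub>adele_ring\<^esub> l = \<zero>\<^bsub>Qp l\<^esub>" "snd \<zero>\<^bsub>adele_ring\<^esub> = 0"
  by (simp_all add: adele_ring_def case_prod_unfold)

lemma adele_extensional:
  "fst (x \<otimes>\<^bsub>adele_ring\<^esub> y) \<in> extensional primes"
  "fst (x \<oplus>\<^bsub>adele_ring\<^esub> y) \<in> extensional primes"
  "fst \<one>\<^bsub>adele_ring\<^esub> \<in> extensional primes"
  "fst \<zero>\<^bsub>adele_ring\<^esub> \<in> extensional primes"
  by (simp_all add: adele_ring_def case_prod_unfold)

lemma carrier_adele_ring:
  "x \<in> carrier adele_ring \<longleftrightarrow> fst x \<in> extensional primes \<and> (\<forall>l. prime l \<longrightarrow> fst x l \<in> carrier (Qp l)) \<and>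
    finite {l. prime l \<and> \<not> padic_norm l (fst x l) \<le> 1}"
proof -
  have "{l. prime l \<and> fst x l \<notin> carrier (Zp l)} = {l. prime l \<and> \<not> padic_norm l (fst x l) \<le> 1}"
    if "\<forall>l. prime l \<longrightarrow> fst x l \<in> carrier (Qp l)"
    using that by auto
  then show ?thesis
    by (cases x) (auto simp: adele_ring_def PiE_iff)
qed

lemma adele_closed: "x \<in> carrier adele_ring \<Longrightarrow> prime l \<Longrightarrow> fst x l \<in> carrier (Qp l)"
  by (simp add: carrier_adele_ring)

lemma adele_eqI:
  assumes "fst x \<in> extensional primes" "fst y \<in> extensional primes"
    and "\<And>l. prime l \<Longrightarrow> fst x l = fst y l" "snd x = snd y"
  shows "x = y"
proof -
  have "fst x = fst y" by (rule extensionalityI[OF assms(1,2)]) (simp add: assms(3))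
  then show ?thesis using assms(4) by (simp add: prod_eq_iff)
qed

lemma adele_ext: "x \<in> carrier adele_ring \<Longrightarrow> fst x \<in> extensional primes"
  by (simp add: carrier_adele_ring)

lemma adele_mult_closed:
  assumes x: "x \<in> carrier adele_ring" and y: "y \<in> carrier adele_ring"
  shows "x \<otimes>\<^bsub>adele_ring\<^esub> y \<in> carrier adele_ring"
proof -
  have "{l. prime l \<and> \<not> padic_norm l (fst (x \<otimes>\<^bsub>adele_ring\<^esub> y) l) \<le> 1} \<subseteq>
      {l. prime l \<and> \<not> padic_norm l (fst x l) \<le> 1} \<union> {l. prime l \<and> \<not> padic_norm l (fst y l) \<le> 1}"
  proof (rule subsetI, rule ccontr)
    fix l assume l: "l \<in> {l. prime l \<and> \<not> padic_norm l (fst (x \<otimes>\<^bsub>adele_ring\<^esub> y) l) \<le> 1}"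
      "l \<notin> {l. prime l \<and> \<not> padic_norm l (fst x l) \<le> 1} \<union> {l. prime l \<and> \<not> padic_norm l (fst y l) \<le> 1}"
    then have pl: "prime l" and "padic_norm l (fst x l) \<le> 1" "padic_norm l (fst y l) \<le> 1" by auto
    then have "padic_norm l (fst x l) * padic_norm l (fst y l) \<le> 1"
      using padic_norm_nonneg[OF pl adele_closed[OF y pl]] by (simp add: mult_le_one)
    then show False
      using l(1) by (simp add: pl adele_simps padic_norm_mult[OF pl adele_closed[OF x pl] adele_closed[OF y pl]])
  qed
  then show ?thesis
    using x y finite_subset by (auto simp: carrier_adele_ring adele_simps adele_extensional Qp_ops)
qed

lemma adele_add_closed:
  assumes x: "x \<in> carrier adele_ring" and y: "y \<in> carrier adele_ring"
  shows "x \<oplus>\<^bsub>adele_ring\<^esub> y \<in> carrier adele_ring"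
proof -
  have "{l. prime l \<and> \<not> padic_norm l (fst (x \<oplus>\<^bsub>adele_ring\<^esub> y) l) \<le> 1} \<subseteq>
      {l. prime l \<and> \<not> padic_norm l (fst x l) \<le> 1} \<union> {l. prime l \<and> \<not> padic_norm l (fst y l) \<le> 1}"
  proof (rule subsetI, rule ccontr)
    fix l assume l: "l \<in> {l. prime l \<and> \<not> padic_norm l (fst (x \<oplus>\<^bsub>adele_ring\<^esub> y) l) \<le> 1}"
      "l \<notin> {l. prime l \<and> \<not> padic_norm l (fst x l) \<le> 1} \<union> {l. prime l \<and> \<not> padic_norm l (fst y l) \<le> 1}"
    then have pl: "prime l" and "padic_norm l (fst x l) \<le> 1" "padic_norm l (fst y l) \<le> 1" by auto
    then have "padic_norm l (fst x l \<oplus>\<^bsub>Qp l\<^esub> fst y l) \<le> 1"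
      using padic_norm_add_le[of l "fst x l" "fst y l"] adele_closed[OF x] adele_closed[OF y] by fastforce
    then show False using l(1) by (simp add: pl adele_simps)
  qed
  then show ?thesis
    using x y finite_subset by (auto simp: carrier_adele_ring adele_simps adele_extensional Qp_ops)
qed

lemma adele_one_closed: "\<one>\<^bsub>adele_ring\<^esub> \<in> carrier adele_ring"
proof -
  have "{l. prime l \<and> \<not> padic_norm l (fst \<one>\<^bsub>adele_ring\<^esub> l) \<le> 1} = {}"
    by (simp add: adele_simps padic_norm_one cong: conj_cong)
  then show ?thesis
    by (simp only: carrier_adele_ring) (simp add: adele_simps adele_extensional Qp_ops)
qed

lemma adele_zero_closed: "\<zero>\<^bsub>adele_ring\<^esub> \<in> carrier adele_ring"
proof -
  have "{l. prime l \<and> \<not> padic_norm l (fst \<zero>\<^bsub>adele_ring\<^esub> l) \<le> 1} = {}"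
    by (simp add: adele_simps padic_norm_zero cong: conj_cong)
  then show ?thesis
    by (simp only: carrier_adele_ring) (simp add: adele_simps adele_extensional Qp_ops)
qed

lemma comm_monoid_adele: "comm_monoid adele_ring"
proof (rule comm_monoidI)
  fix x y z assume x: "x \<in> carrier adele_ring" and y: "y \<in> carrier adele_ring"
  show "x \<otimes>\<^bsub>adele_ring\<^esub> y = y \<otimes>\<^bsub>adele_ring\<^esub> x"
    by (rule adele_eqI) (simp_all add: adele_extensional adele_simps Qp_m_comm adele_closed x y)
  show "\<one>\<^bsub>adele_ring\<^esub> \<otimes>\<^bsub>adele_ring\<^esub> x = x"
    by (rule adele_eqI) (simp_all add: adele_extensional adele_simps Qp_ops adele_closed x adele_ext)
  assume z: "z \<in> carrier adele_ring"
  show "x \<otimes>\<^bsub>adele_ring\<^esub> y \<otimes>\<^bsub>adele_ring\<^esub> z = x \<otimes>\<^bsub>adele_ring\<^esub> (y \<otimes>\<^bsub>adele_ring\<^esub> z)"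
    by (rule adele_eqI) (simp_all add: adele_extensional adele_simps Qp_m_assoc adele_closed x y z)
qed (simp_all add: adele_mult_closed adele_one_closed)

interpretation A: comm_monoid adele_ring by (rule comm_monoid_adele)

definition principal :: "rat \<Rightarrow> adele" where
  "principal q = (\<lambda>l\<in>primes. Qp_of_rat l q, of_rat q)"

lemma principal_simps:
  "prime l \<Longrightarrow> fst (principal q) l = Qp_of_rat l q" "snd (principal q) = of_rat q"
  "fst (principal q) \<in> extensional primes"
  by (simp_all add: principal_def)

lemma finite_padic_abs_ne_1: "q \<noteq> 0 \<Longrightarrow> finite {l. prime l \<and> padic_abs l q \<noteq> 1}"
proof -
  assume q: "q \<noteq> 0"
  obtain a b where ab: "b \<noteq> 0" "q = of_int a / of_int b" by (rule rat_quotient_exhaust)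
  have a: "a \<noteq> 0" using q ab by auto
  have "{l. prime l \<and> padic_abs l q \<noteq> 1} \<subseteq> {l. int l dvd a * b}"
  proof (intro subsetI, rule ccontr)
    fix l assume l: "l \<in> {l. prime l \<and> padic_abs l q \<noteq> 1}" "l \<notin> {l. int l dvd a * b}"
    then have "\<not> int l dvd a" "\<not> int l dvd b" by auto
    then have "multiplicity (int l) a = 0" "multiplicity (int l) b = 0" by (simp_all add: not_dvd_imp_multiplicity_0)
    then have "padic_abs l q = 1" using padic_abs_quotient[of l a b] l(1) a ab by simp
    then show False using l(1) by simp
  qed
  moreover have "finite {l. int l dvd a * b}"
  proof (rule finite_subset)
    show "{l. int l dvd a * b} \<subseteq> {..nat \<bar>a * b\<bar>}"
    proof
      fix l assume "l \<in> {l. int l dvd a * b}"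
      then have "int l \<le> \<bar>a * b\<bar>" using a ab zdvd_imp_le[of "int l" "\<bar>a * b\<bar>"] by simp
      then show "l \<in> {..nat \<bar>a * b\<bar>}" by simp
    qed
  qed simp
  ultimately show ?thesis by (rule finite_subset)
qed

lemma principal_closed: "principal q \<in> carrier adele_ring"
proof (cases "q = 0")
  case True
  have "{l. prime l \<and> \<not> padic_norm l (fst (principal q) l) \<le> 1} = {}"
    by (simp add: principal_simps padic_norm_of_rat True padic_abs_zero cong: conj_cong)
  then show ?thesis by (simp only: carrier_adele_ring) (simp add: principal_simps Qp_of_rat_closed)
next
  case False
  have "{l. prime l \<and> \<not> padic_norm l (fst (principal q) l) \<le> 1} \<subseteq> {l. prime l \<and> padic_abs l q \<noteq> 1}"
    by (auto simp: principal_simps padic_norm_of_rat)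
  then show ?thesis
    using finite_padic_abs_ne_1[OF False] finite_subset
    by (auto simp: carrier_adele_ring principal_simps Qp_of_rat_closed)
qed

lemma principal_mult: "principal (q * r) = principal q \<otimes>\<^bsub>adele_ring\<^esub> principal r"
  by (rule adele_eqI) (simp_all add: principal_simps adele_extensional adele_simps Qp_of_rat_mult of_rat_mult)

lemma principal_one: "principal 1 = \<one>\<^bsub>adele_ring\<^esub>"
  by (rule adele_eqI) (simp_all add: principal_simps adele_extensional adele_simps Qp_of_rat_one)

lemma principal_ideles_eq: "principal_ideles = {principal q | q. q \<noteq> 0}"
  by (simp add: principal_ideles_def principal_def)

lemma adele_class_eq: "adele_class a = {principal q \<otimes>\<^bsub>adele_ring\<^esub> a | q. q \<noteq> 0}"
  unfolding adele_class_def r_coset_def principal_ideles_eq by blast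

lemma adele_class_self: "a \<in> carrier adele_ring \<Longrightarrow> a \<in> adele_class a"
  unfolding adele_class_eq using principal_one A.l_one[of a] by (metis (mono_tags, lifting) mem_Collect_eq zero_neq_one)

lemma principal_cancel:
  assumes "a \<in> carrier adele_ring" "q \<noteq> 0"
  shows "principal (inverse q) \<otimes>\<^bsub>adele_ring\<^esub> (principal q \<otimes>\<^bsub>adele_ring\<^esub> a) = a"
    "principal q \<otimes>\<^bsub>adele_ring\<^esub> (principal (inverse q) \<otimes>\<^bsub>adele_ring\<^esub> a) = a"
  using assms by (simp_all add: principal_closed principal_one flip: A.m_assoc principal_mult)

lemma adele_class_principal_mult:
  assumes a: "a \<in> carrier adele_ring" and q: "q \<noteq> 0"
  shows "adele_class (principal q \<otimes>\<^bsub>adele_ring\<^esub> a) = adele_class a"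
proof (intro subset_antisym subsetI)
  fix x assume "x \<in> adele_class (principal q \<otimes>\<^bsub>adele_ring\<^esub> a)"
  then obtain r where r: "r \<noteq> 0" "x = principal r \<otimes>\<^bsub>adele_ring\<^esub> (principal q \<otimes>\<^bsub>adele_ring\<^esub> a)"
    unfolding adele_class_eq by blast
  have "x = principal (r * q) \<otimes>\<^bsub>adele_ring\<^esub> a"
    using a by (simp add: r(2) principal_mult principal_closed A.m_assoc)
  then show "x \<in> adele_class a" unfolding adele_class_eq using r(1) q by (metis (mono_tags, lifting) mem_Collect_eq mult_eq_0_iff)
next
  fix x assume "x \<in> adele_class a"
  then obtain r where r: "r \<noteq> 0" "x = principal r \<otimes>\<^bsub>adele_ring\<^esub> a" unfolding adele_class_eq by blast
  have "x = principal (r * inverse q) \<otimes>\<^bsub>adele_ring\<^esub> (principal q \<otimes>\<^bsub>adele_ring\<^esub> a)"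
    using a q by (simp add: r(2) principal_mult principal_closed A.m_assoc principal_cancel)
  moreover have "r * inverse q \<noteq> 0" using r(1) q by simp
  ultimately show "x \<in> adele_class (principal q \<otimes>\<^bsub>adele_ring\<^esub> a)" unfolding adele_class_eq by blast
qed

lemma adele_class_eq_iff:
  assumes a: "a \<in> carrier adele_ring" and b: "b \<in> carrier adele_ring"
  shows "adele_class a = adele_class b \<longleftrightarrow> (\<exists>q. q \<noteq> 0 \<and> b = principal q \<otimes>\<^bsub>adele_ring\<^esub> a)"
proof
  assume "adele_class a = adele_class b"
  then have "b \<in> adele_class a" using adele_class_self[OF b] by simp
  then show "\<exists>q. q \<noteq> 0 \<and> b = principal q \<otimes>\<^bsub>adele_ring\<^esub> a" unfolding adele_class_eq by blast
qed (use adele_class_principal_mult[OF a] in auto)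

lemma HQ_mult:
  assumes a: "a \<in> carrier adele_ring" and b: "b \<in> carrier adele_ring"
  shows "adele_class a \<otimes>\<^bsub>HQ\<^esub> adele_class b = adele_class (a \<otimes>\<^bsub>adele_ring\<^esub> b)"
proof -
  have "adele_class a <#>\<^bsub>adele_ring\<^esub> adele_class b = adele_class (a \<otimes>\<^bsub>adele_ring\<^esub> b)"
  proof (intro subset_antisym subsetI)
    fix x assume "x \<in> adele_class a <#>\<^bsub>adele_ring\<^esub> adele_class b"
    then obtain q r where qr: "q \<noteq> 0" "r \<noteq> 0"
      "x = (principal q \<otimes>\<^bsub>adele_ring\<^esub> a) \<otimes>\<^bsub>adele_ring\<^esub> (principal r \<otimes>\<^bsub>adele_ring\<^esub> b)"
      unfolding set_mult_def adele_class_eq by blast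
    have "x = principal (q * r) \<otimes>\<^bsub>adele_ring\<^esub> (a \<otimes>\<^bsub>adele_ring\<^esub> b)"
      unfolding qr(3) principal_mult using a b principal_closed by (simp add: A.m_ac)
    moreover have "q * r \<noteq> 0" using qr by simp
    ultimately show "x \<in> adele_class (a \<otimes>\<^bsub>adele_ring\<^esub> b)" unfolding adele_class_eq by blast
  next
    fix x assume "x \<in> adele_class (a \<otimes>\<^bsub>adele_ring\<^esub> b)"
    then obtain q where q: "q \<noteq> 0" "x = principal q \<otimes>\<^bsub>adele_ring\<^esub> (a \<otimes>\<^bsub>adele_ring\<^esub> b)"
      unfolding adele_class_eq by blast
    have "x = (principal q \<otimes>\<^bsub>adele_ring\<^esub> a) \<otimes>\<^bsub>adele_ring\<^esub> b"
      unfolding q(2) using a b principal_closed by (simp add: A.m_assoc)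
    moreover have "principal q \<otimes>\<^bsub>adele_ring\<^esub> a \<in> adele_class a" unfolding adele_class_eq using q(1) by blast
    ultimately show "x \<in> adele_class a <#>\<^bsub>adele_ring\<^esub> adele_class b"
      unfolding set_mult_def using adele_class_self[OF b] by blast
  qed
  then show ?thesis by (simp add: HQ_def)
qed

lemma carrier_HQ: "carrier HQ = adele_class ` carrier adele_ring"
  by (simp add: HQ_def)

section \<open>Hyperideals of the adele class space\<close>

text \<open>The ideal generated by a class consists of its multiples; sums of multiples are multiples by
  distributivity, for all choices of representatives.\<close>

lemma hyperideal_multiples:
  assumes a: "a \<in> carrier adele_ring"
  shows "hyperideal HQ {adele_class (x \<otimes>\<^bsub>adele_ring\<^esub> a) | x. x \<in> carrier adele_ring}" (is "hyperideal HQ ?J")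
  unfolding hyperideal_def
proof (intro conjI ballI)
  show "?J \<subseteq> carrier HQ" using a by (auto simp: carrier_HQ)
  have "\<zero>\<^bsub>adele_ring\<^esub> \<otimes>\<^bsub>adele_ring\<^esub> a = \<zero>\<^bsub>adele_ring\<^esub>"
    by (rule adele_eqI) (simp_all add: adele_extensional adele_simps Qp_ops adele_closed a)
  then have "hzero HQ = adele_class (\<zero>\<^bsub>adele_ring\<^esub> \<otimes>\<^bsub>adele_ring\<^esub> a)" by (simp add: HQ_def)
  then show "hzero HQ \<in> ?J" using adele_zero_closed by blast
next
  fix s t assume "s \<in> ?J" "t \<in> ?J"
  then obtain x y where x: "x \<in> carrier adele_ring" "s = adele_class (x \<otimes>\<^bsub>adele_ring\<^esub> a)"
    and y: "y \<in> carrier adele_ring" "t = adele_class (y \<otimes>\<^bsub>adele_ring\<^esub> a)" by blast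
  show "hadd HQ s t \<subseteq> ?J"
  proof
    fix u assume "u \<in> hadd HQ s t"
    then obtain b c where bc: "u = adele_class (b \<oplus>\<^bsub>adele_ring\<^esub> c)" "b \<in> s" "c \<in> t" by (auto simp: HQ_def)
    obtain q r where qr: "b = principal q \<otimes>\<^bsub>adele_ring\<^esub> (x \<otimes>\<^bsub>adele_ring\<^esub> a)" "c = principal r \<otimes>\<^bsub>adele_ring\<^esub> (y \<otimes>\<^bsub>adele_ring\<^esub> a)"
      using bc(2,3) unfolding x(2) y(2) adele_class_eq by blast
    define z where "z = (principal q \<otimes>\<^bsub>adele_ring\<^esub> x) \<oplus>\<^bsub>adele_ring\<^esub> (principal r \<otimes>\<^bsub>adele_ring\<^esub> y)"
    have z: "z \<in> carrier adele_ring"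
      unfolding z_def using x(1) y(1) principal_closed by (simp add: adele_add_closed)
    have "b \<oplus>\<^bsub>adele_ring\<^esub> c = z \<otimes>\<^bsub>adele_ring\<^esub> a"
      unfolding qr z_def
      by (rule adele_eqI)
        (simp_all add: adele_extensional adele_simps adele_closed x(1) y(1) a principal_closed Qp_ops Qp_m_assoc Qp_l_distr algebra_simps)
    then have "u = adele_class (z \<otimes>\<^bsub>adele_ring\<^esub> a)" using bc(1) by simp
    then show "u \<in> ?J" using z by blast
  qed
next
  fix s t assume "s \<in> carrier HQ" "t \<in> ?J"
  then obtain y x where y: "y \<in> carrier adele_ring" "s = adele_class y"
    and x: "x \<in> carrier adele_ring" "t = adele_class (x \<otimes>\<^bsub>adele_ring\<^esub> a)" by (auto simp: carrier_HQ)
  have "s \<otimes>\<^bsub>HQ\<^esub> t = adele_class ((y \<otimes>\<^bsub>adele_ring\<^esub> x) \<otimes>\<^bsub>adele_ring\<^esub> a)"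
    unfolding x(2) y(2) using x(1) y(1) a by (simp add: HQ_mult A.m_assoc)
  then show "s \<otimes>\<^bsub>HQ\<^esub> t \<in> ?J" using x(1) y(1) by blast
qed

lemma principal_hyperideal_eq:
  assumes a: "a \<in> carrier adele_ring"
  shows "principal_hyperideal HQ (adele_class a) = {adele_class (x \<otimes>\<^bsub>adele_ring\<^esub> a) | x. x \<in> carrier adele_ring}"
    (is "_ = ?J")
proof (rule subset_antisym)
  have "adele_class a = adele_class (\<one>\<^bsub>adele_ring\<^esub> \<otimes>\<^bsub>adele_ring\<^esub> a)" using a by simp
  then have "adele_class a \<in> ?J" using adele_one_closed by blast
  then show "principal_hyperideal HQ (adele_class a) \<subseteq> ?J"
    unfolding principal_hyperideal_def using hyperideal_multiples[OF a] by blast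
  show "?J \<subseteq> principal_hyperideal HQ (adele_class a)"
    unfolding principal_hyperideal_def
  proof (intro subsetI InterI)
    fix s I assume s: "s \<in> ?J" and I: "I \<in> {I. hyperideal HQ I \<and> adele_class a \<in> I}"
    obtain x where x: "x \<in> carrier adele_ring" "s = adele_class x \<otimes>\<^bsub>HQ\<^esub> adele_class a"
      using s HQ_mult[OF _ a] by auto
    have "adele_class x \<in> carrier HQ" using x(1) by (simp add: carrier_HQ)
    then show "s \<in> I" using I x(2) unfolding hyperideal_def by blast
  qed
qed

section \<open>Ideles and rational numbers\<close>

lemma finite_prime_power_product:
  assumes F: "finite F" "\<And>l. l \<in> F \<Longrightarrow> prime l"
  shows "\<exists>q::rat. q > 0 \<and> (\<forall>l. prime l \<longrightarrow> padic_abs l q = (if l \<in> F then real l powi k l else 1))"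
  using F
proof (induction F rule: finite_induct)
  case empty
  then show ?case by (intro exI[of _ 1]) (simp add: padic_abs_one)
next
  case (insert m F)
  then obtain q :: rat where q: "q > 0" "\<forall>l. prime l \<longrightarrow> padic_abs l q = (if l \<in> F then real l powi k l else 1)" by auto
  have m: "prime m" using insert.prems by simp
  then have m0: "(of_nat m :: rat) > 0" by (simp add: prime_gt_0_nat)
  have powi: "padic_abs l (x powi j) = padic_abs l x powi j" if "prime l" for l x j
  proof -
    have "padic_abs l (x ^ n) = padic_abs l x ^ n" for x n
      by (induction n) (simp_all add: padic_abs_one[OF that] padic_abs_mult[OF that])
    then show ?thesis by (simp add: power_int_def padic_abs_inverse[OF that])
  qed
  define q' where "q' = of_nat m powi (- k m) * q"
  have "padic_abs l q' = (if l \<in> insert m F then real l powi k l else 1)" if l: "prime l" for l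
  proof (cases "l = m")
    case True
    have "padic_abs m (of_nat m) powi (- k m) = real m powi k m"
      using padic_abs_prime[OF m] m0 by (simp add: power_int_inverse power_int_minus)
    then show ?thesis using True q(2) insert.hyps m by (simp add: q'_def padic_abs_mult[OF m] powi[OF m])
  next
    case False
    then have "\<not> l dvd m" using l m primes_dvd_imp_eq by blast
    then have "padic_abs l (of_nat m) = 1" by (rule padic_abs_of_nat_eq_1[OF l])
    then show ?thesis using False q(2) l by (simp add: q'_def padic_abs_mult[OF l] powi[OF l])
  qed
  moreover have "q' > 0" using q(1) m0 by (simp add: q'_def)
  ultimately show ?case by blast
qed

text \<open>The class number of \<open>\<rat>\<close> is one: prescribed absolute values at the primes and a prescribed
  sign are those of a rational number.\<close>

lemma rational_with_norms:
  assumes a: "\<And>l. prime l \<Longrightarrow> a l \<in> carrier (Qp l) \<and> a l \<noteq> \<zero>\<^bsub>Qp l\<^esub>"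
    and fin: "finite {l. prime l \<and> padic_norm l (a l) \<noteq> 1}" and s: "s \<noteq> (0::real)"
  obtains q :: rat where "q \<noteq> 0" "\<And>l. prime l \<Longrightarrow> padic_abs l q = padic_norm l (a l)" "s / of_rat q > 0"
proof -
  define F where "F = {l. prime l \<and> padic_norm l (a l) \<noteq> 1}"
  have "\<exists>k::int. padic_norm l (a l) = real l powi k" if "l \<in> F" for l
    using padic_norm_eq_power[of l "a l"] a[of l] that unfolding F_def by blast
  then obtain k where k: "\<And>l. l \<in> F \<Longrightarrow> padic_norm l (a l) = real l powi k l" by metis
  obtain q :: rat where q: "q > 0" "\<forall>l. prime l \<longrightarrow> padic_abs l q = (if l \<in> F then real l powi k l else 1)"
    using finite_prime_power_product[of F k] fin unfolding F_def by blast
  have abs: "padic_abs l q = padic_norm l (a l)" if "prime l" for l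
    using q(2) that k[of l] by (auto simp: F_def)
  show ?thesis
  proof (cases "s > 0")
    case True
    then show ?thesis using that[of q] q(1) abs by simp
  next
    case False
    then have "s / of_rat (- q) > 0" using s q(1) by (simp add: of_rat_minus divide_neg_pos)
    then show ?thesis using that[of "- q"] q(1) abs padic_abs_minus by simp
  qed
qed

text \<open>In lowest terms, no prime other than \<open>p\<close> divides the numerator or the denominator.\<close>

lemma rational_power_of_prime:
  assumes p: "prime p" and q: "q > 0" and abs: "\<And>l. prime l \<Longrightarrow> l \<noteq> p \<Longrightarrow> padic_abs l q = 1"
  shows "\<exists>k::int. q = of_nat p powi k"
proof -
  obtain a b where ab: "b > 0" "q = of_int a / of_int b" "coprime a b"
    using quotient_of_denom_pos' quotient_of_div quotient_of_coprime by (metis prod.collapse)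
  have a: "a > 0" using q ab by (simp add: zero_less_divide_iff)
  have only_p: "l = p" if "prime l" "int l dvd a \<or> int l dvd b" for l
  proof (rule ccontr)
    assume "l \<noteq> p"
    then have "padic_abs l q = 1" by (rule abs[OF that(1)])
    then have eq: "padic_abs l (of_int a) = padic_abs l (of_int b)"
      unfolding ab(2) padic_abs_divide[OF that(1)] using padic_abs_pos[OF that(1), of "of_int b"] ab(1) by (simp add: field_simps)
    have "int l dvd x \<longleftrightarrow> padic_abs l (of_int x) \<le> inverse (real l ^ 1)" for x
      using padic_abs_of_int_le_iff[OF that(1), of x 1] by simp
    then have "int l dvd a" "int l dvd b" using that(2) eq by auto
    then have "is_unit (int l)" using ab(3) coprime_common_divisor by blast
    then show False using that(1) prime_gt_1_nat by fastforce
  qed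
  have pow: "\<exists>k. x = p ^ k" if "x > 0" "\<And>l. prime l \<Longrightarrow> l dvd x \<Longrightarrow> l = p" for x :: nat
  proof -
    have "prime_factors x \<subseteq> {p}" using that by (auto simp: prime_factors_dvd)
    then have "(\<Prod>l\<in>prime_factors x. l ^ multiplicity l x) = p ^ multiplicity p x \<or> (\<Prod>l\<in>prime_factors x. l ^ multiplicity l x) = p ^ 0"
      by (auto simp: subset_singleton_iff)
    then show ?thesis using prime_factorization_nat[OF that(1)] by metis
  qed
  obtain i where i: "nat a = p ^ i"
    using pow[of "nat a"] a only_p by (metis int_dvd_int_iff nat_0_le order_less_imp_le zero_less_nat_eq)
  obtain j where j: "nat b = p ^ j"
    using pow[of "nat b"] ab(1) only_p by (metis int_dvd_int_iff nat_0_le order_less_imp_le zero_less_nat_eq)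
  have "a = int p ^ i" "b = int p ^ j" using i j a ab(1) by (metis int_nat_eq nat_0_le of_nat_power order_less_imp_le)+
  then have "q = of_nat p ^ i / of_nat p ^ j" by (simp add: ab(2))
  also have "\<dots> = of_nat p powi (int i - int j)"
    using prime_gt_0_nat[OF p] by (simp add: power_int_diff)
  finally show ?thesis by blast
qed

definition ideles :: "adele set" where
  "ideles = {x. fst x \<in> extensional primes \<and> (\<forall>l. prime l \<longrightarrow> fst x l \<in> carrier (Qp l) \<and> fst x l \<noteq> \<zero>\<^bsub>Qp l\<^esub>) \<and>
     finite {l. prime l \<and> padic_norm l (fst x l) \<noteq> 1} \<and> snd x \<noteq> 0}"

lemma ideles_subset: "ideles \<subseteq> carrier adele_ring"
proof
  fix x assume x: "x \<in> ideles"
  have "{l. prime l \<and> \<not> padic_norm l (fst x l) \<le> 1} \<subseteq> {l. prime l \<and> padic_norm l (fst x l) \<noteq> 1}" by auto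
  then show "x \<in> carrier adele_ring"
    using x finite_subset unfolding ideles_def carrier_adele_ring by blast
qed

lemma topspace_idele_top: "topspace idele_top = ideles"
proof -
  let ?S = "{(\<Pi>\<^sub>E l\<in>primes. U l) \<times> (V :: real set) | U V.
        (\<forall>l\<in>primes. openin (Qp_top l) (U l) \<and> U l \<subseteq> Units (Qp l)) \<and>
        finite {l \<in> primes. U l \<noteq> Units (Zp l)} \<and> open V \<and> 0 \<notin> V}"
  have "\<Union>?S = ideles"
  proof (intro subset_antisym subsetI)
    fix x assume "x \<in> \<Union>?S"
    then obtain U V where U: "\<forall>l\<in>primes. openin (Qp_top l) (U l) \<and> U l \<subseteq> Units (Qp l)"
      "finite {l \<in> primes. U l \<noteq> Units (Zp l)}" "(0::real) \<notin> V" "x \<in> (\<Pi>\<^sub>E l\<in>primes. U l) \<times> V" by blast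
    then have ext: "fst x \<in> extensional primes" and mem: "\<And>l. prime l \<Longrightarrow> fst x l \<in> U l" and s: "snd x \<noteq> 0"
      by (auto simp: PiE_iff)
    have "{l. prime l \<and> padic_norm l (fst x l) \<noteq> 1} \<subseteq> {l \<in> primes. U l \<noteq> Units (Zp l)}"
    proof
      fix l assume l: "l \<in> {l. prime l \<and> padic_norm l (fst x l) \<noteq> 1}"
      then have "fst x l \<in> U l" "fst x l \<notin> Units (Zp l)" using mem Units_Zp[of l] by auto
      then show "l \<in> {l \<in> primes. U l \<noteq> Units (Zp l)}" using l by auto
    qed
    then have "finite {l. prime l \<and> padic_norm l (fst x l) \<noteq> 1}" using U(2) by (rule finite_subset)
    moreover have "fst x l \<in> Units (Qp l)" if "prime l" for l using U(1) mem[OF that] that by blast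
    ultimately show "x \<in> ideles" using ext s Units_Qp by (simp add: ideles_def)
  next
    fix x assume x: "x \<in> ideles"
    define U where "U l = (if padic_norm l (fst x l) = 1 then Units (Zp l) else Units (Qp l))" for l
    have "\<forall>l\<in>primes. openin (Qp_top l) (U l) \<and> U l \<subseteq> Units (Qp l)"
      using openin_Units_Zp openin_Units_Qp Units_Zp_subset_Units_Qp by (simp add: U_def)
    moreover have "finite {l \<in> primes. U l \<noteq> Units (Zp l)}"
    proof (rule finite_subset)
      show "{l \<in> primes. U l \<noteq> Units (Zp l)} \<subseteq> {l. prime l \<and> padic_norm l (fst x l) \<noteq> 1}" by (auto simp: U_def)
      show "finite {l. prime l \<and> padic_norm l (fst x l) \<noteq> 1}" using x by (simp add: ideles_def)
    qed
    moreover have "fst x l \<in> U l" if "prime l" for l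
      using x that Units_Zp[OF that] Units_Qp[OF that] by (auto simp: U_def ideles_def)
    then have "x \<in> (\<Pi>\<^sub>E l\<in>primes. U l) \<times> (- {0})"
      using x by (auto simp: ideles_def PiE_iff mem_Times_iff)
    moreover have "open (- {0::real})" "(0::real) \<notin> - {0}" by auto
    ultimately show "x \<in> \<Union>?S" by blast
  qed
  then show ?thesis by (simp only: idele_top_def topology_generated_by_topspace)
qed

lemma Qp_one_not_zero: "prime l \<Longrightarrow> \<one>\<^bsub>Qp l\<^esub> \<noteq> \<zero>\<^bsub>Qp l\<^esub>"
proof
  assume l: "prime l" and eq: "\<one>\<^bsub>Qp l\<^esub> = \<zero>\<^bsub>Qp l\<^esub>"
  have "padic_norm l \<one>\<^bsub>Qp l\<^esub> = padic_norm l \<zero>\<^bsub>Qp l\<^esub>" by (rule arg_cong[OF eq])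
  then have "(1::real) = 0" by (simp only: padic_norm_one[OF l] padic_norm_zero[OF l])
  then show False by simp
qed

lemma padic_norm_one_unit: "prime l \<Longrightarrow> a \<in> Units (Zp l) \<Longrightarrow> a \<in> carrier (Qp l) \<and> padic_norm l a = 1 \<and> a \<noteq> \<zero>\<^bsub>Qp l\<^esub>"
  using Units_Zp padic_norm_zero by fastforce

section \<open>The fiber over \<open>p\<close>\<close>

context
  fixes p :: nat
  assumes prime_p: "prime p"
begin

text \<open>The adeles that vanish at \<open>p\<close> and agree with an idele at all other places.\<close>

definition fiber_adeles :: "adele set" where
  "fiber_adeles = {x. fst x \<in> extensional primes \<and> fst x p = \<zero>\<^bsub>Qp p\<^esub> \<and>
     (\<forall>l. prime l \<longrightarrow> l \<noteq> p \<longrightarrow> fst x l \<in> carrier (Qp l) \<and> fst x l \<noteq> \<zero>\<^bsub>Qp l\<^esub>) \<and>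
     finite {l. prime l \<and> l \<noteq> p \<and> padic_norm l (fst x l) \<noteq> 1} \<and> snd x \<noteq> 0}"

lemma fiber_adeles_subset: "fiber_adeles \<subseteq> carrier adele_ring"
proof
  fix x assume x: "x \<in> fiber_adeles"
  have "{l. prime l \<and> \<not> padic_norm l (fst x l) \<le> 1} \<subseteq> insert p {l. prime l \<and> l \<noteq> p \<and> padic_norm l (fst x l) \<noteq> 1}"
    by auto
  moreover have "finite (insert p {l. prime l \<and> l \<noteq> p \<and> padic_norm l (fst x l) \<noteq> 1})"
    using x by (simp add: fiber_adeles_def)
  ultimately have "finite {l. prime l \<and> \<not> padic_norm l (fst x l) \<le> 1}" by (rule finite_subset)
  moreover have "fst x l \<in> carrier (Qp l)" if "prime l" for l
    using x that Qp_ops(4)[OF that] by (cases "l = p") (simp_all add: fiber_adeles_def)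
  ultimately show "x \<in> carrier adele_ring"
    using x by (simp add: carrier_adele_ring fiber_adeles_def)
qed

lemma adele_zero_at_simps:
  "fst (adele_zero_at p g t) \<in> extensional primes" "snd (adele_zero_at p g t) = t"
  "fst (adele_zero_at p g t) p = \<zero>\<^bsub>Qp p\<^esub>"
  "prime l \<Longrightarrow> l \<noteq> p \<Longrightarrow> fst (adele_zero_at p g t) l = g l"
  using prime_p by (simp_all add: adele_zero_at_def)

lemma adele_zero_at_fiber: "g \<in> carrier (Gp p) \<Longrightarrow> t \<noteq> 0 \<Longrightarrow> adele_zero_at p g t \<in> fiber_adeles"
proof -
  assume g: "g \<in> carrier (Gp p)" and t: "t \<noteq> 0"
  have gl: "g l \<in> carrier (Qp l) \<and> padic_norm l (g l) = 1" if "prime l" "l \<noteq> p" for l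
    using g that by (simp add: carrier_Gp[OF prime_p])
  have "{l. prime l \<and> l \<noteq> p \<and> padic_norm l (fst (adele_zero_at p g t) l) \<noteq> 1} = {}"
    using gl by (simp add: adele_zero_at_simps cong: conj_cong)
  then have "finite {l. prime l \<and> l \<noteq> p \<and> padic_norm l (fst (adele_zero_at p g t) l) \<noteq> 1}"
    by (simp only: finite.emptyI)
  moreover have "g l \<noteq> \<zero>\<^bsub>Qp l\<^esub>" if "prime l" "l \<noteq> p" for l
    using gl[OF that] padic_norm_zero[OF that(1)] by auto
  ultimately show ?thesis
    using gl t by (simp add: fiber_adeles_def adele_zero_at_simps)
qed

abbreviation idem :: adele where
  "idem \<equiv> adele_zero_at p \<one>\<^bsub>Gp p\<^esub> 1"

lemma idem_fiber: "idem \<in> fiber_adeles"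
  using comm_group_Gp[OF prime_p] by (intro adele_zero_at_fiber) (simp_all add: comm_group_def comm_monoid_def monoid.one_closed)

lemma idem_closed: "idem \<in> carrier adele_ring"
  using idem_fiber fiber_adeles_subset by blast

lemma idem_mult:
  assumes x: "x \<in> carrier adele_ring"
  shows "fst (x \<otimes>\<^bsub>adele_ring\<^esub> idem) p = \<zero>\<^bsub>Qp p\<^esub>" "snd (x \<otimes>\<^bsub>adele_ring\<^esub> idem) = snd x"
    "prime l \<Longrightarrow> l \<noteq> p \<Longrightarrow> fst (x \<otimes>\<^bsub>adele_ring\<^esub> idem) l = fst x l"
  using prime_p adele_closed[OF x]
  by (simp_all add: adele_simps adele_zero_at_simps Qp_ops Gp_one[OF prime_p])

lemma fiber_adeles_eq: "fiber_adeles = (\<lambda>a. a \<otimes>\<^bsub>adele_ring\<^esub> idem) ` ideles"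
proof (intro subset_antisym subsetI)
  fix z assume z: "z \<in> fiber_adeles"
  define a where "a = (\<lambda>l\<in>primes. if l = p then \<one>\<^bsub>Qp p\<^esub> else fst z l, snd z)"
  have al: "fst a l = (if l = p then \<one>\<^bsub>Qp p\<^esub> else fst z l)" if "prime l" for l
    using that by (simp add: a_def)
  have "{l. prime l \<and> padic_norm l (fst a l) \<noteq> 1} \<subseteq> {l. prime l \<and> l \<noteq> p \<and> padic_norm l (fst z l) \<noteq> 1}"
    using padic_norm_one[OF prime_p] by (auto simp: al split: if_splits)
  moreover have "finite {l. prime l \<and> l \<noteq> p \<and> padic_norm l (fst z l) \<noteq> 1}"
    using z by (simp add: fiber_adeles_def)
  ultimately have "finite {l. prime l \<and> padic_norm l (fst a l) \<noteq> 1}" by (rule finite_subset)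
  moreover note Qp_one_not_zero[OF prime_p]
  ultimately have a: "a \<in> ideles"
    using z by (simp add: ideles_def fiber_adeles_def al Qp_ops(3)) (simp add: a_def)
  then have ac: "a \<in> carrier adele_ring" using ideles_subset by blast
  have "z = a \<otimes>\<^bsub>adele_ring\<^esub> idem"
  proof (rule adele_eqI)
    show "fst z l = fst (a \<otimes>\<^bsub>adele_ring\<^esub> idem) l" if "prime l" for l
      using z idem_mult[OF ac] al[OF that] that by (cases "l = p") (simp_all add: fiber_adeles_def)
    show "snd z = snd (a \<otimes>\<^bsub>adele_ring\<^esub> idem)" using idem_mult(2)[OF ac] by (simp add: a_def)
  qed (use z in \<open>simp_all add: fiber_adeles_def adele_extensional\<close>)
  then show "z \<in> (\<lambda>a. a \<otimes>\<^bsub>adele_ring\<^esub> idem) ` ideles" using a by blast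
next
  fix z assume "z \<in> (\<lambda>a. a \<otimes>\<^bsub>adele_ring\<^esub> idem) ` ideles"
  then obtain a where a: "a \<in> ideles" "z = a \<otimes>\<^bsub>adele_ring\<^esub> idem" by blast
  have ac: "a \<in> carrier adele_ring" using a ideles_subset by blast
  have "{l. prime l \<and> l \<noteq> p \<and> padic_norm l (fst z l) \<noteq> 1} \<subseteq> {l. prime l \<and> padic_norm l (fst a l) \<noteq> 1}"
    using idem_mult(3)[OF ac] by (auto simp: a(2))
  moreover have "finite {l. prime l \<and> padic_norm l (fst a l) \<noteq> 1}" using a(1) by (simp add: ideles_def)
  ultimately have "finite {l. prime l \<and> l \<noteq> p \<and> padic_norm l (fst z l) \<noteq> 1}" by (rule finite_subset)
  then show "z \<in> fiber_adeles"
    using a(1) idem_mult[OF ac] by (simp add: fiber_adeles_def a(2) adele_extensional ideles_def)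
qed

lemma place_ideal_class_iff:
  assumes b: "b \<in> carrier adele_ring"
  shows "adele_class b \<in> place_ideal p \<longleftrightarrow> fst b p = \<zero>\<^bsub>Qp p\<^esub>"
proof
  assume "adele_class b \<in> place_ideal p"
  then show "fst b p = \<zero>\<^bsub>Qp p\<^esub>" unfolding place_ideal_def using adele_class_self[OF b] by blast
next
  assume b0: "fst b p = \<zero>\<^bsub>Qp p\<^esub>"
  have "fst a p = \<zero>\<^bsub>Qp p\<^esub>" if a: "a \<in> adele_class b" for a
  proof -
    obtain q where "a = principal q \<otimes>\<^bsub>adele_ring\<^esub> b" using a unfolding adele_class_eq by blast
    then show ?thesis using b0 by (simp add: adele_simps prime_p principal_simps Qp_ops Qp_of_rat_closed)
  qed
  then show "adele_class b \<in> place_ideal p" unfolding place_ideal_def carrier_HQ using b by blast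
qed

text \<open>An adele \<open>b\<close> that vanishes at \<open>p\<close> is a multiple of \<open>z\<close>: the quotient \<open>b / z\<close> outside \<open>p\<close> is integral at
  almost all primes, because \<open>z\<close> is a unit at almost all primes.\<close>

lemma principal_hyperideal_fiber:
  assumes z: "z \<in> fiber_adeles"
  shows "principal_hyperideal HQ (adele_class z) = place_ideal p"
proof -
  have zc: "z \<in> carrier adele_ring" using z fiber_adeles_subset by blast
  show ?thesis
    unfolding principal_hyperideal_eq[OF zc]
  proof (intro subset_antisym subsetI)
    fix s assume "s \<in> {adele_class (x \<otimes>\<^bsub>adele_ring\<^esub> z) | x. x \<in> carrier adele_ring}"
    then obtain x where x: "x \<in> carrier adele_ring" "s = adele_class (x \<otimes>\<^bsub>adele_ring\<^esub> z)" by blast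
    have "fst (x \<otimes>\<^bsub>adele_ring\<^esub> z) p = \<zero>\<^bsub>Qp p\<^esub>"
      using z adele_closed[OF x(1) prime_p] by (simp add: adele_simps prime_p fiber_adeles_def Qp_ops)
    then show "s \<in> place_ideal p" unfolding x(2) using place_ideal_class_iff x(1) zc by simp
  next
    fix s assume s: "s \<in> place_ideal p"
    then obtain b where b: "b \<in> carrier adele_ring" "s = adele_class b" unfolding place_ideal_def carrier_HQ by blast
    have bp: "fst b p = \<zero>\<^bsub>Qp p\<^esub>" using s place_ideal_class_iff[OF b(1)] b(2) by simp
    have "\<exists>c\<in>carrier (Qp l). fst z l \<otimes>\<^bsub>Qp l\<^esub> c = \<one>\<^bsub>Qp l\<^esub>" if "prime l" "l \<noteq> p" for l
      using z that by (intro Qp_inverse_exists) (simp_all add: fiber_adeles_def)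
    then obtain c where c: "\<And>l. prime l \<Longrightarrow> l \<noteq> p \<Longrightarrow> c l \<in> carrier (Qp l)"
      "\<And>l. prime l \<Longrightarrow> l \<noteq> p \<Longrightarrow> fst z l \<otimes>\<^bsub>Qp l\<^esub> c l = \<one>\<^bsub>Qp l\<^esub>" by metis
    define x where "x = (\<lambda>l\<in>primes. if l = p then \<zero>\<^bsub>Qp p\<^esub> else fst b l \<otimes>\<^bsub>Qp l\<^esub> c l, snd b / snd z)"
    have xl: "fst x l = (if l = p then \<zero>\<^bsub>Qp p\<^esub> else fst b l \<otimes>\<^bsub>Qp l\<^esub> c l)" if "prime l" for l
      using that by (simp add: x_def)
    have zl: "fst z l \<in> carrier (Qp l)" if "prime l" for l using adele_closed[OF zc that] .
    have bl: "fst b l \<in> carrier (Qp l)" if "prime l" for l using adele_closed[OF b(1) that] .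
    have norm_c: "padic_norm l (fst z l) * padic_norm l (c l) = 1" if "prime l" "l \<noteq> p" for l
      using padic_norm_mult[OF that(1) zl[OF that(1)] c(1)[OF that]] c(2)[OF that] padic_norm_one[OF that(1)] by simp
    have xcl: "fst x l \<in> carrier (Qp l)" if "prime l" for l
      using that bl[OF that] c(1)[OF that] Qp_ops(4)[OF prime_p] by (auto simp: xl Qp_ops)
    have "{l. prime l \<and> \<not> padic_norm l (fst x l) \<le> 1} \<subseteq>
        {l. prime l \<and> \<not> padic_norm l (fst b l) \<le> 1} \<union> {l. prime l \<and> l \<noteq> p \<and> padic_norm l (fst z l) \<noteq> 1}"
    proof (rule subsetI, rule ccontr)
      fix l assume l: "l \<in> {l. prime l \<and> \<not> padic_norm l (fst x l) \<le> 1}"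
        "l \<notin> {l. prime l \<and> \<not> padic_norm l (fst b l) \<le> 1} \<union> {l. prime l \<and> l \<noteq> p \<and> padic_norm l (fst z l) \<noteq> 1}"
      have pl: "prime l" and lp: "l \<noteq> p" using l(1) xl[of l] padic_norm_zero[OF prime_p] by auto
      then have "padic_norm l (fst b l) \<le> 1" "padic_norm l (c l) = 1" using l(2) norm_c[OF pl lp] by auto
      then show False using l(1) xl[OF pl] lp padic_norm_mult[OF pl bl[OF pl] c(1)[OF pl lp]] by simp
    qed
    moreover have "finite ({l. prime l \<and> \<not> padic_norm l (fst b l) \<le> 1} \<union> {l. prime l \<and> l \<noteq> p \<and> padic_norm l (fst z l) \<noteq> 1})"
      using b(1) z by (simp add: carrier_adele_ring fiber_adeles_def)
    ultimately have "finite {l. prime l \<and> \<not> padic_norm l (fst x l) \<le> 1}" by (rule finite_subset)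
    then have x: "x \<in> carrier adele_ring" using xcl by (simp add: carrier_adele_ring) (simp add: x_def)
    have "b = x \<otimes>\<^bsub>adele_ring\<^esub> z"
    proof (rule adele_eqI[OF adele_ext[OF b(1)] adele_extensional(1)])
      show "snd b = snd (x \<otimes>\<^bsub>adele_ring\<^esub> z)" using z by (simp add: adele_simps x_def fiber_adeles_def)
      fix l :: nat assume l: "prime l"
      show "fst b l = fst (x \<otimes>\<^bsub>adele_ring\<^esub> z) l"
      proof (cases "l = p")
        case True
        then show ?thesis using bp zl[OF prime_p] by (simp add: adele_simps xl prime_p Qp_ops)
      next
        case False
        have "fst b l \<otimes>\<^bsub>Qp l\<^esub> c l \<otimes>\<^bsub>Qp l\<^esub> fst z l = fst b l \<otimes>\<^bsub>Qp l\<^esub> (fst z l \<otimes>\<^bsub>Qp l\<^esub> c l)"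
          using bl[OF l] zl[OF l] c(1)[OF l False] by (simp add: Qp_m_assoc[OF l] Qp_m_comm[OF l, of "c l"])
        then show ?thesis using False c(2)[OF l False] bl[OF l] by (simp add: adele_simps l xl Qp_ops)
      qed
    qed
    then show "s \<in> {adele_class (x \<otimes>\<^bsub>adele_ring\<^esub> z) | x. x \<in> carrier adele_ring}" using x b(2) by blast
  qed
qed

text \<open>A product of adeles vanishes at \<open>p\<close> only if one of the factors does, because \<open>\<rat>\<^sub>p\<close> is a field.\<close>

lemma prime_place_ideal: "prime_hyperideal HQ (place_ideal p)"
  unfolding prime_hyperideal_def
proof (intro conjI ballI impI)
  show "hyperideal HQ (place_ideal p)"
    using hyperideal_multiples[OF idem_closed] principal_hyperideal_eq[OF idem_closed]
      principal_hyperideal_fiber[OF idem_fiber] by simp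
  have "fst \<one>\<^bsub>adele_ring\<^esub> p \<noteq> \<zero>\<^bsub>Qp p\<^esub>"
    using Qp_one_not_zero[OF prime_p] by (simp add: adele_simps prime_p)
  then have "adele_class \<one>\<^bsub>adele_ring\<^esub> \<notin> place_ideal p" using place_ideal_class_iff[OF adele_one_closed] by simp
  moreover have "adele_class \<one>\<^bsub>adele_ring\<^esub> \<in> carrier HQ" using adele_one_closed by (simp add: carrier_HQ)
  ultimately show "place_ideal p \<noteq> carrier HQ" by blast
  fix s t assume "s \<in> carrier HQ" "t \<in> carrier HQ" and st: "s \<otimes>\<^bsub>HQ\<^esub> t \<in> place_ideal p"
  then obtain x y where xy: "x \<in> carrier adele_ring" "s = adele_class x" "y \<in> carrier adele_ring" "t = adele_class y"
    unfolding carrier_HQ by blast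
  have "fst (x \<otimes>\<^bsub>adele_ring\<^esub> y) p = \<zero>\<^bsub>Qp p\<^esub>"
    using st xy place_ideal_class_iff[OF A.m_closed[OF xy(1,3)]] by (simp add: HQ_mult)
  then have "fst x p = \<zero>\<^bsub>Qp p\<^esub> \<or> fst y p = \<zero>\<^bsub>Qp p\<^esub>"
    using Qp_mult_eq_zero_iff[OF prime_p adele_closed[OF xy(1) prime_p] adele_closed[OF xy(3) prime_p]]
    by (simp add: adele_simps prime_p)
  then show "s \<in> place_ideal p \<or> t \<in> place_ideal p"
    using place_ideal_class_iff[OF xy(1)] place_ideal_class_iff[OF xy(3)] xy by simp
qed

text \<open>A generator divides the idempotent that vanishes at \<open>p\<close> only, so its components outside \<open>p\<close> are
  invertible, with inverses that are integral at almost all primes.\<close>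

lemma Pp_eq: "Pp p = adele_class ` fiber_adeles"
proof (intro subset_antisym subsetI)
  fix s assume "s \<in> adele_class ` fiber_adeles"
  then obtain z where z: "z \<in> fiber_adeles" "s = adele_class z" by blast
  then show "s \<in> Pp p"
    using principal_hyperideal_fiber[OF z(1)] prime_place_ideal fiber_adeles_subset
    by (auto simp: Pp_def prime_elements_def carrier_HQ)
next
  fix s assume s: "s \<in> Pp p"
  then obtain z where z: "z \<in> carrier adele_ring" "s = adele_class z"
    unfolding Pp_def prime_elements_def carrier_HQ by blast
  have ideal: "principal_hyperideal HQ (adele_class z) = place_ideal p" using s z(2) by (simp add: Pp_def)
  have "adele_class z = adele_class (\<one>\<^bsub>adele_ring\<^esub> \<otimes>\<^bsub>adele_ring\<^esub> z)" using z(1) by simp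
  then have "adele_class z \<in> place_ideal p"
    unfolding ideal[symmetric] principal_hyperideal_eq[OF z(1)] using adele_one_closed by blast
  then have zp: "fst z p = \<zero>\<^bsub>Qp p\<^esub>" using place_ideal_class_iff[OF z(1)] by simp
  have "adele_class idem \<in> place_ideal p"
    using place_ideal_class_iff[OF idem_closed] by (simp add: adele_zero_at_simps)
  then obtain x where x: "x \<in> carrier adele_ring" "adele_class (x \<otimes>\<^bsub>adele_ring\<^esub> z) = adele_class idem"
    unfolding ideal[symmetric] principal_hyperideal_eq[OF z(1)] by auto
  then obtain q where q: "q \<noteq> 0" "idem = principal q \<otimes>\<^bsub>adele_ring\<^esub> (x \<otimes>\<^bsub>adele_ring\<^esub> z)"
    using adele_class_eq_iff[OF A.m_closed[OF x(1) z(1)] idem_closed] by blast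
  define y where "y = principal q \<otimes>\<^bsub>adele_ring\<^esub> x"
  have y: "y \<in> carrier adele_ring" unfolding y_def using x(1) principal_closed by simp
  have yz: "idem = y \<otimes>\<^bsub>adele_ring\<^esub> z" unfolding y_def q(2) using x(1) z(1) principal_closed by (simp add: A.m_assoc)
  have one: "fst y l \<otimes>\<^bsub>Qp l\<^esub> fst z l = \<one>\<^bsub>Qp l\<^esub>" if l: "prime l" "l \<noteq> p" for l
    using arg_cong[OF yz, of "\<lambda>a. fst a l"] by (simp add: adele_zero_at_simps(4)[OF l] Gp_one[OF prime_p l] adele_simps(1)[OF l(1)])
  have norm: "padic_norm l (fst y l) * padic_norm l (fst z l) = 1" if l: "prime l" "l \<noteq> p" for l
    using padic_norm_mult[OF l(1) adele_closed[OF y l(1)] adele_closed[OF z(1) l(1)]] one[OF l] padic_norm_one[OF l(1)] by simp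
  have "fst z l \<noteq> \<zero>\<^bsub>Qp l\<^esub>" if l: "prime l" "l \<noteq> p" for l
    using norm[OF l] padic_norm_zero[OF l(1)] by auto
  moreover have "finite {l. prime l \<and> l \<noteq> p \<and> padic_norm l (fst z l) \<noteq> 1}"
  proof (rule finite_subset)
    show "{l. prime l \<and> l \<noteq> p \<and> padic_norm l (fst z l) \<noteq> 1} \<subseteq>
       {l. prime l \<and> \<not> padic_norm l (fst y l) \<le> 1} \<union> {l. prime l \<and> \<not> padic_norm l (fst z l) \<le> 1}"
    proof (rule subsetI, rule ccontr)
      fix l assume l: "l \<in> {l. prime l \<and> l \<noteq> p \<and> padic_norm l (fst z l) \<noteq> 1}"
        "l \<notin> {l. prime l \<and> \<not> padic_norm l (fst y l) \<le> 1} \<union> {l. prime l \<and> \<not> padic_norm l (fst z l) \<le> 1}"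
      then have pl: "prime l" "l \<noteq> p" and le: "padic_norm l (fst y l) \<le> 1" "padic_norm l (fst z l) \<le> 1" by auto
      have "padic_norm l (fst z l) = 1"
        using norm[OF pl] le mult_left_le[of "padic_norm l (fst y l)" "padic_norm l (fst z l)"]
          padic_norm_nonneg[OF pl(1) adele_closed[OF z(1) pl(1)]] by (simp add: mult.commute)
      then show False using l(1) by simp
    qed
    show "finite ({l. prime l \<and> \<not> padic_norm l (fst y l) \<le> 1} \<union> {l. prime l \<and> \<not> padic_norm l (fst z l) \<le> 1})"
      using y z(1) by (simp add: carrier_adele_ring)
  qed
  moreover have "snd z \<noteq> 0" using arg_cong[OF yz, of snd] by (auto simp: adele_zero_at_simps adele_simps)
  ultimately have "z \<in> fiber_adeles"
    using zp adele_closed[OF z(1)] adele_ext[OF z(1)] by (simp add: fiber_adeles_def)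
  then show "s \<in> adele_class ` fiber_adeles" using z(2) by blast
qed

subsection \<open>The topology of the fiber\<close>

lemma idele_class_top_eq: "idele_class_top = quotient_topology idele_top adele_class"
  by (simp add: idele_class_top_def adele_class_def[abs_def] r_coset_def units_of_def)

lemma topspace_Pp_top: "topspace (Pp_top p) = Pp p"
proof -
  have "adele_class a \<otimes>\<^bsub>HQ\<^esub> adele_class idem = adele_class (a \<otimes>\<^bsub>adele_ring\<^esub> idem)" if "a \<in> ideles" for a
    using HQ_mult[OF _ idem_closed] that ideles_subset by blast
  then have "(\<lambda>c. c \<otimes>\<^bsub>HQ\<^esub> adele_class idem) ` adele_class ` ideles = adele_class ` (\<lambda>a. a \<otimes>\<^bsub>adele_ring\<^esub> idem) ` ideles"
    unfolding image_image by (rule image_cong[OF refl])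
  then show ?thesis
    by (simp add: Pp_top_def idele_class_top_eq topspace_idele_top Pp_eq fiber_adeles_eq)
qed

lemma openin_Pp_top:
  "openin (Pp_top p) U \<longleftrightarrow> U \<subseteq> Pp p \<and> openin idele_top {a \<in> ideles. adele_class (a \<otimes>\<^bsub>adele_ring\<^esub> idem) \<in> U}"
proof -
  have eq: "{a \<in> ideles. adele_class a \<otimes>\<^bsub>HQ\<^esub> adele_class idem \<in> U} = {a \<in> ideles. adele_class (a \<otimes>\<^bsub>adele_ring\<^esub> idem) \<in> U}"
    using HQ_mult[OF _ idem_closed] ideles_subset by (metis (no_types, lifting) subsetD)
  have "openin (Pp_top p) U \<longleftrightarrow> U \<subseteq> Pp p \<and>
      openin idele_class_top {c \<in> topspace idele_class_top. c \<otimes>\<^bsub>HQ\<^esub> adele_class idem \<in> U}"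
    unfolding topspace_Pp_top[symmetric] Pp_top_def openin_quotient_topology topspace_quotient_topology ..
  also have "openin idele_class_top {c \<in> topspace idele_class_top. c \<otimes>\<^bsub>HQ\<^esub> adele_class idem \<in> U} \<longleftrightarrow>
      openin idele_top {a \<in> ideles. adele_class a \<otimes>\<^bsub>HQ\<^esub> adele_class idem \<in> U}"
  proof -
    have "{a \<in> ideles. adele_class a \<in> {c \<in> adele_class ` ideles. c \<otimes>\<^bsub>HQ\<^esub> adele_class idem \<in> U}} =
        {a \<in> ideles. adele_class a \<otimes>\<^bsub>HQ\<^esub> adele_class idem \<in> U}" by blast
    then show ?thesis
      by (simp only: idele_class_top_eq openin_quotient_topology topspace_quotient_topology topspace_idele_top) blast
  qed
  finally show ?thesis unfolding eq .
qed

end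

section \<open>The bundle of \<open>G\<^sub>p\<close> and the fiber\<close>

context
  fixes p :: nat
  assumes prime_p: "prime p"
begin

interpretation T: torsor p "Gp_top p" "Gp_translation p"
  by (intro torsor.intro prime_p compact_Gp_torsor_translation)

lemma topspace_Gp: "topspace (Gp_top p) = carrier (Gp p)"
  by (rule topspace_Gp_top[OF prime_p])

lemma frob_pow_component:
  assumes l: "prime l" "l \<noteq> p"
  shows "(frob p [^]\<^bsub>Gp p\<^esub> (k::int)) l = Qp_of_rat l (of_nat p powi k)"
proof (induction k rule: int_induct[of _ 0])
  case base
  then show ?case by (simp add: Gp_one[OF prime_p l] Qp_of_rat_one[OF l(1)])
next
  have p0: "(of_nat p :: rat) \<noteq> 0" using prime_gt_0_nat[OF prime_p] by simp
  have f: "frob p l = Qp_of_rat l (of_nat p)" using l by (simp add: frob_def)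
  have step: "(frob p [^]\<^bsub>Gp p\<^esub> (k + 1)) l = (frob p [^]\<^bsub>Gp p\<^esub> k) l \<otimes>\<^bsub>Qp l\<^esub> Qp_of_rat l (of_nat p)" for k :: int
    using frob_in_Gp[OF prime_p] by (simp add: T.G.int_pow_mult Gp_mult[OF prime_p l] f)
  {
    case (step1 k)
    then show ?case using step[of k] p0 by (simp add: power_int_add Qp_of_rat_mult[OF l(1)])
  next
    case (step2 k)
    define x where "x = (frob p [^]\<^bsub>Gp p\<^esub> (k - 1)) l"
    have x: "x \<in> carrier (Qp l)" unfolding x_def by (rule Gp_closed[OF prime_p frob_pow_closed[OF prime_p] l])
    have xp: "x \<otimes>\<^bsub>Qp l\<^esub> Qp_of_rat l (of_nat p) = Qp_of_rat l (of_nat p powi k)"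
      using step[of "k - 1"] step2.IH by (simp add: x_def)
    have "x = x \<otimes>\<^bsub>Qp l\<^esub> (Qp_of_rat l (of_nat p) \<otimes>\<^bsub>Qp l\<^esub> Qp_of_rat l (inverse (of_nat p)))"
      using p0 x by (simp add: Qp_of_rat_one[OF l(1)] Qp_ops[OF l(1)] flip: Qp_of_rat_mult[OF l(1)])
    also have "\<dots> = Qp_of_rat l (of_nat p powi k) \<otimes>\<^bsub>Qp l\<^esub> Qp_of_rat l (inverse (of_nat p))"
      using x by (simp add: Qp_of_rat_closed[OF l(1)] flip: xp Qp_m_assoc[OF l(1)])
    also have "\<dots> = Qp_of_rat l (of_nat p powi (k - 1))"
      using p0 by (simp add: power_int_diff divide_inverse flip: Qp_of_rat_mult[OF l(1)])
    finally show ?case by (simp add: x_def)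
  }
qed

definition fiber_point :: "(nat \<Rightarrow> (nat \<Rightarrow> rat) set) \<times> real \<Rightarrow> adele set" where
  "fiber_point z = adele_class (adele_zero_at p (fst z) (- ln (snd z)))"

lemma XI_cases:
  assumes "z \<in> topspace T.XI"
  obtains g \<rho> where "z = (g, \<rho>)" "g \<in> carrier (Gp p)" "\<rho> \<in> {0<..<1}" "- ln \<rho> > 0"
proof -
  have "fst z \<in> carrier (Gp p)" "snd z \<in> {0<..<1}"
    using assms unfolding T.topspace_XI topspace_Gp mem_Times_iff by simp_all
  then show ?thesis by (intro that[of "fst z" "snd z"]) simp_all
qed

lemma XI_adele: "z \<in> topspace T.XI \<Longrightarrow> adele_zero_at p (fst z) (- ln (snd z)) \<in> fiber_adeles p"
  by (erule XI_cases) (simp add: adele_zero_at_fiber[OF prime_p])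

text \<open>Multiplication by the rational number \<open>p\<^sup>k\<close> does not change the class. Outside \<open>p\<close> it is multiplication
  by \<open>f\<^sub>p\<^sup>k\<close>, and at infinity it turns \<open>- ln \<rho>\<close> into the negative logarithm of \<open>\<rho> powr p\<^sup>k\<close>.\<close>

lemma fiber_point_shift:
  assumes z: "z \<in> topspace T.XI"
  shows "fiber_point (T.shift k z) = fiber_point z"
proof -
  obtain g \<rho> where g: "z = (g, \<rho>)" "g \<in> carrier (Gp p)" "\<rho> \<in> {0<..<1}" "- ln \<rho> > 0" by (rule XI_cases[OF z])
  let ?q = "of_nat p powi k :: rat"
  have p0: "p > 0" by (rule prime_gt_0_nat[OF prime_p])
  have q0: "?q \<noteq> 0" using p0 by simp
  have a: "adele_zero_at p g (- ln \<rho>) \<in> carrier adele_ring"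
    using XI_adele[OF z] fiber_adeles_subset[OF prime_p] by (auto simp: g(1))
  have of_rat_q: "(of_rat ?q :: real) = real p powr of_int k"
    using p0 by (simp add: powr_real_of_int' power_int_def of_rat_power of_rat_inverse)
  have "adele_zero_at p (Gp_translation p (frob p [^]\<^bsub>Gp p\<^esub> k) g) (- ln (\<rho> powr (real p powr of_int k))) =
      principal ?q \<otimes>\<^bsub>adele_ring\<^esub> adele_zero_at p g (- ln \<rho>)"
  proof (rule adele_eqI)
    show "snd (adele_zero_at p (Gp_translation p (frob p [^]\<^bsub>Gp p\<^esub> k) g) (- ln (\<rho> powr (real p powr of_int k)))) =
        snd (principal ?q \<otimes>\<^bsub>adele_ring\<^esub> adele_zero_at p g (- ln \<rho>))"
      using g(3) by (simp add: adele_zero_at_simps[OF prime_p] adele_simps principal_simps of_rat_q ln_powr)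
    fix l :: nat assume l: "prime l"
    show "fst (adele_zero_at p (Gp_translation p (frob p [^]\<^bsub>Gp p\<^esub> k) g) (- ln (\<rho> powr (real p powr of_int k)))) l =
        fst (principal ?q \<otimes>\<^bsub>adele_ring\<^esub> adele_zero_at p g (- ln \<rho>)) l"
    proof (cases "l = p")
      case True
      then show ?thesis
        by (simp add: adele_simps prime_p adele_zero_at_simps[OF prime_p] principal_simps Qp_ops Qp_of_rat_closed)
    next
      case False
      then show ?thesis
        using l g(2) by (simp add: adele_simps adele_zero_at_simps[OF prime_p] principal_simps
          Gp_translation_def Gp_mult[OF prime_p] frob_pow_component)
    qed
  qed (simp_all add: adele_zero_at_simps[OF prime_p] adele_extensional)
  then have "fiber_point (T.shift k z) = adele_class (principal ?q \<otimes>\<^bsub>adele_ring\<^esub> adele_zero_at p g (- ln \<rho>))"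
    by (simp add: fiber_point_def T.shift_def g(1))
  then show ?thesis using adele_class_principal_mult[OF a q0] by (simp add: fiber_point_def g(1))
qed

text \<open>Two points with the same class differ by a positive rational that is a unit outside \<open>p\<close>, and
  such a rational is a power of \<open>p\<close>.\<close>

lemma fiber_point_eq_iff:
  assumes z: "z \<in> topspace T.XI" and w: "w \<in> topspace T.XI"
  shows "fiber_point z = fiber_point w \<longleftrightarrow> (\<exists>k. w = T.shift k z)"
proof
  assume eq: "fiber_point z = fiber_point w"
  obtain g \<rho> where g: "z = (g, \<rho>)" "g \<in> carrier (Gp p)" "\<rho> \<in> {0<..<1}" "- ln \<rho> > 0" by (rule XI_cases[OF z])
  obtain h \<sigma> where h: "w = (h, \<sigma>)" "h \<in> carrier (Gp p)" "\<sigma> \<in> {0<..<1}" "- ln \<sigma> > 0" by (rule XI_cases[OF w])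
  have "adele_zero_at p g (- ln \<rho>) \<in> carrier adele_ring" "adele_zero_at p h (- ln \<sigma>) \<in> carrier adele_ring"
    using XI_adele[OF z] XI_adele[OF w] fiber_adeles_subset[OF prime_p] by (auto simp: g(1) h(1))
  then obtain q where q: "q \<noteq> 0" "adele_zero_at p h (- ln \<sigma>) = principal q \<otimes>\<^bsub>adele_ring\<^esub> adele_zero_at p g (- ln \<rho>)"
    using eq adele_class_eq_iff by (auto simp: fiber_point_def g(1) h(1))
  have s: "- ln \<sigma> = of_rat q * (- ln \<rho>)"
    using arg_cong[OF q(2), of snd] by (simp add: adele_zero_at_simps[OF prime_p] adele_simps principal_simps)
  have "(of_rat q :: real) > 0"
    using s g(4) h(4) by (metis zero_less_mult_pos2)
  then have q_pos: "q > 0" by simp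
  have comp: "h l = Qp_of_rat l q \<otimes>\<^bsub>Qp l\<^esub> g l" if l: "prime l" "l \<noteq> p" for l
    using arg_cong[OF q(2), of "\<lambda>a. fst a l"] l by (simp add: adele_zero_at_simps[OF prime_p] adele_simps principal_simps)
  have "padic_abs l q = 1" if l: "prime l" "l \<noteq> p" for l
  proof -
    have "padic_norm l (h l) = padic_abs l q * padic_norm l (g l)"
      unfolding comp[OF l] using padic_norm_mult[OF l(1) Qp_of_rat_closed[OF l(1)] Gp_closed[OF prime_p g(2) l]]
      by (simp add: padic_norm_of_rat[OF l(1)])
    then show ?thesis using g(2) h(2) l by (simp add: carrier_Gp[OF prime_p])
  qed
  then obtain k where k: "q = of_nat p powi k" using rational_power_of_prime[OF prime_p q_pos] by blast
  have "h = Gp_translation p (frob p [^]\<^bsub>Gp p\<^esub> k) g"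
  proof (rule extensionalityI[of _ "primes - {p}"])
    have hg: "frob p [^]\<^bsub>Gp p\<^esub> k \<otimes>\<^bsub>Gp p\<^esub> g \<in> carrier (Gp p)" using g(2) frob_pow_closed[OF prime_p] by simp
    show "h \<in> extensional (primes - {p})" "Gp_translation p (frob p [^]\<^bsub>Gp p\<^esub> k) g \<in> extensional (primes - {p})"
      using h(2) g(2) hg carrier_Gp[OF prime_p] by (simp_all add: Gp_translation_def)
    fix l assume "l \<in> primes - {p}"
    then show "h l = Gp_translation p (frob p [^]\<^bsub>Gp p\<^esub> k) g l"
      using g(2) comp[of l] by (simp add: Gp_translation_def Gp_mult[OF prime_p] frob_pow_component k)
  qed
  moreover have "\<sigma> = \<rho> powr (real p powr of_int k)"
  proof -
    have "(of_rat q :: real) = real p powr of_int k"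
      using prime_gt_0_nat[OF prime_p] by (simp add: k powr_real_of_int' power_int_def of_rat_power of_rat_inverse)
    with s have "- ln \<sigma> = real p powr of_int k * - ln \<rho>" by (simp only:)
    then have "ln \<sigma> = real p powr of_int k * ln \<rho>" by (simp only: mult_minus_right neg_equal_iff_equal)
    also have "\<dots> = ln (\<rho> powr (real p powr of_int k))" using g(3) by (simp only: ln_powr)
    finally have "ln \<sigma> = ln (\<rho> powr (real p powr of_int k))" .
    then show ?thesis by (rule ln_inj_iff[THEN iffD1, rotated 2]) (use g(3) h(3) in simp_all)
  qed
  ultimately show "\<exists>k. w = T.shift k z" by (intro exI[of _ k]) (simp add: T.shift_def g(1) h(1))
next
  assume "\<exists>k. w = T.shift k z"
  then show "fiber_point z = fiber_point w" using fiber_point_shift[OF z] by auto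
qed

text \<open>Multiplying by the idempotent replaces the component at \<open>p\<close> by 0, so the orbit map sends a unit idele
  to the point of the fiber given by its components outside \<open>p\<close>.\<close>

lemma unit_idele_class:
  assumes u: "u \<in> (\<Pi>\<^sub>E l\<in>primes. Units (Zp l))" and t: "t > 0"
  shows "(restrict u (primes - {p}), exp (- t)) \<in> topspace T.XI"
    and "adele_class ((u, t) \<otimes>\<^bsub>adele_ring\<^esub> adele_zero_at p \<one>\<^bsub>Gp p\<^esub> 1) = fiber_point (restrict u (primes - {p}), exp (- t))"
    and "(u, t) \<in> ideles"
proof -
  have ul: "u l \<in> carrier (Qp l) \<and> padic_norm l (u l) = 1 \<and> u l \<noteq> \<zero>\<^bsub>Qp l\<^esub>" if "prime l" for l
    using padic_norm_one_unit[OF that] u that by (auto simp: PiE_iff)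
  have "restrict u (primes - {p}) \<in> carrier (Gp p)" using ul by (simp add: carrier_Gp[OF prime_p])
  then show "(restrict u (primes - {p}), exp (- t)) \<in> topspace T.XI"
    unfolding T.topspace_XI topspace_Gp using t by simp
  have "{l. prime l \<and> padic_norm l (u l) \<noteq> 1} = {}" using ul by blast
  then have "finite {l. prime l \<and> padic_norm l (u l) \<noteq> 1}" by (simp only: finite.emptyI)
  then show ideles: "(u, t) \<in> ideles" using ul t u by (simp add: ideles_def PiE_iff)
  then have c: "(u, t) \<in> carrier adele_ring" using ideles_subset by blast
  have "(u, t) \<otimes>\<^bsub>adele_ring\<^esub> adele_zero_at p \<one>\<^bsub>Gp p\<^esub> 1 = adele_zero_at p (restrict u (primes - {p})) t"
  proof (rule adele_eqI)
    fix l :: nat assume l: "prime l"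
    show "fst ((u, t) \<otimes>\<^bsub>adele_ring\<^esub> adele_zero_at p \<one>\<^bsub>Gp p\<^esub> 1) l = fst (adele_zero_at p (restrict u (primes - {p})) t) l"
      using idem_mult[OF prime_p c] l by (cases "l = p") (simp_all add: adele_zero_at_simps[OF prime_p])
  qed (simp_all add: adele_extensional adele_zero_at_simps[OF prime_p] idem_mult[OF prime_p c])
  then show "adele_class ((u, t) \<otimes>\<^bsub>adele_ring\<^esub> adele_zero_at p \<one>\<^bsub>Gp p\<^esub> 1) = fiber_point (restrict u (primes - {p}), exp (- t))"
    by (simp add: fiber_point_def)
qed

text \<open>A rational number with the absolute values and the sign of \<open>a\<close> leaves units and a positive real number
  after division.\<close>

lemma idele_decompose:
  assumes a: "a \<in> ideles"
  obtains q u t where "q \<noteq> 0" "u \<in> (\<Pi>\<^sub>E l\<in>primes. Units (Zp l))" "t > 0"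
    "a = principal q \<otimes>\<^bsub>adele_ring\<^esub> (u, t)"
proof -
  have ac: "a \<in> carrier adele_ring" using a ideles_subset by blast
  have al: "fst a l \<in> carrier (Qp l) \<and> fst a l \<noteq> \<zero>\<^bsub>Qp l\<^esub>" if "prime l" for l using a that by (simp add: ideles_def)
  have fin: "finite {l. prime l \<and> padic_norm l (fst a l) \<noteq> 1}" and s0: "snd a \<noteq> 0"
    using a by (simp_all add: ideles_def)
  obtain q where q: "q \<noteq> 0" "\<And>l. prime l \<Longrightarrow> padic_abs l q = padic_norm l (fst a l)" "snd a / of_rat q > 0"
    using rational_with_norms[of "fst a" "snd a"] al fin s0 by auto
  define b where "b = principal (inverse q) \<otimes>\<^bsub>adele_ring\<^esub> a"
  have b: "fst b l \<in> Units (Zp l)" if l: "prime l" for l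
  proof -
    have "padic_norm l (fst b l) = padic_abs l (inverse q) * padic_norm l (fst a l)"
      using al[OF l] by (simp add: b_def adele_simps l principal_simps padic_norm_mult[OF l] Qp_of_rat_closed[OF l] padic_norm_of_rat[OF l])
    also have "\<dots> = 1" using q(1) q(2)[OF l] padic_abs_pos[OF l q(1)] by (simp add: padic_abs_inverse[OF l])
    finally show ?thesis
      using al[OF l] by (simp add: Units_Zp[OF l] b_def adele_simps l principal_simps Qp_ops[OF l] Qp_of_rat_closed[OF l])
  qed
  have "fst b \<in> (\<Pi>\<^sub>E l\<in>primes. Units (Zp l))"
    using b adele_extensional by (auto simp: PiE_iff b_def)
  moreover have "snd b > 0" using q(3) by (simp add: b_def adele_simps principal_simps of_rat_inverse divide_inverse mult.commute)
  moreover have "a = principal q \<otimes>\<^bsub>adele_ring\<^esub> (fst b, snd b)"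
    using principal_cancel(2)[OF ac q(1)] by (simp add: b_def)
  ultimately show ?thesis using that q(1) by blast
qed

lemma fiber_point_image: "fiber_point ` topspace T.XI = Pp p"
proof (intro subset_antisym subsetI)
  show "s \<in> Pp p" if "s \<in> fiber_point ` topspace T.XI" for s
    using that XI_adele unfolding Pp_eq[OF prime_p] fiber_point_def by blast
  fix s assume "s \<in> Pp p"
  then obtain a where a: "a \<in> ideles" "s = adele_class (a \<otimes>\<^bsub>adele_ring\<^esub> adele_zero_at p \<one>\<^bsub>Gp p\<^esub> 1)"
    unfolding Pp_eq[OF prime_p] fiber_adeles_eq[OF prime_p] by blast
  obtain q u t where q: "q \<noteq> 0" "u \<in> (\<Pi>\<^sub>E l\<in>primes. Units (Zp l))" "t > 0" "a = principal q \<otimes>\<^bsub>adele_ring\<^esub> (u, t)"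
    by (rule idele_decompose[OF a(1)])
  have c: "(u, t) \<in> carrier adele_ring" using unit_idele_class(3)[OF q(2,3)] ideles_subset by blast
  have "s = adele_class ((u, t) \<otimes>\<^bsub>adele_ring\<^esub> adele_zero_at p \<one>\<^bsub>Gp p\<^esub> 1)"
    unfolding a(2) q(4) using c idem_closed[OF prime_p] principal_closed adele_class_principal_mult[OF _ q(1)] by (simp add: A.m_assoc)
  then show "s \<in> fiber_point ` topspace T.XI" using unit_idele_class(1,2)[OF q(2,3)] by blast
qed

text \<open>Putting 1 at the prime \<open>p\<close> is a continuous lift from \<open>G\<^sub>p \<times> (0, 1)\<close> to the ideles.\<close>

lemma continuous_map_fiber_point: "continuous_map T.XI (Pp_top p) fiber_point"
proof -
  define j where "j z = (\<lambda>l\<in>primes. if l = p then \<one>\<^bsub>Qp p\<^esub> else fst z l, - ln (snd z))" for z :: "(nat \<Rightarrow> (nat \<Rightarrow> rat) set) \<times> real"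
  have j: "fst (j z) \<in> (\<Pi>\<^sub>E l\<in>primes. Units (Zp l))" "snd (j z) > 0" "restrict (fst (j z)) (primes - {p}) = fst z" "exp (- snd (j z)) = snd z"
    if z: "z \<in> topspace T.XI" for z
  proof -
    obtain g \<rho> where g: "z = (g, \<rho>)" "g \<in> carrier (Gp p)" "\<rho> \<in> {0<..<1}" "- ln \<rho> > 0" by (rule XI_cases[OF z])
    have "\<one>\<^bsub>Qp p\<^esub> \<in> Units (Zp p)" by (simp add: Units_Zp[OF prime_p] Qp_ops[OF prime_p] padic_norm_one[OF prime_p])
    then show "fst (j z) \<in> (\<Pi>\<^sub>E l\<in>primes. Units (Zp l))"
      using g(1,2) unfolding carrier_Gp_PiE[OF prime_p] by (auto simp: j_def PiE_iff)
    show "snd (j z) > 0" "exp (- snd (j z)) = snd z" using g by (simp_all add: j_def)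
    show "restrict (fst (j z)) (primes - {p}) = fst z"
      using g(1,2) unfolding carrier_Gp_PiE[OF prime_p] by (auto simp: j_def PiE_iff extensional_def fun_eq_iff restrict_def)
  qed
  have j_ideles: "j z \<in> ideles" if "z \<in> topspace T.XI" for z
    using unit_idele_class(3)[OF j(1,2)[OF that]] by simp
  have "continuous_map T.XI idele_top j"
    unfolding idele_top_def
  proof (rule continuous_on_generated_topo)
    have "j ` topspace T.XI \<subseteq> topspace idele_top" using j_ideles topspace_idele_top by blast
    then show "j ` topspace T.XI \<subseteq> \<Union> {(\<Pi>\<^sub>E l\<in>primes. U l) \<times> V | U V.
        (\<forall>l\<in>primes. openin (Qp_top l) (U l) \<and> U l \<subseteq> Units (Qp l)) \<and>
        finite {l \<in> primes. U l \<noteq> Units (Zp l)} \<and> open V \<and> 0 \<notin> V}"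
      unfolding idele_top_def topology_generated_by_topspace .
    fix W :: "adele set" assume "W \<in> {(\<Pi>\<^sub>E l\<in>primes. U l) \<times> V | U V.
        (\<forall>l\<in>primes. openin (Qp_top l) (U l) \<and> U l \<subseteq> Units (Qp l)) \<and>
        finite {l \<in> primes. U l \<noteq> Units (Zp l)} \<and> open V \<and> 0 \<notin> V}"
    then obtain U V where UV: "W = (\<Pi>\<^sub>E l\<in>primes. U l) \<times> V" "\<And>l. prime l \<Longrightarrow> openin (Qp_top l) (U l)"
      "finite {l \<in> primes. U l \<noteq> Units (Zp l)}" "open V" by blast
    define B where "B l = U l \<inter> Units (Zp l)" for l
    have B: "openin (Gp_top p) (\<Pi>\<^sub>E l\<in>primes - {p}. B l)"
      unfolding Gp_top_def openin_PiE_gen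
    proof (intro disjI2 conjI ballI)
      show "finite {l \<in> primes - {p}. B l \<noteq> topspace (subtopology (Qp_top l) (Units (Zp l)))}"
      proof (rule finite_subset[OF _ UV(3)], rule subsetI, rule ccontr)
        fix l assume l: "l \<in> {l \<in> primes - {p}. B l \<noteq> topspace (subtopology (Qp_top l) (Units (Zp l)))}" "l \<notin> {l \<in> primes. U l \<noteq> Units (Zp l)}"
        then have "prime l" "U l = Units (Zp l)" by auto
        then show False using l(1) topspace_Units_top[of l] by (simp add: B_def)
      qed
      show "openin (subtopology (Qp_top l) (Units (Zp l))) (B l)" if "l \<in> primes - {p}" for l
        using UV(2)[of l] that by (auto simp: openin_subtopology B_def)
    qed
    have V: "openin (top_of_set {0<..<1}) {\<rho> \<in> {0<..<1::real}. - ln \<rho> \<in> V}"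
    proof -
      have "continuous_map (top_of_set {0<..<1}) euclideanreal (\<lambda>\<rho>. - ln \<rho>)"
        by (simp, intro continuous_intros) auto
      from openin_continuous_map_preimage[OF this, of V] show ?thesis using UV(4) by simp
    qed
    have eq: "j -` W \<inter> topspace T.XI = (if \<one>\<^bsub>Qp p\<^esub> \<in> U p then (\<Pi>\<^sub>E l\<in>primes - {p}. B l) \<times> {\<rho> \<in> {0<..<1::real}. - ln \<rho> \<in> V} else {})"
    proof -
      have mem: "fst (j z) \<in> (\<Pi>\<^sub>E l\<in>primes. U l) \<longleftrightarrow> \<one>\<^bsub>Qp p\<^esub> \<in> U p \<and> (\<forall>l\<in>primes - {p}. fst z l \<in> U l)" for z
        using prime_p by (auto simp: j_def PiE_iff)
      have "a \<in> (\<Pi>\<^sub>E l\<in>primes - {p}. B l) \<longleftrightarrow> a \<in> carrier (Gp p) \<and> (\<forall>l\<in>primes - {p}. a l \<in> U l)" for a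
        unfolding carrier_Gp_PiE[OF prime_p] PiE_iff B_def by blast
      then show ?thesis
        unfolding T.topspace_XI topspace_Gp UV(1) set_eq_iff Int_iff vimage_eq mem_Times_iff mem
        by (auto simp: j_def)
    qed
    show "openin T.XI (j -` W \<inter> topspace T.XI)"
      unfolding eq using B V by (simp add: openin_prod_Times_iff)
  qed
  then have j_cont: "openin T.XI {z \<in> topspace T.XI. j z \<in> W}" if "openin idele_top W" for W
    using that by (rule openin_continuous_map_preimage)
  have point: "adele_class (j z \<otimes>\<^bsub>adele_ring\<^esub> adele_zero_at p \<one>\<^bsub>Gp p\<^esub> 1) = fiber_point z" if "z \<in> topspace T.XI" for z
    using unit_idele_class(2)[OF j(1,2)[OF that]] j(3,4)[OF that] by simp
  show ?thesis
    unfolding continuous_map_def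
  proof (intro conjI allI impI)
    show "fiber_point \<in> topspace T.XI \<rightarrow> topspace (Pp_top p)"
      using fiber_point_image topspace_Pp_top[OF prime_p] by blast
    fix W assume "openin (Pp_top p) W"
    then have "openin idele_top {a \<in> ideles. adele_class (a \<otimes>\<^bsub>adele_ring\<^esub> adele_zero_at p \<one>\<^bsub>Gp p\<^esub> 1) \<in> W}"
      unfolding openin_Pp_top[OF prime_p] by blast
    from j_cont[OF this] show "openin T.XI {z \<in> topspace T.XI. fiber_point z \<in> W}"
      by (rule back_subst[where P = "openin T.XI"]) (use j_ideles point in auto)
  qed
qed

text \<open>Let the preimage of \<open>W\<close> in \<open>G\<^sub>p \<times> (0, 1)\<close> be open, and let \<open>a\<close> be an idele over \<open>W\<close>, with \<open>a = q u\<close> for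
  a rational number \<open>q\<close> and a unit idele \<open>u\<close> with positive real component. A box around \<open>u\<close> consists of unit
  ideles over \<open>W\<close>. Multiplication by \<open>q\<close> maps it to a box around \<open>a\<close>, because \<open>q\<close> is a unit at almost all
  primes, and does not change the classes. So the ideles over \<open>W\<close> form an open set.\<close>

lemma quotient_map_fiber_point: "quotient_map T.XI (Pp_top p) fiber_point"
proof -
  have "openin (Pp_top p) W" if W: "W \<subseteq> topspace (Pp_top p)" "openin T.XI {z \<in> topspace T.XI. fiber_point z \<in> W}" for W
    unfolding openin_Pp_top[OF prime_p]
  proof (intro conjI)
    show "W \<subseteq> Pp p" using W(1) topspace_Pp_top[OF prime_p] by simp
    let ?I = "{a \<in> ideles. adele_class (a \<otimes>\<^bsub>adele_ring\<^esub> adele_zero_at p \<one>\<^bsub>Gp p\<^esub> 1) \<in> W}"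
    show "openin idele_top ?I"
    proof (subst openin_subopen, intro ballI)
      fix a assume a: "a \<in> ?I"
      then obtain q u t where q: "q \<noteq> 0" "u \<in> (\<Pi>\<^sub>E l\<in>primes. Units (Zp l))" "t > 0" "a = principal q \<otimes>\<^bsub>adele_ring\<^esub> (u, t)"
        using idele_decompose by blast
      have orbit_map: "adele_class ((principal q \<otimes>\<^bsub>adele_ring\<^esub> (v, s)) \<otimes>\<^bsub>adele_ring\<^esub> adele_zero_at p \<one>\<^bsub>Gp p\<^esub> 1) = fiber_point (restrict v (primes - {p}), exp (- s))"
        if vs: "v \<in> (\<Pi>\<^sub>E l\<in>primes. Units (Zp l))" "s > 0" for v s
      proof -
        have c: "(v, s) \<in> carrier adele_ring" using unit_idele_class(3)[OF vs] ideles_subset by blast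
        then have "(principal q \<otimes>\<^bsub>adele_ring\<^esub> (v, s)) \<otimes>\<^bsub>adele_ring\<^esub> adele_zero_at p \<one>\<^bsub>Gp p\<^esub> 1 = principal q \<otimes>\<^bsub>adele_ring\<^esub> ((v, s) \<otimes>\<^bsub>adele_ring\<^esub> adele_zero_at p \<one>\<^bsub>Gp p\<^esub> 1)"
          using idem_closed[OF prime_p] principal_closed by (simp add: A.m_assoc)
        then show ?thesis
          using adele_class_principal_mult[OF _ q(1)] c idem_closed[OF prime_p] unit_idele_class(2)[OF vs] by simp
      qed
      let ?z = "(restrict u (primes - {p}), exp (- t))"
      have "?z \<in> {z \<in> topspace T.XI. fiber_point z \<in> W}"
        using a orbit_map[OF q(2,3)] unit_idele_class(1)[OF q(2,3)] q(4) by simp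
      then obtain A1 A2 where A12: "openin (Gp_top p) A1" "openin (top_of_set {0<..<1}) A2"
        "restrict u (primes - {p}) \<in> A1" "exp (- t) \<in> A2" "A1 \<times> A2 \<subseteq> {z \<in> topspace T.XI. fiber_point z \<in> W}"
        using W(2) unfolding openin_prod_topology_alt by meson
      obtain B where B: "finite {l \<in> primes - {p}. B l \<noteq> topspace (subtopology (Qp_top l) (Units (Zp l)))}"
        "\<And>l. l \<in> primes - {p} \<Longrightarrow> openin (subtopology (Qp_top l) (Units (Zp l))) (B l)"
        "restrict u (primes - {p}) \<in> PiE (primes - {p}) B" "PiE (primes - {p}) B \<subseteq> A1"
        using A12(1,3) unfolding Gp_top_def openin_product_topology_alt by meson
      have B_units: "B l \<subseteq> Units (Zp l)" if "prime l" "l \<noteq> p" for l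
        using openin_subset[OF B(2)[of l]] that topspace_Units_top[OF that(1)] by simp
      have B_open: "openin (Qp_top l) (B l)" if "prime l" "l \<noteq> p" for l
        using B(2)[of l] that openin_Units_Zp[OF that(1)] openin_trans_full by blast
      obtain O2 where O2: "open O2" "A2 = {0<..<1} \<inter> O2" using A12(2) by (auto simp: openin_open)
      \<comment> \<open>all units at \<open>p\<close> give the same point of the fiber\<close>
      define B' where "B' l = (if l = p then Units (Zp l) else B l)" for l
      define U where "U l = (\<lambda>x. Qp_of_rat l q \<otimes>\<^bsub>Qp l\<^esub> x) ` B' l" for l
      define V where "V = {s :: real. s / of_rat q > 0 \<and> exp (- (s / of_rat q)) \<in> O2}"
      have q0: "(of_rat q :: real) \<noteq> 0" using q(1) by simp
      have B'_units: "B' l \<subseteq> Units (Zp l)" if "prime l" for l using B_units[OF that] by (simp add: B'_def)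
      have qunit: "Qp_of_rat l q \<in> Units (Qp l)" if "prime l" for l
        using q(1) padic_norm_of_rat[OF that, of q] padic_norm_zero[OF that] padic_abs_eq_0_iff[OF that, of q]
        by (auto simp: Units_Qp[OF that] Qp_of_rat_closed[OF that])
      have U_open: "openin (Qp_top l) (U l)" if "prime l" for l
      proof -
        have "openin (Qp_top l) (B' l)" using openin_Units_Zp[OF that] B_open[OF that] by (cases "l = p") (simp_all add: B'_def)
        then show ?thesis unfolding U_def by (rule openin_Qp_scale[OF that qunit[OF that]])
      qed
      have U_units: "U l \<subseteq> Units (Qp l)" if l: "prime l" for l
      proof
        fix y assume "y \<in> U l"
        then obtain x where x: "x \<in> Units (Zp l)" "y = Qp_of_rat l q \<otimes>\<^bsub>Qp l\<^esub> x" using B'_units[OF l] unfolding U_def by blast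
        then show "y \<in> Units (Qp l)"
          using padic_norm_one_unit[OF l x(1)] qunit[OF l] Qp_mult_eq_zero_iff[OF l, of "Qp_of_rat l q" x]
          by (simp add: Units_Qp[OF l] Qp_ops[OF l])
      qed
      have U_fin: "finite {l \<in> primes. U l \<noteq> Units (Zp l)}"
      proof (rule finite_subset)
        show "{l \<in> primes. U l \<noteq> Units (Zp l)} \<subseteq>
          insert p {l \<in> primes - {p}. B l \<noteq> topspace (subtopology (Qp_top l) (Units (Zp l)))} \<union> {l. prime l \<and> padic_abs l q \<noteq> 1}"
        proof (rule subsetI, rule ccontr)
          fix l assume l: "l \<in> {l \<in> primes. U l \<noteq> Units (Zp l)}"
            "l \<notin> insert p {l \<in> primes - {p}. B l \<noteq> topspace (subtopology (Qp_top l) (Units (Zp l)))} \<union> {l. prime l \<and> padic_abs l q \<noteq> 1}"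
          then have pl: "prime l" "l \<noteq> p" and q1: "padic_abs l q = 1" and Bl: "B' l = Units (Zp l)"
            using topspace_Units_top[of l] by (auto simp: B'_def simp del: topspace_subtopology)
          have qc: "Qp_of_rat l q \<in> carrier (Qp l)" "Qp_of_rat l (inverse q) \<in> carrier (Qp l)" using Qp_of_rat_closed[OF pl(1)] by auto
          have "U l = Units (Zp l)"
          proof (intro subset_antisym subsetI)
            show "y \<in> Units (Zp l)" if "y \<in> U l" for y
              using that q1 qc(1) unfolding U_def Bl
              by (auto simp: Units_Zp[OF pl(1)] Qp_ops[OF pl(1)] padic_norm_mult[OF pl(1)] padic_norm_of_rat[OF pl(1)])
            fix y assume y: "y \<in> Units (Zp l)"
            then have yc: "y \<in> carrier (Qp l)" "padic_norm l y = 1" by (simp_all add: Units_Zp[OF pl(1)])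
            have "y = Qp_of_rat l q \<otimes>\<^bsub>Qp l\<^esub> (Qp_of_rat l (inverse q) \<otimes>\<^bsub>Qp l\<^esub> y)"
              using q(1) yc qc by (simp add: Qp_of_rat_one[OF pl(1)] Qp_ops[OF pl(1)] flip: Qp_m_assoc[OF pl(1)] Qp_of_rat_mult[OF pl(1)])
            moreover have "Qp_of_rat l (inverse q) \<otimes>\<^bsub>Qp l\<^esub> y \<in> Units (Zp l)"
              using yc qc q1 by (simp add: Units_Zp[OF pl(1)] Qp_ops[OF pl(1)] padic_norm_mult[OF pl(1)] padic_norm_of_rat[OF pl(1)] padic_abs_inverse[OF pl(1)])
            ultimately show "y \<in> U l" unfolding U_def Bl by (rule image_eqI)
          qed
          then show False using l(1) by simp
        qed
        show "finite (insert p {l \<in> primes - {p}. B l \<noteq> topspace (subtopology (Qp_top l) (Units (Zp l)))} \<union> {l. prime l \<and> padic_abs l q \<noteq> 1})"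
          using B(1) finite_padic_abs_ne_1[OF q(1)] by simp
      qed
      have V_open: "open V"
        unfolding V_def using q0
        by (intro open_Collect_conj open_Collect_less continuous_intros)
          (auto intro!: open_vimage[OF O2(1), unfolded vimage_def] continuous_intros)
      have "0 \<notin> V" by (simp add: V_def)
      then have open_box: "openin idele_top ((\<Pi>\<^sub>E l\<in>primes. U l) \<times> V)"
        unfolding idele_top_def using U_open U_units U_fin V_open by (intro topology_generated_by_Basis) blast
      have "u l \<in> B' l" if "prime l" for l
        using B(3) q(2) that by (auto simp: B'_def PiE_iff)
      then have "a \<in> (\<Pi>\<^sub>E l\<in>primes. U l) \<times> V"
        using q(3) A12(4) O2(2) q0 adele_extensional
        by (auto simp: q(4) mem_Times_iff PiE_iff adele_simps principal_simps U_def V_def)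
      moreover have "(\<Pi>\<^sub>E l\<in>primes. U l) \<times> V \<subseteq> ?I"
      proof
        fix b assume b: "b \<in> (\<Pi>\<^sub>E l\<in>primes. U l) \<times> V"
        have "\<exists>x\<in>B' l. fst b l = Qp_of_rat l q \<otimes>\<^bsub>Qp l\<^esub> x" if "prime l" for l
          using b that unfolding U_def by (auto simp: mem_Times_iff PiE_iff)
        then obtain v0 where v0: "\<And>l. prime l \<Longrightarrow> v0 l \<in> B' l \<and> fst b l = Qp_of_rat l q \<otimes>\<^bsub>Qp l\<^esub> v0 l" by metis
        define v where "v = restrict v0 primes"
        define s where "s = snd b / of_rat q"
        have v: "v \<in> (\<Pi>\<^sub>E l\<in>primes. Units (Zp l))" using v0 B'_units by (auto simp: v_def PiE_iff)
        have s: "s > 0" "exp (- s) \<in> A2" using b O2(2) by (auto simp: s_def V_def mem_Times_iff)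
        have "b = principal q \<otimes>\<^bsub>adele_ring\<^esub> (v, s)"
          using b v0 q0 by (intro adele_eqI) (auto simp: mem_Times_iff PiE_iff adele_extensional adele_simps principal_simps v_def s_def)
        moreover have "restrict v (primes - {p}) \<in> A1"
        proof (rule subsetD[OF B(4)], rule PiE_I)
          fix l assume l: "l \<in> primes - {p}"
          then have "v0 l \<in> B' l" "restrict v (primes - {p}) l = v0 l" using v0 by (simp_all add: v_def)
          then show "restrict v (primes - {p}) l \<in> B l" using l by (simp add: B'_def)
        qed (simp only: restrict_apply if_False)
        then have "fiber_point (restrict v (primes - {p}), exp (- s)) \<in> W" using s(2) A12(5) by blast
        ultimately have "adele_class (b \<otimes>\<^bsub>adele_ring\<^esub> adele_zero_at p \<one>\<^bsub>Gp p\<^esub> 1) \<in> W" using orbit_map[OF v s(1)] by simp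
        moreover have "b \<in> ideles" using openin_subset[OF open_box] b topspace_idele_top by blast
        ultimately show "b \<in> ?I" by blast
      qed
      ultimately show "\<exists>N. openin idele_top N \<and> a \<in> N \<and> N \<subseteq> ?I" using open_box by blast
    qed
  qed
  moreover have "openin T.XI {z \<in> topspace T.XI. fiber_point z \<in> W}" if "openin (Pp_top p) W" for W
    by (rule openin_continuous_map_preimage[OF continuous_map_fiber_point that])
  ultimately show ?thesis
    unfolding quotient_map_def using fiber_point_image topspace_Pp_top[OF prime_p] by blast
qed

text \<open>Both spaces are quotients of \<open>G\<^sub>p \<times> (0, 1)\<close>, by maps with the same fibers.\<close>

lemma Yspace_homeomorphic_fiber:
  "\<exists>\<Phi>. homeomorphic_map (Yspace p (Gp_top p) (Gp_translation p)) (Pp_top p) \<Phi> \<and>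
     (\<forall>z\<in>carrier (Gp p) \<times> {0<..<1}. \<Phi> (sigma_orbit p (Gp_top p) (Gp_translation p) z) = fiber_point z)"
proof -
  let ?Y = "Yspace p (Gp_top p) (Gp_translation p)" and ?o = "sigma_orbit p (Gp_top p) (Gp_translation p)"
  have eq: "fiber_point z = fiber_point w \<longleftrightarrow> ?o z = ?o w" if "z \<in> topspace T.XI" "w \<in> topspace T.XI" for z w
    using fiber_point_eq_iff[OF that] T.sigma_orbit_eq_iff[OF that] by blast
  obtain \<Phi> where \<Phi>: "continuous_map ?Y (Pp_top p) \<Phi>" "\<forall>z\<in>topspace T.XI. \<Phi> (?o z) = fiber_point z"
    using quotient_map_lift[OF T.quotient_map_Yspace continuous_map_fiber_point] eq by blast
  have "quotient_map T.XI (Pp_top p) (\<Phi> \<circ> ?o)"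
    by (rule quotient_map_eq[OF quotient_map_fiber_point]) (simp add: \<Phi>(2) del: topspace_prod_topology)
  then have "quotient_map ?Y (Pp_top p) \<Phi>"
    by (rule quotient_map_from_composition[OF quotient_imp_continuous_map[OF T.quotient_map_Yspace] \<Phi>(1)])
  moreover have "inj_on \<Phi> (topspace ?Y)"
  proof (rule inj_onI)
    fix x y assume "x \<in> topspace ?Y" "y \<in> topspace ?Y" and \<Phi>xy: "\<Phi> x = \<Phi> y"
    then obtain z w where zw: "z \<in> topspace T.XI" "w \<in> topspace T.XI" "x = ?o z" "y = ?o w"
      unfolding T.topspace_Yspace by blast
    then show "x = y" using \<Phi>xy \<Phi>(2) eq[OF zw(1,2)] by simp
  qed
  ultimately have "homeomorphic_map ?Y (Pp_top p) \<Phi>" unfolding homeomorphic_map_def by (rule conjI)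
  then show ?thesis using \<Phi>(2) unfolding T.topspace_XI topspace_Gp by (intro exI conjI)
qed

lemma fiber_point_translate:
  assumes g: "g \<in> carrier (Gp p)" and \<rho>: "\<rho> \<in> {0<..<1}"
    and u: "u \<in> carrier (product_group primes (\<lambda>l. units_of (Zp l)))" and r: "r > 0"
  shows "(restrict u (primes - {p}) \<otimes>\<^bsub>Gp p\<^esub> g, \<rho> powr r) \<in> carrier (Gp p) \<times> {0<..<1}"
    "fiber_point (restrict u (primes - {p}) \<otimes>\<^bsub>Gp p\<^esub> g, \<rho> powr r) = adele_class (u, r) \<otimes>\<^bsub>HQ\<^esub> fiber_point (g, \<rho>)"
proof -
  have u': "u \<in> (\<Pi>\<^sub>E l\<in>primes. Units (Zp l))" using u by (simp add: units_of_def)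
  have c: "(u, r) \<in> carrier adele_ring" using unit_idele_class(3)[OF u' r] ideles_subset by blast
  have z: "(g, \<rho>) \<in> topspace T.XI" unfolding T.topspace_XI topspace_Gp using g \<rho> by blast
  have gc: "adele_zero_at p g (- ln \<rho>) \<in> carrier adele_ring"
    using XI_adele[OF z] fiber_adeles_subset[OF prime_p] by auto
  have ug: "restrict u (primes - {p}) \<in> carrier (Gp p)"
    using unit_idele_class(1)[OF u' r] unfolding T.topspace_XI topspace_Gp by blast
  have "\<rho> powr r < 1" using \<rho> r powr_less_mono2[of r \<rho> 1] by simp
  then show "(restrict u (primes - {p}) \<otimes>\<^bsub>Gp p\<^esub> g, \<rho> powr r) \<in> carrier (Gp p) \<times> {0<..<1}"
    using ug g \<rho> by simp
  have ucl: "u p \<in> carrier (Qp p)" using u' prime_p padic_norm_one_unit[OF prime_p] by (auto simp: PiE_iff)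
  have "adele_zero_at p (restrict u (primes - {p}) \<otimes>\<^bsub>Gp p\<^esub> g) (- ln (\<rho> powr r)) = (u, r) \<otimes>\<^bsub>adele_ring\<^esub> adele_zero_at p g (- ln \<rho>)"
  proof (rule adele_eqI)
    show "snd (adele_zero_at p (restrict u (primes - {p}) \<otimes>\<^bsub>Gp p\<^esub> g) (- ln (\<rho> powr r))) = snd ((u, r) \<otimes>\<^bsub>adele_ring\<^esub> adele_zero_at p g (- ln \<rho>))"
      using \<rho> by (simp add: adele_zero_at_simps[OF prime_p] adele_simps ln_powr)
    fix l :: nat assume l: "prime l"
    show "fst (adele_zero_at p (restrict u (primes - {p}) \<otimes>\<^bsub>Gp p\<^esub> g) (- ln (\<rho> powr r))) l = fst ((u, r) \<otimes>\<^bsub>adele_ring\<^esub> adele_zero_at p g (- ln \<rho>)) l"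
    proof (cases "l = p")
      case True
      then show ?thesis using ucl by (simp add: adele_simps prime_p adele_zero_at_simps[OF prime_p] Qp_ops)
    next
      case False
      then show ?thesis using l by (simp add: adele_simps adele_zero_at_simps[OF prime_p] Gp_mult[OF prime_p])
    qed
  qed (simp_all add: adele_zero_at_simps[OF prime_p] adele_extensional)
  then show "fiber_point (restrict u (primes - {p}) \<otimes>\<^bsub>Gp p\<^esub> g, \<rho> powr r) = adele_class (u, r) \<otimes>\<^bsub>HQ\<^esub> fiber_point (g, \<rho>)"
    using HQ_mult[OF c gc] by (simp add: fiber_point_def)
qed

end

theorem proposition9p3:
  fixes p :: nat
  assumes "prime p"
  shows
    "(mu_action p \<in> iso (Gp p) (AutoGroup (mu_prime_to p)) \<and>
      frob p \<in> carrier (Gp p) \<and>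
      (\<forall>\<xi>\<in>carrier (mu_prime_to p). mu_action p (frob p) \<xi> = \<xi> ^ p))
   \<and>
     (\<forall>(X :: 'x topology) \<phi>. compact_Gp_torsor p X \<phi> \<longrightarrow>
        compact_space (Yspace p X \<phi>) \<and> Hausdorff_space (Yspace p X \<phi>) \<and>
        (\<exists>\<tau> \<pi>.
           principal_bundle solenoid solenoid_top \<tau> (Yspace p X \<phi>) (Zspace p X \<phi>) \<pi> \<and>
           (\<forall>x\<in>topspace X. \<forall>\<rho>\<in>{0<..<1::real}.
              \<pi> (sigma_orbit p X \<phi> (x, \<rho>)) = frob_orbit p \<phi> x \<and>
              (\<forall>(n::int) (s::real).
                 \<tau> (solenoid_class (Zhat_of_int n, s)) (sigma_orbit p X \<phi> (x, \<rho>)) =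
                 sigma_orbit p X \<phi>
                   (\<phi> (frob p [^]\<^bsub>Gp p\<^esub> n) x, \<rho> powr (real p powr s))))))
   \<and>
     (compact_Gp_torsor p (Gp_top p) (Gp_translation p) \<and>
      topspace (Pp_top p) = Pp p \<and>
      (\<exists>\<Phi>.
         homeomorphic_map (Yspace p (Gp_top p) (Gp_translation p)) (Pp_top p) \<Phi> \<and>
         (\<forall>g\<in>carrier (Gp p). \<forall>\<rho>\<in>{0<..<1::real}.
            \<Phi> (sigma_orbit p (Gp_top p) (Gp_translation p) (g, \<rho>)) =
              adele_class (adele_zero_at p g (- ln \<rho>)) \<and>
            (\<forall>u\<in>carrier (product_group primes (\<lambda>l. units_of (Zp l))). \<forall>r>0::real.
               \<Phi> (sigma_orbit p (Gp_top p) (Gp_translation p)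
                    (restrict u (primes - {p}) \<otimes>\<^bsub>Gp p\<^esub> g, \<rho> powr r)) =
               adele_class (u, r) \<otimes>\<^bsub>HQ\<^esub>
                 \<Phi> (sigma_orbit p (Gp_top p) (Gp_translation p) (g, \<rho>))))))"
proof (intro conjI)
  show "mu_action p \<in> iso (Gp p) (AutoGroup (mu_prime_to p))" by (rule mu_action_iso[OF assms])
  show "frob p \<in> carrier (Gp p)" by (rule frob_in_Gp[OF assms])
  show "\<forall>\<xi>\<in>carrier (mu_prime_to p). mu_action p (frob p) \<xi> = \<xi> ^ p" using mu_action_frob[OF assms] by blast
  show "\<forall>(X :: 'x topology) \<phi>. compact_Gp_torsor p X \<phi> \<longrightarrow>
      compact_space (Yspace p X \<phi>) \<and> Hausdorff_space (Yspace p X \<phi>) \<and>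
      (\<exists>\<tau> \<pi>.
         principal_bundle solenoid solenoid_top \<tau> (Yspace p X \<phi>) (Zspace p X \<phi>) \<pi> \<and>
         (\<forall>x\<in>topspace X. \<forall>\<rho>\<in>{0<..<1::real}.
            \<pi> (sigma_orbit p X \<phi> (x, \<rho>)) = frob_orbit p \<phi> x \<and>
            (\<forall>(n::int) (s::real).
               \<tau> (solenoid_class (Zhat_of_int n, s)) (sigma_orbit p X \<phi> (x, \<rho>)) =
               sigma_orbit p X \<phi> (\<phi> (frob p [^]\<^bsub>Gp p\<^esub> n) x, \<rho> powr (real p powr s)))))"
    (is "\<forall>X \<phi>. _ X \<phi> \<longrightarrow> ?bundle X \<phi>")
  proof (intro allI impI)
    fix X :: "'x topology" and \<phi>
    assume "compact_Gp_torsor p X \<phi>"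
    with assms interpret torsor p X \<phi> by (rule torsor.intro)
    show "?bundle X \<phi>" by (rule conjI[OF compact_space_Yspace solenoid_bundle])
  qed
  show "compact_Gp_torsor p (Gp_top p) (Gp_translation p)" by (rule compact_Gp_torsor_translation[OF assms])
  show "topspace (Pp_top p) = Pp p" by (rule topspace_Pp_top[OF assms])
  obtain \<Phi> where \<Phi>: "homeomorphic_map (Yspace p (Gp_top p) (Gp_translation p)) (Pp_top p) \<Phi>"
    "\<And>z. z \<in> carrier (Gp p) \<times> {0<..<1} \<Longrightarrow>
       \<Phi> (sigma_orbit p (Gp_top p) (Gp_translation p) z) = fiber_point p z"
    using Yspace_homeomorphic_fiber[OF assms] by blast
  show "\<exists>\<Phi>. homeomorphic_map (Yspace p (Gp_top p) (Gp_translation p)) (Pp_top p) \<Phi> \<and>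
      (\<forall>g\<in>carrier (Gp p). \<forall>\<rho>\<in>{0<..<1::real}.
         \<Phi> (sigma_orbit p (Gp_top p) (Gp_translation p) (g, \<rho>)) = adele_class (adele_zero_at p g (- ln \<rho>)) \<and>
         (\<forall>u\<in>carrier (product_group primes (\<lambda>l. units_of (Zp l))). \<forall>r>0::real.
            \<Phi> (sigma_orbit p (Gp_top p) (Gp_translation p)
                 (restrict u (primes - {p}) \<otimes>\<^bsub>Gp p\<^esub> g, \<rho> powr r)) =
            adele_class (u, r) \<otimes>\<^bsub>HQ\<^esub> \<Phi> (sigma_orbit p (Gp_top p) (Gp_translation p) (g, \<rho>))))"
  proof (intro exI[of _ \<Phi>] conjI ballI allI impI)
    show "homeomorphic_map (Yspace p (Gp_top p) (Gp_translation p)) (Pp_top p) \<Phi>" by (rule \<Phi>(1))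
    fix g and \<rho> :: real assume g: "g \<in> carrier (Gp p)" "\<rho> \<in> {0<..<1}"
    then have \<Phi>g: "\<Phi> (sigma_orbit p (Gp_top p) (Gp_translation p) (g, \<rho>)) = fiber_point p (g, \<rho>)"
      by (intro \<Phi>(2) SigmaI)
    then show "\<Phi> (sigma_orbit p (Gp_top p) (Gp_translation p) (g, \<rho>)) = adele_class (adele_zero_at p g (- ln \<rho>))"
      by (simp only: fiber_point_def[OF assms] fst_conv snd_conv)
    fix u and r :: real assume u: "u \<in> carrier (product_group primes (\<lambda>l. units_of (Zp l)))" "r > 0"
    show "\<Phi> (sigma_orbit p (Gp_top p) (Gp_translation p) (restrict u (primes - {p}) \<otimes>\<^bsub>Gp p\<^esub> g, \<rho> powr r)) =
        adele_class (u, r) \<otimes>\<^bsub>HQ\<^esub> \<Phi> (sigma_orbit p (Gp_top p) (Gp_translation p) (g, \<rho>))"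
      unfolding \<Phi>g fiber_point_translate(2)[OF assms g u, symmetric]
      by (rule \<Phi>(2)[OF fiber_point_translate(1)[OF assms g u]])
  qed
qed

end
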